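(* Let $k\ge 2$ and $\alpha\in[0,1)$, and let $g=\rho^{-2}\bar g$ be a Riemannian metric on $M$ such that $$\bar g\in C^{k,\alpha}_2(M)\quad\text{and}\quad \mathcal L_X\bar g\in C^{k-1,\alpha}_2(M)\ \text{ for every } X\in\mathfrak X(\bar M),$$ where $\mathfrak X(\bar M)$ is the space of smooth vector fields on $\bar M$ and $\mathcal L$ is the Lie derivative. Then the following are equivalent: (1) $\mathrm{Riem}[g]\to-\mathrm{Id}$ as $\rho\to0$; (2) $\mathrm{Ric}[g]\to -n\,\delta$ as $\rho\to 0$; (3) $\mathrm R[g]\to -n(n+1)$ as $\rho\to0$; (4) $|d\rho|_{\bar g}=1$ on $\partial M$.
   Context: Setting. $\bar M$ is a smooth compact $(n+1)$-dimensional manifold with boundary $\partial M$ ($n\ge1$), $M$ is its interior, and $\rho:\bar M\to[0,\infty)$ is a fixed smooth defining function, i.e. $\rho^{-1}(0)=\partial M$ and $d\rho\ne0$ on $\partial M$. Function spaces. Identify a collar neighborhood of $\partial M$ in $\bar M$ with $\partial M\times[0,\rho_* )$ so that $\rho$ is the last coordinate. Fix finitely many charts $(U,\theta)$ covering $\partial M$, each extending smoothly to a chart containing $\bar U$; then $\Theta=(\theta,\rho)$ on $U\times[0,\rho_* )$ are called background coordinates. Let $\mathbb H=\{(x,y)\in\mathbb R^n\times(0,\infty)\}$ with hyperbolic metric $\breve g=y^{-2}(|dx|^2+dy^2)$ and let $B_r$ be the $\breve g$-ball of radius $r$ about $(0,1)$. For a point $p_0$ of the interior of the collar with background coordinates $(\theta_0,\rho_0)$,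 the Möbius parametrization $\Phi:B_2\to M$ centered at $p_0$ is $\Phi(x,y)=(\theta_0+\rho_0x,\rho_0y)$. Fix a countable family $\Phi_i:B_2\to M$ consisting of such maps together with finitely many smooth parametrizations covering the (compact) rest of $M$, such that $\{\Phi_i(B_1)\}$ covers $M$ and $\{\Phi_i(B_2)\}$ is uniformly locally finite. For $k\in\mathbb N_0$, $\alpha\in[0,1)$, $\delta\in\mathbb R$, $C^{k,\alpha}(M)$ is the space of tensor fields $u$ (of a given type) with $\|u\|_{C^{k,\alpha}(M)}=\sup_i\|\Phi_i^*u\|_{C^{k,\alpha}(B_2)}<\infty$ (with $C^{k,0}=C^k$), and $C^{k,\alpha}_\delta(M)=\rho^\delta C^{k,\alpha}(M)$ with norm $\|u\|_{C^{k,\alpha}_\delta(M)}=\|\rho^{-\delta}u\|_{C^{k,\alpha}(M)}$. The regularity conditions in the claim imply that $\bar g$ extends to a Lipschitz continuous tensor field on $\bar M$; condition (4) refers to this extension. Curvature. $\mathrm{Riem}[g]$ is viewed as the curvature operator $\Lambda^2(TM)\to\Lambda^2(TM)$ (a $(2,2)$-tensor), with sign such that constant sectional curvature $\kappa$ corresponds to $\kappa\,\mathrm{Id}$, $\mathrm{Id}$ being the identity of $\Lambda^2(TM)$; $\mathrm{Ric}[g]$ is the Ricci operator, viewed as a $(1,1)$-tensor, and $\delta$ in (2) is the identity of $TM$; $\mathrm R[g]$ is the scalar curvature. Convergence of tensors as $\rho\to0$ is in the pointwise norm of a smooth metric on $\bar M$.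
   Formalization: Assumed in addition: the continuous extension of \bar g to \bar M is positive definite (a Riemannian metric) on ∂M; otherwise |dρ|_{\bar g} in (4) need not be defined and the equivalence can fail. *)

theory Defs
  imports "HOL-Analysis.Analysis"
begin

section \<open>Functions of class C^k and smooth functions\<close>

text \<open>Iterated directional derivatives; with entries from \<^term>\<open>Basis\<close> these are the iterated
  partial derivatives.\<close>

primrec iter_deriv :: "'e list \<Rightarrow> ('e::euclidean_space \<Rightarrow> 'f::real_normed_vector) \<Rightarrow> 'e \<Rightarrow> 'f" where
  "iter_deriv [] f = f"
| "iter_deriv (v # vs) f = (\<lambda>x. frechet_derivative (iter_deriv vs f) (at x) v)"

text \<open>Meant for open \<open>S\<close>.\<close>

definition Ck_on :: "nat \<Rightarrow> 'e::euclidean_space set \<Rightarrow> ('e \<Rightarrow> 'f::real_normed_vector) \<Rightarrow> bool" where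
  "Ck_on k S f \<longleftrightarrow> (\<forall>vs. set vs \<subseteq> Basis \<longrightarrow>
     (length vs < k \<longrightarrow> (\<forall>x\<in>S. iter_deriv vs f differentiable (at x))) \<and>
     (length vs \<le> k \<longrightarrow> continuous_on S (iter_deriv vs f)))"

text \<open>On a set that need not be open (such as a relatively open subset of a half-space), smoothness
  means the existence of local smooth extensions.\<close>

definition smooth_on :: "'e::euclidean_space set \<Rightarrow> ('e \<Rightarrow> 'f::real_normed_vector) \<Rightarrow> bool" where
  "smooth_on S f \<longleftrightarrow> (\<forall>x\<in>S. \<exists>W F. open W \<and> x \<in> W \<and> (\<forall>k. Ck_on k W F) \<and> (\<forall>y\<in>S \<inter> W. F y = f y))"

text \<open>The \<open>C\<^sup>k\<^sup>,\<^sup>\<alpha>\<close> norm, with values in \<open>[0,\<infinity>]\<close>; there is no Hoelder term if \<open>\<alpha> = 0\<close>, so that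
  \<open>C\<^sup>k\<^sup>,\<^sup>0 = C\<^sup>k\<close>.\<close>

definition holder_norm ::
  "nat \<Rightarrow> real \<Rightarrow> 'e::euclidean_space set \<Rightarrow> ('e \<Rightarrow> real) \<Rightarrow> ennreal" where
  "holder_norm k \<alpha> S f =
     (SUP vs\<in>{vs. set vs \<subseteq> Basis \<and> length vs \<le> k}. SUP x\<in>S. ennreal \<bar>iter_deriv vs f x\<bar>) +
     (if \<alpha> = 0 then 0 else
       (SUP vs\<in>{vs. set vs \<subseteq> Basis \<and> length vs = k}.
         SUP (x, y)\<in>{(x, y). x \<in> S \<and> y \<in> S \<and> x \<noteq> y}.
           ennreal (\<bar>iter_deriv vs f x - iter_deriv vs f y\<bar> / dist x y powr \<alpha>)))"


section \<open>Manifolds with boundary\<close>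

text \<open>Dimension \<open>n + 1\<close> with \<open>n = CARD('n)\<close>; charts take values in the half-space
  \<open>\<real>\<^sup>n \<times> [0,\<infinity>)\<close>. A chart is a pair of a domain and a map, whose values off the domain are
  irrelevant.\<close>

type_synonym 'n coord = "(real, 'n) vec \<times> real"
type_synonym ('a, 'n) chart = "'a set \<times> ('a \<Rightarrow> 'n coord)"

definition half_space :: "('n::finite) coord set" where
  "half_space = {z. snd z \<ge> 0}"

definition chart_inv :: "('a, 'n::finite) chart \<Rightarrow> 'n coord \<Rightarrow> 'a" where
  "chart_inv c = inv_into (fst c) (snd c)"

definition is_chart :: "'a::t2_space set \<Rightarrow> ('a, 'n::finite) chart \<Rightarrow> bool" where
  "is_chart Mbar c \<longleftrightarrow>
     openin (top_of_set Mbar) (fst c) \<and>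
     openin (top_of_set half_space) (snd c ` fst c) \<and>
     homeomorphism (fst c) (snd c ` fst c) (snd c) (chart_inv c)"

definition compatible :: "('a, 'n::finite) chart \<Rightarrow> ('a, 'n) chart \<Rightarrow> bool" where
  "compatible c d \<longleftrightarrow>
     smooth_on (snd c ` (fst c \<inter> fst d)) (snd d \<circ> chart_inv c) \<and>
     smooth_on (snd d ` (fst c \<inter> fst d)) (snd c \<circ> chart_inv d)"

text \<open>A smooth structure is a maximal smooth atlas.\<close>

definition smooth_structure :: "'a::t2_space set \<Rightarrow> ('a, 'n::finite) chart set \<Rightarrow> bool" where
  "smooth_structure Mbar A \<longleftrightarrow>
     (\<forall>c\<in>A. is_chart Mbar c) \<and> (\<Union>c\<in>A. fst c) = Mbar \<and> (\<forall>c\<in>A. \<forall>d\<in>A. compatible c d) \<and>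
     (\<forall>c. is_chart Mbar c \<and> (\<forall>d\<in>A. compatible c d) \<longrightarrow> c \<in> A)"

definition compact_manifold :: "'a::t2_space set \<Rightarrow> ('a, 'n::finite) chart set \<Rightarrow> bool" where
  "compact_manifold Mbar A \<longleftrightarrow> compact Mbar \<and> smooth_structure Mbar A"

definition mbdry :: "('a, 'n::finite) chart set \<Rightarrow> 'a set" where
  "mbdry A = {p. \<exists>c\<in>A. p \<in> fst c \<and> snd (snd c p) = 0}"

definition mint :: "('a, 'n::finite) chart set \<Rightarrow> 'a set" where
  "mint A = (\<Union>c\<in>A. fst c) - mbdry A"

text \<open>Some chart around \<open>p\<close>, used to evaluate chart-independent quantities.\<close>

definition chart_at :: "('a, 'n::finite) chart set \<Rightarrow> 'a \<Rightarrow> ('a, 'n) chart" where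
  "chart_at A p = (SOME c. c \<in> A \<and> p \<in> fst c)"

definition smooth_fun :: "('a, 'n::finite) chart set \<Rightarrow> ('a \<Rightarrow> real) \<Rightarrow> bool" where
  "smooth_fun A f \<longleftrightarrow> (\<forall>c\<in>A. smooth_on (snd c ` fst c) (f \<circ> chart_inv c))"

text \<open>Derivatives are taken within the half-space, so that they also make sense on the boundary.\<close>

definition differential :: "('a \<Rightarrow> real) \<Rightarrow> ('a, 'n::finite) chart \<Rightarrow> 'a \<Rightarrow> 'n coord \<Rightarrow> real" where
  "differential f c p = frechet_derivative (f \<circ> chart_inv c) (at (snd c p) within half_space)"

definition dtrans :: "('a, 'n::finite) chart \<Rightarrow> ('a, 'n) chart \<Rightarrow> 'a \<Rightarrow> 'n coord \<Rightarrow> 'n coord" where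
  "dtrans c d p = frechet_derivative (snd d \<circ> chart_inv c) (at (snd c p) within half_space)"

definition defining_function :: "('a, 'n::finite) chart set \<Rightarrow> ('a \<Rightarrow> real) \<Rightarrow> bool" where
  "defining_function A \<rho> \<longleftrightarrow>
     smooth_fun A \<rho> \<and> (\<forall>p\<in>(\<Union>c\<in>A. fst c). \<rho> p \<ge> 0 \<and> (\<rho> p = 0 \<longleftrightarrow> p \<in> mbdry A)) \<and>
     (\<forall>c\<in>A. \<forall>p\<in>mbdry A \<inter> fst c. differential \<rho> c p \<noteq> (\<lambda>v. 0))"


section \<open>Tensor fields\<close>

text \<open>Vector fields and covariant 2-tensor fields are given by their representations in all the
  charts of the smooth structure, related by the transformation laws. The tensor \<open>u\<close> at the
  point \<open>p\<close> is represented in the chart \<open>c\<close> by the bilinear form \<open>u c p\<close>.\<close>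

type_synonym ('a, 'n) vfield = "('a, 'n) chart \<Rightarrow> 'a \<Rightarrow> 'n coord"
type_synonym ('a, 'n) tensor2 = "('a, 'n) chart \<Rightarrow> 'a \<Rightarrow> 'n coord \<Rightarrow> 'n coord \<Rightarrow> real"

definition tensor2_on ::
  "('a, 'n::finite) chart set \<Rightarrow> 'a set \<Rightarrow> ('a, 'n) tensor2 \<Rightarrow> bool" where
  "tensor2_on A N u \<longleftrightarrow>
     (\<forall>c\<in>A. \<forall>p\<in>fst c \<inter> N. bilinear (u c p)) \<and>
     (\<forall>c\<in>A. \<forall>d\<in>A. \<forall>p\<in>fst c \<inter> fst d \<inter> N. \<forall>v w.
        u c p v w = u d p (dtrans c d p v) (dtrans c d p w))"

definition sym_pos_def :: "('e::real_vector \<Rightarrow> 'e \<Rightarrow> real) \<Rightarrow> bool" where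
  "sym_pos_def G \<longleftrightarrow> (\<forall>v w. G v w = G w v) \<and> (\<forall>v. v \<noteq> 0 \<longrightarrow> G v v > 0)"

definition riemannian_on ::
  "('a, 'n::finite) chart set \<Rightarrow> 'a set \<Rightarrow> ('a, 'n) tensor2 \<Rightarrow> bool" where
  "riemannian_on A N g \<longleftrightarrow>
     tensor2_on A N g \<and> (\<forall>c\<in>A. \<forall>p\<in>fst c \<inter> N. sym_pos_def (g c p))"

definition smooth_metric :: "('a, 'n::finite) chart set \<Rightarrow> ('a, 'n) tensor2 \<Rightarrow> bool" where
  "smooth_metric A h \<longleftrightarrow>
     riemannian_on A (\<Union>c\<in>A. fst c) h \<and>
     (\<forall>c\<in>A. \<forall>v w. smooth_on (snd c ` fst c) (\<lambda>x. h c (chart_inv c x) v w))"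

definition smooth_vfield :: "('a, 'n::finite) chart set \<Rightarrow> ('a, 'n) vfield \<Rightarrow> bool" where
  "smooth_vfield A X \<longleftrightarrow>
     (\<forall>c\<in>A. \<forall>d\<in>A. \<forall>p\<in>fst c \<inter> fst d. X d p = dtrans c d p (X c p)) \<and>
     (\<forall>c\<in>A. smooth_on (snd c ` fst c) (\<lambda>x. X c (chart_inv c x)))"

text \<open>\<open>(L\<^sub>X u)\<^sub>i\<^sub>j = X\<^sup>k \<partial>\<^sub>k u\<^sub>i\<^sub>j + u\<^sub>k\<^sub>j \<partial>\<^sub>i X\<^sup>k + u\<^sub>i\<^sub>k \<partial>\<^sub>j X\<^sup>k\<close>, at interior points.\<close>

definition lie_deriv :: "('a, 'n::finite) vfield \<Rightarrow> ('a, 'n) tensor2 \<Rightarrow> ('a, 'n) tensor2" where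
  "lie_deriv X u = (\<lambda>c p v w.
     let DX = frechet_derivative (\<lambda>x. X c (chart_inv c x)) (at (snd c p)) in
     frechet_derivative (\<lambda>x. u c (chart_inv c x) v w) (at (snd c p)) (X c p)
       + u c p (DX v) w + u c p v (DX w))"

definition scale_tensor :: "('a \<Rightarrow> real) \<Rightarrow> ('a, 'n::finite) tensor2 \<Rightarrow> ('a, 'n) tensor2" where
  "scale_tensor f u = (\<lambda>c p v w. f p * u c p v w)"

text \<open>The continuous extension to the boundary of a tensor field on the interior, as a limit. The
  extension of a metric may degenerate: if \<open>g\<close> is hyperbolic and \<open>r\<close> is the distance to a point,
  then for \<open>\<rho> = e\<^sup>-\<^sup>2\<^sup>r\<close> near the boundary \<open>\<rho>\<^sup>2 g = d\<rho>\<^sup>2/4 + \<rho> (1 - \<rho>)\<^sup>2 d\<sigma>\<^sup>2/4\<close> is smooth up to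
  \<open>\<rho> = 0\<close>, but not a metric there. So the norm of \<open>d\<rho>\<close> on the boundary needs positive
  definiteness of the extension as a separate assumption.\<close>

definition extend_tensor ::
  "('a::t2_space, 'n::finite) chart set \<Rightarrow> ('a, 'n) tensor2 \<Rightarrow> ('a, 'n) tensor2" where
  "extend_tensor A u = (\<lambda>c p v w.
     if p \<in> mint A then u c p v w else Lim (at p within mint A) (\<lambda>q. u c q v w))"


section \<open>The hyperbolic half-space\<close>

text \<open>Distance of the metric \<open>y\<^sup>-\<^sup>2(|dx|\<^sup>2 + dy\<^sup>2)\<close>. The length is required to exist as an integral
  (rather than written with \<^term>\<open>integral\<close>, which is zero for functions that are not integrable).\<close>

definition hyp_dist :: "('n::finite) coord \<Rightarrow> 'n coord \<Rightarrow> real" where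
  "hyp_dist z w = Inf {L. \<exists>\<gamma>. \<gamma> piecewise_C1_differentiable_on {0..1} \<and>
     path_image \<gamma> \<subseteq> {q. snd q > 0} \<and> pathstart \<gamma> = z \<and> pathfinish \<gamma> = w \<and>
     ((\<lambda>t. norm (vector_derivative \<gamma> (at t)) / snd (\<gamma> t)) has_integral L) {0..1}}"

definition hyp_ball :: "real \<Rightarrow> ('n::finite) coord set" where
  "hyp_ball r = {q. snd q > 0 \<and> hyp_dist (0, 1) q < r}"


section \<open>Collar, background coordinates and Moebius parametrizations\<close>

text \<open>Charts \<open>(V, \<theta>)\<close> of \<open>\<partial>M\<close>; its smooth structure is the one induced by the first components
  of the charts of \<open>A\<close>.\<close>

definition bdry_chart ::
  "('a::t2_space, 'n::finite) chart set \<Rightarrow> 'a set \<Rightarrow> ('a \<Rightarrow> real^'n) \<Rightarrow> bool" where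
  "bdry_chart A V \<theta> \<longleftrightarrow>
     openin (top_of_set (mbdry A)) V \<and> open (\<theta> ` V) \<and>
     homeomorphism V (\<theta> ` V) \<theta> (inv_into V \<theta>) \<and>
     (\<forall>c\<in>A. smooth_on ((fst \<circ> snd c) ` (V \<inter> fst c))
                (\<theta> \<circ> inv_into (fst c \<inter> mbdry A) (fst \<circ> snd c)) \<and>
             smooth_on (\<theta> ` (V \<inter> fst c)) (fst \<circ> snd c \<circ> inv_into V \<theta>))"

text \<open>The map \<open>p \<mapsto> (\<kappa> p, \<rho> p)\<close> is a diffeomorphism of the neighborhood \<open>K\<close> of \<open>\<partial>M\<close> onto
  \<open>\<partial>M \<times> [0, \<rho>\<^sub>*)\<close> (a bijection that composes with charts of \<open>\<partial>M\<close> to charts of the manifold)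
  restricting to the identity of \<open>\<partial>M\<close>.\<close>

definition collar ::
  "'a::t2_space set \<Rightarrow> ('a, 'n::finite) chart set \<Rightarrow> ('a \<Rightarrow> real) \<Rightarrow> real \<Rightarrow> 'a set \<Rightarrow> ('a \<Rightarrow> 'a) \<Rightarrow> bool"
  where
  "collar Mbar A \<rho> \<rho>s K \<kappa> \<longleftrightarrow>
     \<rho>s > 0 \<and> openin (top_of_set Mbar) K \<and> mbdry A \<subseteq> K \<and>
     bij_betw (\<lambda>p. (\<kappa> p, \<rho> p)) K (mbdry A \<times> {0..<\<rho>s}) \<and>
     (\<forall>p\<in>mbdry A. \<kappa> p = p) \<and>
     (\<forall>V \<theta>. bdry_chart A V \<theta> \<longrightarrow> ({p\<in>K. \<kappa> p \<in> V}, \<lambda>p. (\<theta> (\<kappa> p), \<rho> p)) \<in> A)"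

text \<open>A triple \<open>(U, V, \<theta>)\<close> stands for the chart \<open>(U, \<theta>)\<close> of \<open>\<partial>M\<close> and its extension \<open>(V, \<theta>)\<close>.\<close>

definition background_charts ::
  "('a::t2_space, 'n::finite) chart set \<Rightarrow> ('a set \<times> 'a set \<times> ('a \<Rightarrow> real^'n)) set \<Rightarrow> bool" where
  "background_charts A B \<longleftrightarrow>
     finite B \<and> (\<Union>(U, V, \<theta>)\<in>B. U) = mbdry A \<and>
     (\<forall>(U, V, \<theta>)\<in>B. openin (top_of_set (mbdry A)) U \<and> closure U \<subseteq> V \<and> bdry_chart A V \<theta>)"

text \<open>\<open>\<Phi>\<close> is centered at \<open>p\<^sub>0\<close>, with \<open>\<kappa> p\<^sub>0 \<in> U\<close>; its image has to lie in the domain of the extended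
  background coordinates.\<close>

definition moebius_param ::
  "('a \<Rightarrow> real) \<Rightarrow> 'a set \<Rightarrow> ('a \<Rightarrow> 'a) \<Rightarrow> ('a set \<times> 'a set \<times> ('a \<Rightarrow> real^'n::finite)) set \<Rightarrow>
    ('n coord \<Rightarrow> 'a) \<Rightarrow> bool" where
  "moebius_param \<rho> K \<kappa> B \<Phi> \<longleftrightarrow>
     (\<exists>(U, V, \<theta>)\<in>B. \<exists>p0\<in>K. \<kappa> p0 \<in> U \<and> \<rho> p0 > 0 \<and>
        (\<forall>(x, y)\<in>hyp_ball 2. \<Phi> (x, y) \<in> K \<and> \<kappa> (\<Phi> (x, y)) \<in> V \<and>
           \<theta> (\<kappa> (\<Phi> (x, y))) = \<theta> (\<kappa> p0) + \<rho> p0 *\<^sub>R x \<and> \<rho> (\<Phi> (x, y)) = \<rho> p0 * y))"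

text \<open>Smooth parametrizations are inverses of charts.\<close>

definition smooth_param :: "('a, 'n::finite) chart set \<Rightarrow> ('n coord \<Rightarrow> 'a) \<Rightarrow> bool" where
  "smooth_param A \<Phi> \<longleftrightarrow>
     (\<exists>c\<in>A. snd c ` fst c = hyp_ball 2 \<and> (\<forall>z\<in>hyp_ball 2. \<Phi> z \<in> fst c \<and> snd c (\<Phi> z) = z))"

definition param_family ::
  "'a::t2_space set \<Rightarrow> ('a, 'n::finite) chart set \<Rightarrow> ('a \<Rightarrow> real) \<Rightarrow> 'a set \<Rightarrow> ('a \<Rightarrow> 'a) \<Rightarrow>
    ('a set \<times> 'a set \<times> ('a \<Rightarrow> real^'n)) set \<Rightarrow> nat set \<Rightarrow> (nat \<Rightarrow> 'n coord \<Rightarrow> 'a) \<Rightarrow> bool" where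
  "param_family Mbar A \<rho> K \<kappa> B I \<Phi> \<longleftrightarrow>
     (\<exists>J\<subseteq>I. finite J \<and> (\<forall>i\<in>I - J. moebius_param \<rho> K \<kappa> B (\<Phi> i)) \<and> (\<forall>i\<in>J. smooth_param A (\<Phi> i))) \<and>
     (\<Union>i\<in>I. \<Phi> i ` hyp_ball 1) = mint A \<and>
     (\<exists>N. \<forall>p\<in>mint A. \<exists>W. openin (top_of_set Mbar) W \<and> p \<in> W \<and>
        finite {i\<in>I. \<Phi> i ` hyp_ball 2 \<inter> W \<noteq> {}} \<and> card {i\<in>I. \<Phi> i ` hyp_ball 2 \<inter> W \<noteq> {}} \<le> N)"


section \<open>The spaces of covariant 2-tensor fields\<close>

definition pullback ::
  "('a, 'n::finite) chart set \<Rightarrow> ('n coord \<Rightarrow> 'a) \<Rightarrow> ('a, 'n) tensor2 \<Rightarrow>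
    'n coord \<Rightarrow> 'n coord \<Rightarrow> 'n coord \<Rightarrow> real" where
  "pullback A \<Phi> u = (\<lambda>x v w.
     let c = chart_at A (\<Phi> x); D = frechet_derivative (snd c \<circ> \<Phi>) (at x)
     in u c (\<Phi> x) (D v) (D w))"

text \<open>Norms on \<open>B\<^sub>2\<close> are those of the components with respect to the standard coordinates of
  \<open>\<real>\<^sup>n \<times> (0,\<infinity>)\<close>.\<close>

definition tensor_norm ::
  "('a, 'n::finite) chart set \<Rightarrow> nat set \<Rightarrow> (nat \<Rightarrow> 'n coord \<Rightarrow> 'a) \<Rightarrow> nat \<Rightarrow> real \<Rightarrow>
    ('a, 'n) tensor2 \<Rightarrow> ennreal" where
  "tensor_norm A I \<Phi> k \<alpha> u =
     (SUP i\<in>I. \<Sum>a\<in>Basis. \<Sum>b\<in>Basis. holder_norm k \<alpha> (hyp_ball 2) (\<lambda>x. pullback A (\<Phi> i) u x a b))"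

definition Ck_tensors ::
  "('a, 'n::finite) chart set \<Rightarrow> nat set \<Rightarrow> (nat \<Rightarrow> 'n coord \<Rightarrow> 'a) \<Rightarrow> nat \<Rightarrow> real \<Rightarrow>
    ('a, 'n) tensor2 set" where
  "Ck_tensors A I \<Phi> k \<alpha> = {u. tensor2_on A (mint A) u \<and>
     (\<forall>i\<in>I. \<forall>a\<in>Basis. \<forall>b\<in>Basis. Ck_on k (hyp_ball 2) (\<lambda>x. pullback A (\<Phi> i) u x a b)) \<and>
     tensor_norm A I \<Phi> k \<alpha> u < \<infinity>}"

definition weighted_Ck_tensors ::
  "('a, 'n::finite) chart set \<Rightarrow> ('a \<Rightarrow> real) \<Rightarrow> nat set \<Rightarrow> (nat \<Rightarrow> 'n coord \<Rightarrow> 'a) \<Rightarrow>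
    nat \<Rightarrow> real \<Rightarrow> real \<Rightarrow> ('a, 'n) tensor2 set" where
  "weighted_Ck_tensors A \<rho> I \<Phi> k \<alpha> \<delta> =
     {u. scale_tensor (\<lambda>p. \<rho> p powr (- \<delta>)) u \<in> Ck_tensors A I \<Phi> k \<alpha>}"


section \<open>Curvature\<close>

text \<open>For an inner product \<open>G\<close>: the vector dual to a covector, the norm of a covector, and the
  components \<open>G\<^sup>a\<^sup>b\<close> of the dual inner product.\<close>

definition sharp :: "('e::real_vector \<Rightarrow> 'e \<Rightarrow> real) \<Rightarrow> ('e \<Rightarrow> real) \<Rightarrow> 'e" where
  "sharp G l = (THE v. \<forall>w. G v w = l w)"

definition covector_norm :: "('e::real_vector \<Rightarrow> 'e \<Rightarrow> real) \<Rightarrow> ('e \<Rightarrow> real) \<Rightarrow> real" where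
  "covector_norm G l = sqrt (l (sharp G l))"

definition dual_metric :: "('e::real_inner \<Rightarrow> 'e \<Rightarrow> real) \<Rightarrow> 'e \<Rightarrow> 'e \<Rightarrow> real" where
  "dual_metric G a b = inner b (sharp G (inner a))"

text \<open>In all that follows, \<open>u\<close>, \<open>v\<close>, \<open>w\<close> are coordinate vectors in the chart \<open>c\<close>, extended as vector
  fields with constant components. \<open>christoffel g c p u v\<close> is \<open>\<nabla>\<^sub>u v\<close> at \<open>p\<close>, and
  \<open>riemann g c p u v w\<close> is \<open>R(u,v)w = \<nabla>\<^sub>u \<nabla>\<^sub>v w - \<nabla>\<^sub>v \<nabla>\<^sub>u w\<close>.\<close>

definition christoffel ::
  "('a, 'n::finite) tensor2 \<Rightarrow> ('a, 'n) chart \<Rightarrow> 'a \<Rightarrow> 'n coord \<Rightarrow> 'n coord \<Rightarrow> 'n coord" where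
  "christoffel g c p u v =
     (let Dg = (\<lambda>a b e. frechet_derivative (\<lambda>x. g c (chart_inv c x) b e) (at (snd c p)) a)
      in sharp (g c p) (\<lambda>w. (Dg u v w + Dg v u w - Dg w u v) / 2))"

definition riemann ::
  "('a, 'n::finite) tensor2 \<Rightarrow> ('a, 'n) chart \<Rightarrow> 'a \<Rightarrow> 'n coord \<Rightarrow> 'n coord \<Rightarrow> 'n coord \<Rightarrow> 'n coord"
  where
  "riemann g c p u v w =
     (let \<Gamma> = christoffel g c p;
          D\<Gamma> = (\<lambda>a b e. frechet_derivative (\<lambda>x. christoffel g c (chart_inv c x) b e) (at (snd c p)) a)
      in D\<Gamma> u v w - D\<Gamma> v u w + \<Gamma> u (\<Gamma> v w) - \<Gamma> v (\<Gamma> u w))"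

text \<open>Bivectors are alternating bilinear functions of two covectors, and an endomorphism of \<open>\<Lambda>\<^sup>2\<close> is
  given, as a (2,2)-tensor, by its values on the bivectors \<open>u \<and> v\<close>. In this form the identity is
  \<open>wedge\<close>. If \<open>R(u,v)w = \<kappa> (g(v,w) u - g(u,w) v)\<close> (constant sectional curvature \<open>\<kappa>\<close>), then the
  curvature operator is \<open>\<kappa>\<close> times the identity.\<close>

type_synonym 'n tensor22 =
  "'n coord \<Rightarrow> 'n coord \<Rightarrow> ('n coord \<Rightarrow> real) \<Rightarrow> ('n coord \<Rightarrow> real) \<Rightarrow> real"

definition wedge :: "('n::finite) tensor22" where
  "wedge u v = (\<lambda>l m. l u * m v - l v * m u)"

definition curvature_operator ::
  "('a, 'n::finite) tensor2 \<Rightarrow> ('a, 'n) chart \<Rightarrow> 'a \<Rightarrow> 'n tensor22" where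
  "curvature_operator g c p u v = (\<lambda>l m. l (riemann g c p u v (sharp (g c p) m)))"

definition ricci ::
  "('a, 'n::finite) tensor2 \<Rightarrow> ('a, 'n) tensor2" where
  "ricci g c p v w = (\<Sum>b\<in>Basis. inner b (riemann g c p b v w))"

definition ricci_operator ::
  "('a, 'n::finite) tensor2 \<Rightarrow> ('a, 'n) chart \<Rightarrow> 'a \<Rightarrow> 'n coord \<Rightarrow> 'n coord" where
  "ricci_operator g c p v = sharp (g c p) (ricci g c p v)"

definition scalar_curvature ::
  "('a, 'n::finite) tensor2 \<Rightarrow> ('a, 'n) chart \<Rightarrow> 'a \<Rightarrow> real" where
  "scalar_curvature g c p = (\<Sum>b\<in>Basis. inner b (ricci_operator g c p b))"


section \<open>Convergence at the boundary\<close>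

text \<open>\<open>|T|\<^sup>2 = H\<^sup>a\<^sup>b H\<^sub>i\<^sub>j T\<^sub>a\<^sup>i T\<^sub>b\<^sup>j\<close>, and similarly for (2,2)-tensors; \<open>inner i\<close> is the coordinate
  covector \<open>dx\<^sup>i\<close>.\<close>

definition norm11 :: "('n coord \<Rightarrow> 'n coord \<Rightarrow> real) \<Rightarrow> ('n coord \<Rightarrow> ('n::finite) coord) \<Rightarrow> real" where
  "norm11 H T = sqrt (\<Sum>a\<in>Basis. \<Sum>b\<in>Basis. dual_metric H a b * H (T a) (T b))"

definition norm22 :: "('n coord \<Rightarrow> 'n coord \<Rightarrow> real) \<Rightarrow> ('n::finite) tensor22 \<Rightarrow> real" where
  "norm22 H T = sqrt (\<Sum>a\<in>Basis. \<Sum>a'\<in>Basis. \<Sum>b\<in>Basis. \<Sum>b'\<in>Basis.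
     \<Sum>i\<in>Basis. \<Sum>i'\<in>Basis. \<Sum>j\<in>Basis. \<Sum>j'\<in>Basis.
       dual_metric H a a' * dual_metric H b b' * H i i' * H j j' *
       T a b (inner i) (inner j) * T a' b' (inner i') (inner j'))"

definition to_bdry :: "('a, 'n::finite) chart set \<Rightarrow> ('a \<Rightarrow> real) \<Rightarrow> 'a filter" where
  "to_bdry A \<rho> = inf (filtercomap \<rho> (nhds 0)) (principal (mint A))"

text \<open>Convergence \<open>T \<rightarrow> S\<close> in the pointwise norm of \<open>h\<close>.\<close>

definition tendsto11 ::
  "('a, 'n::finite) chart set \<Rightarrow> ('a, 'n) tensor2 \<Rightarrow> (('a, 'n) chart \<Rightarrow> 'a \<Rightarrow> 'n coord \<Rightarrow> 'n coord) \<Rightarrow>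
    (('a, 'n) chart \<Rightarrow> 'a \<Rightarrow> 'n coord \<Rightarrow> 'n coord) \<Rightarrow> 'a filter \<Rightarrow> bool" where
  "tendsto11 A h T S F \<longleftrightarrow>
     ((\<lambda>p. let c = chart_at A p in norm11 (h c p) (\<lambda>v. T c p v - S c p v)) \<longlongrightarrow> 0) F"

definition tendsto22 ::
  "('a, 'n::finite) chart set \<Rightarrow> ('a, 'n) tensor2 \<Rightarrow> (('a, 'n) chart \<Rightarrow> 'a \<Rightarrow> 'n tensor22) \<Rightarrow>
    (('a, 'n) chart \<Rightarrow> 'a \<Rightarrow> 'n tensor22) \<Rightarrow> 'a filter \<Rightarrow> bool" where
  "tendsto22 A h T S F \<longleftrightarrow>
     ((\<lambda>p. let c = chart_at A p in norm22 (h c p) (\<lambda>u v l m. T c p u v l m - S c p u v l m)) \<longlongrightarrow> 0) F"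

end

(* Near a boundary point take background coordinates, in which rho is the last coordinate y, and write
   g = G / y^2. Since the coordinate vector fields are smooth up to the boundary, the hypothesis on Lie
   derivatives bounds dG, and then dd G = O(1/y). Hence G extends continuously, with limit G0, and
   y dG, y^2 ddG tend to 0, so all terms of y^2 Riem[g] that contain derivatives of G vanish in the limit:
     y^2 R(u,v)w  -->  - N (G0(v,w) u - G0(u,w) v),   N = |dy|^2 with respect to G0.
   So the curvature operator, the Ricci operator and the scalar curvature tend to -N Id, -nN Id and
   -n(n+1)N, and at each boundary point each of (1)-(4) says that N = 1. Convergence as rho tends to 0 is
   convergence at every boundary point because the manifold is compact. *)
theory Submission
  imports Defs
begin

section \<open>Inner products and tensor norms\<close>

text \<open>The norms in the hypotheses are taken in Moebius charts that shrink toward the boundary,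
  whereas the limits are taken at a fixed boundary point p. Weight 2 cancels the factor \<rho>^2
  that a dilation by \<rho> puts on a covariant 2-tensor, so in background coordinates it amounts to
  |u| <= C and |du| <= C/\<rho>. For gbar alone this would leave \<rho> dG merely bounded; the Lie
  derivatives gain the missing power. Three obstacles shape the rest. The hypothesis speaks of
  global vector fields, so constant fields must be cut off by bump functions. A point near p may be
  covered by a Moebius chart that belongs to another background chart, and the domain of that chart
  must be shown to contain p before its bounds can be carried over. Finally, the norms in (1) and
  (2) are evaluated in a chart \<open>chart_at A q\<close> chosen arbitrarily at every q, so
  curvature and norms have to be shown invariant under changes of coordinates, which takes three
  derivatives of the transition maps.\<close>

definition inner_form :: "('e::real_vector \<Rightarrow> 'e \<Rightarrow> real) \<Rightarrow> bool" where
  "inner_form H \<longleftrightarrow> bilinear H \<and> sym_pos_def H"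

lemma inner_form_bilinear: "inner_form H \<Longrightarrow> bilinear H"
  and inner_form_sym: "inner_form H \<Longrightarrow> H v w = H w v"
  and inner_form_pos: "inner_form H \<Longrightarrow> v \<noteq> 0 \<Longrightarrow> H v v > 0"
  by (auto simp: inner_form_def sym_pos_def_def)

lemma inner_form_ext:
  assumes "inner_form H" "\<And>w. H v w = H v' w" shows "v = v'"
proof (rule ccontr)
  assume "v \<noteq> v'"
  then have "H (v - v') (v - v') > 0" using inner_form_pos[OF assms(1)] by simp
  then show False
    using assms(2) bilinear_lsub[OF inner_form_bilinear[OF assms(1)], of v v' "v - v'"] by simp
qed

lemma linear_expand:
  fixes f :: "'e::euclidean_space \<Rightarrow> 'f::real_vector"
  assumes "linear f" shows "f w = (\<Sum>b\<in>Basis. (w \<bullet> b) *\<^sub>R f b)"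
proof -
  have "f w = f (\<Sum>b\<in>Basis. (w \<bullet> b) *\<^sub>R b)" by (simp add: euclidean_representation)
  then show ?thesis using assms by (simp add: linear_sum linear_scale)
qed

lemma linear_realI:
  fixes f :: "'e::real_vector \<Rightarrow> real"
  assumes "\<And>x y. f (x + y) = f x + f y" "\<And>c x. f (c *\<^sub>R x) = c * f x"
  shows "linear f"
  using assms by (intro linearI) auto

lemma bilinear_expand:
  fixes B :: "'e::euclidean_space \<Rightarrow> 'e \<Rightarrow> 'f::real_vector"
  assumes "bilinear B"
  shows "B a b = (\<Sum>i\<in>Basis. \<Sum>j\<in>Basis. ((a \<bullet> i) * (b \<bullet> j)) *\<^sub>R B i j)"
proof -
  have "B a b = (\<Sum>i\<in>Basis. (a \<bullet> i) *\<^sub>R B i b)"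
    using assms by (intro linear_expand[of "\<lambda>x. B x b"]) (simp add: bilinear_def)
  also have "\<dots> = (\<Sum>i\<in>Basis. (a \<bullet> i) *\<^sub>R (\<Sum>j\<in>Basis. (b \<bullet> j) *\<^sub>R B i j))"
    using assms by (intro sum.cong refl arg_cong[where f="scaleR _"] linear_expand) (simp add: bilinear_def)
  finally show ?thesis by (simp add: scaleR_sum_right)
qed

lemma bilinear_cmult:
  assumes "bilinear B" shows "bilinear (\<lambda>x y. c * (B x y :: real))"
  unfolding bilinear_def
  by (auto intro!: linear_realI simp: bilinear_ladd[OF assms] bilinear_radd[OF assms]
      bilinear_lmul[OF assms] bilinear_rmul[OF assms] distrib_left)

lemma bilinear_sum_forms:
  "(\<And>i. i \<in> I \<Longrightarrow> bilinear (B i)) \<Longrightarrow> bilinear (\<lambda>x y. \<Sum>i\<in>I. B i x y)"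
  unfolding bilinear_def by (auto intro!: linear_compose_sum)

lemma bilinear_mult_linear:
  fixes f g :: "'e::real_vector \<Rightarrow> real"
  assumes "linear f" "linear g" shows "bilinear (\<lambda>x y. f x * g y)"
  unfolding bilinear_def
  by (auto intro!: linear_realI simp: linear_add[OF assms(1)] linear_add[OF assms(2)]
      linear_scale[OF assms(1)] linear_scale[OF assms(2)] algebra_simps)

lemma bilinear_comp_linear:
  assumes "bilinear B" "linear f" "linear g" shows "bilinear (\<lambda>x y. B (f x) (g y))"
  unfolding bilinear_def
proof (intro conjI allI)
  show "linear (\<lambda>y. B (f z) (g y))" for z
    using linear_compose[OF assms(3), of "B (f z)"] assms(1) by (simp add: bilinear_def comp_def)
  show "linear (\<lambda>x. B (f x) (g z))" for z
    using linear_compose[OF assms(2), of "\<lambda>x. B x (g z)"] assms(1) by (simp add: bilinear_def comp_def)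
qed

section \<open>Duality between vectors and covectors\<close>

text \<open>Positive definiteness makes \<open>T\<close> injective, hence surjective in finite
  dimension; a linear l is determined by its values on the basis.\<close>

lemma sharp_ex:
  fixes H :: "'e::euclidean_space \<Rightarrow> 'e \<Rightarrow> real"
  assumes H: "inner_form H" and l: "linear l"
  shows "\<exists>v. \<forall>w. H v w = l w"
proof -
  have bil: "bilinear H" using H by (rule inner_form_bilinear)
  define T where "T = (\<lambda>v. \<Sum>b\<in>Basis. H v b *\<^sub>R b)"
  have linT: "linear T"
    unfolding T_def
    by (rule linearI)
      (simp_all add: bilinear_ladd[OF bil] bilinear_lmul[OF bil] scaleR_add_left sum.distrib scaleR_sum_right)
  have *: "H v w = l w" if "T v = (\<Sum>b\<in>Basis. l b *\<^sub>R b)" "linear l" for v w l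
  proof -
    have "H v b = l b" if "b \<in> Basis" for b
    proof -
      have "T v \<bullet> b = (\<Sum>b\<in>Basis. l b *\<^sub>R b) \<bullet> b" using \<open>T v = _\<close> by simp
      then show ?thesis using that by (simp add: T_def inner_sum_left_Basis)
    qed
    then show ?thesis
      using linear_expand[of "H v" w] linear_expand[OF \<open>linear l\<close>, of w] bil
      by (simp add: bilinear_def)
  qed
  have "inj T"
  proof (subst linear_injective_0[OF linT], intro allI impI)
    fix v assume "T v = 0"
    then have "H v w = 0" for w using *[of v "\<lambda>w. 0" w] by (simp add: linear_zero)
    then show "v = 0" using inner_form_pos[OF H, of v] by fastforce
  qed
  then have "surj T" using linT linear_injective_imp_surjective by blast
  then obtain v where "T v = (\<Sum>b\<in>Basis. l b *\<^sub>R b)" by (metis surjD)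
  then show ?thesis using * l by blast
qed

text \<open>\<open>sharp\<close> is a definite description, so it is computed by guessing the vector
  and checking the defining equation.\<close>

lemma sharp_unique:
  assumes "inner_form H" "\<And>w. H v w = l w" shows "sharp H l = v"
  unfolding sharp_def
proof (rule the_equality)
  show "\<forall>w. H v w = l w" using assms by blast
  show "\<And>v'. \<forall>w. H v' w = l w \<Longrightarrow> v' = v" using assms inner_form_ext by metis
qed

lemma sharp_works:
  fixes H :: "'e::euclidean_space \<Rightarrow> 'e \<Rightarrow> real"
  assumes "inner_form H" "linear l" shows "H (sharp H l) w = l w"
  using sharp_ex[OF assms] sharp_unique[OF assms(1)] by metis

lemma sharp_add:
  fixes H :: "'e::euclidean_space \<Rightarrow> 'e \<Rightarrow> real"
  assumes "inner_form H" "linear l" "linear m"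
  shows "sharp H (\<lambda>w. l w + m w) = sharp H l + sharp H m"
  by (rule sharp_unique[OF assms(1)])
    (simp add: bilinear_ladd[OF inner_form_bilinear[OF assms(1)]] sharp_works[OF assms(1)] assms)

lemma sharp_cmult:
  fixes H :: "'e::euclidean_space \<Rightarrow> 'e \<Rightarrow> real"
  assumes "inner_form H" "linear l"
  shows "sharp H (\<lambda>w. c * l w) = c *\<^sub>R sharp H l"
  by (rule sharp_unique[OF assms(1)])
    (simp add: bilinear_lmul[OF inner_form_bilinear[OF assms(1)]] sharp_works[OF assms(1)] assms)

lemma sharp_zero:
  fixes H :: "'e::euclidean_space \<Rightarrow> 'e \<Rightarrow> real"
  assumes "inner_form H" shows "sharp H (\<lambda>w. 0) = 0"
  by (rule sharp_unique[OF assms]) (simp add: bilinear_lzero[OF inner_form_bilinear[OF assms]])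

lemma linear_inner: "linear (inner (b::'e::real_inner))"
  by (rule linear_realI) (simp_all add: inner_right_distrib)

lemma sharp_expand:
  fixes H :: "'e::euclidean_space \<Rightarrow> 'e \<Rightarrow> real"
  assumes "inner_form H" "linear l"
  shows "sharp H l = (\<Sum>b\<in>Basis. l b *\<^sub>R sharp H (inner b))"
proof (rule sharp_unique[OF assms(1)])
  fix w
  have lin: "linear (\<lambda>v. H v w)" using inner_form_bilinear[OF assms(1)] by (simp add: bilinear_def)
  show "H (\<Sum>b\<in>Basis. l b *\<^sub>R sharp H (inner b)) w = l w"
    by (simp add: linear_sum[OF lin] linear_scale[OF lin] sharp_works[OF assms(1) linear_inner]
        linear_expand[OF assms(2), of w] inner_commute mult.commute)
qed

lemma linear_sharp_inner:
  fixes H :: "'e::euclidean_space \<Rightarrow> 'e \<Rightarrow> real"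
  assumes "inner_form H" shows "linear (\<lambda>x. sharp H (inner x))"
proof (rule linearI)
  fix x y :: 'e and c :: real
  have "(inner (x + y)) = (\<lambda>w. x \<bullet> w + y \<bullet> w)" by (auto simp: inner_left_distrib)
  then show "sharp H (inner (x + y)) = sharp H (inner x) + sharp H (inner y)"
    using sharp_add[OF assms linear_inner linear_inner] by simp
  have "inner (c *\<^sub>R x) = (\<lambda>w. c * (x \<bullet> w))" by auto
  then show "sharp H (inner (c *\<^sub>R x)) = c *\<^sub>R sharp H (inner x)"
    using sharp_cmult[OF assms linear_inner] by simp
qed

lemma inner_form_scale:
  assumes "inner_form H" "c > 0" shows "inner_form (\<lambda>v w. c * H v w)"
  using assms by (auto simp: inner_form_def sym_pos_def_def bilinear_cmult)

lemma sharp_scale: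
  fixes H :: "'e::euclidean_space \<Rightarrow> 'e \<Rightarrow> real"
  assumes "inner_form H" "c > 0" "linear l"
  shows "sharp (\<lambda>v w. c * H v w) l = inverse c *\<^sub>R sharp H l"
  using assms(2)
  by (intro sharp_unique[OF inner_form_scale[OF assms(1,2)]])
    (simp add: bilinear_lmul[OF inner_form_bilinear[OF assms(1)]] sharp_works[OF assms(1,3)])

text \<open>The constant is the minimum on the unit sphere, which is attained by compactness;
  homogeneity does the rest.\<close>

lemma inner_form_coercive:
  fixes H :: "'e::euclidean_space \<Rightarrow> 'e \<Rightarrow> real"
  assumes "inner_form H"
  obtains c where "c > 0" "\<And>v. H v v \<ge> c * (norm v)\<^sup>2"
proof -
  have bb: "bounded_bilinear H"
    using inner_form_bilinear[OF assms] bilinear_conv_bounded_bilinear by blast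
  have cont: "continuous_on (sphere 0 1) (\<lambda>v. H v v)"
    by (intro bounded_bilinear.continuous_on[OF bb] continuous_intros)
  have ne: "sphere (0::'e) 1 \<noteq> {}" by simp
  obtain v0 where v0: "v0 \<in> sphere 0 1" "\<And>v. v \<in> sphere 0 1 \<Longrightarrow> H v0 v0 \<le> H v v"
    using continuous_attains_inf[OF compact_sphere ne cont] by blast
  have pos: "H v0 v0 > 0" using v0(1) by (intro inner_form_pos[OF assms]) auto
  moreover have "H v v \<ge> H v0 v0 * (norm v)\<^sup>2" for v
  proof (cases "v = 0")
    case False
    have "H v0 v0 \<le> H (v /\<^sub>R norm v) (v /\<^sub>R norm v)" using False by (intro v0(2)) simp
    also have "\<dots> = H v v / (norm v)\<^sup>2"
      using inner_form_bilinear[OF assms]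
      by (simp add: bilinear_lmul bilinear_rmul power2_eq_square divide_inverse)
    finally show ?thesis using False by (simp add: field_simps)
  qed (simp add: bilinear_lzero[OF inner_form_bilinear[OF assms]])
  ultimately show ?thesis using that by blast
qed

lemma tendsto_bilinear_forms:
  fixes B :: "'q \<Rightarrow> 'e::euclidean_space \<Rightarrow> 'e \<Rightarrow> 'f::real_normed_vector"
  assumes "\<And>v w. ((\<lambda>q. B q v w) \<longlongrightarrow> B0 v w) F" "\<forall>\<^sub>F q in F. bilinear (B q)" "bilinear B0"
    and "(a \<longlongrightarrow> a0) F" "(b \<longlongrightarrow> b0) F"
  shows "((\<lambda>q. B q (a q) (b q)) \<longlongrightarrow> B0 a0 b0) F"
proof -
  have "((\<lambda>q. \<Sum>i\<in>Basis. \<Sum>j\<in>Basis. ((a q \<bullet> i) * (b q \<bullet> j)) *\<^sub>R B q i j)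
      \<longlongrightarrow> (\<Sum>i\<in>Basis. \<Sum>j\<in>Basis. ((a0 \<bullet> i) * (b0 \<bullet> j)) *\<^sub>R B0 i j)) F"
    by (intro tendsto_intros assms)
  moreover have "\<forall>\<^sub>F q in F. (\<Sum>i\<in>Basis. \<Sum>j\<in>Basis. ((a q \<bullet> i) * (b q \<bullet> j)) *\<^sub>R B q i j) = B q (a q) (b q)"
    using assms(2) by eventually_elim (rule bilinear_expand[symmetric])
  ultimately show ?thesis
    using bilinear_expand[OF assms(3), of a0 b0] by (simp add: Lim_transform_eventually)
qed

lemma tendsto_linear_forms:
  fixes l :: "'q \<Rightarrow> 'e::euclidean_space \<Rightarrow> 'f::real_normed_vector"
  assumes "\<And>w. ((\<lambda>q. l q w) \<longlongrightarrow> l0 w) F" "\<forall>\<^sub>F q in F. linear (l q)" "linear l0"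
    and "(a \<longlongrightarrow> a0) F"
  shows "((\<lambda>q. l q (a q)) \<longlongrightarrow> l0 a0) F"
proof -
  have "((\<lambda>q. \<Sum>i\<in>Basis. (a q \<bullet> i) *\<^sub>R l q i) \<longlongrightarrow> (\<Sum>i\<in>Basis. (a0 \<bullet> i) *\<^sub>R l0 i)) F"
    by (intro tendsto_intros assms)
  moreover have "\<forall>\<^sub>F q in F. (\<Sum>i\<in>Basis. (a q \<bullet> i) *\<^sub>R l q i) = l q (a q)"
    using assms(2) by eventually_elim (rule linear_expand[symmetric])
  ultimately show ?thesis
    using linear_expand[OF assms(3), of a0] by (simp add: Lim_transform_eventually)
qed

text \<open>For s = \<open>sharp G l\<close> one has G s = l, so the covector H s equals l - (G - H)
  s; subtracting l0 and applying the sharp of H gives the formula. The unknown s occurs on the right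
  only next to the factor G - H, so continuity and differentiability of \<open>sharp\<close> follow
  without inverting matrices.\<close>

lemma sharp_diff_expand:
  fixes G :: "'e::euclidean_space \<Rightarrow> 'e \<Rightarrow> real"
  assumes G: "inner_form G" "linear l" and H: "inner_form H" "linear l0"
  shows "sharp G l - sharp H l0 =
    (\<Sum>b\<in>Basis. ((l b - l0 b) - (\<Sum>e\<in>Basis. (sharp G l \<bullet> e) * (G e b - H e b))) *\<^sub>R sharp H (inner b))"
proof -
  note bG = inner_form_bilinear[OF G(1)] and bH = inner_form_bilinear[OF H(1)]
  define s where "s = sharp G l"
  define m where "m = (\<lambda>w. (l w - l0 w) - (G s w - H s w))"
  have "linear (G s)" "linear (H s)" using bG bH by (auto simp: bilinear_def)
  then have lin: "linear m" unfolding m_def using G H by (intro linear_compose_sub)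
  have "sharp H m = s - sharp H l0"
    by (rule sharp_unique[OF H(1)])
      (simp add: bilinear_lsub[OF bH] sharp_works[OF H] m_def s_def sharp_works[OF G])
  moreover have "m b = (l b - l0 b) - (\<Sum>e\<in>Basis. (s \<bullet> e) * (G e b - H e b))" for b
  proof -
    have "linear (\<lambda>v. G v b)" "linear (\<lambda>v. H v b)" using bG bH by (auto simp: bilinear_def)
    from linear_expand[OF this(1), of s] linear_expand[OF this(2), of s] show ?thesis
      by (simp add: m_def right_diff_distrib sum_subtractf)
  qed
  ultimately show ?thesis using sharp_expand[OF H(1) lin] by (simp add: s_def)
qed

text \<open>A uniform bound on \<open>sharp (G q) (l q)\<close> comes first; with it, every term on
  the right of \<open>sharp_diff_expand\<close> tends to 0.\<close>

lemma tendsto_sharp: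
  fixes G :: "'q \<Rightarrow> 'e::euclidean_space \<Rightarrow> 'e \<Rightarrow> real"
  assumes G: "\<And>v w. ((\<lambda>q. G q v w) \<longlongrightarrow> H v w) F" "\<forall>\<^sub>F q in F. inner_form (G q)" and H: "inner_form H"
    and l: "\<And>w. ((\<lambda>q. l q w) \<longlongrightarrow> l0 w) F" "\<forall>\<^sub>F q in F. linear (l q)" and l0: "linear l0"
  shows "((\<lambda>q. sharp (G q) (l q)) \<longlongrightarrow> sharp H l0) F"
proof -
  obtain c where c: "c > 0" "\<And>v. H v v \<ge> c * (norm v)\<^sup>2" using inner_form_coercive[OF H] by metis
  define d where "d = (\<lambda>q. \<Sum>i\<in>Basis. \<Sum>j\<in>Basis. \<bar>G q i j - H i j\<bar>)"
  define L where "L = (\<lambda>q. \<Sum>i\<in>Basis. \<bar>l q i\<bar>)"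
  define L0 where "L0 = (\<Sum>i\<in>Basis. \<bar>l0 i\<bar>)"
  have "(d \<longlongrightarrow> (\<Sum>i\<in>(Basis::'e set). \<Sum>j\<in>(Basis::'e set). \<bar>H i j - H i j\<bar>)) F"
    unfolding d_def by (intro tendsto_intros G)
  then have "(d \<longlongrightarrow> 0) F" by simp
  then have ev1: "\<forall>\<^sub>F q in F. d q < c / 2" using c(1) by (intro order_tendstoD) auto
  have "(L \<longlongrightarrow> L0) F" unfolding L_def L0_def by (intro tendsto_intros l)
  then have ev2: "\<forall>\<^sub>F q in F. L q < L0 + 1" by (intro order_tendstoD) auto
  \<comment> \<open>When the entries of G q and H differ by less than c/2 in total, G q is still
    coercive with constant c/2, and c/2 |s|^2 <= G q s s = l q s bounds |s|.\<close>
  have bdd: "\<forall>\<^sub>F q in F. norm (sharp (G q) (l q)) \<le> 2 * (L0 + 1) / c"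
    using ev1 ev2 G(2) l(2)
  proof eventually_elim
    fix q assume q: "d q < c / 2" "L q < L0 + 1" "inner_form (G q)" "linear (l q)"
    define s where "s = sharp (G q) (l q)"
    have "\<bar>G q s s - H s s\<bar> \<le> d q * (norm s)\<^sup>2"
    proof -
      have "G q s s - H s s = (\<Sum>i\<in>Basis. \<Sum>j\<in>Basis. ((s \<bullet> i) * (s \<bullet> j)) * (G q i j - H i j))"
        using bilinear_expand[OF inner_form_bilinear[OF q(3)], of s s]
          bilinear_expand[OF inner_form_bilinear[OF H], of s s]
        by (simp add: right_diff_distrib sum_subtractf)
      also have "\<bar>\<dots>\<bar> \<le> (\<Sum>i\<in>Basis. \<Sum>j\<in>Basis. (norm s)\<^sup>2 * \<bar>G q i j - H i j\<bar>)"
      proof (intro order.trans[OF sum_abs] sum_mono)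
        fix i j :: 'e assume ij: "i \<in> Basis" "j \<in> Basis"
        have "\<bar>(s \<bullet> i) * (s \<bullet> j)\<bar> \<le> norm s * norm s"
          unfolding abs_mult using ij by (intro mult_mono Basis_le_norm) auto
        then show "\<bar>s \<bullet> i * (s \<bullet> j) * (G q i j - H i j)\<bar> \<le> (norm s)\<^sup>2 * \<bar>G q i j - H i j\<bar>"
          by (simp add: abs_mult power2_eq_square mult_right_mono)
      qed
      finally show ?thesis by (simp add: d_def sum_distrib_right sum_distrib_left mult.commute)
    qed
    moreover have "d q * (norm s)\<^sup>2 \<le> c / 2 * (norm s)\<^sup>2" using q(1) by (intro mult_right_mono) auto
    ultimately have "c / 2 * (norm s)\<^sup>2 \<le> G q s s" using c(2)[of s] by (simp add: field_simps)
    also have "G q s s = l q s" unfolding s_def using q by (intro sharp_works)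
    also have "\<dots> \<le> norm s * L q"
    proof -
      have "l q s = (\<Sum>b\<in>Basis. (s \<bullet> b) * l q b)" using linear_expand[OF q(4), of s] by simp
      also have "\<dots> \<le> (\<Sum>b\<in>Basis. norm s * \<bar>l q b\<bar>)"
      proof (rule sum_mono)
        fix b :: 'e assume "b \<in> Basis"
        then have "\<bar>(s \<bullet> b) * l q b\<bar> \<le> norm s * \<bar>l q b\<bar>"
          unfolding abs_mult by (intro mult_mono Basis_le_norm) auto
        then show "(s \<bullet> b) * l q b \<le> norm s * \<bar>l q b\<bar>" by linarith
      qed
      finally show ?thesis by (simp add: L_def sum_distrib_left)
    qed
    also have "\<dots> \<le> norm s * (L0 + 1)" using q(2) by (intro mult_left_mono) auto
    finally have "norm s * (c / 2 * norm s) \<le> norm s * (L0 + 1)" by (simp add: power2_eq_square mult_ac)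
    moreover have "L0 \<ge> 0" by (auto simp: L0_def intro: sum_nonneg)
    ultimately have "c / 2 * norm s \<le> L0 + 1" by (cases "s = 0") auto
    then show "norm (sharp (G q) (l q)) \<le> 2 * (L0 + 1) / c"
      using c(1) by (simp add: s_def[symmetric] field_simps)
  qed
  have lim0: "((\<lambda>q. (sharp (G q) (l q) \<bullet> e) * (G q e b - H e b)) \<longlongrightarrow> 0) F" if "e \<in> Basis" for e b
  proof (rule Lim_null_comparison)
    show "\<forall>\<^sub>F q in F. norm ((sharp (G q) (l q) \<bullet> e) * (G q e b - H e b)) \<le>
        2 * (L0 + 1) / c * \<bar>G q e b - H e b\<bar>"
      using bdd
    proof eventually_elim
      fix q assume "norm (sharp (G q) (l q)) \<le> 2 * (L0 + 1) / c"
      then have "\<bar>sharp (G q) (l q) \<bullet> e\<bar> \<le> 2 * (L0 + 1) / c"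
        using Basis_le_norm[OF that, of "sharp (G q) (l q)"] by linarith
      then show "norm ((sharp (G q) (l q) \<bullet> e) * (G q e b - H e b)) \<le> 2 * (L0 + 1) / c * \<bar>G q e b - H e b\<bar>"
        unfolding real_norm_def abs_mult by (intro mult_right_mono) auto
    qed
    have "((\<lambda>q. 2 * (L0 + 1) / c * \<bar>G q e b - H e b\<bar>) \<longlongrightarrow> 2 * (L0 + 1) / c * \<bar>H e b - H e b\<bar>) F"
      by (intro tendsto_mult tendsto_const tendsto_rabs tendsto_diff G)
    then show "((\<lambda>q. 2 * (L0 + 1) / c * \<bar>G q e b - H e b\<bar>) \<longlongrightarrow> 0) F" by simp
  qed
  have "((\<lambda>q. \<Sum>b\<in>Basis. ((l q b - l0 b) - (\<Sum>e\<in>Basis. (sharp (G q) (l q) \<bullet> e) * (G q e b - H e b))) *\<^sub>R sharp H (inner b))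
    \<longlongrightarrow> (\<Sum>b\<in>Basis. ((l0 b - l0 b) - (\<Sum>e\<in>(Basis::'e set). 0)) *\<^sub>R sharp H (inner b))) F"
    by (intro tendsto_sum tendsto_scaleR tendsto_diff tendsto_const l lim0)
  moreover have "\<forall>\<^sub>F q in F. (\<Sum>b\<in>Basis. ((l q b - l0 b) - (\<Sum>e\<in>Basis. (sharp (G q) (l q) \<bullet> e) * (G q e b - H e b))) *\<^sub>R sharp H (inner b))
      = sharp (G q) (l q) - sharp H l0"
    using G(2) l(2) by eventually_elim (simp add: sharp_diff_expand H l0)
  ultimately have "((\<lambda>q. sharp (G q) (l q) - sharp H l0) \<longlongrightarrow> 0) F"
    by (simp add: Lim_transform_eventually)
  then show ?thesis by (simp add: LIM_zero_iff)
qed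

text \<open>Where h vanishes, continuity of f is enough for the product rule. In
  \<open>has_derivative_sharp\<close> the factor f is a component of the vector whose derivative is
  yet to be found, and h is an entry of G x - G x0.\<close>

lemma has_derivative_mult_vanishing:
  fixes f h :: "'e::real_normed_vector \<Rightarrow> real"
  assumes f: "isCont f x0" and h: "(h has_derivative h') (at x0)" "h x0 = 0"
  shows "((\<lambda>x. f x * h x) has_derivative (\<lambda>a. f x0 * h' a)) (at x0)"
proof -
  interpret h': bounded_linear h' using h(1) by (rule has_derivative_bounded_linear)
  obtain K where K: "K > 0" "\<And>x. norm (h' x) \<le> norm x * K" using h'.pos_bounded by blast
  have lim: "((\<lambda>x. norm (h x - h x0 - h' (x - x0)) / norm (x - x0)) \<longlongrightarrow> 0) (at x0)"
    using h(1) by (simp add: has_derivative_iff_norm)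
  show ?thesis
    unfolding has_derivative_iff_norm
  proof (intro conjI)
    show "bounded_linear (\<lambda>a. f x0 * h' a)" using h'.bounded_linear_axioms by (rule bounded_linear_const_mult)
    show "((\<lambda>x. norm (f x * h x - f x0 * h x0 - f x0 * h' (x - x0)) / norm (x - x0)) \<longlongrightarrow> 0) (at x0)"
    proof (rule Lim_null_comparison)
      show "\<forall>\<^sub>F x in at x0. norm (norm (f x * h x - f x0 * h x0 - f x0 * h' (x - x0)) / norm (x - x0))
        \<le> \<bar>f x\<bar> * (norm (h x - h x0 - h' (x - x0)) / norm (x - x0)) + \<bar>f x - f x0\<bar> * K"
      proof (rule eventually_at_topological[THEN iffD2], intro exI[of _ UNIV] conjI ballI impI)
        fix x assume "x \<noteq> x0"
        have "f x * h x - f x0 * h x0 - f x0 * h' (x - x0) =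
            f x * (h x - h x0 - h' (x - x0)) + (f x - f x0) * h' (x - x0)"
          using h(2) by (simp add: algebra_simps)
        also have "norm \<dots> \<le> \<bar>f x\<bar> * norm (h x - h x0 - h' (x - x0)) + \<bar>f x - f x0\<bar> * (norm (x - x0) * K)"
          using K(2)[of "x - x0"] by (intro order.trans[OF norm_triangle_ineq] add_mono)
            (simp_all add: abs_mult mult_left_mono)
        finally have "norm (f x * h x - f x0 * h x0 - f x0 * h' (x - x0)) / norm (x - x0) \<le> (\<bar>f x\<bar> * norm (h x - h x0 - h' (x - x0)) + \<bar>f x - f x0\<bar> * (norm (x - x0) * K)) / norm (x - x0)"
          by (rule divide_right_mono) simp
        then show "norm (norm (f x * h x - f x0 * h x0 - f x0 * h' (x - x0)) / norm (x - x0))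
        \<le> \<bar>f x\<bar> * (norm (h x - h x0 - h' (x - x0)) / norm (x - x0)) + \<bar>f x - f x0\<bar> * K"
          using \<open>x \<noteq> x0\<close> by (simp add: add_divide_distrib)
      qed auto
      have f': "(f \<longlongrightarrow> f x0) (at x0)" using f by (simp add: isCont_def)
      have "((\<lambda>x. \<bar>f x\<bar> * (norm (h x - h x0 - h' (x - x0)) / norm (x - x0)) + \<bar>f x - f x0\<bar> * K)
        \<longlongrightarrow> \<bar>f x0\<bar> * 0 + \<bar>f x0 - f x0\<bar> * K) (at x0)"
        by (intro tendsto_add tendsto_mult tendsto_rabs f' lim tendsto_const tendsto_diff)
      then show "((\<lambda>x. \<bar>f x\<bar> * (norm (h x - h x0 - h' (x - x0)) / norm (x - x0)) + \<bar>f x - f x0\<bar> * K)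
        \<longlongrightarrow> 0) (at x0)" by simp
    qed
  qed
qed

text \<open>Differentiation in x commutes with the linear operations on w, and derivatives are
  unique.\<close>

lemma linear_derivative_forms:
  fixes l :: "'e::real_normed_vector \<Rightarrow> 'v::real_vector \<Rightarrow> 'f::real_normed_vector"
  assumes S: "open S" "x0 \<in> S" "\<And>x. x \<in> S \<Longrightarrow> linear (l x)"
    and l: "\<And>w. ((\<lambda>x. l x w) has_derivative (\<lambda>a. l' a w)) (at x0)"
  shows "linear (l' a)"
proof (rule linearI)
  fix v w c
  have "((\<lambda>x. l x (v + w)) has_derivative (\<lambda>a. l' a v + l' a w)) (at x0)"
    by (rule has_derivative_transform_within_open[OF has_derivative_add[OF l[of v] l[of w]] S(1,2)])
      (simp add: S(3) linear_add)
  with l[of "v + w"] have "(\<lambda>a. l' a (v + w)) = (\<lambda>a. l' a v + l' a w)" by (rule has_derivative_unique)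
  then show "l' a (v + w) = l' a v + l' a w" by metis
  have "((\<lambda>x. l x (c *\<^sub>R v)) has_derivative (\<lambda>a. c *\<^sub>R l' a v)) (at x0)"
    by (rule has_derivative_transform_within_open[OF has_derivative_scaleR_right[OF l[of v], of c] S(1,2)])
      (simp add: S(3) linear_scale)
  with l[of "c *\<^sub>R v"] have "(\<lambda>a. l' a (c *\<^sub>R v)) = (\<lambda>a. c *\<^sub>R l' a v)" by (rule has_derivative_unique)
  then show "l' a (c *\<^sub>R v) = c *\<^sub>R l' a v" by metis
qed

lemma bilinear_derivative_forms:
  fixes B :: "'e::real_normed_vector \<Rightarrow> 'v::real_vector \<Rightarrow> 'v \<Rightarrow> 'f::real_normed_vector"
  assumes S: "open S" "x0 \<in> S" "\<And>x. x \<in> S \<Longrightarrow> bilinear (B x)"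
    and B: "\<And>v w. ((\<lambda>x. B x v w) has_derivative (\<lambda>a. B' a v w)) (at x0)"
  shows "bilinear (B' a)"
  unfolding bilinear_def
proof (intro conjI allI)
  fix v w
  show "linear (B' a v)"
    using S(3) by (intro linear_derivative_forms[where l="\<lambda>x w. B x v w" and l'="\<lambda>a w. B' a v w", OF S(1,2) _ B]) (simp add: bilinear_def)
  show "linear (\<lambda>v. B' a v w)"
    using S(3) by (intro linear_derivative_forms[where l="\<lambda>x v. B x v w" and l'="\<lambda>a v. B' a v w", OF S(1,2) _ B])
      (simp add: bilinear_def)
qed

text \<open>The formula is what differentiating G x (s x) w = l x w suggests; that the derivative
  exists comes from \<open>sharp_diff_expand\<close> with the fixed form G x0.\<close>

lemma has_derivative_sharp:
  fixes G :: "'e::real_normed_vector \<Rightarrow> 'v::euclidean_space \<Rightarrow> 'v \<Rightarrow> real"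
  assumes S: "open S" "x0 \<in> S" "\<And>x. x \<in> S \<Longrightarrow> inner_form (G x)" "\<And>x. x \<in> S \<Longrightarrow> linear (l x)"
    and G: "\<And>v w. ((\<lambda>x. G x v w) has_derivative (\<lambda>a. G' a v w)) (at x0)"
    and l: "\<And>w. ((\<lambda>x. l x w) has_derivative (\<lambda>a. l' a w)) (at x0)"
  shows "((\<lambda>x. sharp (G x) (l x)) has_derivative
    (\<lambda>a. sharp (G x0) (\<lambda>w. l' a w - G' a (sharp (G x0) (l x0)) w))) (at x0)"
proof -
  define s where "s = (\<lambda>x. sharp (G x) (l x))"
  note H = S(3)[OF S(2)] S(4)[OF S(2)]
  have evS: "\<forall>\<^sub>F x in at x0. x \<in> S" using S by (intro eventually_at_in_open') 
  have cont: "isCont s x0"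
    unfolding isCont_def s_def
  proof (rule tendsto_sharp)
    show "((\<lambda>q. G q v w) \<longlongrightarrow> G x0 v w) (at x0)" for v w
      using has_derivative_continuous[OF G] by (simp add: isCont_def)
    show "((\<lambda>q. l q w) \<longlongrightarrow> l x0 w) (at x0)" for w
      using has_derivative_continuous[OF l] by (simp add: isCont_def)
    show "\<forall>\<^sub>F q in at x0. inner_form (G q)" using evS by eventually_elim (rule S)
    show "\<forall>\<^sub>F q in at x0. linear (l q)" using evS by eventually_elim (rule S)
  qed (use H in auto)
  define m where "m = (\<lambda>x b. (l x b - l x0 b) - (\<Sum>e\<in>Basis. (s x \<bullet> e) * (G x e b - G x0 e b)))"
  have G0: "((\<lambda>x. G x e b - G x0 e b) has_derivative (\<lambda>a. G' a e b)) (at x0)" for e b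
    using has_derivative_diff[OF G has_derivative_const] by simp
  have l0: "((\<lambda>x. l x b - l x0 b) has_derivative (\<lambda>a. l' a b)) (at x0)" for b
    using has_derivative_diff[OF l has_derivative_const] by simp
  \<comment> \<open>Each difference in m vanishes at x0, so
    \<open>has_derivative_mult_vanishing\<close> applies although s is so far only known to be
    continuous.\<close>
  have D1: "((\<lambda>x. s x0 + (\<Sum>b\<in>Basis. m x b *\<^sub>R sharp (G x0) (inner b))) has_derivative
      (\<lambda>a. 0 + (\<Sum>b\<in>Basis. (l' a b - (\<Sum>e\<in>Basis. (s x0 \<bullet> e) * G' a e b)) *\<^sub>R sharp (G x0) (inner b)))) (at x0)"
    unfolding m_def
    by (intro has_derivative_add has_derivative_const has_derivative_sum has_derivative_scaleR_left
        has_derivative_diff has_derivative_mult_vanishing G0 l0 continuous_intros cont) auto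
  have bG': "bilinear (G' a)" for a
    using S(3) by (intro bilinear_derivative_forms[OF S(1,2) _ G] inner_form_bilinear)
  have ll': "linear (l' a)" for a by (intro linear_derivative_forms[OF S(1,2) _ l] S(4))
  have eq: "0 + (\<Sum>b\<in>Basis. (l' a b - (\<Sum>e\<in>Basis. (s x0 \<bullet> e) * G' a e b)) *\<^sub>R sharp (G x0) (inner b))
      = sharp (G x0) (\<lambda>w. l' a w - G' a (s x0) w)" for a
  proof -
    have lin: "linear (\<lambda>w. l' a w - G' a (s x0) w)"
      using ll' bG'[of a] by (intro linear_compose_sub) (auto simp: bilinear_def)
    have "linear (\<lambda>v. G' a v b)" for b using bG'[of a] by (simp add: bilinear_def)
    then have "(\<Sum>e\<in>Basis. (s x0 \<bullet> e) * G' a e b) = G' a (s x0) b" for b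
      using linear_expand[of "\<lambda>v. G' a v b" "s x0"] by simp
    then show ?thesis by (simp add: sharp_expand[OF H(1) lin])
  qed
  have "(s has_derivative (\<lambda>a. sharp (G x0) (\<lambda>w. l' a w - G' a (s x0) w))) (at x0)"
  proof (rule has_derivative_transform_within_open[OF D1[unfolded eq] S(1,2)])
    fix x assume "x \<in> S"
    show "s x0 + (\<Sum>b\<in>Basis. m x b *\<^sub>R sharp (G x0) (inner b)) = s x"
      using sharp_diff_expand[OF S(3)[OF \<open>x \<in> S\<close>] S(4)[OF \<open>x \<in> S\<close>] H] by (simp add: m_def s_def algebra_simps)
  qed
  then show ?thesis by (simp add: s_def)
qed


text \<open>Cyclicity of the trace. With a change of coordinates as one factor it makes the
  contractions in \<open>ricci\<close> and \<open>scalar_curvature\<close> independent of the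
  chart.\<close>

lemma trace_comm:
  fixes P Q :: "'e::euclidean_space \<Rightarrow> 'e"
  assumes "linear P" "linear Q"
  shows "(\<Sum>b\<in>Basis. b \<bullet> P (Q b)) = (\<Sum>b\<in>Basis. b \<bullet> Q (P b))"
proof -
  have "(\<Sum>b\<in>Basis. b \<bullet> P (Q b)) = (\<Sum>b\<in>Basis. \<Sum>e\<in>Basis. (Q b \<bullet> e) * (b \<bullet> P e))"
  proof (rule sum.cong[OF refl])
    fix b :: 'e
    show "b \<bullet> P (Q b) = (\<Sum>e\<in>Basis. (Q b \<bullet> e) * (b \<bullet> P e))"
      by (subst linear_expand[OF assms(1)]) (simp add: inner_sum_right)
  qed
  also have "\<dots> = (\<Sum>e\<in>Basis. \<Sum>b\<in>Basis. (Q b \<bullet> e) * (b \<bullet> P e))" by (rule sum.swap)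
  also have "\<dots> = (\<Sum>e\<in>Basis. e \<bullet> Q (P e))"
  proof (rule sum.cong[OF refl])
    fix e :: 'e
    show "(\<Sum>b\<in>Basis. (Q b \<bullet> e) * (b \<bullet> P e)) = e \<bullet> Q (P e)"
      by (subst linear_expand[OF assms(2), of "P e"]) (simp add: inner_sum_right inner_commute mult.commute)
  qed
  finally show ?thesis .
qed

section \<open>Invariance of contractions and tensor norms under linear isometries\<close>

text \<open>L stands for the derivative of a transition map and M for its inverse. Vectors are
  transported by L; covectors, read as vectors through the Euclidean inner product, by the adjoint
  of M.\<close>

locale isometry_forms =
  fixes H1 H2 :: "'e::euclidean_space \<Rightarrow> 'e \<Rightarrow> real" and L M :: "'e \<Rightarrow> 'e"
  assumes H1: "inner_form H1" and H2: "inner_form H2"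
    and L: "linear L" and M: "linear M" and right_inverse: "\<And>x. L (M x) = x" and left_inverse: "\<And>x. M (L x) = x"
    and iso: "\<And>v w. H1 v w = H2 (L v) (L w)"
begin

lemma sharp_transform:
  assumes "linear l" shows "L (sharp H1 l) = sharp H2 (\<lambda>w. l (M w))"
proof (rule sharp_unique[OF H2, symmetric])
  fix w
  show "H2 (L (sharp H1 l)) w = l (M w)"
    using iso[of "sharp H1 l" "M w"] sharp_works[OF H1 assms] by (simp add: right_inverse)
qed

lemma covector_norm_transform:
  assumes "linear l" shows "covector_norm H1 (\<lambda>v. l (L v)) = covector_norm H2 l"
proof -
  have "linear (\<lambda>v. l (L v))" using linear_compose[OF L assms] by (simp add: comp_def)
  from sharp_transform[OF this] show ?thesis by (simp add: covector_norm_def right_inverse)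
qed

text \<open>Contracting one index with \<open>dual_metric\<close> inserts a sharp, so both sides
  become sums of B at a basis vector and its sharp, and \<open>sharp_transform\<close> carries one
  into the other.\<close>

lemma dual_metric_sum_transform:
  assumes B: "bilinear B"
  shows "(\<Sum>a\<in>Basis. \<Sum>b\<in>Basis. dual_metric H1 a b * B (L a) (L b)) =
    (\<Sum>a\<in>Basis. \<Sum>b\<in>Basis. dual_metric H2 a b * B a b :: real)"
proof -
  have linBr: "linear (B x)" and linBl: "linear (\<lambda>x. B x y)" for x y using B by (auto simp: bilinear_def)
  have *: "(\<Sum>b\<in>Basis. dual_metric H a b * B x (T b)) = B x (T (sharp H (inner a)))"
    if "linear T" for T x a and H :: "'e \<Rightarrow> 'e \<Rightarrow> real"
  proof -
    have "linear (\<lambda>v. B x (T v))" using linear_compose[OF that linBr] by (simp add: comp_def)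
    from linear_expand[OF this, of "sharp H (inner a)"] show ?thesis
      by (simp add: dual_metric_def inner_commute)
  qed
  have eq: "L (sharp H1 (inner a)) = (\<Sum>c\<in>Basis. (a \<bullet> M c) *\<^sub>R sharp H2 (inner c))" for a
  proof -
    have "linear (\<lambda>w. a \<bullet> M w)" using linear_compose[OF M linear_inner] by (simp add: comp_def)
    from sharp_expand[OF H2 this] sharp_transform[OF linear_inner, of a] show ?thesis by simp
  qed
  have "(\<Sum>a\<in>Basis. \<Sum>b\<in>Basis. dual_metric H1 a b * B (L a) (L b))
      = (\<Sum>a\<in>Basis. B (L a) (L (sharp H1 (inner a))))"
    by (simp add: *[OF L])
  also have "\<dots> = (\<Sum>a\<in>Basis. \<Sum>c\<in>Basis. (M c \<bullet> a) * B (L a) (sharp H2 (inner c)))"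
    by (simp add: eq linear_sum[OF linBr] linear_scale[OF linBr] inner_commute)
  also have "\<dots> = (\<Sum>c\<in>Basis. \<Sum>a\<in>Basis. (M c \<bullet> a) * B (L a) (sharp H2 (inner c)))" by (rule sum.swap)
  also have "\<dots> = (\<Sum>c\<in>Basis. B c (sharp H2 (inner c)))"
  proof (rule sum.cong[OF refl])
    fix c
    have "linear (\<lambda>v. B (L v) (sharp H2 (inner c)))"
      using linear_compose[OF L linBl] by (simp add: comp_def)
    from linear_expand[OF this, of "M c"]
    show "(\<Sum>a\<in>Basis. (M c \<bullet> a) * B (L a) (sharp H2 (inner c))) = B c (sharp H2 (inner c))"
      by (simp add: right_inverse)
  qed
  also have "\<dots> = (\<Sum>a\<in>Basis. \<Sum>b\<in>Basis. dual_metric H2 a b * B a b)"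
    using *[OF linear_ident] by simp
  finally show ?thesis .
qed

text \<open>Here the indices of B are covector indices. The matrices of L and of the adjoint of M
  invert each other in the sense of \<open>sum_adj\<close>, so \<open>key\<close> removes the
  transformation from one index at a time.\<close>

lemma metric_sum_transform:
  assumes B: "bilinear B"
  shows "(\<Sum>i\<in>Basis. \<Sum>j\<in>Basis. H1 i j * B (adjoint M i) (adjoint M j)) =
    (\<Sum>i\<in>Basis. \<Sum>j\<in>Basis. H2 i j * B i j :: real)"
proof -
  have linBr: "linear (B x)" and linBl: "linear (\<lambda>x. B x y)" for x y using B by (auto simp: bilinear_def)
  have bH: "bilinear H2" using H2 by (rule inner_form_bilinear)
  have linHr: "linear (H2 x)" and linHl: "linear (\<lambda>x. H2 x y)" for x y using bH by (auto simp: bilinear_def)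
  have adj: "adjoint M i \<bullet> x = i \<bullet> M x" for i x using adjoint_works[OF M, of x i] by (simp add: inner_commute)
  have sum_adj: "(\<Sum>i\<in>Basis. (L i \<bullet> k) *\<^sub>R adjoint M i) = k" for k
  proof (rule euclidean_eqI)
    fix b :: 'e assume "b \<in> Basis"
    have "(\<Sum>i\<in>Basis. (L i \<bullet> k) *\<^sub>R adjoint M i) \<bullet> b = (\<Sum>i\<in>Basis. (M b \<bullet> i) * (L i \<bullet> k))"
      by (simp add: inner_sum_left adj inner_commute[of "M b"] mult.commute)
    also have "\<dots> = L (M b) \<bullet> k"
      by (subst linear_expand[OF L, of "M b"]) (simp add: inner_sum_left)
    finally show "(\<Sum>i\<in>Basis. (L i \<bullet> k) *\<^sub>R adjoint M i) \<bullet> b = k \<bullet> b" by (simp add: right_inverse inner_commute)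
  qed
  have key: "(\<Sum>i\<in>Basis. (\<Sum>k\<in>Basis. (L i \<bullet> k) * f k) * g (adjoint M i)) = (\<Sum>k\<in>Basis. f k * g k)"
    if "linear g" for f g :: "'e \<Rightarrow> real"
  proof -
    have "(\<Sum>i\<in>Basis. (\<Sum>k\<in>Basis. (L i \<bullet> k) * f k) * g (adjoint M i)) =
        (\<Sum>k\<in>Basis. \<Sum>i\<in>Basis. f k * ((L i \<bullet> k) * g (adjoint M i)))"
      by (subst sum.swap) (simp add: sum_distrib_right sum_distrib_left mult_ac)
    also have "\<dots> = (\<Sum>k\<in>Basis. f k * g (\<Sum>i\<in>Basis. (L i \<bullet> k) *\<^sub>R adjoint M i))"
      by (simp add: linear_sum[OF that] linear_scale[OF that] sum_distrib_left)
    finally show ?thesis by (simp add: sum_adj)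
  qed
  have ex: "H1 i j = (\<Sum>k\<in>Basis. (L j \<bullet> k) * H2 (L i) k)" for i j
    using iso[of i j] linear_expand[OF linHr, of "L i" "L j"] by simp
  have ex': "H2 (L i) k = (\<Sum>l\<in>Basis. (L i \<bullet> l) * H2 l k)" for i k
    using linear_expand[OF linHl, of "L i" k] by simp
  have "(\<Sum>i\<in>Basis. \<Sum>j\<in>Basis. H1 i j * B (adjoint M i) (adjoint M j))
      = (\<Sum>i\<in>Basis. \<Sum>k\<in>Basis. H2 (L i) k * B (adjoint M i) k)"
    unfolding ex by (simp add: key[OF linBr])
  also have "\<dots> = (\<Sum>k\<in>Basis. \<Sum>i\<in>Basis. H2 (L i) k * B (adjoint M i) k)" by (rule sum.swap)
  also have "\<dots> = (\<Sum>k\<in>Basis. \<Sum>l\<in>Basis. H2 l k * B l k)"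
    unfolding ex' by (simp add: key[OF linBl])
  also have "\<dots> = (\<Sum>i\<in>Basis. \<Sum>j\<in>Basis. H2 i j * B i j)" by (rule sum.swap)
  finally show ?thesis .
qed

end

lemma (in isometry_forms) norm11_transform:
  fixes T1 T2 :: "'e \<Rightarrow> 'e"
  assumes "linear T2" "\<And>v. L (T1 v) = T2 (L v)"
  shows "(\<Sum>a\<in>Basis. \<Sum>b\<in>Basis. dual_metric H1 a b * H1 (T1 a) (T1 b)) =
    (\<Sum>a\<in>Basis. \<Sum>b\<in>Basis. dual_metric H2 a b * H2 (T2 a) (T2 b))"
  using dual_metric_sum_transform[OF bilinear_comp_linear[OF inner_form_bilinear[OF H2] assms(1,1)]]
  by (simp add: iso assms(2))

text \<open>The squared norm is four nested contractions, each of a form bilinear in one pair of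
  indices with the other indices as parameters. They are transformed one at a time, from the
  innermost pair outward.\<close>

lemma (in isometry_forms) norm22_transform:
  fixes t1 t2 :: "'e \<Rightarrow> 'e \<Rightarrow> 'e \<Rightarrow> 'e \<Rightarrow> real"
  assumes lin: "\<And>v i j. linear (\<lambda>u. t2 u v i j)" "\<And>u i j. linear (\<lambda>v. t2 u v i j)"
      "\<And>u v j. linear (\<lambda>i. t2 u v i j)" "\<And>u v i. linear (\<lambda>j. t2 u v i j)"
    and t1: "\<And>u v i j. t1 u v i j = t2 (L u) (L v) (adjoint M i) (adjoint M j)"
  shows "(\<Sum>a\<in>Basis. \<Sum>a'\<in>Basis. \<Sum>b\<in>Basis. \<Sum>b'\<in>Basis.
     \<Sum>i\<in>Basis. \<Sum>i'\<in>Basis. \<Sum>j\<in>Basis. \<Sum>j'\<in>Basis.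
       dual_metric H1 a a' * dual_metric H1 b b' * H1 i i' * H1 j j' * t1 a b i j * t1 a' b' i' j') =
   (\<Sum>a\<in>Basis. \<Sum>a'\<in>Basis. \<Sum>b\<in>Basis. \<Sum>b'\<in>Basis.
     \<Sum>i\<in>Basis. \<Sum>i'\<in>Basis. \<Sum>j\<in>Basis. \<Sum>j'\<in>Basis.
       dual_metric H2 a a' * dual_metric H2 b b' * H2 i i' * H2 j j' * t2 a b i j * t2 a' b' i' j')"
proof -
  have nest: "(\<Sum>a\<in>Basis. \<Sum>a'\<in>Basis. \<Sum>b\<in>Basis. \<Sum>b'\<in>Basis.
     \<Sum>i\<in>Basis. \<Sum>i'\<in>Basis. \<Sum>j\<in>Basis. \<Sum>j'\<in>Basis.
       dual_metric H a a' * dual_metric H b b' * H i i' * H j j' * t a b i j * t a' b' i' j') =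
   (\<Sum>a\<in>Basis. \<Sum>a'\<in>Basis. dual_metric H a a' * (\<Sum>b\<in>Basis. \<Sum>b'\<in>Basis. dual_metric H b b' *
     (\<Sum>i\<in>Basis. \<Sum>i'\<in>Basis. H i i' * (\<Sum>j\<in>Basis. \<Sum>j'\<in>Basis. H j j' * (t a b i j * t a' b' i' j')))))"
    for H :: "'e \<Rightarrow> 'e \<Rightarrow> real" and t :: "'e \<Rightarrow> 'e \<Rightarrow> 'e \<Rightarrow> 'e \<Rightarrow> real"
    by (simp add: sum_distrib_left mult.assoc)
  have s1: "(\<Sum>j\<in>Basis. \<Sum>j'\<in>Basis. H1 j j' * (t2 u v x (adjoint M j) * t2 u' v' x' (adjoint M j'))) =
      (\<Sum>j\<in>Basis. \<Sum>j'\<in>Basis. H2 j j' * (t2 u v x j * t2 u' v' x' j'))" for u v x u' v' x'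
    by (rule metric_sum_transform[OF bilinear_mult_linear]) (rule lin)+
  have s2: "(\<Sum>i\<in>Basis. \<Sum>i'\<in>Basis. H1 i i' * (\<Sum>j\<in>Basis. \<Sum>j'\<in>Basis. H2 j j' * (t2 u v (adjoint M i) j * t2 u' v' (adjoint M i') j'))) =
      (\<Sum>i\<in>Basis. \<Sum>i'\<in>Basis. H2 i i' * (\<Sum>j\<in>Basis. \<Sum>j'\<in>Basis. H2 j j' * (t2 u v i j * t2 u' v' i' j')))" for u v u' v'
    by (rule metric_sum_transform) (intro bilinear_sum_forms bilinear_cmult bilinear_mult_linear lin)
  have s3: "(\<Sum>b\<in>Basis. \<Sum>b'\<in>Basis. dual_metric H1 b b' * (\<Sum>i\<in>Basis. \<Sum>i'\<in>Basis. H2 i i' *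
        (\<Sum>j\<in>Basis. \<Sum>j'\<in>Basis. H2 j j' * (t2 u (L b) i j * t2 u' (L b') i' j')))) =
      (\<Sum>b\<in>Basis. \<Sum>b'\<in>Basis. dual_metric H2 b b' * (\<Sum>i\<in>Basis. \<Sum>i'\<in>Basis. H2 i i' *
        (\<Sum>j\<in>Basis. \<Sum>j'\<in>Basis. H2 j j' * (t2 u b i j * t2 u' b' i' j'))))" for u u'
    by (rule dual_metric_sum_transform) (intro bilinear_sum_forms bilinear_cmult bilinear_mult_linear lin)
  have s4: "(\<Sum>a\<in>Basis. \<Sum>a'\<in>Basis. dual_metric H1 a a' *
        (\<Sum>b\<in>Basis. \<Sum>b'\<in>Basis. dual_metric H2 b b' * (\<Sum>i\<in>Basis. \<Sum>i'\<in>Basis. H2 i i' *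
        (\<Sum>j\<in>Basis. \<Sum>j'\<in>Basis. H2 j j' * (t2 (L a) b i j * t2 (L a') b' i' j'))))) =
      (\<Sum>a\<in>Basis. \<Sum>a'\<in>Basis. dual_metric H2 a a' *
        (\<Sum>b\<in>Basis. \<Sum>b'\<in>Basis. dual_metric H2 b b' * (\<Sum>i\<in>Basis. \<Sum>i'\<in>Basis. H2 i i' *
        (\<Sum>j\<in>Basis. \<Sum>j'\<in>Basis. H2 j j' * (t2 a b i j * t2 a' b' i' j')))))"
    by (rule dual_metric_sum_transform) (intro bilinear_sum_forms bilinear_cmult bilinear_mult_linear lin)
  show ?thesis unfolding nest t1 s1 s2 s3 s4 ..
qed

section \<open>Norms of multiples of the identity, and continuity of the norms\<close>

lemma dual_metric_contract:
  fixes H :: "'e::euclidean_space \<Rightarrow> 'e \<Rightarrow> real"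
  assumes H: "inner_form H"
  shows "(\<Sum>c\<in>Basis. dual_metric H a c * H b c) = a \<bullet> b"
proof -
  have "linear (H b)" using inner_form_bilinear[OF H] by (simp add: bilinear_def)
  from linear_expand[OF this, of "sharp H (inner a)"]
  have "(\<Sum>c\<in>Basis. dual_metric H a c * H b c) = H b (sharp H (inner a))"
    by (simp add: dual_metric_def inner_commute)
  also have "\<dots> = a \<bullet> b"
    using inner_form_sym[OF H] sharp_works[OF H linear_inner] by metis
  finally show ?thesis .
qed

lemma norm11_scale_id:
  fixes H :: "'n::finite coord \<Rightarrow> 'n coord \<Rightarrow> real"
  assumes H: "inner_form H"
  shows "norm11 H (\<lambda>v. c *\<^sub>R v) = \<bar>c\<bar> * sqrt (real DIM('n coord))"
proof -
  note bil = inner_form_bilinear[OF H]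
  have "(\<Sum>a\<in>Basis. \<Sum>b\<in>Basis. dual_metric H a b * H (c *\<^sub>R a) (c *\<^sub>R b)) =
      (\<Sum>a\<in>Basis. c\<^sup>2 * (\<Sum>b\<in>Basis. dual_metric H a b * H a b))"
    by (simp add: bilinear_lmul[OF bil] bilinear_rmul[OF bil] sum_distrib_left power2_eq_square mult_ac)
  also have "\<dots> = c\<^sup>2 * real DIM('n coord)"
    unfolding dual_metric_contract[OF H] by (simp add: mult.commute)
  finally show ?thesis by (simp add: norm11_def real_sqrt_mult)
qed

text \<open>\<open>wedge\<close> is the identity on bivectors, a space of dimension N (N - 1) / 2,
  and summing over ordered pairs on both sides counts each diagonal entry four times. The result 2 N
  (N - 1) is positive for N >= 2, so this norm detects c in dimension n + 1.\<close>

lemma norm22_scale_wedge: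
  fixes H :: "'n::finite coord \<Rightarrow> 'n coord \<Rightarrow> real"
  assumes H: "inner_form H"
  defines "N \<equiv> real DIM('n coord)"
  shows "norm22 H (\<lambda>u v l m. c * wedge u v l m) = \<bar>c\<bar> * sqrt (2 * (N\<^sup>2 - N))"
proof -
  let ?B = "Basis :: 'n coord set"
  define d where "d = dual_metric H"
  define w where "w = (\<lambda>(a::'n coord) b i j. (i \<bullet> a) * (j \<bullet> b) - (i \<bullet> b) * (j \<bullet> a))"
  have contr: "(\<Sum>i\<in>?B. f i * (i \<bullet> a)) = f a" if "a \<in> ?B" for f :: "'n coord \<Rightarrow> real" and a
    using that by (simp add: inner_Basis if_distrib[of "\<lambda>x. _ * x"] sum.delta cong: if_cong)
  \<comment> \<open>On basis vectors w is a difference of products of Kronecker deltas.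
    \<open>I1\<close> and \<open>I2\<close> evaluate the two contractions over covector indices; the
    dual metric is contracted afterwards.\<close>
  have I1: "(\<Sum>i'\<in>?B. \<Sum>j'\<in>?B. H i i' * H j j' * w a' b' i' j') = H i a' * H j b' - H i b' * H j a'"
    if "a' \<in> ?B" "b' \<in> ?B" for i j a' b'
  proof -
    have "(\<Sum>i'\<in>?B. \<Sum>j'\<in>?B. H i i' * H j j' * w a' b' i' j') =
       (\<Sum>i'\<in>?B. H i i' * (i' \<bullet> a')) * (\<Sum>j'\<in>?B. H j j' * (j' \<bullet> b')) -
       (\<Sum>i'\<in>?B. H i i' * (i' \<bullet> b')) * (\<Sum>j'\<in>?B. H j j' * (j' \<bullet> a'))"
      by (simp add: w_def sum_product sum_subtractf right_diff_distrib mult_ac)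
    then show ?thesis by (simp add: contr that)
  qed
  have I2: "(\<Sum>i\<in>?B. \<Sum>j\<in>?B. (H i a' * H j b' - H i b' * H j a') * w a b i j) =
      2 * (H a a' * H b b' - H a b' * H b a')" if "a \<in> ?B" "b \<in> ?B" for a b a' b'
  proof -
    have "(\<Sum>i\<in>?B. \<Sum>j\<in>?B. (H i a' * H j b' - H i b' * H j a') * w a b i j) =
       (\<Sum>i\<in>?B. H i a' * (i \<bullet> a)) * (\<Sum>j\<in>?B. H j b' * (j \<bullet> b)) -
       (\<Sum>i\<in>?B. H i a' * (i \<bullet> b)) * (\<Sum>j\<in>?B. H j b' * (j \<bullet> a)) -
       ((\<Sum>i\<in>?B. H i b' * (i \<bullet> a)) * (\<Sum>j\<in>?B. H j a' * (j \<bullet> b)) -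
       (\<Sum>i\<in>?B. H i b' * (i \<bullet> b)) * (\<Sum>j\<in>?B. H j a' * (j \<bullet> a)))"
      unfolding sum_product sum_subtractf[symmetric]
      by (intro sum.cong refl) (simp add: w_def algebra_simps)
    then show ?thesis by (simp add: contr that)
  qed
  have "(\<Sum>a\<in>?B. \<Sum>a'\<in>?B. \<Sum>b\<in>?B. \<Sum>b'\<in>?B. \<Sum>i\<in>?B. \<Sum>i'\<in>?B. \<Sum>j\<in>?B. \<Sum>j'\<in>?B.
       d a a' * d b b' * H i i' * H j j' * (c * wedge a b (inner i) (inner j)) * (c * wedge a' b' (inner i') (inner j')))
     = (\<Sum>a\<in>?B. \<Sum>a'\<in>?B. \<Sum>b\<in>?B. \<Sum>b'\<in>?B. d a a' * d b b' * c\<^sup>2 *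
        (\<Sum>i\<in>?B. \<Sum>j\<in>?B. (\<Sum>i'\<in>?B. \<Sum>j'\<in>?B. H i i' * H j j' * w a' b' i' j') * w a b i j))"
  proof (intro sum.cong refl)
    fix a a' b b'
    have "(\<Sum>i\<in>?B. \<Sum>i'\<in>?B. \<Sum>j\<in>?B. \<Sum>j'\<in>?B.
       d a a' * d b b' * H i i' * H j j' * (c * wedge a b (inner i) (inner j)) * (c * wedge a' b' (inner i') (inner j')))
      = (\<Sum>i\<in>?B. \<Sum>j\<in>?B. \<Sum>i'\<in>?B. \<Sum>j'\<in>?B.
       d a a' * d b b' * H i i' * H j j' * (c * wedge a b (inner i) (inner j)) * (c * wedge a' b' (inner i') (inner j')))"
      by (intro sum.cong refl sum.swap)
    also have "\<dots> = d a a' * d b b' * c\<^sup>2 *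
        (\<Sum>i\<in>?B. \<Sum>j\<in>?B. (\<Sum>i'\<in>?B. \<Sum>j'\<in>?B. H i i' * H j j' * w a' b' i' j') * w a b i j)"
      unfolding sum_distrib_left sum_distrib_right wedge_def w_def[symmetric]
      by (intro sum.cong refl) (simp add: w_def power2_eq_square mult_ac)
    finally show "(\<Sum>i\<in>?B. \<Sum>i'\<in>?B. \<Sum>j\<in>?B. \<Sum>j'\<in>?B.
       d a a' * d b b' * H i i' * H j j' * (c * wedge a b (inner i) (inner j)) * (c * wedge a' b' (inner i') (inner j')))
      = d a a' * d b b' * c\<^sup>2 *
        (\<Sum>i\<in>?B. \<Sum>j\<in>?B. (\<Sum>i'\<in>?B. \<Sum>j'\<in>?B. H i i' * H j j' * w a' b' i' j') * w a b i j)" .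
  qed
  also have "\<dots> = (\<Sum>a\<in>?B. \<Sum>a'\<in>?B. \<Sum>b\<in>?B. \<Sum>b'\<in>?B. d a a' * d b b' * c\<^sup>2 *
      (2 * (H a a' * H b b' - H a b' * H b a')))"
    by (simp add: I1 I2)
  also have "\<dots> = 2 * c\<^sup>2 * ((\<Sum>a\<in>?B. \<Sum>a'\<in>?B. d a a' * H a a') * (\<Sum>b\<in>?B. \<Sum>b'\<in>?B. d b b' * H b b')
      - (\<Sum>a\<in>?B. \<Sum>a'\<in>?B. d a a' * (\<Sum>b\<in>?B. H b a' * (\<Sum>b'\<in>?B. d b b' * H a b'))))"
  proof -
    define Y where "Y = (\<Sum>b\<in>?B. \<Sum>b'\<in>?B. d b b' * H b b')"
    have "(\<Sum>b\<in>?B. \<Sum>b'\<in>?B. d a a' * d b b' * c\<^sup>2 * (2 * (H a a' * H b b' - H a b' * H b a')))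
        = 2 * c\<^sup>2 * (d a a' * H a a' * Y - d a a' * (\<Sum>b\<in>?B. H b a' * (\<Sum>b'\<in>?B. d b b' * H a b')))" for a a'
      unfolding Y_def sum_distrib_left right_diff_distrib sum_subtractf[symmetric]
      by (intro sum.cong refl) (simp add: algebra_simps)
    then show ?thesis
      by (simp add: Y_def[symmetric] sum_distrib_left[symmetric] sum_distrib_right[symmetric] sum_subtractf)
  qed
  also have "\<dots> = 2 * c\<^sup>2 * (N * N - N)"
  proof -
    have "(\<Sum>b\<in>?B. H b a' * (\<Sum>b'\<in>?B. d b b' * H a b')) = H a a'" if "a \<in> ?B" for a a'
      unfolding d_def dual_metric_contract[OF H] by (rule contr[OF that])
    then show ?thesis by (simp add: d_def dual_metric_contract[OF H] N_def)
  qed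
  also have "\<dots> = c\<^sup>2 * (2 * (N\<^sup>2 - N))" by (simp add: power2_eq_square)
  finally show ?thesis
    unfolding norm22_def d_def by (simp only: real_sqrt_mult[of "c\<^sup>2"] real_sqrt_abs)
qed

lemma tendsto_dual_metric:
  fixes H :: "'e::euclidean_space \<Rightarrow> 'e \<Rightarrow> real"
  assumes "\<And>v w. ((\<lambda>q. G q v w) \<longlongrightarrow> H v w) F" "\<forall>\<^sub>F q in F. inner_form (G q)" "inner_form H"
  shows "((\<lambda>q. dual_metric (G q) a b) \<longlongrightarrow> dual_metric H a b) F"
  unfolding dual_metric_def
  by (intro tendsto_inner tendsto_const tendsto_sharp assms always_eventually allI linear_inner)

lemma tendsto_norm11:
  assumes "\<And>v w. ((\<lambda>q. G q v w) \<longlongrightarrow> H v w) F" "\<forall>\<^sub>F q in F. inner_form (G q)" "inner_form H"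
    and T: "\<And>v. ((\<lambda>q. T q v) \<longlongrightarrow> T0 v) F"
  shows "((\<lambda>q. norm11 (G q) (T q)) \<longlongrightarrow> norm11 H T0) F"
  unfolding norm11_def
  by (intro tendsto_real_sqrt tendsto_sum tendsto_mult tendsto_dual_metric assms
      tendsto_bilinear_forms[OF assms(1) _ inner_form_bilinear[OF assms(3)]]
      eventually_mono[OF assms(2) inner_form_bilinear])

lemma tendsto_norm22:
  assumes "\<And>v w. ((\<lambda>q. G q v w) \<longlongrightarrow> H v w) F" "\<forall>\<^sub>F q in F. inner_form (G q)" "inner_form H"
    and T: "\<And>u v i j. ((\<lambda>q. T q u v (inner i) (inner j)) \<longlongrightarrow> T0 u v (inner i) (inner j)) F"
  shows "((\<lambda>q. norm22 (G q) (T q)) \<longlongrightarrow> norm22 H T0) F"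
  unfolding norm22_def
  by (intro tendsto_real_sqrt tendsto_sum tendsto_mult tendsto_dual_metric assms)

section \<open>Local Riemannian geometry\<close>

text \<open>Differentiability of x -> B x v is known only for fixed v; expanding p x in a basis
  turns the composite into a finite sum of products.\<close>

lemma has_derivative_linear_forms:
  fixes B :: "'e::real_normed_vector \<Rightarrow> 'v::euclidean_space \<Rightarrow> 'f::real_normed_vector"
  assumes S: "open S" "x0 \<in> S" "\<And>x. x \<in> S \<Longrightarrow> linear (B x)"
    and B: "\<And>v. ((\<lambda>x. B x v) has_derivative (\<lambda>a. B' a v)) (at x0)"
    and p: "(p has_derivative p') (at x0)"
  shows "((\<lambda>x. B x (p x)) has_derivative (\<lambda>a. B' a (p x0) + B x0 (p' a))) (at x0)"
proof -
  have "((\<lambda>x. \<Sum>i\<in>Basis. (p x \<bullet> i) *\<^sub>R B x i) has_derivative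
      (\<lambda>a. \<Sum>i\<in>Basis. (p x0 \<bullet> i) *\<^sub>R B' a i + (p' a \<bullet> i) *\<^sub>R B x0 i)) (at x0)"
    by (intro has_derivative_sum has_derivative_scaleR has_derivative_inner_left B p)
  moreover have "(\<lambda>a. \<Sum>i\<in>Basis. (p x0 \<bullet> i) *\<^sub>R B' a i + (p' a \<bullet> i) *\<^sub>R B x0 i) = (\<lambda>a. B' a (p x0) + B x0 (p' a))"
  proof -
    have "(\<Sum>i\<in>Basis. (p x0 \<bullet> i) *\<^sub>R B' a i) = B' a (p x0)" for a
      by (rule linear_expand[symmetric], rule linear_derivative_forms[OF S B])
    moreover have "(\<Sum>i\<in>Basis. (p' a \<bullet> i) *\<^sub>R B x0 i) = B x0 (p' a)" for a
      by (rule linear_expand[symmetric], rule S(3)[OF S(2)])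
    ultimately show ?thesis by (simp add: sum.distrib)
  qed
  ultimately have "((\<lambda>x. \<Sum>i\<in>Basis. (p x \<bullet> i) *\<^sub>R B x i) has_derivative (\<lambda>a. B' a (p x0) + B x0 (p' a))) (at x0)"
    by simp
  then show ?thesis
    by (rule has_derivative_transform_within_open[OF _ S(1,2)]) (rule linear_expand[symmetric], rule S)
qed

lemma has_derivative_bilinear_forms:
  fixes B :: "'e::real_normed_vector \<Rightarrow> 'v::euclidean_space \<Rightarrow> 'v \<Rightarrow> 'f::real_normed_vector"
  assumes S: "open S" "x0 \<in> S" "\<And>x. x \<in> S \<Longrightarrow> bilinear (B x)"
    and B: "\<And>v w. ((\<lambda>x. B x v w) has_derivative (\<lambda>a. B' a v w)) (at x0)"
    and p: "(p has_derivative p') (at x0)" and q: "(q has_derivative q') (at x0)"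
  shows "((\<lambda>x. B x (p x) (q x)) has_derivative
    (\<lambda>a. B' a (p x0) (q x0) + B x0 (p' a) (q x0) + B x0 (p x0) (q' a))) (at x0)"
proof -
  have 1: "((\<lambda>x. B x (p x) w) has_derivative (\<lambda>a. B' a (p x0) w + B x0 (p' a) w)) (at x0)" for w
    using S(3) by (intro has_derivative_linear_forms[where B="\<lambda>x v. B x v w" and B'="\<lambda>a v. B' a v w", OF S(1,2) _ B p])
      (simp add: bilinear_def)
  show ?thesis
    using has_derivative_linear_forms[where B="\<lambda>x w. B x (p x) w" and B'="\<lambda>a w. B' a (p x0) w + B x0 (p' a) w", OF S(1,2) _ 1 q] S(3)
    by (simp add: bilinear_def)
qed

section \<open>Symmetry of second derivatives\<close>

text \<open>The mean value theorem is applied in direction a to the difference of f along h b, and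
  then in direction b to the a-derivative of f. The second difference is symmetric in a and b,
  whereas the right side is not obviously so.\<close>

lemma second_difference_mean_value:
  fixes f :: "'e::real_normed_vector \<Rightarrow> real"
  assumes f1: "\<And>x. x \<in> ball x0 r \<Longrightarrow> (f has_derivative f1 x) (at x)"
    and f2: "\<And>x. x \<in> ball x0 r \<Longrightarrow> ((\<lambda>x. f1 x a) has_derivative (\<lambda>b. f2 x b)) (at x)"
    and h: "h > 0" "h * (norm a + norm b) < r"
  obtains z where "dist z x0 \<le> h * (norm a + norm b)"
    "f (x0 + h *\<^sub>R a + h *\<^sub>R b) - f (x0 + h *\<^sub>R a) - f (x0 + h *\<^sub>R b) + f x0 = h * h * f2 z b"
proof -
  have close: "dist (x0 + s *\<^sub>R a + t *\<^sub>R b) x0 \<le> h * (norm a + norm b)" if "0 \<le> s" "s \<le> h" "0 \<le> t" "t \<le> h" for s t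
  proof -
    have "norm (s *\<^sub>R a + t *\<^sub>R b) \<le> s * norm a + t * norm b" using norm_triangle_ineq[of "s *\<^sub>R a" "t *\<^sub>R b"] that by simp
    also have "\<dots> \<le> h * norm a + h * norm b" using that by (intro add_mono mult_right_mono) auto
    finally show ?thesis by (simp add: dist_norm algebra_simps)
  qed
  have inb: "x0 + s *\<^sub>R a + t *\<^sub>R b \<in> ball x0 r" if "0 \<le> s" "s \<le> h" "0 \<le> t" "t \<le> h" for s t
    using close[OF that] h by (simp add: dist_commute)
  define g where "g = (\<lambda>s. f (x0 + s *\<^sub>R a + h *\<^sub>R b) - f (x0 + s *\<^sub>R a + 0 *\<^sub>R b))"
  have lin: "linear (f1 x)" if "x \<in> ball x0 r" for x using f1[OF that] by (rule has_derivative_linear)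
  have dg: "(g has_derivative (\<lambda>d. d * (f1 (x0 + s *\<^sub>R a + h *\<^sub>R b) a - f1 (x0 + s *\<^sub>R a + 0 *\<^sub>R b) a))) (at s)"
    if "0 \<le> s" "s \<le> h" for s
  proof -
    have D: "((\<lambda>s. f (x0 + s *\<^sub>R a + t *\<^sub>R b)) has_derivative (\<lambda>d. f1 (x0 + s *\<^sub>R a + t *\<^sub>R b) (d *\<^sub>R a))) (at s)"
      if "0 \<le> t" "t \<le> h" for t
      by (rule has_derivative_compose[where f="\<lambda>s. x0 + s *\<^sub>R a + t *\<^sub>R b" and g=f])
        (auto intro!: derivative_eq_intros f1 inb \<open>0 \<le> s\<close> \<open>s \<le> h\<close> that)
    have "(g has_derivative (\<lambda>d. f1 (x0 + s *\<^sub>R a + h *\<^sub>R b) (d *\<^sub>R a) - f1 (x0 + s *\<^sub>R a + 0 *\<^sub>R b) (d *\<^sub>R a))) (at s)"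
      unfolding g_def using h by (intro has_derivative_diff D) auto
    moreover have "f1 (x0 + s *\<^sub>R a + t *\<^sub>R b) (d *\<^sub>R a) = d * f1 (x0 + s *\<^sub>R a + t *\<^sub>R b) a" if "0 \<le> t" "t \<le> h" for d t
      by (subst linear_scale[OF lin[OF inb]]) (use \<open>0 \<le> s\<close> \<open>s \<le> h\<close> that in auto)
    from this[of h] this[of 0] h(1) have "(\<lambda>d. f1 (x0 + s *\<^sub>R a + h *\<^sub>R b) (d *\<^sub>R a) - f1 (x0 + s *\<^sub>R a + 0 *\<^sub>R b) (d *\<^sub>R a))
       = (\<lambda>d. d * (f1 (x0 + s *\<^sub>R a + h *\<^sub>R b) a - f1 (x0 + s *\<^sub>R a + 0 *\<^sub>R b) a))"
      by (simp only: right_diff_distrib)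
    ultimately show ?thesis by metis
  qed
  have "\<exists>s\<in>{0<..<h}. g h - g 0 = (h - 0) * (f1 (x0 + s *\<^sub>R a + h *\<^sub>R b) a - f1 (x0 + s *\<^sub>R a + 0 *\<^sub>R b) a)"
    by (rule mvt_simple[OF h(1)]) (rule has_derivative_at_withinI, rule dg)
  then obtain s where s: "0 < s" "s < h" "g h - g 0 = h * (f1 (x0 + s *\<^sub>R a + h *\<^sub>R b) a - f1 (x0 + s *\<^sub>R a + 0 *\<^sub>R b) a)"
    by auto
  have lin2: "linear (f2 x)" if "x \<in> ball x0 r" for x using f2[OF that] by (rule has_derivative_linear)
  have ex_t: "\<exists>t\<in>{0<..<h}. f1 (x0 + s *\<^sub>R a + h *\<^sub>R b) a - f1 (x0 + s *\<^sub>R a + 0 *\<^sub>R b) a = f2 (x0 + s *\<^sub>R a + t *\<^sub>R b) ((h - 0) *\<^sub>R b)"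
  proof (rule mvt_simple[where f="\<lambda>t. f1 (x0 + s *\<^sub>R a + t *\<^sub>R b) a" and f'="\<lambda>t d. f2 (x0 + s *\<^sub>R a + t *\<^sub>R b) (d *\<^sub>R b)"])
    show "0 < h" using h by simp
    fix t assume t: "0 \<le> t" "t \<le> h"
    show "((\<lambda>t. f1 (x0 + s *\<^sub>R a + t *\<^sub>R b) a) has_derivative (\<lambda>d. f2 (x0 + s *\<^sub>R a + t *\<^sub>R b) (d *\<^sub>R b))) (at t within {0..h})"
      by (rule has_derivative_at_withinI, rule has_derivative_compose[where f="\<lambda>t. x0 + s *\<^sub>R a + t *\<^sub>R b" and g="\<lambda>x. f1 x a"])
        (use s t in \<open>auto intro!: derivative_eq_intros f2 inb\<close>)
  qed
  obtain t where t: "0 < t" "t < h"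
    "f1 (x0 + s *\<^sub>R a + h *\<^sub>R b) a - f1 (x0 + s *\<^sub>R a + 0 *\<^sub>R b) a = h * f2 (x0 + s *\<^sub>R a + t *\<^sub>R b) b"
  proof -
    obtain t where t: "t \<in> {0<..<h}" "f1 (x0 + s *\<^sub>R a + h *\<^sub>R b) a - f1 (x0 + s *\<^sub>R a + 0 *\<^sub>R b) a = f2 (x0 + s *\<^sub>R a + t *\<^sub>R b) ((h - 0) *\<^sub>R b)"
      using ex_t by blast
    have "f2 (x0 + s *\<^sub>R a + t *\<^sub>R b) (h *\<^sub>R b) = h * f2 (x0 + s *\<^sub>R a + t *\<^sub>R b) b"
      by (subst linear_scale[OF lin2[OF inb]]) (use s t in auto)
    then show thesis using that[of t] t by simp
  qed
  show ?thesis
  proof (rule that)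
    show "dist (x0 + s *\<^sub>R a + t *\<^sub>R b) x0 \<le> h * (norm a + norm b)" using s t by (intro close) auto
    show "f (x0 + h *\<^sub>R a + h *\<^sub>R b) - f (x0 + h *\<^sub>R a) - f (x0 + h *\<^sub>R b) + f x0 = h * h * f2 (x0 + s *\<^sub>R a + t *\<^sub>R b) b"
      using s(3) t(3) by (simp add: g_def)
  qed
qed

text \<open>Both orders of differentiation compute the same second difference divided by h^2, at
  points that converge to x0; continuity passes to the limit.\<close>

lemma second_derivative_symmetric_real:
  fixes f :: "'e::real_normed_vector \<Rightarrow> real"
  assumes S: "open S" "x0 \<in> S"
    and f1: "\<And>x. x \<in> S \<Longrightarrow> (f has_derivative f1 x) (at x)"
    and f2: "\<And>x v. x \<in> S \<Longrightarrow> ((\<lambda>x. f1 x v) has_derivative (\<lambda>b. f2 x b v)) (at x)"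
    and cont: "isCont (\<lambda>x. f2 x a b) x0" "isCont (\<lambda>x. f2 x b a) x0"
  shows "f2 x0 a b = f2 x0 b a"
proof -
  obtain r where r: "r > 0" "ball x0 r \<subseteq> S" using S open_contains_ball by blast
  define n where "n = norm a + norm b"
  \<comment> \<open>The parallelogram stays in the ball because h k * n < r; n + 1 keeps the
    denominator positive also for a = b = 0.\<close>
  define h where "h = (\<lambda>k. r / (2 * (n + 1) * real (Suc k)))"
  have n0: "n \<ge> 0" by (simp add: n_def)
  have hpos: "h k > 0" for k using r n0 by (auto simp: h_def intro!: divide_pos_pos mult_pos_pos)
  have hn: "h k * n < r" for k
  proof -
    have "r * n < r * (2 * (n + 1) * real (Suc k))"
    proof (rule mult_strict_left_mono)
      have "n < 2 * (n + 1) * 1" using n0 by simp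
      also have "\<dots> \<le> 2 * (n + 1) * real (Suc k)" using n0 by (intro mult_left_mono) auto
      finally show "n < 2 * (n + 1) * real (Suc k)" .
    qed (use r in auto)
    then show ?thesis using n0 by (simp add: h_def pos_divide_less_eq)
  qed
  have hlim: "h \<longlonglongrightarrow> 0"
  proof -
    have "(\<lambda>k. r / (2 * (n + 1)) * inverse (real (Suc k))) \<longlonglongrightarrow> r / (2 * (n + 1)) * 0"
      by (intro tendsto_mult tendsto_const LIMSEQ_inverse_real_of_nat)
    then show ?thesis by (simp add: h_def field_simps)
  qed
  have fb1: "x \<in> ball x0 r \<Longrightarrow> (f has_derivative f1 x) (at x)" for x using f1 r by blast
  have fb2: "x \<in> ball x0 r \<Longrightarrow> ((\<lambda>x. f1 x v) has_derivative (\<lambda>b. f2 x b v)) (at x)" for x v using f2 r by blast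
  have "\<forall>k. \<exists>z. dist z x0 \<le> h k * n \<and>
     f (x0 + h k *\<^sub>R a + h k *\<^sub>R b) - f (x0 + h k *\<^sub>R a) - f (x0 + h k *\<^sub>R b) + f x0 = h k * h k * f2 z b a"
    
  proof
    fix k
    obtain z where "dist z x0 \<le> h k * (norm a + norm b)"
      "f (x0 + h k *\<^sub>R a + h k *\<^sub>R b) - f (x0 + h k *\<^sub>R a) - f (x0 + h k *\<^sub>R b) + f x0 = h k * h k * f2 z b a"
      by (rule second_difference_mean_value[where ?f2.0="\<lambda>x b. f2 x b a", OF fb1 fb2 hpos hn[of k, unfolded n_def]]) auto
    then show "\<exists>z. dist z x0 \<le> h k * n \<and>
     f (x0 + h k *\<^sub>R a + h k *\<^sub>R b) - f (x0 + h k *\<^sub>R a) - f (x0 + h k *\<^sub>R b) + f x0 = h k * h k * f2 z b a"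
      unfolding n_def by blast
  qed
  then obtain z where z: "\<And>k. dist (z k) x0 \<le> h k * n"
    "\<And>k. f (x0 + h k *\<^sub>R a + h k *\<^sub>R b) - f (x0 + h k *\<^sub>R a) - f (x0 + h k *\<^sub>R b) + f x0 = h k * h k * f2 (z k) b a"
    by metis
  have "\<forall>k. \<exists>z. dist z x0 \<le> h k * n \<and>
     f (x0 + h k *\<^sub>R b + h k *\<^sub>R a) - f (x0 + h k *\<^sub>R b) - f (x0 + h k *\<^sub>R a) + f x0 = h k * h k * f2 z a b"
    
  proof
    fix k
    have hk: "h k * (norm b + norm a) < r" using hn[of k] by (simp add: n_def add.commute)
    obtain z where "dist z x0 \<le> h k * (norm b + norm a)"
      "f (x0 + h k *\<^sub>R b + h k *\<^sub>R a) - f (x0 + h k *\<^sub>R b) - f (x0 + h k *\<^sub>R a) + f x0 = h k * h k * f2 z a b"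
      by (rule second_difference_mean_value[where ?f2.0="\<lambda>x a. f2 x a b", OF fb1 fb2 hpos hk]) auto
    then show "\<exists>z. dist z x0 \<le> h k * n \<and>
     f (x0 + h k *\<^sub>R b + h k *\<^sub>R a) - f (x0 + h k *\<^sub>R b) - f (x0 + h k *\<^sub>R a) + f x0 = h k * h k * f2 z a b"
      unfolding n_def by (metis add.commute)
  qed
  then obtain y where y: "\<And>k. dist (y k) x0 \<le> h k * n"
    "\<And>k. f (x0 + h k *\<^sub>R b + h k *\<^sub>R a) - f (x0 + h k *\<^sub>R b) - f (x0 + h k *\<^sub>R a) + f x0 = h k * h k * f2 (y k) a b"
    by metis
  have eq: "f2 (z k) b a = f2 (y k) a b" for k
  proof -
    have swap: "x0 + h k *\<^sub>R b + h k *\<^sub>R a = x0 + h k *\<^sub>R a + h k *\<^sub>R b" by simp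
    have "h k * h k * f2 (z k) b a = h k * h k * f2 (y k) a b" using z(2)[of k] y(2)[of k, unfolded swap] by linarith
    then show ?thesis using hpos[of k] by simp
  qed
  have hn0: "(\<lambda>k. h k * n) \<longlonglongrightarrow> 0" using tendsto_mult_right[OF hlim, of n] by simp
  have "z \<longlonglongrightarrow> x0" "y \<longlonglongrightarrow> x0"
    using z(1) y(1) by (auto intro!: metric_tendsto_imp_tendsto[OF hn0] always_eventually simp: hpos n0 less_imp_le)
  then have "(\<lambda>k. f2 (z k) b a) \<longlonglongrightarrow> f2 x0 b a" "(\<lambda>k. f2 (y k) a b) \<longlonglongrightarrow> f2 x0 a b"
    using cont isCont_tendsto_compose by blast+
  then show ?thesis unfolding eq using LIMSEQ_unique by blast
qed

lemma second_derivative_symmetric: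
  fixes f :: "'e::real_normed_vector \<Rightarrow> 'f::euclidean_space"
  assumes S: "open S" "x0 \<in> S"
    and f1: "\<And>x. x \<in> S \<Longrightarrow> (f has_derivative f1 x) (at x)"
    and f2: "\<And>x v. x \<in> S \<Longrightarrow> ((\<lambda>x. f1 x v) has_derivative (\<lambda>b. f2 x b v)) (at x)"
    and cont: "\<And>a b. isCont (\<lambda>x. f2 x a b) x0"
  shows "f2 x0 a b = f2 x0 b a"
proof (rule euclidean_eqI)
  fix i :: 'f
  show "f2 x0 a b \<bullet> i = f2 x0 b a \<bullet> i"
    by (rule second_derivative_symmetric_real[OF S, of "\<lambda>x. f x \<bullet> i" "\<lambda>x v. f1 x v \<bullet> i" "\<lambda>x b v. f2 x b v \<bullet> i"])
      (auto intro!: has_derivative_inner_left f1 f2 continuous_intros cont)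
qed

section \<open>Christoffel symbols and curvature in coordinates\<close>

definition dform :: "('e::real_normed_vector \<Rightarrow> 'v \<Rightarrow> 'v \<Rightarrow> real) \<Rightarrow> 'e \<Rightarrow> 'e \<Rightarrow> 'v \<Rightarrow> 'v \<Rightarrow> real" where
  "dform G x a v w = frechet_derivative (\<lambda>y. G y v w) (at x) a"

definition d2form :: "('e::real_normed_vector \<Rightarrow> 'v \<Rightarrow> 'v \<Rightarrow> real) \<Rightarrow> 'e \<Rightarrow> 'e \<Rightarrow> 'e \<Rightarrow> 'v \<Rightarrow> 'v \<Rightarrow> real" where
  "d2form G x b a v w = frechet_derivative (\<lambda>y. dform G y a v w) (at x) b"

text \<open>Christoffel symbols of the first kind; \<open>chris\<close> raises the last
  index.\<close>

definition koszul :: "('e::real_normed_vector \<Rightarrow> 'e \<Rightarrow> 'e \<Rightarrow> real) \<Rightarrow> 'e \<Rightarrow> 'e \<Rightarrow> 'e \<Rightarrow> 'e \<Rightarrow> real" where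
  "koszul G x u v w = (dform G x u v w + dform G x v u w - dform G x w u v) / 2"

definition dkoszul :: "('e::real_normed_vector \<Rightarrow> 'e \<Rightarrow> 'e \<Rightarrow> real) \<Rightarrow> 'e \<Rightarrow> 'e \<Rightarrow> 'e \<Rightarrow> 'e \<Rightarrow> 'e \<Rightarrow> real" where
  "dkoszul G x b u v w = (d2form G x b u v w + d2form G x b v u w - d2form G x b w u v) / 2"

definition chris :: "('e::real_normed_vector \<Rightarrow> 'e \<Rightarrow> 'e \<Rightarrow> real) \<Rightarrow> 'e \<Rightarrow> 'e \<Rightarrow> 'e \<Rightarrow> 'e" where
  "chris G x u v = sharp (G x) (koszul G x u v)"

text \<open>The derivative of \<open>chris\<close> in direction b as predicted by the formula in
  \<open>has_derivative_sharp\<close>; \<open>has_derivative_chris\<close> confirms it.\<close>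

definition dchris :: "('e::real_normed_vector \<Rightarrow> 'e \<Rightarrow> 'e \<Rightarrow> real) \<Rightarrow> 'e \<Rightarrow> 'e \<Rightarrow> 'e \<Rightarrow> 'e \<Rightarrow> 'e" where
  "dchris G x b u v = sharp (G x) (\<lambda>w. dkoszul G x b u v w - dform G x b (chris G x u v) w)"

definition rie :: "('e::real_normed_vector \<Rightarrow> 'e \<Rightarrow> 'e \<Rightarrow> real) \<Rightarrow> 'e \<Rightarrow> 'e \<Rightarrow> 'e \<Rightarrow> 'e \<Rightarrow> 'e" where
  "rie G x u v w = frechet_derivative (\<lambda>y. chris G y v w) (at x) u - frechet_derivative (\<lambda>y. chris G y u w) (at x) v
     + chris G x u (chris G x v w) - chris G x v (chris G x u w)"

text \<open>The second derivatives of G are only required to exist, which is what differentiability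
  of the Lie derivatives supplies.\<close>

locale metric_field =
  fixes G :: "'e::euclidean_space \<Rightarrow> 'e \<Rightarrow> 'e \<Rightarrow> real" and S :: "'e set"
  assumes S: "open S" and form: "\<And>x. x \<in> S \<Longrightarrow> inner_form (G x)"
    and diff1: "\<And>x v w. x \<in> S \<Longrightarrow> (\<lambda>y. G y v w) differentiable (at x)"
    and diff2: "\<And>x a v w. x \<in> S \<Longrightarrow> (\<lambda>y. dform G y a v w) differentiable (at x)"
begin

lemma has_derivative_form:
  "x \<in> S \<Longrightarrow> ((\<lambda>y. G y v w) has_derivative (\<lambda>a. dform G x a v w)) (at x)"
  using diff1[of x v w] unfolding dform_def frechet_derivative_works by (simp add: eta_contract_eq)

lemma has_derivative_dform:
  "x \<in> S \<Longrightarrow> ((\<lambda>y. dform G y a v w) has_derivative (\<lambda>b. d2form G x b a v w)) (at x)"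
  using diff2[of x a v w] unfolding d2form_def frechet_derivative_works by (simp add: eta_contract_eq)

lemma bilinear_G: "x \<in> S \<Longrightarrow> bilinear (G x)" using form inner_form_bilinear by blast

lemma bilinear_dform: "x \<in> S \<Longrightarrow> bilinear (dform G x a)"
  by (rule bilinear_derivative_forms[OF S _ bilinear_G has_derivative_form])

lemma linear_dform: assumes "x \<in> S" shows "linear (\<lambda>a. dform G x a v w)" "linear (\<lambda>v. dform G x a v w)" "linear (\<lambda>w. dform G x a v w)"
  using has_derivative_linear[OF has_derivative_form[OF assms]] bilinear_dform[OF assms, of a] by (auto simp: bilinear_def)

lemma linear_d2form:
  assumes "x \<in> S"
  shows "linear (\<lambda>b. d2form G x b a v w)" "linear (\<lambda>a. d2form G x b a v w)" "linear (\<lambda>v. d2form G x b a v w)"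
    "linear (\<lambda>w. d2form G x b a v w)"
proof -
  show "linear (\<lambda>b. d2form G x b a v w)" using has_derivative_linear[OF has_derivative_dform[OF assms]] .
  show "linear (\<lambda>a. d2form G x b a v w)"
    by (rule linear_derivative_forms[where l="\<lambda>x a. dform G x a v w" and l'="\<lambda>b a. d2form G x b a v w", OF S assms])
      (auto intro: linear_dform has_derivative_dform assms)
  show "linear (\<lambda>v. d2form G x b a v w)"
    by (rule linear_derivative_forms[where l="\<lambda>x v. dform G x a v w" and l'="\<lambda>b v. d2form G x b a v w", OF S assms])
      (auto intro: linear_dform has_derivative_dform assms)
  show "linear (\<lambda>w. d2form G x b a v w)"
    by (rule linear_derivative_forms[where l="\<lambda>x w. dform G x a v w" and l'="\<lambda>b w. d2form G x b a v w", OF S assms])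
      (auto intro: linear_dform has_derivative_dform assms)
qed

lemma linear_koszul:
  assumes "x \<in> S"
  shows "linear (\<lambda>u. koszul G x u v w)" "linear (\<lambda>v. koszul G x u v w)" "linear (\<lambda>w. koszul G x u v w)"
  unfolding koszul_def
  by (auto intro!: linear_realI simp: linear_add[OF linear_dform(1)[OF assms]] linear_add[OF linear_dform(2)[OF assms]]
      linear_add[OF linear_dform(3)[OF assms]] linear_scale[OF linear_dform(1)[OF assms]]
      linear_scale[OF linear_dform(2)[OF assms]] linear_scale[OF linear_dform(3)[OF assms]] field_simps)

lemma linear_dkoszul:
  assumes "x \<in> S"
  shows "linear (\<lambda>b. dkoszul G x b u v w)" "linear (\<lambda>u. dkoszul G x b u v w)"
     "linear (\<lambda>v. dkoszul G x b u v w)" "linear (\<lambda>w. dkoszul G x b u v w)"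
  unfolding dkoszul_def
  by (auto intro!: linear_realI simp: linear_add[OF linear_d2form(1)[OF assms]] linear_add[OF linear_d2form(2)[OF assms]]
      linear_add[OF linear_d2form(3)[OF assms]] linear_add[OF linear_d2form(4)[OF assms]]
      linear_scale[OF linear_d2form(1)[OF assms]] linear_scale[OF linear_d2form(2)[OF assms]]
      linear_scale[OF linear_d2form(3)[OF assms]] linear_scale[OF linear_d2form(4)[OF assms]] field_simps)

lemma G_chris: "x \<in> S \<Longrightarrow> G x (chris G x u v) w = koszul G x u v w"
  unfolding chris_def by (rule sharp_works[OF form linear_koszul(3)])

lemma bilinear_chris: assumes "x \<in> S" shows "bilinear (chris G x)"
  unfolding bilinear_def
proof (intro conjI allI; rule linearI)
  note [simp] = bilinear_ladd[OF bilinear_G[OF assms]] bilinear_lmul[OF bilinear_G[OF assms]] G_chris[OF assms]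
    linear_add[OF linear_koszul(1)[OF assms]] linear_add[OF linear_koszul(2)[OF assms]]
    linear_scale[OF linear_koszul(1)[OF assms]] linear_scale[OF linear_koszul(2)[OF assms]]
  fix u v v' c
  show "chris G x u (v + v') = chris G x u v + chris G x u v'" by (rule inner_form_ext[OF form[OF assms]]) simp
  show "chris G x u (c *\<^sub>R v) = c *\<^sub>R chris G x u v" by (rule inner_form_ext[OF form[OF assms]]) simp
  show "chris G x (v + v') u = chris G x v u + chris G x v' u" by (rule inner_form_ext[OF form[OF assms]]) simp
  show "chris G x (c *\<^sub>R v) u = c *\<^sub>R chris G x v u" by (rule inner_form_ext[OF form[OF assms]]) simp
qed

lemma has_derivative_koszul:
  "x \<in> S \<Longrightarrow> ((\<lambda>y. koszul G y u v w) has_derivative (\<lambda>b. dkoszul G x b u v w)) (at x)"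
  unfolding koszul_def dkoszul_def
  by (intro bounded_linear.has_derivative[OF bounded_linear_divide] has_derivative_add has_derivative_diff has_derivative_dform)

lemma has_derivative_chris:
  assumes "x \<in> S"
  shows "((\<lambda>y. chris G y u v) has_derivative (\<lambda>b. dchris G x b u v)) (at x)"
  unfolding chris_def[abs_def] dchris_def[abs_def]
  by (rule has_derivative_sharp[OF S assms form linear_koszul(3) has_derivative_form[OF assms] has_derivative_koszul[OF assms]])

lemma linear_dchris_args:
  assumes "x \<in> S"
  shows "linear (\<lambda>b. dchris G x b u v)" "bilinear (dchris G x b)"
  using has_derivative_linear[OF has_derivative_chris[OF assms]]
    bilinear_derivative_forms[OF S assms bilinear_chris has_derivative_chris[OF assms]] by auto

lemma rie_eq:
  assumes "x \<in> S"
  shows "rie G x u v w = dchris G x u v w - dchris G x v u w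
     + chris G x u (chris G x v w) - chris G x v (chris G x u w)"
  unfolding rie_def frechet_derivative_at[OF has_derivative_chris[OF assms], symmetric] ..

lemma linear_rie:
  assumes "x \<in> S"
  shows "linear (\<lambda>u. rie G x u v w)" "linear (\<lambda>v. rie G x u v w)" "linear (\<lambda>w. rie G x u v w)"
  using linear_dchris_args(2)[OF assms] bilinear_chris[OF assms]
  by (auto intro!: linearI simp: rie_eq[OF assms] linear_add[OF linear_dchris_args(1)[OF assms]]
      linear_scale[OF linear_dchris_args(1)[OF assms]] bilinear_ladd bilinear_radd bilinear_lmul bilinear_rmul
      algebra_simps)

end

section \<open>Behaviour of the curvature under changes of coordinates\<close>

text \<open>F1, F2, F3 are the successive derivatives of F, the latest direction being the first
  argument after the point. Christoffel symbols transform with F2 and curvature differentiates them,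
  so F3 enters; its continuity yields \<open>F3_sym\<close>.\<close>

locale metric_transform = D: metric_field G1 S1 + E: metric_field G2 S2
  for G1 :: "'e::euclidean_space \<Rightarrow> 'e \<Rightarrow> 'e \<Rightarrow> real" and S1 and G2 :: "'e \<Rightarrow> 'e \<Rightarrow> 'e \<Rightarrow> real" and S2 +
  fixes F :: "'e \<Rightarrow> 'e" and F1 F2 F3
  assumes F_in: "\<And>x. x \<in> S1 \<Longrightarrow> F x \<in> S2"
    and F1: "\<And>x. x \<in> S1 \<Longrightarrow> (F has_derivative F1 x) (at x)"
    and F2: "\<And>x v. x \<in> S1 \<Longrightarrow> ((\<lambda>x. F1 x v) has_derivative (\<lambda>a. F2 x a v)) (at x)"
    and F3: "\<And>x a v. x \<in> S1 \<Longrightarrow> ((\<lambda>x. F2 x a v) has_derivative (\<lambda>b. F3 x b a v)) (at x)"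
    and F3_cont: "\<And>x b a v. x \<in> S1 \<Longrightarrow> isCont (\<lambda>x. F3 x b a v) x"
    and surj: "\<And>x. x \<in> S1 \<Longrightarrow> surj (F1 x)"
    and pull: "\<And>x v w. x \<in> S1 \<Longrightarrow> G1 x v w = G2 (F x) (F1 x v) (F1 x w)"
begin

lemma linear_F1: "x \<in> S1 \<Longrightarrow> linear (F1 x)"
  using F1 has_derivative_linear by blast

lemma F2_sym: assumes "x \<in> S1" shows "F2 x a b = F2 x b a"
  by (rule second_derivative_symmetric[OF D.S assms F1 F2]) (auto intro!: has_derivative_continuous F3 assms)

lemma F3_sym: assumes "x \<in> S1" shows "F3 x a b v = F3 x b a v"
  using second_derivative_symmetric[OF D.S assms F2[of _ v] F3 F3_cont[OF assms]] .

lemma linear_F2: assumes "x \<in> S1" shows "linear (\<lambda>a. F2 x a v)" "linear (F2 x a)"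
  using has_derivative_linear[OF F2[OF assms]] linear_derivative_forms[OF D.S assms linear_F1 F2[OF assms]] by auto

lemma dform_pull:
  assumes "x \<in> S1"
  shows "dform G1 x a v w = dform G2 (F x) (F1 x a) (F1 x v) (F1 x w)
     + G2 (F x) (F2 x a v) (F1 x w) + G2 (F x) (F1 x v) (F2 x a w)"
proof -
  have comp: "((\<lambda>y. G2 (F y) v w) has_derivative (\<lambda>a. dform G2 (F x) (F1 x a) v w)) (at x)" for v w
    using has_derivative_compose[OF F1[OF assms] E.has_derivative_form[OF F_in[OF assms]]] .
  have "((\<lambda>y. G2 (F y) (F1 y v) (F1 y w)) has_derivative
     (\<lambda>a. dform G2 (F x) (F1 x a) (F1 x v) (F1 x w) + G2 (F x) (F2 x a v) (F1 x w) + G2 (F x) (F1 x v) (F2 x a w))) (at x)"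
    by (rule has_derivative_bilinear_forms[where B="\<lambda>y. G2 (F y)", OF D.S assms E.bilinear_G[OF F_in] comp F2[OF assms] F2[OF assms]])
  then have "((\<lambda>y. G1 y v w) has_derivative
     (\<lambda>a. dform G2 (F x) (F1 x a) (F1 x v) (F1 x w) + G2 (F x) (F2 x a v) (F1 x w) + G2 (F x) (F1 x v) (F2 x a w))) (at x)"
    by (rule has_derivative_transform_within_open[OF _ D.S assms]) (simp add: pull)
  from has_derivative_unique[OF D.has_derivative_form[OF assms] this] show ?thesis by metis
qed

text \<open>Of the F2 terms in the Koszul expression only G2 (F2 u v) (F1 w) survives, by the
  symmetry of F2 and G2. Surjectivity of F1 allows testing against every vector.\<close>

lemma chris_pull:
  assumes "x \<in> S1"
  shows "F1 x (chris G1 x u v) = F2 x u v + chris G2 (F x) (F1 x u) (F1 x v)"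
proof (rule inner_form_ext[OF E.form[OF F_in[OF assms]]])
  fix w' obtain w where w': "w' = F1 x w" using surj[OF assms] by (metis surjD)
  note FS = F_in[OF assms]
  have "G2 (F x) (F1 x (chris G1 x u v)) (F1 x w) = koszul G1 x u v w"
    using D.G_chris[OF assms] pull[OF assms] by metis
  also have "\<dots> = koszul G2 (F x) (F1 x u) (F1 x v) (F1 x w) + G2 (F x) (F2 x u v) (F1 x w)"
    using inner_form_sym[OF E.form[OF FS]]
    by (simp add: koszul_def dform_pull[OF assms] F2_sym[OF assms, of v u] F2_sym[OF assms, of w] field_simps)
  also have "\<dots> = G2 (F x) (F2 x u v + chris G2 (F x) (F1 x u) (F1 x v)) (F1 x w)"
    by (simp add: bilinear_ladd[OF E.bilinear_G[OF FS]] E.G_chris[OF FS])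
  finally show "G2 (F x) (F1 x (chris G1 x u v)) w' = G2 (F x) (F2 x u v + chris G2 (F x) (F1 x u) (F1 x v)) w'"
    by (simp add: w')
qed

text \<open>The two sides of \<open>chris_pull\<close> are differentiated separately by the product
  rule and compared.\<close>

lemma dchris_pull:
  assumes "x \<in> S1"
  shows "F1 x (dchris G1 x u v w) = F3 x u v w + dchris G2 (F x) (F1 x u) (F1 x v) (F1 x w)
    + chris G2 (F x) (F2 x u v) (F1 x w) + chris G2 (F x) (F1 x v) (F2 x u w) - F2 x u (chris G1 x v w)"
proof -
  have comp: "((\<lambda>y. chris G2 (F y) v w) has_derivative (\<lambda>a. dchris G2 (F x) (F1 x a) v w)) (at x)" for v w
    using has_derivative_compose[OF F1[OF assms] E.has_derivative_chris[OF F_in[OF assms]]] .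
  have "((\<lambda>y. F2 y v w + chris G2 (F y) (F1 y v) (F1 y w)) has_derivative
     (\<lambda>a. F3 x a v w + (dchris G2 (F x) (F1 x a) (F1 x v) (F1 x w) + chris G2 (F x) (F2 x a v) (F1 x w)
       + chris G2 (F x) (F1 x v) (F2 x a w)))) (at x)"
    by (intro has_derivative_add F3 assms
        has_derivative_bilinear_forms[where B="\<lambda>y. chris G2 (F y)", OF D.S assms E.bilinear_chris[OF F_in] comp F2[OF assms] F2[OF assms]])
  then have 1: "((\<lambda>y. F1 y (chris G1 y v w)) has_derivative
     (\<lambda>a. F3 x a v w + (dchris G2 (F x) (F1 x a) (F1 x v) (F1 x w) + chris G2 (F x) (F2 x a v) (F1 x w)
       + chris G2 (F x) (F1 x v) (F2 x a w)))) (at x)"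
    by (rule has_derivative_transform_within_open[OF _ D.S assms]) (simp add: chris_pull)
  have 2: "((\<lambda>y. F1 y (chris G1 y v w)) has_derivative (\<lambda>a. F2 x a (chris G1 x v w) + F1 x (dchris G1 x a v w))) (at x)"
    by (rule has_derivative_linear_forms[OF D.S assms linear_F1 F2[OF assms] D.has_derivative_chris[OF assms]])
  have "F2 x u (chris G1 x v w) + F1 x (dchris G1 x u v w) = F3 x u v w + (dchris G2 (F x) (F1 x u) (F1 x v) (F1 x w)
     + chris G2 (F x) (F2 x u v) (F1 x w) + chris G2 (F x) (F1 x v) (F2 x u w))"
    using has_derivative_unique[OF 2 1] by metis
  then show ?thesis by (simp add: algebra_simps)
qed

text \<open>Antisymmetrizing in u and v removes the symmetric F3, and the F2 terms from the
  derivatives cancel those from the quadratic terms.\<close>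

lemma rie_pull:
  assumes "x \<in> S1"
  shows "F1 x (rie G1 x u v w) = rie G2 (F x) (F1 x u) (F1 x v) (F1 x w)"
proof -
  note [simp] = linear_add[OF linear_F1[OF assms]] linear_diff[OF linear_F1[OF assms]]
    linear_add[OF linear_F2(2)[OF assms]] bilinear_radd[OF E.bilinear_chris[OF F_in[OF assms]]]
  show ?thesis
    by (simp add: D.rie_eq[OF assms] E.rie_eq[OF F_in[OF assms]] dchris_pull[OF assms] chris_pull[OF assms]
        F3_sym[OF assms, of v u w] F2_sym[OF assms, of v u] algebra_simps)
qed

end

section \<open>Conformally compact metrics in a half-space\<close>

text \<open>The conformal factor is the inverse square of a linear function, in the application the
  last coordinate, so that \<alpha> is its own differential at every point and no second derivatives
  of it arise.\<close>

locale conformal_field = metric_field G S for G :: "'e::euclidean_space \<Rightarrow> 'e \<Rightarrow> 'e \<Rightarrow> real" and S +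
  fixes \<alpha> :: "'e \<Rightarrow> real"
  assumes linear_\<alpha>: "linear \<alpha>" and pos: "\<And>x. x \<in> S \<Longrightarrow> \<alpha> x > 0"
begin

definition g :: "'e \<Rightarrow> 'e \<Rightarrow> 'e \<Rightarrow> real" where "g x v w = inverse ((\<alpha> x)\<^sup>2) * G x v w"

definition nu :: "'e \<Rightarrow> 'e" where "nu x = sharp (G x) \<alpha>"

definition dnu :: "'e \<Rightarrow> 'e \<Rightarrow> 'e" where "dnu x a = sharp (G x) (\<lambda>w. 0 - dform G x a (nu x) w)"

text \<open>Divided by \<open>\<alpha> x\<close>, this is the difference of the Christoffel symbols
  of g and G (\<open>chris_g\<close>); \<open>nu\<close> is the G-gradient of \<alpha>.\<close>

definition shape :: "'e \<Rightarrow> 'e \<Rightarrow> 'e \<Rightarrow> 'e" where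
  "shape x u v = G x u v *\<^sub>R nu x - \<alpha> u *\<^sub>R v - \<alpha> v *\<^sub>R u"

definition dshape :: "'e \<Rightarrow> 'e \<Rightarrow> 'e \<Rightarrow> 'e \<Rightarrow> 'e" where
  "dshape x a u v = dform G x a u v *\<^sub>R nu x + G x u v *\<^sub>R dnu x a"

lemma has_derivative_\<alpha>: "(\<alpha> has_derivative \<alpha>) (at x)"
  using linear_\<alpha> by (simp add: linear_conv_bounded_linear bounded_linear_imp_has_derivative)

lemma has_derivative_g:
  assumes "x \<in> S"
  shows "((\<lambda>y. g y v w) has_derivative
    (\<lambda>a. inverse ((\<alpha> x)\<^sup>2) * dform G x a v w - 2 * inverse ((\<alpha> x) ^ 3) * \<alpha> a * G x v w)) (at x)"
  unfolding g_def using pos[OF assms]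
  by (auto intro!: derivative_eq_intros has_derivative_\<alpha> has_derivative_form[OF assms]
      simp: field_simps power2_eq_square power3_eq_cube fun_eq_iff)

lemma dform_g:
  "x \<in> S \<Longrightarrow> dform g x a v w = inverse ((\<alpha> x)\<^sup>2) * dform G x a v w - 2 * inverse ((\<alpha> x) ^ 3) * \<alpha> a * G x v w"
  unfolding dform_def[of g] by (rule fun_cong[OF frechet_derivative_at[OF has_derivative_g], symmetric])

lemma inner_form_g: "x \<in> S \<Longrightarrow> inner_form (g x)"
  using inner_form_scale[OF form, of x "inverse ((\<alpha> x)\<^sup>2)"] pos[of x] by (simp add: g_def[abs_def])

lemma metric_field_g: "metric_field g S"
proof
  show "open S" by (rule S)
  fix x assume x: "x \<in> S"
  then show "inner_form (g x)" by (rule inner_form_g)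
  show "(\<lambda>y. g y v w) differentiable at x" for v w using has_derivative_g[OF x] differentiableI by blast
  show "(\<lambda>y. dform g y a v w) differentiable at x" for a v w
  proof -
    have "\<alpha> differentiable at x" using has_derivative_\<alpha> differentiableI by blast
    then have "(\<lambda>y. inverse ((\<alpha> y)\<^sup>2) * dform G y a v w - 2 * inverse ((\<alpha> y) ^ 3) * \<alpha> a * G y v w) differentiable at x"
      using pos[OF x]
      by (intro differentiable_diff differentiable_mult differentiable_const differentiable_inverse differentiable_power diff1 diff2 x) auto
    then obtain D where D: "((\<lambda>y. inverse ((\<alpha> y)\<^sup>2) * dform G y a v w - 2 * inverse ((\<alpha> y) ^ 3) * \<alpha> a * G y v w) has_derivative D) (at x)"
      by (auto simp: differentiable_def)
    have "((\<lambda>y. dform g y a v w) has_derivative D) (at x)"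
      by (rule has_derivative_transform_within_open[OF D S x]) (simp add: dform_g)
    then show ?thesis by (rule differentiableI)
  qed
qed

sublocale conf: metric_field g S by (rule metric_field_g)

lemma G_nu: "x \<in> S \<Longrightarrow> G x (nu x) w = \<alpha> w"
  unfolding nu_def by (rule sharp_works[OF form linear_\<alpha>])

lemma chris_g:
  assumes "x \<in> S"
  shows "chris g x u v = chris G x u v + inverse (\<alpha> x) *\<^sub>R shape x u v"
  unfolding chris_def[of g]
proof (rule sharp_unique[OF inner_form_g[OF assms]])
  fix w
  note bil = bilinear_G[OF assms]
  show "g x (chris G x u v + inverse (\<alpha> x) *\<^sub>R shape x u v) w = koszul g x u v w"
    using pos[OF assms] inner_form_sym[OF form[OF assms], of u w] inner_form_sym[OF form[OF assms], of v w]
    by (simp add: g_def koszul_def dform_g[OF assms] shape_def bilinear_ladd[OF bil] bilinear_lsub[OF bil]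
        bilinear_lmul[OF bil] G_chris[OF assms] G_nu[OF assms])
      (simp add: koszul_def field_simps power2_eq_square power3_eq_cube)
qed

lemma has_derivative_nu: "x \<in> S \<Longrightarrow> (nu has_derivative dnu x) (at x)"
  unfolding nu_def[abs_def] dnu_def[abs_def, unfolded nu_def]
  by (rule has_derivative_sharp[OF S _ form linear_\<alpha> has_derivative_form has_derivative_const])

lemma has_derivative_shape:
  assumes "x \<in> S" shows "((\<lambda>y. shape y u v) has_derivative (\<lambda>a. dshape x a u v)) (at x)"
proof -
  have "((\<lambda>y. shape y u v) has_derivative (\<lambda>a. (G x u v *\<^sub>R dnu x a + dform G x a u v *\<^sub>R nu x) - 0 - 0)) (at x)"
    unfolding shape_def
    by (intro has_derivative_diff has_derivative_scaleR has_derivative_const has_derivative_form has_derivative_nu assms)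
  then show ?thesis by (simp add: dshape_def add.commute)
qed

lemma dchris_g:
  assumes "x \<in> S"
  shows "dchris g x a u v = dchris G x a u v + inverse (\<alpha> x) *\<^sub>R dshape x a u v - (\<alpha> a * inverse ((\<alpha> x)\<^sup>2)) *\<^sub>R shape x u v"
proof -
  have inv: "((\<lambda>y. inverse (\<alpha> y)) has_derivative (\<lambda>a. - (\<alpha> a * inverse ((\<alpha> x)\<^sup>2)))) (at x)"
    using pos[OF assms] by (auto intro!: derivative_eq_intros has_derivative_\<alpha> simp: power2_eq_square fun_eq_iff)
  have "((\<lambda>y. chris G y u v + inverse (\<alpha> y) *\<^sub>R shape y u v) has_derivative
      (\<lambda>a. dchris G x a u v + (inverse (\<alpha> x) *\<^sub>R dshape x a u v + (- (\<alpha> a * inverse ((\<alpha> x)\<^sup>2))) *\<^sub>R shape x u v))) (at x)"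
    by (intro has_derivative_add has_derivative_scaleR has_derivative_chris has_derivative_shape inv assms)
  then have "((\<lambda>y. chris g y u v) has_derivative
      (\<lambda>a. dchris G x a u v + (inverse (\<alpha> x) *\<^sub>R dshape x a u v + (- (\<alpha> a * inverse ((\<alpha> x)\<^sup>2))) *\<^sub>R shape x u v))) (at x)"
    by (rule has_derivative_transform_within_open[OF _ S assms]) (simp add: chris_g)
  from has_derivative_unique[OF conf.has_derivative_chris[OF assms] this]
  show ?thesis by (metis (no_types, lifting) add_diff_eq diff_conv_add_uminus scaleR_minus_left)
qed

text \<open>\<alpha> times the Christoffel symbols of g (\<open>c_eq\<close>), written without
  division by \<alpha> so that its limit at the boundary can be read off.\<close>

definition c :: "'e \<Rightarrow> 'e \<Rightarrow> 'e \<Rightarrow> 'e" where "c x u v = \<alpha> x *\<^sub>R chris G x u v + shape x u v"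

lemma c_eq: "x \<in> S \<Longrightarrow> c x u v = \<alpha> x *\<^sub>R chris g x u v"
  using pos[of x] by (simp add: c_def chris_g scaleR_add_right)

text \<open>The factor \<alpha>^2 makes every term converge: under the assumptions of
  \<open>conformal_limit\<close> the first four tend to 0 and the others to expressions in
  \<open>shape0\<close>.\<close>

lemma rie_g:
  assumes "x \<in> S"
  shows "(\<alpha> x)\<^sup>2 *\<^sub>R rie g x u v w = (\<alpha> x)\<^sup>2 *\<^sub>R dchris G x u v w - (\<alpha> x)\<^sup>2 *\<^sub>R dchris G x v u w
    + \<alpha> x *\<^sub>R dshape x u v w - \<alpha> x *\<^sub>R dshape x v u w - \<alpha> u *\<^sub>R shape x v w + \<alpha> v *\<^sub>R shape x u w
    + c x u (c x v w) - c x v (c x u w)"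
proof -
  have cc: "c x u (c x v w) = (\<alpha> x)\<^sup>2 *\<^sub>R chris g x u (chris g x v w)" for u v
    by (simp add: c_eq[OF assms] bilinear_rmul[OF conf.bilinear_chris[OF assms]] power2_eq_square)
  have d: "(\<alpha> x)\<^sup>2 *\<^sub>R dchris g x u v w = (\<alpha> x)\<^sup>2 *\<^sub>R dchris G x u v w + \<alpha> x *\<^sub>R dshape x u v w - \<alpha> u *\<^sub>R shape x v w" for u v
  proof -
    have "(\<alpha> x)\<^sup>2 * inverse (\<alpha> x) = \<alpha> x" "(\<alpha> x)\<^sup>2 * (\<alpha> u * inverse ((\<alpha> x)\<^sup>2)) = \<alpha> u"
      using pos[OF assms] by (simp_all add: power2_eq_square field_simps)
    then show ?thesis by (simp add: dchris_g[OF assms] scaleR_add_right scaleR_diff_right)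
  qed
  have "(\<alpha> x)\<^sup>2 *\<^sub>R rie g x u v w = (\<alpha> x)\<^sup>2 *\<^sub>R dchris g x u v w - (\<alpha> x)\<^sup>2 *\<^sub>R dchris g x v u w
     + (\<alpha> x)\<^sup>2 *\<^sub>R chris g x u (chris g x v w) - (\<alpha> x)\<^sup>2 *\<^sub>R chris g x v (chris g x u w)"
    by (simp add: conf.rie_eq[OF assms] scaleR_add_right scaleR_diff_right)
  then show ?thesis by (simp add: d cc)
qed

end

section \<open>The limit of the curvature at the boundary\<close>

locale conformal_limit = conformal_field G S \<alpha> for G :: "'e::euclidean_space \<Rightarrow> 'e \<Rightarrow> 'e \<Rightarrow> real" and S \<alpha> +
  fixes F :: "'e filter" and G0 :: "'e \<Rightarrow> 'e \<Rightarrow> real"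
  assumes ev: "\<forall>\<^sub>F x in F. x \<in> S" and form0: "inner_form G0"
    and lim0: "\<And>v w. ((\<lambda>x. G x v w) \<longlongrightarrow> G0 v w) F"
    and lim1: "\<And>a v w. ((\<lambda>x. \<alpha> x * dform G x a v w) \<longlongrightarrow> 0) F"
    and lim2: "\<And>b a v w. ((\<lambda>x. (\<alpha> x)\<^sup>2 * d2form G x b a v w) \<longlongrightarrow> 0) F"
begin

definition nu0 :: 'e where "nu0 = sharp G0 \<alpha>"

definition shape0 :: "'e \<Rightarrow> 'e \<Rightarrow> 'e" where
  "shape0 u v = G0 u v *\<^sub>R nu0 - \<alpha> u *\<^sub>R v - \<alpha> v *\<^sub>R u"

lemma ev_form: "\<forall>\<^sub>F x in F. inner_form (G x)"
  using ev by eventually_elim (rule form)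

lemma tendsto_sharp_G:
  assumes "\<And>w. ((\<lambda>x. l x w) \<longlongrightarrow> l0 w) F" "\<And>x. x \<in> S \<Longrightarrow> linear (l x)" "linear l0"
  shows "((\<lambda>x. sharp (G x) (l x)) \<longlongrightarrow> sharp G0 l0) F"
  using ev by (intro tendsto_sharp lim0 ev_form form0 assms eventually_mono[OF ev])

lemma tendsto_sharp_G_scaled:
  assumes "\<And>w. ((\<lambda>x. t x * l x w) \<longlongrightarrow> 0) F" "\<And>x. x \<in> S \<Longrightarrow> linear (l x)"
  shows "((\<lambda>x. t x *\<^sub>R sharp (G x) (l x)) \<longlongrightarrow> 0) F"
proof -
  have "((\<lambda>x. sharp (G x) (\<lambda>w. t x * l x w)) \<longlongrightarrow> sharp G0 (\<lambda>w. 0)) F"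
    using linear_compose_scale_right[OF assms(2)]
    by (intro tendsto_sharp_G assms linear_zero) simp
  moreover have "\<forall>\<^sub>F x in F. sharp (G x) (\<lambda>w. t x * l x w) = t x *\<^sub>R sharp (G x) (l x)"
    using ev by eventually_elim (rule sharp_cmult[OF form assms(2)])
  ultimately show ?thesis using sharp_zero[OF form0] by (simp add: Lim_transform_eventually)
qed

lemma tendsto_nu: "(nu \<longlongrightarrow> nu0) F"
  unfolding nu_def[abs_def] nu0_def by (intro tendsto_sharp_G tendsto_const linear_\<alpha>)

lemma tendsto_shape: "((\<lambda>x. shape x u v) \<longlongrightarrow> shape0 u v) F"
  unfolding shape_def shape0_def by (intro tendsto_intros lim0 tendsto_nu)

lemma tendsto_chris: "((\<lambda>x. \<alpha> x *\<^sub>R chris G x u v) \<longlongrightarrow> 0) F"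
  unfolding chris_def
proof (rule tendsto_sharp_G_scaled[OF _ linear_koszul(3)])
  fix w
  have "((\<lambda>x. (\<alpha> x * dform G x u v w + \<alpha> x * dform G x v u w - \<alpha> x * dform G x w u v) / 2) \<longlongrightarrow> (0 + 0 - 0) / 2) F"
    by (intro tendsto_intros lim1) auto
  then show "((\<lambda>x. \<alpha> x * koszul G x u v w) \<longlongrightarrow> 0) F" by (simp add: koszul_def algebra_simps)
qed

lemma tendsto_c: "((\<lambda>x. c x u v) \<longlongrightarrow> shape0 u v) F"
  unfolding c_def using tendsto_add[OF tendsto_chris tendsto_shape] by simp

lemma bilinear_shape0: "bilinear shape0"
  using inner_form_bilinear[OF form0]
  unfolding bilinear_def[of shape0] shape0_def
  by (auto intro!: linearI simp: bilinear_ladd bilinear_radd bilinear_lmul bilinear_rmul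
      linear_add[OF linear_\<alpha>] linear_scale[OF linear_\<alpha>] algebra_simps)

lemma tendsto_cc: "((\<lambda>x. c x u (c x v w)) \<longlongrightarrow> shape0 u (shape0 v w)) F"
proof (rule tendsto_bilinear_forms[OF tendsto_c _ bilinear_shape0 tendsto_const tendsto_c])
  show "\<forall>\<^sub>F x in F. bilinear (c x)"
    using ev
  proof eventually_elim
    fix x assume "x \<in> S"
    then show "bilinear (c x)"
      unfolding bilinear_def[of "c x"]
      by (auto intro!: linearI simp: c_eq bilinear_ladd[OF conf.bilinear_chris] bilinear_radd[OF conf.bilinear_chris]
          bilinear_lmul[OF conf.bilinear_chris] bilinear_rmul[OF conf.bilinear_chris] scaleR_add_right)
  qed
qed

lemma tendsto_dform_arg: "((\<lambda>x. \<alpha> x * dform G x a (p x) w) \<longlongrightarrow> 0) F" if "(p \<longlongrightarrow> p0) F"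
proof (rule tendsto_linear_forms[where l="\<lambda>x v. \<alpha> x * dform G x a v w" and ?l0.0="\<lambda>v. 0", OF lim1 _ linear_zero that])
  show "\<forall>\<^sub>F x in F. linear (\<lambda>v. \<alpha> x * dform G x a v w)"
    using ev by eventually_elim (rule linear_compose_scale_right[OF linear_dform(2), simplified real_scaleR_def])
qed

lemma tendsto_dchris: "((\<lambda>x. (\<alpha> x)\<^sup>2 *\<^sub>R dchris G x b u v) \<longlongrightarrow> 0) F"
  unfolding dchris_def
proof (rule tendsto_sharp_G_scaled)
  fix w
  \<comment> \<open>The two factors \<alpha> are shared out: one goes with the derivative of G, the
    other with the Christoffel symbol, and each product tends to 0.\<close>
  have 1: "((\<lambda>x. \<alpha> x * dform G x b (\<alpha> x *\<^sub>R chris G x u v) w) \<longlongrightarrow> 0) F"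
    by (rule tendsto_dform_arg[OF tendsto_chris])
  have "((\<lambda>x. ((\<alpha> x)\<^sup>2 * d2form G x b u v w + (\<alpha> x)\<^sup>2 * d2form G x b v u w - (\<alpha> x)\<^sup>2 * d2form G x b w u v) / 2
      - \<alpha> x * dform G x b (\<alpha> x *\<^sub>R chris G x u v) w) \<longlongrightarrow> (0 + 0 - 0) / 2 - 0) F"
    by (intro tendsto_intros lim2 1) auto
  then have "((\<lambda>x. ((\<alpha> x)\<^sup>2 * d2form G x b u v w + (\<alpha> x)\<^sup>2 * d2form G x b v u w - (\<alpha> x)\<^sup>2 * d2form G x b w u v) / 2
      - \<alpha> x * dform G x b (\<alpha> x *\<^sub>R chris G x u v) w) \<longlongrightarrow> 0) F" by simp
  moreover have "\<forall>\<^sub>F x in F. ((\<alpha> x)\<^sup>2 * d2form G x b u v w + (\<alpha> x)\<^sup>2 * d2form G x b v u w - (\<alpha> x)\<^sup>2 * d2form G x b w u v) / 2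
      - \<alpha> x * dform G x b (\<alpha> x *\<^sub>R chris G x u v) w = (\<alpha> x)\<^sup>2 * (dkoszul G x b u v w - dform G x b (chris G x u v) w)"
    using ev by eventually_elim
      (simp add: dkoszul_def linear_scale[OF linear_dform(2)] algebra_simps power2_eq_square)
  ultimately show "((\<lambda>x. (\<alpha> x)\<^sup>2 * (dkoszul G x b u v w - dform G x b (chris G x u v) w)) \<longlongrightarrow> 0) F"
    by (rule Lim_transform_eventually)
  fix x assume "x \<in> S"
  then show "linear (\<lambda>w. dkoszul G x b u v w - dform G x b (chris G x u v) w)"
    by (intro linear_compose_sub linear_dkoszul linear_dform)
qed

lemma tendsto_dshape: "((\<lambda>x. \<alpha> x *\<^sub>R dshape x a u v) \<longlongrightarrow> 0) F"
proof -
  have 1: "((\<lambda>x. \<alpha> x *\<^sub>R dnu x a) \<longlongrightarrow> 0) F"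
    unfolding dnu_def
  proof (rule tendsto_sharp_G_scaled)
    show "((\<lambda>x. \<alpha> x * (0 - dform G x a (nu x) w)) \<longlongrightarrow> 0) F" for w
      using tendsto_minus[OF tendsto_dform_arg[OF tendsto_nu]] by simp
    show "linear (\<lambda>w. 0 - dform G x a (nu x) w)" if "x \<in> S" for x
      using that by (intro linear_compose_sub linear_dform linear_zero)
  qed
  have "((\<lambda>x. (\<alpha> x * dform G x a u v) *\<^sub>R nu x + G x u v *\<^sub>R (\<alpha> x *\<^sub>R dnu x a)) \<longlongrightarrow> 0 *\<^sub>R nu0 + G0 u v *\<^sub>R 0) F"
    by (intro tendsto_intros lim0 lim1 tendsto_nu 1)
  then show ?thesis by (simp add: dshape_def scaleR_add_right mult.commute)
qed

text \<open>This is the curvature of the model metric \<open>G0 / \<alpha>\<^sup>2\<close> with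
  constant G0, which has constant curvature \<open>- \<alpha> nu0\<close>. In the products of
  \<open>shape0\<close> everything cancels except the terms with \<open>\<alpha> nu0\<close>, the
  squared G0-norm of \<alpha>.\<close>

lemma shape0_curvature:
  "- \<alpha> u *\<^sub>R shape0 v w + \<alpha> v *\<^sub>R shape0 u w + shape0 u (shape0 v w) - shape0 v (shape0 u w) =
   - (\<alpha> nu0) *\<^sub>R (G0 v w *\<^sub>R u - G0 u w *\<^sub>R v)"
proof -
  have Gnu: "G0 nu0 w = \<alpha> w" for w unfolding nu0_def by (rule sharp_works[OF form0 linear_\<alpha>])
  note bil = inner_form_bilinear[OF form0]
  have G_shape: "G0 u (shape0 v w) = G0 v w * \<alpha> u - \<alpha> v * G0 u w - \<alpha> w * G0 u v" for u v w
    by (simp add: shape0_def bilinear_rsub[OF bil] bilinear_rmul[OF bil] inner_form_sym[OF form0, of _ nu0] Gnu)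
  have \<alpha>_shape: "\<alpha> (shape0 v w) = G0 v w * \<alpha> nu0 - 2 * \<alpha> v * \<alpha> w" for v w
    by (simp add: shape0_def linear_diff[OF linear_\<alpha>] linear_scale[OF linear_\<alpha>])
  have sh: "shape0 u (shape0 v w) = (G0 v w * \<alpha> u - \<alpha> v * G0 u w - \<alpha> w * G0 u v) *\<^sub>R nu0
      - \<alpha> u *\<^sub>R (G0 v w *\<^sub>R nu0 - \<alpha> v *\<^sub>R w - \<alpha> w *\<^sub>R v) - (G0 v w * \<alpha> nu0 - 2 * \<alpha> v * \<alpha> w) *\<^sub>R u" for u v w
    unfolding shape0_def[of u] by (simp add: G_shape \<alpha>_shape) (simp add: shape0_def)
  show ?thesis
    unfolding sh
    by (rule euclidean_eqI)
      (simp add: shape0_def inner_form_sym[OF form0, of v u] inner_add_left inner_diff_left algebra_simps)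
qed

lemma tendsto_rie:
  "((\<lambda>x. (\<alpha> x)\<^sup>2 *\<^sub>R rie g x u v w) \<longlongrightarrow> - (\<alpha> nu0) *\<^sub>R (G0 v w *\<^sub>R u - G0 u w *\<^sub>R v)) F"
proof -
  have "((\<lambda>x. (\<alpha> x)\<^sup>2 *\<^sub>R dchris G x u v w - (\<alpha> x)\<^sup>2 *\<^sub>R dchris G x v u w
    + \<alpha> x *\<^sub>R dshape x u v w - \<alpha> x *\<^sub>R dshape x v u w - \<alpha> u *\<^sub>R shape x v w + \<alpha> v *\<^sub>R shape x u w
    + c x u (c x v w) - c x v (c x u w)) \<longlongrightarrow>
    0 - 0 + 0 - 0 - \<alpha> u *\<^sub>R shape0 v w + \<alpha> v *\<^sub>R shape0 u w + shape0 u (shape0 v w) - shape0 v (shape0 u w)) F"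
    by (intro tendsto_add tendsto_diff tendsto_scaleR tendsto_const tendsto_dchris tendsto_dshape tendsto_shape tendsto_cc)
  moreover have "0 - 0 + 0 - 0 - \<alpha> u *\<^sub>R shape0 v w + \<alpha> v *\<^sub>R shape0 u w + shape0 u (shape0 v w) - shape0 v (shape0 u w)
     = - (\<alpha> nu0) *\<^sub>R (G0 v w *\<^sub>R u - G0 u w *\<^sub>R v)"
    using shape0_curvature[of u v w] by simp
  moreover have "\<forall>\<^sub>F x in F. (\<alpha> x)\<^sup>2 *\<^sub>R dchris G x u v w - (\<alpha> x)\<^sup>2 *\<^sub>R dchris G x v u w
    + \<alpha> x *\<^sub>R dshape x u v w - \<alpha> x *\<^sub>R dshape x v u w - \<alpha> u *\<^sub>R shape x v w + \<alpha> v *\<^sub>R shape x u w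
    + c x u (c x v w) - c x v (c x u w) = (\<alpha> x)\<^sup>2 *\<^sub>R rie g x u v w"
    using ev by eventually_elim (rule rie_g[symmetric])
  ultimately show ?thesis by (simp add: Lim_transform_eventually)
qed

lemma sharp_g:
  assumes "x \<in> S" "linear l" shows "sharp (g x) l = (\<alpha> x)\<^sup>2 *\<^sub>R sharp (G x) l"
  using sharp_scale[OF form[OF assms(1)] _ assms(2), of "inverse ((\<alpha> x)\<^sup>2)"] pos[OF assms(1)]
  by (simp add: g_def[abs_def])

text \<open>Raising the index with g instead of G contributes \<alpha>^2 (\<open>sharp_g\<close>),
  exactly the factor in \<open>tendsto_rie\<close>.\<close>

lemma tendsto_curvature_operator:
  assumes "linear l" "linear m"
  shows "((\<lambda>x. l (rie g x u v (sharp (g x) m))) \<longlongrightarrow> - (\<alpha> nu0) * (l u * m v - l v * m u)) F"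
proof -
  let ?R0 = "\<lambda>w. - (\<alpha> nu0) *\<^sub>R (G0 v w *\<^sub>R u - G0 u w *\<^sub>R v)"
  have lin0: "linear ?R0"
    using inner_form_bilinear[OF form0]
    by (auto intro!: linearI simp: bilinear_radd bilinear_rmul algebra_simps)
  have "((\<lambda>x. (\<lambda>w. (\<alpha> x)\<^sup>2 *\<^sub>R rie g x u v w) (sharp (G x) m)) \<longlongrightarrow> ?R0 (sharp G0 m)) F"
  proof (rule tendsto_linear_forms[OF tendsto_rie _ lin0])
    show "\<forall>\<^sub>F x in F. linear (\<lambda>w. (\<alpha> x)\<^sup>2 *\<^sub>R rie g x u v w)"
      using ev by eventually_elim (intro linear_compose_scale_right conf.linear_rie)
    show "((\<lambda>x. sharp (G x) m) \<longlongrightarrow> sharp G0 m) F" by (intro tendsto_sharp_G tendsto_const assms)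
  qed
  then have "((\<lambda>x. l ((\<alpha> x)\<^sup>2 *\<^sub>R rie g x u v (sharp (G x) m))) \<longlongrightarrow> l (?R0 (sharp G0 m))) F"
    by (rule bounded_linear.tendsto[OF assms(1)[unfolded linear_conv_bounded_linear]])
  moreover have "l (?R0 (sharp G0 m)) = - (\<alpha> nu0) * (l u * m v - l v * m u)"
  proof -
    have "G0 w (sharp G0 m) = m w" for w
      using sharp_works[OF form0 assms(2)] inner_form_sym[OF form0] by metis
    then show ?thesis
      by (simp add: linear_diff[OF assms(1)] linear_scale[OF assms(1)] linear_neg[OF assms(1)] mult.commute)
  qed
  moreover have "\<forall>\<^sub>F x in F. l ((\<alpha> x)\<^sup>2 *\<^sub>R rie g x u v (sharp (G x) m)) = l (rie g x u v (sharp (g x) m))"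
    using ev by eventually_elim (simp add: sharp_g assms linear_scale[OF conf.linear_rie(3)])
  ultimately show ?thesis using Lim_transform_eventually by force
qed

definition ric :: "'e \<Rightarrow> 'e \<Rightarrow> 'e \<Rightarrow> real" where "ric x v w = (\<Sum>b\<in>Basis. b \<bullet> rie g x b v w)"

lemma tendsto_ricci_operator:
  "((\<lambda>x. sharp (g x) (ric x v)) \<longlongrightarrow> (- (\<alpha> nu0) * (real DIM('e) - 1)) *\<^sub>R v) F"
proof -
  let ?l0 = "\<lambda>w. \<Sum>b\<in>Basis. b \<bullet> (- (\<alpha> nu0) *\<^sub>R (G0 v w *\<^sub>R b - G0 b w *\<^sub>R v))"
  note bil = inner_form_bilinear[OF form0]
  \<comment> \<open>The trace of b -> G0 v w b - G0 b w v is dimension times G0 v w from the first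
    term, minus G0 v w from the second.\<close>
  have l0: "?l0 w = G0 ((- (\<alpha> nu0) * (real DIM('e) - 1)) *\<^sub>R v) w" for w
  proof -
    have "linear (\<lambda>b. G0 b w)" using bil by (simp add: bilinear_def)
    then have ex: "(\<Sum>b\<in>Basis. (b \<bullet> v) * G0 b w) = G0 v w"
      using linear_expand[of "\<lambda>b. G0 b w" v] by (simp add: inner_commute)
    have "?l0 w = (\<Sum>b\<in>(Basis::'e set). - (\<alpha> nu0) * G0 v w + \<alpha> nu0 * ((b \<bullet> v) * G0 b w))"
      by (intro sum.cong refl) (simp add: inner_diff_right right_diff_distrib)
    also have "\<dots> = (- (\<alpha> nu0) * (real DIM('e) - 1)) * G0 v w"
      unfolding sum.distrib sum_distrib_left[symmetric] ex by (simp add: algebra_simps)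
    finally show ?thesis by (simp only: bilinear_lmul[OF bil] real_scaleR_def)
  qed
  have lin0: "linear ?l0" unfolding l0 using bil by (simp add: bilinear_def)
  have lin: "linear (ric x v)" if "x \<in> S" for x
    unfolding ric_def[abs_def] using that
    by (intro linear_compose_sum ballI linear_compose[OF conf.linear_rie(3) linear_inner, unfolded comp_def])
  have "((\<lambda>x. sharp (G x) (\<lambda>w. (\<alpha> x)\<^sup>2 * ric x v w)) \<longlongrightarrow> sharp G0 ?l0) F"
  proof (rule tendsto_sharp_G[OF _ _ lin0])
    fix w
    have "((\<lambda>x. \<Sum>b\<in>Basis. b \<bullet> ((\<alpha> x)\<^sup>2 *\<^sub>R rie g x b v w)) \<longlongrightarrow> ?l0 w) F"
      by (intro tendsto_sum tendsto_inner tendsto_const tendsto_rie)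
    then show "((\<lambda>x. (\<alpha> x)\<^sup>2 * ric x v w) \<longlongrightarrow> ?l0 w) F" by (simp add: ric_def sum_distrib_left)
  next
    fix x assume "x \<in> S"
    then show "linear (\<lambda>w. (\<alpha> x)\<^sup>2 * ric x v w)" using linear_compose_scale_right[OF lin] by simp
  qed
  moreover have "sharp G0 ?l0 = (- (\<alpha> nu0) * (real DIM('e) - 1)) *\<^sub>R v"
    by (rule sharp_unique[OF form0]) (rule l0[symmetric])
  moreover have "\<forall>\<^sub>F x in F. sharp (G x) (\<lambda>w. (\<alpha> x)\<^sup>2 * ric x v w) = sharp (g x) (ric x v)"
    using ev by eventually_elim (simp add: sharp_g lin sharp_cmult[OF form])
  ultimately show ?thesis by (simp add: Lim_transform_eventually)
qed

lemma tendsto_scalar_curvature: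
  "((\<lambda>x. \<Sum>b\<in>Basis. b \<bullet> sharp (g x) (ric x b)) \<longlongrightarrow> - (\<alpha> nu0) * (real DIM('e) - 1) * real DIM('e)) F"
proof -
  have "((\<lambda>x. \<Sum>b\<in>Basis. b \<bullet> sharp (g x) (ric x b)) \<longlongrightarrow>
     (\<Sum>b\<in>(Basis::'e set). b \<bullet> ((- (\<alpha> nu0) * (real DIM('e) - 1)) *\<^sub>R b))) F"
    by (intro tendsto_sum tendsto_inner tendsto_const tendsto_ricci_operator)
  then show ?thesis by (simp add: mult_ac)
qed

end

section \<open>Smooth functions\<close>

text \<open>The head of the list is the outermost derivative, so the last entry can be moved into
  the function. This gives the recursion \<open>Ck_on_Suc\<close>, on which the closure properties
  rest by induction on k.\<close>

lemma iter_deriv_append: "iter_deriv (vs @ [b]) f = iter_deriv vs (\<lambda>x. frechet_derivative f (at x) b)"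
  by (induction vs) auto

lemma Ck_on_0: "Ck_on 0 S f \<longleftrightarrow> continuous_on S f"
  by (auto simp: Ck_on_def)

lemma Ck_on_Suc:
  "Ck_on (Suc k) S f \<longleftrightarrow> (\<forall>x\<in>S. f differentiable (at x)) \<and> continuous_on S f \<and>
     (\<forall>b\<in>Basis. Ck_on k S (\<lambda>x. frechet_derivative f (at x) b))" (is "?L \<longleftrightarrow> ?R")
proof
  assume L: ?L
  show ?R
  proof (intro conjI ballI)
    show "\<And>x. x \<in> S \<Longrightarrow> f differentiable at x" "continuous_on S f"
      using L[unfolded Ck_on_def, rule_format, of "[]"] by auto
    fix b :: 'a assume b: "b \<in> Basis"
    show "Ck_on k S (\<lambda>x. frechet_derivative f (at x) b)"
      unfolding Ck_on_def
    proof (intro allI impI)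
      fix vs :: "'a list" assume "set vs \<subseteq> Basis"
      with b L[unfolded Ck_on_def, rule_format, of "vs @ [b]"]
      show "(length vs < k \<longrightarrow> (\<forall>x\<in>S. iter_deriv vs (\<lambda>x. frechet_derivative f (at x) b) differentiable at x)) \<and>
        (length vs \<le> k \<longrightarrow> continuous_on S (iter_deriv vs (\<lambda>x. frechet_derivative f (at x) b)))"
        by (simp add: iter_deriv_append)
    qed
  qed
next
  assume R: ?R
  show ?L
    unfolding Ck_on_def
  proof (intro allI impI)
    fix vs :: "'a list" assume vs: "set vs \<subseteq> Basis"
    show "(length vs < Suc k \<longrightarrow> (\<forall>x\<in>S. iter_deriv vs f differentiable at x)) \<and>
        (length vs \<le> Suc k \<longrightarrow> continuous_on S (iter_deriv vs f))"
    proof (cases vs rule: rev_cases)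
      case (snoc us b)
      with vs R have "Ck_on k S (\<lambda>x. frechet_derivative f (at x) b)" "set us \<subseteq> Basis" by auto
      then show ?thesis by (auto simp: Ck_on_def snoc iter_deriv_append)
    qed (use R in auto)
  qed
qed

lemma Ck_on_SucI:
  assumes "\<And>x. x \<in> S \<Longrightarrow> (f has_derivative f' x) (at x)"
    and "\<And>b. b \<in> Basis \<Longrightarrow> Ck_on k S (\<lambda>x. frechet_derivative f (at x) b)"
  shows "Ck_on (Suc k) S f"
  unfolding Ck_on_Suc
proof (intro conjI ballI assms(2))
  show "f differentiable at x" if "x \<in> S" for x using assms(1)[OF that] by (rule differentiableI)
  show "continuous_on S f"
    by (intro continuous_at_imp_continuous_on ballI) (rule has_derivative_continuous[OF assms(1)])
qed

lemma Ck_on_SucD: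
  assumes "Ck_on (Suc k) S f" "x \<in> S"
  shows "(f has_derivative frechet_derivative f (at x)) (at x)"
proof -
  have "f differentiable at x" using assms unfolding Ck_on_Suc by blast
  then show ?thesis unfolding frechet_derivative_works .
qed

lemma Ck_on_cong:
  assumes "open S" "\<And>x. x \<in> S \<Longrightarrow> f x = g x" "Ck_on k S f"
  shows "Ck_on k S g"
  using assms(2,3)
proof (induction k arbitrary: f g)
  case 0
  then show ?case using continuous_on_cong[OF refl, of S f g] by (simp add: Ck_on_0)
next
  case (Suc k)
  have d: "(g has_derivative frechet_derivative f (at x)) (at x)" if "x \<in> S" for x
    by (rule has_derivative_transform_within_open[OF Ck_on_SucD[OF Suc.prems(2) that] assms(1) that])
      (rule Suc.prems(1))
  then have eq: "frechet_derivative f (at x) = frechet_derivative g (at x)" if "x \<in> S" for x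
    using that frechet_derivative_at by blast
  show ?case
  proof (rule Ck_on_SucI[OF d])
    fix b :: 'a assume "b \<in> Basis"
    then have "Ck_on k S (\<lambda>x. frechet_derivative f (at x) b)" using Suc.prems by (simp add: Ck_on_Suc)
    then show "Ck_on k S (\<lambda>x. frechet_derivative g (at x) b)" by (rule Suc.IH[rotated]) (simp add: eq)
  qed
qed

text \<open>On an open set any derivative that can be named agrees with
  \<open>frechet_derivative\<close>, so the rules of differentiation can be used directly in the
  inductions below.\<close>

lemma Ck_on_derivI:
  assumes S: "open S" and f: "\<And>x. x \<in> S \<Longrightarrow> (f has_derivative f' x) (at x)"
    and f': "\<And>b. b \<in> Basis \<Longrightarrow> Ck_on k S (\<lambda>x. f' x b)"
  shows "Ck_on (Suc k) S f"
proof (rule Ck_on_SucI[OF f])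
  fix b :: 'a assume "b \<in> Basis"
  show "Ck_on k S (\<lambda>x. frechet_derivative f (at x) b)"
    by (rule Ck_on_cong[OF S _ f'[OF \<open>b \<in> Basis\<close>]]) (metis f frechet_derivative_at)
qed

lemma Ck_on_Suc_imp: "Ck_on (Suc k) S f \<Longrightarrow> Ck_on k S f"
  by (auto simp: Ck_on_def)

lemma Ck_on_subset: "Ck_on k S f \<Longrightarrow> T \<subseteq> S \<Longrightarrow> Ck_on k T f"
  unfolding Ck_on_def by (meson continuous_on_subset subset_iff)

lemma Ck_on_const: "Ck_on k S (\<lambda>x. c)"
  by (induction k arbitrary: c) (auto simp: Ck_on_0 intro!: Ck_on_SucI has_derivative_const)

lemma Ck_on_linear_compose:
  assumes "open S" "bounded_linear L" "Ck_on k S f" shows "Ck_on k S (\<lambda>x. L (f x))"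
  using assms(3)
proof (induction k arbitrary: f)
  case 0 then show ?case using assms(2) by (simp add: Ck_on_0 bounded_linear.continuous_on)
next
  case (Suc k)
  show ?case
    by (rule Ck_on_derivI[OF assms(1) bounded_linear.has_derivative[OF assms(2) Ck_on_SucD[OF Suc.prems]]])
      (use Suc in \<open>auto simp: Ck_on_Suc\<close>)
qed

lemma Ck_on_id: "open S \<Longrightarrow> Ck_on k S (\<lambda>x. x)"
proof (cases k)
  case (Suc m) assume "open S"
  then show ?thesis unfolding Suc
    by (intro Ck_on_derivI[where f'="\<lambda>x v. v"] has_derivative_ident Ck_on_const)
qed (simp add: Ck_on_0)

lemma Ck_on_add:
  assumes "open S" "Ck_on k S f" "Ck_on k S g" shows "Ck_on k S (\<lambda>x. f x + g x)"
  using assms(2,3)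
proof (induction k arbitrary: f g)
  case 0 then show ?case by (simp add: Ck_on_0 continuous_on_add)
next
  case (Suc k)
  show ?case
    by (rule Ck_on_derivI[OF assms(1) has_derivative_add[OF Ck_on_SucD[OF Suc.prems(1)] Ck_on_SucD[OF Suc.prems(2)]]])
      (use Suc in \<open>auto simp: Ck_on_Suc\<close>)
qed

lemma Ck_on_sum:
  "open S \<Longrightarrow> (\<And>i. i \<in> I \<Longrightarrow> Ck_on k S (f i)) \<Longrightarrow> Ck_on k S (\<lambda>x. \<Sum>i\<in>I. f i x)"
  by (induction I rule: infinite_finite_induct) (auto intro: Ck_on_const Ck_on_add)

lemma Ck_on_scaleR:
  assumes "open S" "Ck_on k S f" "Ck_on k S g" shows "Ck_on k S (\<lambda>x. f x *\<^sub>R g x)"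
  using assms(2,3)
proof (induction k arbitrary: f g)
  case 0 then show ?case by (simp add: Ck_on_0 continuous_on_scaleR)
next
  case (Suc k)
  note lower = Ck_on_Suc_imp[OF Suc.prems(1)] Ck_on_Suc_imp[OF Suc.prems(2)]
  show ?case
    by (rule Ck_on_derivI[OF assms(1) has_derivative_scaleR[OF Ck_on_SucD[OF Suc.prems(1)] Ck_on_SucD[OF Suc.prems(2)]]])
      (use Suc lower in \<open>auto simp: Ck_on_Suc intro!: Ck_on_add[OF assms(1)] Suc.IH\<close>)
qed

lemma Ck_on_mult:
  fixes f g :: "_ \<Rightarrow> real"
  assumes "open S" "Ck_on k S f" "Ck_on k S g" shows "Ck_on k S (\<lambda>x. f x * g x)"
  using Ck_on_scaleR[OF assms] by simp

lemma Ck_on_inverse: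
  fixes f :: "'e::euclidean_space \<Rightarrow> real"
  assumes S: "open S" and nz: "\<And>x. x \<in> S \<Longrightarrow> f x \<noteq> 0" and f: "Ck_on k S f"
  shows "Ck_on k S (\<lambda>x. inverse (f x))"
  using f
proof (induction k)
  case 0 then show ?case using nz by (simp add: Ck_on_0 continuous_on_inverse)
next
  case (Suc k)
  have d: "((\<lambda>x. inverse (f x)) has_derivative (\<lambda>h. - 1 * (inverse (f x) * frechet_derivative f (at x) h * inverse (f x)))) (at x)"
    if "x \<in> S" for x
    using Ck_on_SucD[OF Suc.prems that] nz[OF that] by (auto intro!: derivative_eq_intros)
  show ?case
  proof (rule Ck_on_derivI[OF S d])
    fix b :: 'e assume "b \<in> Basis"
    then have "Ck_on k S (\<lambda>x. frechet_derivative f (at x) b)" using Suc.prems by (auto simp: Ck_on_Suc)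
    then show "Ck_on k S (\<lambda>x. - 1 * (inverse (f x) * frechet_derivative f (at x) b * inverse (f x)))"
      using Suc Ck_on_Suc_imp by (intro Ck_on_mult[OF S] Ck_on_const) auto
  qed
qed

lemma Ck_on_compose:
  fixes f :: "'e2::euclidean_space \<Rightarrow> 'f::real_normed_vector" and g :: "'e::euclidean_space \<Rightarrow> 'e2"
  assumes S: "open S" and gS: "g ` S \<subseteq> T" and g: "Ck_on k S g" and f: "Ck_on k T f"
  shows "Ck_on k S (\<lambda>x. f (g x))"
  using f g
proof (induction k arbitrary: f)
  case 0 then show ?case using continuous_on_compose2 gS by (auto simp: Ck_on_0)
next
  case (Suc k)
  have gT: "x \<in> S \<Longrightarrow> g x \<in> T" for x using gS by auto
  have d: "((\<lambda>x. f (g x)) has_derivative (\<lambda>h. frechet_derivative f (at (g x)) (frechet_derivative g (at x) h))) (at x)"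
    if "x \<in> S" for x
    by (rule has_derivative_compose[OF Ck_on_SucD[OF Suc.prems(2) that] Ck_on_SucD[OF Suc.prems(1) gT[OF that]]])
  show ?case
  proof (rule Ck_on_derivI[OF S d])
    fix b :: 'e assume b: "b \<in> Basis"
    \<comment> \<open>Expanding the inner derivative in a basis leaves as outer factors the partial
      derivatives of f composed with g, to which the induction hypothesis applies.\<close>
    have "Ck_on k S (\<lambda>x. \<Sum>e\<in>Basis. (frechet_derivative g (at x) b \<bullet> e) *\<^sub>R frechet_derivative f (at (g x)) e)"
    proof (intro Ck_on_sum[OF S] Ck_on_scaleR[OF S] Ck_on_linear_compose[OF S bounded_linear_inner_left])
      show "Ck_on k S (\<lambda>x. frechet_derivative g (at x) b)" using Suc.prems b by (auto simp: Ck_on_Suc)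
      fix e :: 'e2 assume "e \<in> Basis"
      then show "Ck_on k S (\<lambda>x. frechet_derivative f (at (g x)) e)"
        using Suc.prems by (intro Suc.IH) (auto simp: Ck_on_Suc intro: Ck_on_Suc_imp)
    qed
    then show "Ck_on k S (\<lambda>x. frechet_derivative f (at (g x)) (frechet_derivative g (at x) b))"
    proof (rule Ck_on_cong[OF S, rotated])
      fix x assume "x \<in> S"
      show "(\<Sum>e\<in>Basis. (frechet_derivative g (at x) b \<bullet> e) *\<^sub>R frechet_derivative f (at (g x)) e) =
        frechet_derivative f (at (g x)) (frechet_derivative g (at x) b)"
        by (rule linear_expand[symmetric], rule has_derivative_linear, rule Ck_on_SucD[OF Suc.prems(1) gT[OF \<open>x \<in> S\<close>]])
    qed
  qed
qed

definition Cinf_on :: "'e::euclidean_space set \<Rightarrow> ('e \<Rightarrow> 'f::real_normed_vector) \<Rightarrow> bool" where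
  "Cinf_on S f \<longleftrightarrow> (\<forall>k. Ck_on k S f)"

lemma Cinf_onD: "Cinf_on S f \<Longrightarrow> x \<in> S \<Longrightarrow> (f has_derivative frechet_derivative f (at x)) (at x)"
  unfolding Cinf_on_def using Ck_on_SucD by blast

lemma Cinf_on_continuous: "Cinf_on S f \<Longrightarrow> continuous_on S f"
  unfolding Cinf_on_def using Ck_on_0 by blast

lemma Cinf_on_subset: "Cinf_on S f \<Longrightarrow> T \<subseteq> S \<Longrightarrow> Cinf_on T f"
  unfolding Cinf_on_def using Ck_on_subset by blast

lemma Cinf_on_derivative:
  assumes "open S" "Cinf_on S f" shows "Cinf_on S (\<lambda>x. frechet_derivative f (at x) v)"
  unfolding Cinf_on_def
proof
  fix k
  have "Ck_on k S (\<lambda>x. \<Sum>b\<in>Basis. (v \<bullet> b) *\<^sub>R frechet_derivative f (at x) b)"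
    using assms unfolding Cinf_on_def
    by (intro Ck_on_sum Ck_on_scaleR Ck_on_const) (auto dest!: spec[of _ "Suc k"] simp: Ck_on_Suc)
  then show "Ck_on k S (\<lambda>x. frechet_derivative f (at x) v)"
  proof (rule Ck_on_cong[OF assms(1), rotated])
    fix x assume "x \<in> S"
    show "(\<Sum>b\<in>Basis. (v \<bullet> b) *\<^sub>R frechet_derivative f (at x) b) = frechet_derivative f (at x) v"
      by (rule linear_expand[symmetric], rule has_derivative_linear, rule Cinf_onD[OF assms(2) \<open>x \<in> S\<close>])
  qed
qed

section \<open>Bump functions\<close>

text \<open>For m = 0 this is the classical smooth function that is flat at 0. The powers of 1/t are
  included because derivatives then stay in the span of the family, so smoothness follows by
  induction for all m at once.\<close>

definition flat_exp :: "nat \<Rightarrow> real \<Rightarrow> real" where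
  "flat_exp m t = (if t > 0 then inverse t ^ m * exp (- inverse t) else 0)"

text \<open>The single term (1/t)^(m+2) / (m+2)! of the exponential series is at most e^(1/t). A
  bound quadratic in t is what gives derivative 0 at t = 0.\<close>

lemma flat_exp_bound: "\<bar>flat_exp m t\<bar> \<le> fact (m + 2) * t\<^sup>2"
proof (cases "t > 0")
  case True
  have "inverse t ^ (m + 2) / fact (m + 2) \<le> exp (inverse t)"
    using sum_le_suminf[OF summable_exp[of "inverse t"], of "{m + 2}"] True
    by (simp add: exp_def divide_inverse mult.commute)
  then have le: "inverse t ^ (m + 2) \<le> fact (m + 2) * exp (inverse t)" by (simp add: pos_divide_le_eq mult.commute)
  have "inverse t ^ m * exp (- inverse t) = inverse t ^ (m + 2) * (t\<^sup>2 * exp (- inverse t))"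
    using True by (simp add: power_add power2_eq_square field_simps)
  also have "\<dots> \<le> fact (m + 2) * exp (inverse t) * (t\<^sup>2 * exp (- inverse t))"
    using le by (intro mult_right_mono) auto
  also have "\<dots> = fact (m + 2) * t\<^sup>2 * (exp (inverse t) * exp (- inverse t))" by (simp only: mult_ac)
  also have "\<dots> = fact (m + 2) * t\<^sup>2" by (simp add: exp_minus)
  finally have "inverse t ^ m * exp (- inverse t) \<le> fact (m + 2) * t\<^sup>2" .
  with True show ?thesis by (simp add: flat_exp_def)
qed (simp add: flat_exp_def)


lemma flat_exp_derivative:
  "(flat_exp m has_real_derivative flat_exp (m + 2) t - real m * flat_exp (m + 1) t) (at t)"
proof (cases "t = 0")
  case True
  have "((\<lambda>h. (flat_exp m (0 + h) - flat_exp m 0) / h) \<longlongrightarrow> 0) (at 0)"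
  proof (rule Lim_null_comparison)
    show "\<forall>\<^sub>F h in at 0. norm ((flat_exp m (0 + h) - flat_exp m 0) / h) \<le> fact (m + 2) * \<bar>h\<bar>"
    proof (rule eventually_at_topological[THEN iffD2], intro exI[of _ UNIV] conjI ballI impI)
      fix h :: real assume "h \<noteq> 0"
      have "\<bar>flat_exp m h\<bar> / \<bar>h\<bar> \<le> (fact (m + 2) * h\<^sup>2) / \<bar>h\<bar>"
        by (intro divide_right_mono flat_exp_bound) simp
      also have "\<dots> = fact (m + 2) * \<bar>h\<bar>"
        using \<open>h \<noteq> 0\<close> by (subst power2_abs[symmetric]) (simp only: power2_eq_square times_divide_eq_right[symmetric], simp)
      finally show "norm ((flat_exp m (0 + h) - flat_exp m 0) / h) \<le> fact (m + 2) * \<bar>h\<bar>"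
        by (simp add: flat_exp_def[of m 0])
    qed auto
    show "((\<lambda>h. fact (m + 2) * \<bar>h\<bar>) \<longlongrightarrow> (0::real)) (at 0)"
      by (rule tendsto_eq_intros refl | simp)+
  qed
  then show ?thesis using True by (simp add: DERIV_def flat_exp_def[of _ 0])
next
  case False
  show ?thesis
  proof (cases "t > 0")
    case True
    have "((\<lambda>t. inverse t ^ m * exp (- inverse t)) has_real_derivative
        flat_exp (m + 2) t - real m * flat_exp (m + 1) t) (at t)"
    proof -
      \<comment> \<open>For m = 0 the exponent m - Suc 0 is truncated to 0; the factor m makes the
        identity hold nevertheless.\<close>
      have eq: "real m * (inverse t ^ (m - Suc 0) * inverse t) = real m * inverse t ^ m" by (cases m) auto
      have "((\<lambda>t. inverse t ^ m * exp (- inverse t)) has_real_derivative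
          (inverse t ^ m * (exp (- inverse t) * (inverse t * inverse t)) -
           real m * (inverse t ^ (m - Suc 0) * inverse t) * inverse t * exp (- inverse t))) (at t)"
        using True by (auto intro!: derivative_eq_intros simp: algebra_simps)
      then show ?thesis unfolding eq using True by (simp add: flat_exp_def algebra_simps)
    qed
    then show ?thesis
      by (rule has_field_derivative_transform_within_open[where S="{0<..}"]) (use True in \<open>auto simp: flat_exp_def\<close>)
  next
    case False
    with \<open>t \<noteq> 0\<close> have "t < 0" by simp
    have "((\<lambda>t. 0) has_real_derivative flat_exp (m + 2) t - real m * flat_exp (m + 1) t) (at t)"
      using \<open>t < 0\<close> by (simp add: flat_exp_def)
    then show ?thesis
      by (rule has_field_derivative_transform_within_open[where S="{..<0}"]) (use \<open>t < 0\<close> in \<open>auto simp: flat_exp_def\<close>)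
  qed
qed

lemma Ck_on_flat_exp: "Ck_on k UNIV (flat_exp m)"
proof (induction k arbitrary: m)
  case 0 show ?case unfolding Ck_on_0
    using flat_exp_derivative by (meson DERIV_isCont continuous_at_imp_continuous_on)
next
  case (Suc k)
  show ?case
  proof (rule Ck_on_derivI[OF open_UNIV])
    show "(flat_exp m has_derivative (*) (flat_exp (m + 2) x + (- real m) * flat_exp (m + 1) x)) (at x)" for x
      using flat_exp_derivative by (simp add: has_field_derivative_def)
    fix b :: real
    show "Ck_on k UNIV (\<lambda>x. (flat_exp (m + 2) x + (- real m) * flat_exp (m + 1) x) * b)"
      by (intro Ck_on_mult Ck_on_add Suc.IH Ck_on_const open_UNIV)
  qed
qed

lemma Ck_on_dist_squared: "Ck_on k UNIV (\<lambda>z::'e::euclidean_space. (z - a) \<bullet> (z - a))"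
proof (cases k)
  case 0 then show ?thesis by (auto simp: Ck_on_0 intro!: continuous_intros)
next
  case (Suc m)
  show ?thesis unfolding Suc
  proof (rule Ck_on_derivI[OF open_UNIV])
    show "((\<lambda>z. (z - a) \<bullet> (z - a)) has_derivative (\<lambda>v. 2 * ((x + (- a)) \<bullet> v))) (at x)" for x
      by (auto intro!: derivative_eq_intros simp: inner_commute fun_eq_iff algebra_simps)
    fix b :: 'e
    show "Ck_on m UNIV (\<lambda>x. 2 * ((x + (- a)) \<bullet> b))"
      by (intro Ck_on_mult Ck_on_const open_UNIV Ck_on_linear_compose[OF _ bounded_linear_inner_left] Ck_on_add Ck_on_id)
  qed
qed

text \<open>The quotient p / (p + q), where p is positive exactly inside radius r and q exactly
  outside radius r/2, so that the denominator never vanishes.\<close>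

lemma bump_function:
  fixes a :: "'e::euclidean_space"
  assumes r: "r > 0"
  obtains \<beta> :: "'e \<Rightarrow> real" where "Cinf_on UNIV \<beta>" "\<And>z. dist z a < r / 2 \<Longrightarrow> \<beta> z = 1" "\<And>z. dist z a \<ge> r \<Longrightarrow> \<beta> z = 0"
proof -
  define s where "s = (\<lambda>z::'e. (z - a) \<bullet> (z - a))"
  have s: "s z = (dist z a)\<^sup>2" for z by (simp add: s_def dist_norm power2_norm_eq_inner)
  define p where "p = (\<lambda>z. flat_exp 0 (r\<^sup>2 + (-1) * s z))"
  define q where "q = (\<lambda>z. flat_exp 0 (s z + (- (r / 2)\<^sup>2)))"
  have nonneg: "flat_exp 0 t \<ge> 0" and pos: "t > 0 \<Longrightarrow> flat_exp 0 t > 0" for t by (simp_all add: flat_exp_def)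
  have pq: "p z + q z > 0" for z
  proof (cases "s z < r\<^sup>2")
    case True then show ?thesis using nonneg pos by (simp add: p_def q_def add_pos_nonneg)
  next
    case False
    have "(r / 2)\<^sup>2 < r\<^sup>2" using r by (simp add: power2_eq_square)
    with False show ?thesis using nonneg pos by (simp add: p_def q_def add_nonneg_pos)
  qed
  have Cp: "Ck_on k UNIV p" and Cq: "Ck_on k UNIV q" for k
    unfolding p_def q_def s_def
    by (intro Ck_on_compose[OF open_UNIV _ _ Ck_on_flat_exp] Ck_on_add Ck_on_mult Ck_on_const Ck_on_dist_squared open_UNIV; simp)+
  show ?thesis
  proof (rule that[of "\<lambda>z. p z * inverse (p z + q z)"])
    show "Cinf_on UNIV (\<lambda>z. p z * inverse (p z + q z))"
      unfolding Cinf_on_def using pq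
      by (intro allI Ck_on_mult Ck_on_inverse Ck_on_add Cp Cq open_UNIV) (metis less_irrefl)
    fix z
    show "p z * inverse (p z + q z) = 1" if "dist z a < r / 2"
    proof -
      have "s z \<le> (r / 2)\<^sup>2" unfolding s using that by (intro power_mono) auto
      then have "q z = 0" by (simp add: q_def flat_exp_def)
      with pq[of z] show ?thesis by simp
    qed
    show "p z * inverse (p z + q z) = 0" if "dist z a \<ge> r"
    proof -
      have "r\<^sup>2 \<le> s z" unfolding s using that r by (intro power_mono) auto
      then show ?thesis by (simp add: p_def flat_exp_def)
    qed
  qed
qed

section \<open>Hyperbolic balls\<close>

lemma norm_components_le: "norm (fst v) \<le> norm v" "norm (snd v) \<le> norm v"
  using norm_fst_le[of "fst v" "snd v"] norm_snd_le[of "snd v" "fst v"] by simp_all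

text \<open>\<open>hyp_dist\<close> is the infimum of these L. Estimates are made for single curves,
  and \<open>in_hyp_ball_iff\<close> translates them to balls.\<close>

definition hyp_curve :: "('n::finite) coord \<Rightarrow> 'n coord \<Rightarrow> real \<Rightarrow> bool" where
  "hyp_curve z w L \<longleftrightarrow> (\<exists>\<gamma>. \<gamma> piecewise_C1_differentiable_on {0..1} \<and>
     path_image \<gamma> \<subseteq> {q. snd q > 0} \<and> pathstart \<gamma> = z \<and> pathfinish \<gamma> = w \<and>
     ((\<lambda>t. norm (vector_derivative \<gamma> (at t)) / snd (\<gamma> t)) has_integral L) {0..1})"

lemma hyp_curveE:
  assumes "hyp_curve z w L"
  obtains \<gamma> where "\<gamma> piecewise_C1_differentiable_on {0..1}"
    "path_image \<gamma> \<subseteq> {q. snd q > 0}" "pathstart \<gamma> = z" "pathfinish \<gamma> = w"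
    "((\<lambda>t. norm (vector_derivative \<gamma> (at t)) / snd (\<gamma> t)) has_integral L) {0..1}"
proof -
  from assms[unfolded hyp_curve_def] show ?thesis
    by (elim exE conjE) (rule that, assumption+)
qed

lemma hyp_curve_nonneg: assumes "hyp_curve z w L" shows "L \<ge> 0"
proof -
  obtain \<gamma> where \<gamma>: "\<gamma> piecewise_C1_differentiable_on {0..1}" "path_image \<gamma> \<subseteq> {q. snd q > 0}"
    "pathstart \<gamma> = z" "pathfinish \<gamma> = w" "((\<lambda>t. norm (vector_derivative \<gamma> (at t)) / snd (\<gamma> t)) has_integral L) {0..1}"
    by (rule hyp_curveE[OF assms])
  have "snd (\<gamma> t) > 0" if "t \<in> {0..1}" for t using subsetD[OF \<gamma>(2), of "\<gamma> t"] that by (simp add: path_image_def)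
  then show ?thesis by (intro has_integral_nonneg[OF \<gamma>(5)]) (auto intro!: divide_nonneg_pos)
qed

text \<open>The Euclidean segment stays at height at least c, so its integrand is at most |q - p| /
  c.\<close>

lemma hyp_curve_segment:
  fixes p q :: "('n::finite) coord"
  assumes "c > 0" "snd p \<ge> c" "snd q \<ge> c"
  obtains L where "hyp_curve p q L" "L \<le> norm (q - p) / c"
proof -
  let ?\<gamma> = "linepath p q"
  have snd_ge: "snd (?\<gamma> t) \<ge> c" if "t \<in> {0..1}" for t
  proof -
    have "(1 - t) * c + t * c \<le> (1 - t) * snd p + t * snd q"
      using that assms by (intro add_mono mult_left_mono) auto
    then show ?thesis by (simp add: linepath_def algebra_simps)
  qed
  let ?h = "\<lambda>t. norm (q - p) / snd (?\<gamma> t)"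
  have vd: "norm (vector_derivative ?\<gamma> (at t)) / snd (?\<gamma> t) = ?h t" for t by simp
  have "continuous_on {0..1} ?h"
    using snd_ge assms(1) by (intro continuous_intros) force+
  then have int: "?h integrable_on {0..1}" by (rule integrable_continuous_real)
  have "integral {0..1} ?h \<le> integral {0..1} (\<lambda>t::real. norm (q - p) / c)"
    by (intro integral_le int integrable_const_ivl divide_left_mono snd_ge mult_pos_pos)
      (use snd_ge assms(1) in \<open>auto intro: less_le_trans[OF assms(1)]\<close>)
  then have "integral {0..1} ?h \<le> norm (q - p) / c" by simp
  moreover have "hyp_curve p q (integral {0..1} ?h)"
    unfolding hyp_curve_def
  proof (intro exI[of _ ?\<gamma>] conjI)
    show "?\<gamma> piecewise_C1_differentiable_on {0..1}"
      using valid_path_linepath[of p q] by (simp add: valid_path_def)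
    show "path_image ?\<gamma> \<subseteq> {q. snd q > 0}"
      using snd_ge assms(1) unfolding path_image_def by (force intro: less_le_trans)
    show "((\<lambda>t. norm (vector_derivative ?\<gamma> (at t)) / snd (?\<gamma> t)) has_integral integral {0..1} ?h) {0..1}"
      unfolding vd using int by (rule integrable_integral)
  qed auto
  ultimately show ?thesis using that by blast
qed

text \<open>Substitution for the two halves, c = 0 and c = 1, of a joined curve; S collects the
  parameters at which the curve may fail to be differentiable.\<close>

lemma has_integral_half_interval:
  fixes f :: "real \<Rightarrow> real"
  assumes f: "(f has_integral L) {0..1}" and S: "finite S"
    and eq: "\<And>t. t \<in> {0..1} - S \<Longrightarrow> k ((t + c) / 2) = 2 * f t"
  shows "(k has_integral L) {c / 2..(c + 1) / 2}"
proof -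
  have "((\<lambda>x. f (2 *\<^sub>R x + (- c))) has_integral (L /\<^sub>R 2 ^ DIM(real))) (cbox ((0 - (- c)) /\<^sub>R 2) ((1 - (- c)) /\<^sub>R 2))"
    using has_integral_affinity'[of f L 0 1 2 "- c"] f by simp
  then have "((\<lambda>x. f (2 * x - c)) has_integral (L / 2)) {c / 2..(c + 1) / 2}"
    by (simp add: field_simps)
  from has_integral_mult_right[OF this, of 2]
  have *: "((\<lambda>x. 2 * f (2 * x - c)) has_integral L) {c / 2..(c + 1) / 2}" by simp
  show ?thesis
  proof (rule has_integral_spike_finite[OF _ _ *])
    show "finite ((\<lambda>t. (t + c) / 2) ` S)" using S by simp
    fix x assume x: "x \<in> {c / 2..(c + 1) / 2} - (\<lambda>t. (t + c) / 2) ` S"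
    have "2 * x - c \<notin> S"
    proof
      assume "2 * x - c \<in> S"
      then have "(2 * x - c + c) / 2 \<in> (\<lambda>t. (t + c) / 2) ` S" by blast
      with x show False by simp
    qed
    with x have "2 * x - c \<in> {0..1} - S" by (auto simp: field_simps)
    from eq[OF this] show "k x = 2 * f (2 * x - c)" by simp
  qed
qed

lemma hyp_curve_join:
  assumes "hyp_curve z p L1" "hyp_curve p w L2" shows "hyp_curve z w (L1 + L2)"
proof -
  obtain \<gamma>1 where 1: "\<gamma>1 piecewise_C1_differentiable_on {0..1}"
    "path_image \<gamma>1 \<subseteq> {q. snd q > 0}" "pathstart \<gamma>1 = z" "pathfinish \<gamma>1 = p"
    "((\<lambda>t. norm (vector_derivative \<gamma>1 (at t)) / snd (\<gamma>1 t)) has_integral L1) {0..1}"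
    by (rule hyp_curveE[OF assms(1)])
  obtain \<gamma>2 where 2: "\<gamma>2 piecewise_C1_differentiable_on {0..1}"
    "path_image \<gamma>2 \<subseteq> {q. snd q > 0}" "pathstart \<gamma>2 = p" "pathfinish \<gamma>2 = w"
    "((\<lambda>t. norm (vector_derivative \<gamma>2 (at t)) / snd (\<gamma>2 t)) has_integral L2) {0..1}"
    by (rule hyp_curveE[OF assms(2)])
  let ?\<gamma> = "\<gamma>1 +++ \<gamma>2"
  obtain S1 where S1: "finite S1" "\<And>t. t \<in> {0..1} - S1 \<Longrightarrow> \<gamma>1 differentiable at t"
    using 1(1) by (auto simp: piecewise_C1_differentiable_on_def C1_differentiable_on_eq)
  obtain S2 where S2: "finite S2" "\<And>t. t \<in> {0..1} - S2 \<Longrightarrow> \<gamma>2 differentiable at t"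
    using 2(1) by (auto simp: piecewise_C1_differentiable_on_def C1_differentiable_on_eq)
  have d: "vector_derivative ?\<gamma> (at ((t + c) / 2)) = 2 *\<^sub>R vector_derivative \<gamma>' (at t)"
    if diff: "\<gamma>' differentiable at t" and U: "open U" "(t + c) / 2 \<in> U" "\<And>x. x \<in> U \<Longrightarrow> ?\<gamma> x = \<gamma>' (2 * x - c)" for \<gamma>' t c U
  proof (rule vector_derivative_at)
    have "((\<lambda>x. 2 * x - c) has_vector_derivative 2) (at ((t + c) / 2))"
      by (auto intro!: derivative_eq_intros)
    moreover have "(\<gamma>' has_vector_derivative vector_derivative \<gamma>' (at t)) (at (2 * ((t + c) / 2) - c))"
    proof -
      have "2 * ((t + c) / 2) - c = t" by (simp add: field_simps)
      then show ?thesis using diff by (simp only: vector_derivative_works)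
    qed
    ultimately have "((\<gamma>' \<circ> (\<lambda>x. 2 * x - c)) has_vector_derivative 2 *\<^sub>R vector_derivative \<gamma>' (at t)) (at ((t + c) / 2))"
      by (rule vector_diff_chain_at)
    then show "(?\<gamma> has_vector_derivative 2 *\<^sub>R vector_derivative \<gamma>' (at t)) (at ((t + c) / 2))"
      unfolding has_vector_derivative_def
      by (rule has_derivative_transform_within_open[OF _ U(1,2)]) (simp add: U(3))
  qed
  \<comment> \<open>The end parameter 1 is added to the exceptional set, since the joined curve may
    have a corner there; in \<open>int2\<close> the parameter 0 is added.\<close>
  have int1: "((\<lambda>t. norm (vector_derivative ?\<gamma> (at t)) / snd (?\<gamma> t)) has_integral L1) {0/2..(0 + 1) / 2}"
  proof (rule has_integral_half_interval[OF 1(5), of "insert 1 S1"])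
    fix t :: real assume t: "t \<in> {0..1} - insert 1 S1"
    then have "vector_derivative ?\<gamma> (at ((t + 0) / 2)) = 2 *\<^sub>R vector_derivative \<gamma>1 (at t)"
      using S1 by (intro d[where U="{..<1/2}"]) (auto simp: joinpaths_def)
    with t show "norm (vector_derivative ?\<gamma> (at ((t + 0) / 2))) / snd (?\<gamma> ((t + 0) / 2)) =
      2 * (norm (vector_derivative \<gamma>1 (at t)) / snd (\<gamma>1 t))"
      by (simp add: joinpaths_def)
  qed (use S1 in auto)
  have int2: "((\<lambda>t. norm (vector_derivative ?\<gamma> (at t)) / snd (?\<gamma> t)) has_integral L2) {1/2..(1 + 1) / 2}"
  proof (rule has_integral_half_interval[OF 2(5), of "insert 0 S2"])
    fix t :: real assume t: "t \<in> {0..1} - insert 0 S2"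
    then have "vector_derivative ?\<gamma> (at ((t + 1) / 2)) = 2 *\<^sub>R vector_derivative \<gamma>2 (at t)"
      using S2 by (intro d[where U="{1/2<..}"]) (auto simp: joinpaths_def)
    with t show "norm (vector_derivative ?\<gamma> (at ((t + 1) / 2))) / snd (?\<gamma> ((t + 1) / 2)) =
      2 * (norm (vector_derivative \<gamma>2 (at t)) / snd (\<gamma>2 t))"
      by (auto simp: joinpaths_def field_simps)
  qed (use S2 in auto)
  show ?thesis
    unfolding hyp_curve_def
  proof (intro exI[of _ ?\<gamma>] conjI)
    show "?\<gamma> piecewise_C1_differentiable_on {0..1}"
      using valid_path_join[of \<gamma>1 \<gamma>2] 1 2 by (simp add: valid_path_def)
    show "path_image ?\<gamma> \<subseteq> {q. snd q > 0}" using path_image_join_subset[of \<gamma>1 \<gamma>2] 1 2 by blast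
    show "((\<lambda>t. norm (vector_derivative ?\<gamma> (at t)) / snd (?\<gamma> t)) has_integral L1 + L2) {0..1}"
      using int1 int2 by (intro has_integral_combine[of 0 "1/2" 1]) auto
  qed (use 1 2 in auto)
qed

text \<open>Hyperbolic length dominates the variation of ln y, which bounds the height by y0 e^L.
  The Euclidean speed is height times hyperbolic speed, and integrating gives the second
  bound.\<close>

lemma hyp_curve_bounds:
  fixes z w :: "('n::finite) coord"
  assumes "hyp_curve z w L"
  shows "\<bar>ln (snd w) - ln (snd z)\<bar> \<le> L" "norm (w - z) \<le> snd z * exp L * L"
proof -
  obtain \<gamma> where \<gamma>: "\<gamma> piecewise_C1_differentiable_on {0..1}"
    "path_image \<gamma> \<subseteq> {q. snd q > 0}" "pathstart \<gamma> = z" "pathfinish \<gamma> = w"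
    "((\<lambda>t. norm (vector_derivative \<gamma> (at t)) / snd (\<gamma> t)) has_integral L) {0..1}"
    by (rule hyp_curveE[OF assms])
  define h where "h = (\<lambda>t. norm (vector_derivative \<gamma> (at t)) / snd (\<gamma> t))"
  have pos: "snd (\<gamma> t) > 0" if "t \<in> {0..1}" for t using subsetD[OF \<gamma>(2), of "\<gamma> t"] that by (simp add: path_image_def)
  obtain S where S: "finite S" "\<And>t. t \<in> {0..1} - S \<Longrightarrow> \<gamma> differentiable at t"
    using \<gamma>(1) by (auto simp: piecewise_C1_differentiable_on_def C1_differentiable_on_eq)
  have cont: "continuous_on {0..1} \<gamma>" using \<gamma>(1) by (simp add: piecewise_C1_differentiable_on_def)
  have h: "(h has_integral L) {0..1}" using \<gamma>(5) by (simp add: h_def)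
  have h0: "h t \<ge> 0" if "t \<in> {0..1}" for t using pos[OF that] by (simp add: h_def)
  have ends: "\<gamma> 0 = z" "\<gamma> 1 = w" using \<gamma> by (auto simp: pathstart_def pathfinish_def)
  have ln_bound: "\<bar>ln (snd (\<gamma> t)) - ln (snd z)\<bar> \<le> L" if t: "t \<in> {0..1}" for t
  proof -
    define f where "f = (\<lambda>s. snd (vector_derivative \<gamma> (at s)) / snd (\<gamma> s))"
    have f: "(f has_integral (ln (snd (\<gamma> t)) - ln (snd (\<gamma> 0)))) {0..t}"
    proof (rule fundamental_theorem_of_calculus_strong[OF S(1), where f="\<lambda>s. ln (snd (\<gamma> s))"])
      show "0 \<le> t" using t by simp
      show "continuous_on {0..t} (\<lambda>s. ln (snd (\<gamma> s)))"
        using t pos by (intro continuous_intros continuous_on_subset[OF cont]) force+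
      fix s assume s: "s \<in> {0..t} - S"
      then have "\<gamma> differentiable at s" using S t by auto
      then have "(\<gamma> has_derivative (\<lambda>x. x *\<^sub>R vector_derivative \<gamma> (at s))) (at s)"
        by (simp add: vector_derivative_works has_vector_derivative_def)
      from has_derivative_snd[OF this]
      have "((\<lambda>x. snd (\<gamma> x)) has_real_derivative snd (vector_derivative \<gamma> (at s))) (at s)"
        unfolding has_field_derivative_def by (rule has_derivative_eq_rhs) (simp add: fun_eq_iff)
      moreover have "snd (\<gamma> s) > 0" using pos s t by auto
      ultimately have "((\<lambda>x. ln (snd (\<gamma> x))) has_real_derivative f s) (at s)"
        using DERIV_chain2[OF DERIV_ln_divide, of "\<lambda>x. snd (\<gamma> x)" s] by (simp add: f_def)
      then show "((\<lambda>s. ln (snd (\<gamma> s))) has_vector_derivative f s) (at s)"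
        by (simp add: has_real_derivative_iff_has_vector_derivative)
    qed
    have hi: "h integrable_on {0..t}"
      by (rule integrable_on_subinterval[OF has_integral_integrable[OF h]]) (use t in auto)
    have "norm (integral {0..t} f) \<le> integral {0..t} h"
    proof (rule integral_norm_bound_integral[OF _ hi])
      show "f integrable_on {0..t}" using f by blast
      fix s assume "s \<in> {0..t}"
      then have "snd (\<gamma> s) > 0" using pos t by auto
      then show "norm (f s) \<le> h s"
        using norm_components_le(2)[of "vector_derivative \<gamma> (at s)"]
        by (simp add: f_def h_def divide_right_mono)
    qed
    also have "\<dots> \<le> integral {0..1} h" using h0 h hi t by (intro integral_subset_le) auto
    finally show ?thesis using integral_unique[OF f] integral_unique[OF h] ends by simp
  qed
  from ln_bound[of 1] show "\<bar>ln (snd w) - ln (snd z)\<bar> \<le> L" by (simp add: ends)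
  define C where "C = snd z * exp L"
  have zpos: "snd z > 0" using pos[of 0] ends by simp
  have bound: "snd (\<gamma> t) \<le> C" if t: "t \<in> {0..1}" for t
  proof -
    have "ln (snd (\<gamma> t)) \<le> ln C" using ln_bound[OF t] zpos by (simp add: C_def ln_mult)
    moreover have "C > 0" using zpos by (simp add: C_def)
    ultimately show ?thesis using pos[OF t] by (simp add: ln_le_cancel_iff)
  qed
  have "((\<lambda>t. vector_derivative \<gamma> (at t)) has_integral (\<gamma> 1 - \<gamma> 0)) {0..1}"
    using S by (intro fundamental_theorem_of_calculus_strong[OF S(1)] cont) (auto simp: vector_derivative_works[symmetric])
  then have i: "((\<lambda>t. vector_derivative \<gamma> (at t)) has_integral (w - z)) {0..1}" by (simp add: ends)
  have "norm (integral {0..1} (\<lambda>t. vector_derivative \<gamma> (at t))) \<le> integral {0..1} (\<lambda>t. C * h t)"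
  proof (rule integral_norm_bound_integral)
    show "(\<lambda>t. vector_derivative \<gamma> (at t)) integrable_on {0..1}" using i by blast
    show "(\<lambda>t. C * h t) integrable_on {0..1}" using has_integral_mult_right[OF h] by blast
    fix t :: real assume t: "t \<in> {0..1}"
    have "norm (vector_derivative \<gamma> (at t)) = snd (\<gamma> t) * h t" using pos[OF t] by (simp add: h_def)
    also have "\<dots> \<le> C * h t" using bound[OF t] h0[OF t] by (rule mult_right_mono)
    finally show "norm (vector_derivative \<gamma> (at t)) \<le> C * h t" .
  qed
  also have "\<dots> = C * L" using integral_unique[OF has_integral_mult_right[OF h, of C]] .
  finally show "norm (w - z) \<le> snd z * exp L * L" using integral_unique[OF i] by (simp add: C_def)
qed

text \<open>An infimum of a nonempty set bounded below is less than r exactly if some element is;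
  the straight segment shows that the set of lengths is nonempty.\<close>

lemma in_hyp_ball_iff: "q \<in> hyp_ball r \<longleftrightarrow> snd q > 0 \<and> (\<exists>L<r. hyp_curve (0, 1) q L)"
proof -
  have "hyp_dist (0, 1) q < r \<longleftrightarrow> (\<exists>L<r. hyp_curve (0, 1) q L)" if "snd q > 0"
  proof -
    obtain L where L: "hyp_curve (0, 1) q L"
      by (rule hyp_curve_segment[of "min 1 (snd q)" "(0, 1)" q]) (use \<open>snd q > 0\<close> in auto)
    have eq: "hyp_dist (0, 1) q = Inf {L. hyp_curve (0, 1) q L}"
      by (simp add: hyp_dist_def hyp_curve_def)
    have bdd: "bdd_below {L. hyp_curve (0, 1) q L}" by (intro bdd_belowI[of _ 0]) (simp add: hyp_curve_nonneg)
    show ?thesis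
      unfolding eq using cInf_less_iff[OF _ bdd, of r] L by auto
  qed
  then show ?thesis by (auto simp: hyp_ball_def)
qed

lemma hyp_ball_pos: "q \<in> hyp_ball r \<Longrightarrow> snd q > 0"
  by (simp add: hyp_ball_def)

lemma hyp_ball_extend:
  assumes q: "q \<in> hyp_ball r" and c: "c > 0" "snd q \<ge> c" "snd q' \<ge> c" and "norm (q' - q) / c \<le> s"
  shows "q' \<in> hyp_ball (r + s)"
proof -
  obtain L where L: "L < r" "hyp_curve (0, 1) q L" using q by (auto simp: in_hyp_ball_iff)
  obtain L' where L': "hyp_curve q q' L'" "L' \<le> norm (q' - q) / c"
    using hyp_curve_segment[OF c] .
  have "hyp_curve (0, 1) q' (L + L')" using hyp_curve_join[OF L(2) L'(1)] .
  moreover have "L + L' < r + s" using L L' assms(5) by linarith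
  ultimately show ?thesis using c by (auto simp: in_hyp_ball_iff)
qed

lemma open_hyp_ball: "open (hyp_ball r)"
  unfolding open_dist
proof
  fix q :: "'a coord" assume q: "q \<in> hyp_ball r"
  obtain L where L: "L < r" "hyp_curve (0, 1) q L" using q by (auto simp: in_hyp_ball_iff)
  define c where "c = snd q / 2"
  have c: "c > 0" using hyp_ball_pos[OF q] by (simp add: c_def)
  define r' where "r' = (L + r) / 2"
  have qr: "q \<in> hyp_ball r'" using L hyp_ball_pos[OF q] by (auto simp: in_hyp_ball_iff r'_def intro!: exI[of _ L])
  \<comment> \<open>With e <= c, y stays above height c, half that of q; with e <= c (r - r') the
    segment from q to y is no longer than the slack r - r'.\<close>
  define e where "e = min c (c * (r - r'))"
  have "e > 0" using c L by (simp add: e_def r'_def)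
  moreover have "y \<in> hyp_ball r" if "dist y q < e" for y
  proof -
    have n: "norm (y - q) < e" using that by (simp add: dist_norm)
    have "\<bar>snd y - snd q\<bar> \<le> norm (y - q)" using norm_components_le(2)[of "y - q"] by simp
    then have "snd q - snd y \<le> norm (y - q)" by linarith
    with n have "snd y \<ge> c" by (simp add: e_def c_def)
    moreover have "norm (y - q) / c \<le> r - r'" using n c by (simp add: e_def pos_divide_le_eq mult.commute)
    ultimately have "y \<in> hyp_ball (r' + (r - r'))"
      using c by (intro hyp_ball_extend[OF qr c]) (auto simp: c_def)
    then show ?thesis by simp
  qed
  ultimately show "\<exists>e>0. \<forall>y. dist y q < e \<longrightarrow> y \<in> hyp_ball r" by blast
qed

text \<open>\<open>hyp_curve_bounds\<close> from (0, 1) with L < 1. These bounds make \<rho> at the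
  center of a Moebius parametrization comparable to \<rho> on the image of the inner ball.\<close>

lemma hyp_ball_1_bounds:
  fixes q :: "('n::finite) coord"
  assumes "q \<in> hyp_ball 1"
  shows "exp (-1) \<le> snd q" "snd q \<le> exp 1" "norm (fst q) \<le> exp 1" "norm q \<le> exp 1 + 1"
proof -
  obtain L where L: "L < 1" "hyp_curve (0, 1) q L" and pos: "snd q > 0"
    using assms by (auto simp: in_hyp_ball_iff)
  have L0: "L \<ge> 0" using L hyp_curve_nonneg by blast
  have ln: "\<bar>ln (snd q)\<bar> \<le> L" using hyp_curve_bounds(1)[OF L(2)] by simp
  then have "ln (exp (-1)) \<le> ln (snd q)" "ln (snd q) \<le> ln (exp 1)" using L by auto
  then show "exp (-1) \<le> snd q" "snd q \<le> exp 1" using pos by (simp_all only: ln_le_cancel_iff exp_gt_zero)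
  have "norm (q - (0, 1)) \<le> exp L * L" using hyp_curve_bounds(2)[OF L(2)] by simp
  also have "\<dots> \<le> exp 1 * 1" using L L0 by (intro mult_mono) auto
  finally have n: "norm (q - (0, 1)) \<le> exp 1" by simp
  then show "norm (fst q) \<le> exp 1" using norm_components_le(1)[of "q - (0, 1)"] by simp
  have "norm q \<le> norm (q - (0, 1)) + norm (0 :: real^'n, 1 :: real)" by (metis diff_add_cancel norm_triangle_ineq)
  then show "norm q \<le> exp 1 + 1" using n by (simp add: norm_Pair)
qed

text \<open>The inner ball lies above height e^(-1), hence so does its closure; a point of the
  closure is joined to a point of the ball at Euclidean distance below e^(-1) by a segment of
  hyperbolic length at most 1.\<close>

lemma closure_hyp_ball_1: "closure (hyp_ball 1) \<subseteq> (hyp_ball 2 :: ('n::finite) coord set)" "compact (closure (hyp_ball 1 :: 'n coord set))"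
proof -
  show "compact (closure (hyp_ball 1 :: 'n coord set))"
    unfolding compact_closure bounded_iff using hyp_ball_1_bounds(4) by blast
  show "closure (hyp_ball 1) \<subseteq> (hyp_ball 2 :: 'n coord set)"
  proof
    fix q :: "'n coord" assume q: "q \<in> closure (hyp_ball 1)"
    have "closed {q :: 'n coord. exp (-1) \<le> snd q}" by (intro closed_Collect_le continuous_intros)
    then have "closure (hyp_ball 1) \<subseteq> {q :: 'n coord. exp (-1) \<le> snd q}"
      using hyp_ball_1_bounds(1) by (intro closure_minimal) auto
    with q have sq: "exp (-1) \<le> snd q" by auto
    obtain q' where q': "q' \<in> hyp_ball 1" "dist q' q < exp (-1)"
      using q by (meson closure_approachable exp_gt_zero)
    have "q \<in> hyp_ball (1 + 1)"
      using q' sq hyp_ball_1_bounds(1)[OF q'(1)]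
      by (intro hyp_ball_extend[OF q'(1), of "exp (-1)"]) (auto simp: dist_norm norm_minus_commute pos_divide_le_eq)
    then show "q \<in> hyp_ball 2" by simp
  qed
qed

section \<open>Locality of the coordinate formulas, and criteria for metric fields\<close>

lemma frechet_derivative_cong_open:
  assumes "open S" "x \<in> S" "\<And>y. y \<in> S \<Longrightarrow> f y = g y"
  shows "frechet_derivative f (at x) = frechet_derivative g (at x)"
proof -
  have "(f has_derivative f') (at x) \<longleftrightarrow> (g has_derivative f') (at x)" for f'
    using has_derivative_transform_within_open[of f f' x UNIV S g] has_derivative_transform_within_open[of g f' x UNIV S f] assms
    by auto
  then show ?thesis by (simp add: frechet_derivative_def)
qed

lemma dform_cong:
  assumes "open S" "\<And>y. y \<in> S \<Longrightarrow> G y = G' y" "x \<in> S"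
  shows "dform G x = dform G' x"
proof (intro ext)
  fix a v w
  have "frechet_derivative (\<lambda>y. G y v w) (at x) = frechet_derivative (\<lambda>y. G' y v w) (at x)"
    by (rule frechet_derivative_cong_open[OF assms(1,3)]) (simp add: assms(2))
  then show "dform G x a v w = dform G' x a v w" by (simp add: dform_def)
qed

lemma chris_cong:
  assumes "open S" "\<And>y. y \<in> S \<Longrightarrow> G y = G' y" "x \<in> S"
  shows "chris G x = chris G' x"
  using dform_cong[OF assms] assms(2)[OF assms(3)] by (simp add: chris_def[abs_def] koszul_def[abs_def])

lemma rie_cong:
  assumes "open S" "\<And>y. y \<in> S \<Longrightarrow> G y = G' y" "x \<in> S"
  shows "rie G x = rie G' x"
proof (intro ext)
  fix u v w
  have "frechet_derivative (\<lambda>y. chris G y v w) (at x) = frechet_derivative (\<lambda>y. chris G' y v w) (at x)" for v w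
    by (rule frechet_derivative_cong_open[OF assms(1,3)]) (simp add: chris_cong[OF assms(1,2)])
  then show "rie G x u v w = rie G' x u v w" by (simp add: rie_def chris_cong[OF assms])
qed

text \<open>With finitely many basis components to check, one neighborhood can serve for all of
  them.\<close>

lemma metric_fieldI_basis:
  fixes G :: "'e::euclidean_space \<Rightarrow> 'e \<Rightarrow> 'e \<Rightarrow> real"
  assumes S: "open S" and form: "\<And>x. x \<in> S \<Longrightarrow> inner_form (G x)"
    and diff1: "\<And>x v w. x \<in> S \<Longrightarrow> v \<in> Basis \<Longrightarrow> w \<in> Basis \<Longrightarrow> (\<lambda>y. G y v w) differentiable (at x)"
    and diff2: "\<And>x a v w. x \<in> S \<Longrightarrow> a \<in> Basis \<Longrightarrow> v \<in> Basis \<Longrightarrow> w \<in> Basis \<Longrightarrow> (\<lambda>y. dform G y a v w) differentiable (at x)"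
  shows "metric_field G S"
proof
  show "open S" by (rule S)
  fix x assume x: "x \<in> S"
  then show "inner_form (G x)" by (rule form)
  have d1: "((\<lambda>y. G y v w) has_derivative
      (\<lambda>a. \<Sum>i\<in>Basis. \<Sum>j\<in>Basis. ((v \<bullet> i) * (w \<bullet> j)) *\<^sub>R dform G x a i j)) (at x)" if x: "x \<in> S" for x v w
  proof (rule has_derivative_transform_within_open[OF _ S x])
    have "((\<lambda>y. G y i j) has_derivative (\<lambda>a. dform G x a i j)) (at x)" if "i \<in> Basis" "j \<in> Basis" for i j
      using diff1[OF x that] unfolding dform_def frechet_derivative_works by (simp add: eta_contract_eq)
    then show "((\<lambda>y. \<Sum>i\<in>Basis. \<Sum>j\<in>Basis. ((v \<bullet> i) * (w \<bullet> j)) *\<^sub>R G y i j) has_derivative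
      (\<lambda>a. \<Sum>i\<in>Basis. \<Sum>j\<in>Basis. ((v \<bullet> i) * (w \<bullet> j)) *\<^sub>R dform G x a i j)) (at x)"
      by (intro has_derivative_sum has_derivative_scaleR_right)
    fix y assume "y \<in> S"
    then show "(\<Sum>i\<in>Basis. \<Sum>j\<in>Basis. ((v \<bullet> i) * (w \<bullet> j)) *\<^sub>R G y i j) = G y v w"
      by (rule bilinear_expand[OF inner_form_bilinear[OF form], symmetric])
  qed
  then show "(\<lambda>y. G y v w) differentiable (at x)" for v w using x differentiableI by blast
  have d2: "dform G y a v w = (\<Sum>k\<in>Basis. (a \<bullet> k) *\<^sub>R (\<Sum>i\<in>Basis. \<Sum>j\<in>Basis. ((v \<bullet> i) * (w \<bullet> j)) *\<^sub>R dform G y k i j))"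
    if y: "y \<in> S" for y a v w
  proof -
    have eq: "dform G y a v w = (\<Sum>i\<in>Basis. \<Sum>j\<in>Basis. ((v \<bullet> i) * (w \<bullet> j)) *\<^sub>R dform G y a i j)" for a v w
      unfolding dform_def[of G y a v w] by (rule fun_cong[OF frechet_derivative_at[OF d1[OF y]], symmetric])
    have "linear (\<lambda>a. dform G y a v w)"
      using has_derivative_linear[OF d1[OF y, of v w]] by (simp only: eq[symmetric])
    from linear_expand[OF this, of a] show ?thesis by (simp only: eq[symmetric])
  qed
  show "(\<lambda>y. dform G y a v w) differentiable (at x)" for a v w
  proof -
    have "(\<lambda>y. \<Sum>k\<in>Basis. (a \<bullet> k) *\<^sub>R (\<Sum>i\<in>Basis. \<Sum>j\<in>Basis. ((v \<bullet> i) * (w \<bullet> j)) *\<^sub>R dform G y k i j)) differentiable (at x)"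
      by (intro differentiable_sum differentiable_scaleR differentiable_const finite_Basis diff2 x ballI)
    then obtain D where "((\<lambda>y. \<Sum>k\<in>Basis. (a \<bullet> k) *\<^sub>R (\<Sum>i\<in>Basis. \<Sum>j\<in>Basis. ((v \<bullet> i) * (w \<bullet> j)) *\<^sub>R dform G y k i j)) has_derivative D) (at x)"
      by (auto simp: differentiable_def)
    then have "((\<lambda>y. dform G y a v w) has_derivative D) (at x)"
      by (rule has_derivative_transform_within_open[OF _ S x]) (rule d2[symmetric])
    then show ?thesis by (rule differentiableI)
  qed
qed

text \<open>G1 inherits positivity and twice differentiability through the pullback formula, so
  regularity has to be established in one chart only.\<close>

lemma metric_transformI:
  fixes G1 G2 :: "'e::euclidean_space \<Rightarrow> 'e \<Rightarrow> 'e \<Rightarrow> real"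
  assumes G2: "metric_field G2 S2" and S1: "open S1"
    and F_in: "\<And>x. x \<in> S1 \<Longrightarrow> F x \<in> S2"
    and F1: "\<And>x. x \<in> S1 \<Longrightarrow> (F has_derivative F1 x) (at x)"
    and F2: "\<And>x v. x \<in> S1 \<Longrightarrow> ((\<lambda>x. F1 x v) has_derivative (\<lambda>a. F2 x a v)) (at x)"
    and F3: "\<And>x a v. x \<in> S1 \<Longrightarrow> ((\<lambda>x. F2 x a v) has_derivative (\<lambda>b. F3 x b a v)) (at x)"
    and F3_cont: "\<And>x b a v. x \<in> S1 \<Longrightarrow> isCont (\<lambda>x. F3 x b a v) x"
    and surj: "\<And>x. x \<in> S1 \<Longrightarrow> surj (F1 x)"
    and pull: "\<And>x v w. x \<in> S1 \<Longrightarrow> G1 x v w = G2 (F x) (F1 x v) (F1 x w)"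
  shows "metric_transform G1 S1 G2 S2 F F1 F2 F3"
proof -
  interpret E: metric_field G2 S2 by (rule G2)
  have lin: "linear (F1 x)" if "x \<in> S1" for x using F1[OF that] has_derivative_linear by blast
  have comp: "((\<lambda>y. G2 (F y) v w) has_derivative (\<lambda>a. dform G2 (F x) (F1 x a) v w)) (at x)" if "x \<in> S1" for x v w
    using has_derivative_compose[OF F1[OF that] E.has_derivative_form[OF F_in[OF that]]] .
  have comp2: "((\<lambda>y. dform G2 (F y) a v w) has_derivative (\<lambda>b. d2form G2 (F x) (F1 x b) a v w)) (at x)" if "x \<in> S1" for x a v w
    using has_derivative_compose[OF F1[OF that] E.has_derivative_dform[OF F_in[OF that]]] .
  have d1: "((\<lambda>y. G1 y v w) has_derivative
     (\<lambda>a. dform G2 (F x) (F1 x a) (F1 x v) (F1 x w) + G2 (F x) (F2 x a v) (F1 x w) + G2 (F x) (F1 x v) (F2 x a w))) (at x)"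
    if x: "x \<in> S1" for x v w
  proof (rule has_derivative_transform_within_open[OF _ S1 x])
    show "((\<lambda>y. G2 (F y) (F1 y v) (F1 y w)) has_derivative
     (\<lambda>a. dform G2 (F x) (F1 x a) (F1 x v) (F1 x w) + G2 (F x) (F2 x a v) (F1 x w) + G2 (F x) (F1 x v) (F2 x a w))) (at x)"
      by (rule has_derivative_bilinear_forms[where B="\<lambda>y. G2 (F y)", OF S1 x E.bilinear_G[OF F_in] comp[OF x] F2[OF x] F2[OF x]])
  qed (simp add: pull)
  have df: "dform G1 x a v w = dform G2 (F x) (F1 x a) (F1 x v) (F1 x w) + G2 (F x) (F2 x a v) (F1 x w) + G2 (F x) (F1 x v) (F2 x a w)"
    if "x \<in> S1" for x a v w
    unfolding dform_def[of G1] by (rule fun_cong[OF frechet_derivative_at[OF d1[OF that]], symmetric])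
  interpret D: metric_field G1 S1
  proof
    show "open S1" by (rule S1)
    fix x assume x: "x \<in> S1"
    have inj: "inj (F1 x)" by (rule linear_surjective_imp_injective[OF lin[OF x] surj[OF x]]) simp
    have eq: "G1 x = (\<lambda>v w. G2 (F x) (F1 x v) (F1 x w))" by (intro ext) (rule pull[OF x])
    show "inner_form (G1 x)"
      unfolding inner_form_def sym_pos_def_def
    proof (intro conjI allI impI)
      show "bilinear (G1 x)" unfolding eq by (rule bilinear_comp_linear[OF E.bilinear_G[OF F_in[OF x]] lin[OF x] lin[OF x]])
      show "G1 x v w = G1 x w v" for v w unfolding eq using inner_form_sym[OF E.form[OF F_in[OF x]]] .
      fix v :: 'e assume "v \<noteq> 0"
      then have "F1 x v \<noteq> 0" using inj linear_injective_0[OF lin[OF x]] \<open>v \<noteq> 0\<close> by blast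
      then show "0 < G1 x v v" unfolding eq by (rule inner_form_pos[OF E.form[OF F_in[OF x]]])
    qed
    show "(\<lambda>y. G1 y v w) differentiable at x" for v w using d1[OF x] differentiableI by blast
    show "(\<lambda>y. dform G1 y a v w) differentiable at x" for a v w
    proof -
      have 1: "((\<lambda>y. dform G2 (F y) a' (F1 y v) (F1 y w)) has_derivative
          (\<lambda>b. d2form G2 (F x) (F1 x b) a' (F1 x v) (F1 x w) + dform G2 (F x) a' (F2 x b v) (F1 x w)
            + dform G2 (F x) a' (F1 x v) (F2 x b w))) (at x)" for a'
        by (rule has_derivative_bilinear_forms[where B="\<lambda>y. dform G2 (F y) a'", OF S1 x E.bilinear_dform[OF F_in] comp2[OF x] F2[OF x] F2[OF x]])
      have 2: "\<exists>D. ((\<lambda>y. dform G2 (F y) (F1 y a) (F1 y v) (F1 y w)) has_derivative D) (at x)"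
        using has_derivative_linear_forms[where B="\<lambda>y a'. dform G2 (F y) a' (F1 y v) (F1 y w)", OF S1 x E.linear_dform(1)[OF F_in] 1 F2[OF x]]
        by blast
      have 3: "\<exists>D. ((\<lambda>y. G2 (F y) (F2 y a v) (F1 y w)) has_derivative D) (at x)" for v w
        using has_derivative_bilinear_forms[where B="\<lambda>y. G2 (F y)", OF S1 x E.bilinear_G[OF F_in] comp[OF x] F3[OF x] F2[OF x]] by blast
      have 4: "\<exists>D. ((\<lambda>y. G2 (F y) (F1 y v) (F2 y a w)) has_derivative D) (at x)" for v w
        using has_derivative_bilinear_forms[where B="\<lambda>y. G2 (F y)", OF S1 x E.bilinear_G[OF F_in] comp[OF x] F2[OF x] F3[OF x]] by blast
      from 2 3[of v w] 4[of v w] obtain D2 D3 D4 where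
        "((\<lambda>y. dform G2 (F y) (F1 y a) (F1 y v) (F1 y w)) has_derivative D2) (at x)"
        "((\<lambda>y. G2 (F y) (F2 y a v) (F1 y w)) has_derivative D3) (at x)"
        "((\<lambda>y. G2 (F y) (F1 y v) (F2 y a w)) has_derivative D4) (at x)" by blast
      from has_derivative_add[OF has_derivative_add[OF this(1,2)] this(3)]
      have "((\<lambda>y. dform G1 y a v w) has_derivative (\<lambda>b. D2 b + D3 b + D4 b)) (at x)"
        by (rule has_derivative_transform_within_open[OF _ S1 x]) (simp add: df)
      then show ?thesis by (rule differentiableI)
    qed
  qed
  show ?thesis
    by unfold_locales (rule F_in F1 F2 F3 F3_cont surj pull; assumption)+
qed

section \<open>Charts and the boundary filter\<close>

text \<open>Derivatives within the half-space are unique even at boundary points, because every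
  standard basis vector has a nonnegative last component and small positive steps along it stay
  inside.\<close>

lemma half_space_derivative_unique:
  fixes f :: "('n::finite) coord \<Rightarrow> 'f::real_normed_vector"
  assumes "(f has_derivative f') (at z within half_space)" "(f has_derivative f'') (at z within half_space)"
    and z: "z \<in> half_space"
  shows "f' = f''"
proof (rule frechet_derivative_unique_within[OF assms(1,2)])
  fix i :: "'n coord" and e :: real assume "i \<in> Basis" "e > 0"
  moreover from this(1) have "snd i \<ge> 0" by (auto simp: Basis_prod_def)
  ultimately show "\<exists>d. 0 < \<bar>d\<bar> \<and> \<bar>d\<bar> < e \<and> z + d *\<^sub>R i \<in> half_space"
    using z by (intro exI[of _ "e / 2"]) (auto simp: half_space_def)
qed

text \<open>Connects the derivatives in \<open>dtrans\<close> and \<open>differential\<close> with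
  ordinary derivatives of local smooth extensions, for which the calculus above is
  available.\<close>

lemma half_space_derivativeI:
  fixes f :: "('n::finite) coord \<Rightarrow> 'f::real_normed_vector"
  assumes F: "(F has_derivative D) (at z)" and W: "open W" "z \<in> W" and z: "z \<in> half_space"
    and eq: "\<forall>y\<in>W \<inter> half_space. F y = f y"
  shows "(f has_derivative D) (at z within half_space)" "frechet_derivative f (at z within half_space) = D"
proof -
  obtain r where r: "r > 0" "ball z r \<subseteq> W" using W open_contains_ball by blast
  show D: "(f has_derivative D) (at z within half_space)"
    by (rule has_derivative_transform_within[OF has_derivative_at_withinI[OF F] r(1) z])
      (use r eq in \<open>auto simp: dist_commute\<close>)
  then have "(f has_derivative frechet_derivative f (at z within half_space)) (at z within half_space)"
    using differentiableI frechet_derivative_works by blast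
  from half_space_derivative_unique[OF this D z]
  show "frechet_derivative f (at z within half_space) = D" .
qed

lemma smooth_onD:
  assumes "smooth_on S f" "x \<in> S"
  obtains W F where "open W" "x \<in> W" "Cinf_on W F" "\<forall>y\<in>S \<inter> W. F y = f y"
proof -
  from bspec[OF assms(1)[unfolded smooth_on_def] assms(2)] obtain W F
    where *: "open W \<and> x \<in> W \<and> (\<forall>k. Ck_on k W F) \<and> (\<forall>y\<in>S \<inter> W. F y = f y)" by (elim exE)
  show ?thesis by (rule that[of W F]) (use * in \<open>auto simp: Cinf_on_def\<close>)
qed

lemma smooth_onI:
  assumes "\<And>x. x \<in> S \<Longrightarrow> \<exists>W F. open W \<and> x \<in> W \<and> Cinf_on W F \<and> (\<forall>y. y \<in> S \<longrightarrow> y \<in> W \<longrightarrow> F y = f y)"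
  shows "smooth_on S f"
  unfolding smooth_on_def
proof
  fix x assume "x \<in> S"
  from assms[OF this] obtain W F where *: "open W \<and> x \<in> W \<and> Cinf_on W F \<and> (\<forall>y. y \<in> S \<longrightarrow> y \<in> W \<longrightarrow> F y = f y)"
    by (elim exE)
  then have "open W \<and> x \<in> W \<and> (\<forall>k. Ck_on k W F) \<and> (\<forall>y\<in>S \<inter> W. F y = f y)"
    by (auto simp: Cinf_on_def)
  then show "\<exists>W F. open W \<and> x \<in> W \<and> (\<forall>k. Ck_on k W F) \<and> (\<forall>y\<in>S \<inter> W. F y = f y)" by (intro exI)
qed

lemma smooth_on_continuous:
  assumes "smooth_on S f" shows "continuous_on S f"
  unfolding continuous_on_eq_continuous_within
proof
  fix x assume x: "x \<in> S"
  obtain W F where W: "open W" "x \<in> W" "Cinf_on W F" "\<forall>y\<in>S \<inter> W. F y = f y"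
    using smooth_onD[OF assms x] .
  have "(F \<longlongrightarrow> F x) (at x within S)"
    using Cinf_on_continuous[OF W(3)] W(1,2)
    by (meson continuous_on_eq_continuous_at continuous_within isCont_def tendsto_within_subset subset_UNIV)
  moreover have "\<forall>\<^sub>F y in at x within S. F y = f y"
    unfolding eventually_at_topological using W by blast
  ultimately have "(f \<longlongrightarrow> F x) (at x within S)" by (rule Lim_transform_eventually)
  then show "continuous (at x within S) f" using W(4) x W(2) by (simp add: continuous_within)
qed

section \<open>Transition maps and the filter at a boundary point\<close>

locale compact_mfd =
  fixes Mbar :: "'a::t2_space set" and A :: "('a, 'n::finite) chart set"
  assumes compact_manifold: "compact_manifold Mbar A"
begin

lemma is_chart: "c \<in> A \<Longrightarrow> is_chart Mbar c"
  and union_charts: "(\<Union>c\<in>A. fst c) = Mbar"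
  and compatible: "c \<in> A \<Longrightarrow> d \<in> A \<Longrightarrow> compatible c d"
  and compact_Mbar: "compact Mbar"
  using compact_manifold by (auto simp: compact_manifold_def smooth_structure_def)

lemma chart_openin: "c \<in> A \<Longrightarrow> openin (top_of_set Mbar) (fst c)"
  and image_openin: "c \<in> A \<Longrightarrow> openin (top_of_set half_space) (snd c ` fst c)"
  and chart_homeo: "c \<in> A \<Longrightarrow> homeomorphism (fst c) (snd c ` fst c) (snd c) (chart_inv c)"
  using is_chart by (auto simp: is_chart_def)

lemma fst_subset: "c \<in> A \<Longrightarrow> fst c \<subseteq> Mbar"
  using chart_openin openin_imp_subset by blast

lemma chart_inv_left: "c \<in> A \<Longrightarrow> p \<in> fst c \<Longrightarrow> chart_inv c (snd c p) = p"
  using chart_homeo by (auto simp: homeomorphism_def)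

lemma chart_half: "c \<in> A \<Longrightarrow> p \<in> fst c \<Longrightarrow> snd c p \<in> half_space"
  using image_openin openin_imp_subset by blast

lemma chart_inv_in: "c \<in> A \<Longrightarrow> x \<in> snd c ` fst c \<Longrightarrow> chart_inv c x \<in> fst c"
  and chart_inv_right: "c \<in> A \<Longrightarrow> x \<in> snd c ` fst c \<Longrightarrow> snd c (chart_inv c x) = x"
  by (auto simp: chart_inv_left)

lemma mint_eq: "mint A = Mbar - mbdry A"
  by (simp add: mint_def union_charts)

lemma mbdry_subset: "mbdry A \<subseteq> Mbar"
  using union_charts by (auto simp: mbdry_def)

lemma mint_pos: "c \<in> A \<Longrightarrow> q \<in> fst c \<Longrightarrow> q \<in> mint A \<Longrightarrow> snd (snd c q) > 0"
  using chart_half[of c q] by (auto simp: mint_def mbdry_def half_space_def less_le)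

lemma chart_at: assumes "q \<in> Mbar" shows "chart_at A q \<in> A" "q \<in> fst (chart_at A q)"
proof -
  have "\<exists>c. c \<in> A \<and> q \<in> fst c" using assms union_charts by auto
  then have "chart_at A q \<in> A \<and> q \<in> fst (chart_at A q)" unfolding chart_at_def by (rule someI_ex)
  then show "chart_at A q \<in> A" "q \<in> fst (chart_at A q)" by auto
qed

lemma chart_image_open_sub:
  assumes "c \<in> A" "openin (top_of_set Mbar) U" "p \<in> fst c" "p \<in> U"
  obtains W where "open W" "snd c p \<in> W" "\<forall>y\<in>W \<inter> half_space. y \<in> snd c ` (fst c \<inter> U)"
proof -
  obtain T where T: "open T" "U = Mbar \<inter> T" using assms(2) by (meson openin_open)
  have "fst c \<inter> U = fst c \<inter> T" using T fst_subset[OF assms(1)] by auto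
  then have "openin (top_of_set (fst c)) (fst c \<inter> U)" using T(1) by (simp add: openin_open_Int)
  from homeomorphism_imp_open_map[OF chart_homeo[OF assms(1)] this]
  have "openin (top_of_set half_space) (snd c ` (fst c \<inter> U))"
    using image_openin[OF assms(1)] openin_trans by blast
  then obtain W where W: "open W" "snd c ` (fst c \<inter> U) = half_space \<inter> W"
    by (meson openin_open)
  have "snd c p \<in> snd c ` (fst c \<inter> U)" using assms by blast
  then show ?thesis using that[of W] W by blast
qed

text \<open>The transition map is continued smoothly across the boundary of the half-space, and W is
  shrunk until its half-space part lies in the overlap.\<close>

lemma transition_extension:
  assumes c: "c \<in> A" and d: "d \<in> A" and p: "p \<in> fst c" "p \<in> fst d"
  obtains W F where "open W" "snd c p \<in> W" "Cinf_on W F"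
    "\<forall>y\<in>W \<inter> half_space. y \<in> snd c ` (fst c \<inter> fst d)"
    "\<forall>y\<in>W \<inter> half_space. F y = snd d (chart_inv c y)"
proof -
  have "smooth_on (snd c ` (fst c \<inter> fst d)) (snd d \<circ> chart_inv c)"
    using compatible[OF c d] by (simp add: compatible_def)
  then obtain W1 F where 1: "open W1" "snd c p \<in> W1" "Cinf_on W1 F"
    "\<forall>y\<in>snd c ` (fst c \<inter> fst d) \<inter> W1. F y = (snd d \<circ> chart_inv c) y"
    by (rule smooth_onD) (use p in auto)
  obtain W2 where 2: "open W2" "snd c p \<in> W2" "\<forall>y\<in>W2 \<inter> half_space. y \<in> snd c ` (fst c \<inter> fst d)"
    using chart_image_open_sub[OF c chart_openin[OF d] p] .
  show ?thesis
    by (rule that[of "W1 \<inter> W2" F]) (use 1 2 in \<open>auto intro: Cinf_on_subset\<close>)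
qed

lemma transition_derivative:
  assumes c: "c \<in> A" and d: "d \<in> A" and q: "q \<in> fst c" "snd c q \<in> W"
    and W: "open W" "Cinf_on W F" "\<forall>y\<in>W \<inter> half_space. F y = snd d (chart_inv c y)"
  shows "dtrans c d q = frechet_derivative F (at (snd c q))"
  unfolding dtrans_def
  by (rule half_space_derivativeI(2)[OF Cinf_onD[OF W(2) q(2)] W(1) q(2) chart_half[OF c q(1)]]) (simp add: W(3))

lemma has_derivative_dtrans:
  assumes c: "c \<in> A" and d: "d \<in> A" and p: "p \<in> fst c" "p \<in> fst d"
  shows "((\<lambda>x. snd d (chart_inv c x)) has_derivative dtrans c d p) (at (snd c p) within half_space)"
proof -
  obtain W F where W: "open W" "snd c p \<in> W" "Cinf_on W F"
    "\<forall>y\<in>W \<inter> half_space. y \<in> snd c ` (fst c \<inter> fst d)"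
    "\<forall>y\<in>W \<inter> half_space. F y = snd d (chart_inv c y)"
    using transition_extension[OF c d p] .
  show ?thesis
    unfolding transition_derivative[OF c d p(1) W(2,1,3,5)]
    by (rule half_space_derivativeI(1)[OF Cinf_onD[OF W(3,2)] W(1,2) chart_half[OF c p(1)] W(5)])
qed

lemma linear_dtrans:
  "c \<in> A \<Longrightarrow> d \<in> A \<Longrightarrow> p \<in> fst c \<Longrightarrow> p \<in> fst d \<Longrightarrow> linear (dtrans c d p)"
  using has_derivative_linear[OF has_derivative_dtrans] .

text \<open>The chain rule for the extensions. Outside the half-space their composite has no meaning
  on the manifold, but its derivative is already determined by the half-space.\<close>

lemma dtrans_chain:
  assumes c: "c \<in> A" and d: "d \<in> A" and e: "e \<in> A" and p: "p \<in> fst c" "p \<in> fst d" "p \<in> fst e"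
  shows "dtrans d e p (dtrans c d p v) = dtrans c e p v"
proof -
  obtain W F where W: "open W" "snd c p \<in> W" "Cinf_on W F"
    "\<forall>y\<in>W \<inter> half_space. y \<in> snd c ` (fst c \<inter> fst d)"
    "\<forall>y\<in>W \<inter> half_space. F y = snd d (chart_inv c y)"
    using transition_extension[OF c d p(1,2)] .
  obtain W' F' where W': "open W'" "snd d p \<in> W'" "Cinf_on W' F'"
    "\<forall>y\<in>W' \<inter> half_space. y \<in> snd d ` (fst d \<inter> fst e)"
    "\<forall>y\<in>W' \<inter> half_space. F' y = snd e (chart_inv d y)"
    using transition_extension[OF d e p(2,3)] .
  have Fp: "F (snd c p) = snd d p" using W(5) W(2) chart_half[OF c p(1)] by (simp add: chart_inv_left c p)
  have "open (W \<inter> F -` W')"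
    using continuous_open_preimage[OF Cinf_on_continuous[OF W(3)] W(1) W'(1)] .
  moreover have "snd c p \<in> W \<inter> F -` W'" using W(2) W'(2) Fp by simp
  moreover have "((\<lambda>x. F' (F x)) has_derivative (\<lambda>v. dtrans d e p (dtrans c d p v))) (at (snd c p))"
    using has_derivative_compose[OF Cinf_onD[OF W(3,2)], of F' "dtrans d e p"] Cinf_onD[OF W'(3,2)] Fp
      transition_derivative[OF c d p(1) W(2,1,3,5)] transition_derivative[OF d e p(2) W'(2,1,3,5)] by simp
  moreover have "F' (F y) = snd e (chart_inv c y)" if y: "y \<in> W \<inter> F -` W'" "y \<in> half_space" for y
  proof -
    have in_img: "y \<in> snd c ` (fst c \<inter> fst d)" using W(4) y by auto
    then obtain q where q: "q \<in> fst c" "q \<in> fst d" "y = snd c q" by auto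
    have "F y = snd d q" using W(5) y q by (simp add: chart_inv_left c)
    then show ?thesis using W'(5) y q chart_half[OF d q(2)] by (simp add: chart_inv_left c d)
  qed
  ultimately have "frechet_derivative (\<lambda>y. snd e (chart_inv c y)) (at (snd c p) within half_space)
      = (\<lambda>v. dtrans d e p (dtrans c d p v))"
    using half_space_derivativeI(2)[of "\<lambda>x. F' (F x)" _ "snd c p" "W \<inter> F -` W'" "\<lambda>y. snd e (chart_inv c y)"]
      chart_half[OF c p(1)] by blast
  then show ?thesis by (simp add: dtrans_def comp_def)
qed

lemma dtrans_self: assumes c: "c \<in> A" and p: "p \<in> fst c" shows "dtrans c c p v = v"
proof -
  obtain W where W: "open W" "snd c p \<in> W" "\<forall>y\<in>W \<inter> half_space. y \<in> snd c ` (fst c \<inter> fst c)"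
    using chart_image_open_sub[OF c chart_openin[OF c] p p] .
  have "frechet_derivative (\<lambda>y. snd c (chart_inv c y)) (at (snd c p) within half_space) = (\<lambda>v. v)"
    by (rule half_space_derivativeI(2)[OF has_derivative_ident W(1,2) chart_half[OF c p]])
      (use W(3) chart_inv_right[OF c] in auto)
  then show ?thesis by (simp add: dtrans_def comp_def)
qed

lemma dtrans_inverse:
  assumes "c \<in> A" "d \<in> A" "p \<in> fst c" "p \<in> fst d"
  shows "dtrans d c p (dtrans c d p v) = v"
  using dtrans_chain[OF assms(1,2,1) assms(3,4,3)] dtrans_self assms by simp

lemma isometry_formsI:
  assumes "c \<in> A" "d \<in> A" "p \<in> fst c" "p \<in> fst d"
    and "inner_form H1" "inner_form H2" "\<And>v w. H1 v w = H2 (dtrans c d p v) (dtrans c d p w)"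
  shows "isometry_forms H1 H2 (dtrans c d p) (dtrans d c p)"
  by (rule isometry_forms.intro) (simp_all add: assms linear_dtrans dtrans_inverse)

lemma continuous_on_MbarI:
  assumes "\<And>c. c \<in> A \<Longrightarrow> continuous_on (fst c) f" shows "continuous_on Mbar f"
  unfolding continuous_on_eq_continuous_within
proof
  fix p assume "p \<in> Mbar"
  then obtain c where c: "c \<in> A" "p \<in> fst c" using union_charts by blast
  obtain T where T: "open T" "fst c = Mbar \<inter> T" using chart_openin[OF c(1)] by (meson openin_open)
  have "at p within fst c = at p within Mbar"
    using c T by (intro at_within_nhd[of p T]) auto
  moreover have "continuous (at p within fst c) f"
    using assms[OF c(1)] c(2) by (simp add: continuous_on_eq_continuous_within)
  ultimately show "continuous (at p within Mbar) f" by simp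
qed

lemma eventually_bdryI:
  assumes "openin (top_of_set Mbar) U" "p \<in> U"
  shows "\<forall>\<^sub>F q in at p within mint A. q \<in> U"
proof -
  obtain T where "open T" "U = Mbar \<inter> T" using assms(1) by (meson openin_open)
  then show ?thesis
    unfolding eventually_at_topological using assms(2) by (intro exI[of _ T]) (auto simp: mint_eq)
qed

lemma eventually_mint: "\<forall>\<^sub>F q in at p within mint A. q \<in> mint A"
  unfolding eventually_at_topological by (intro exI[of _ UNIV]) auto

lemma tendsto_chart:
  assumes c: "c \<in> A" "p \<in> fst c" shows "(snd c \<longlongrightarrow> snd c p) (at p within mint A)"
proof (rule topological_tendstoI)
  fix W assume W: "open W" "snd c p \<in> W"
  have "openin (top_of_set (fst c)) (fst c \<inter> snd c -` W)"
    using chart_homeo[OF c(1)] W(1) continuous_openin_preimage_gen by (auto simp: homeomorphism_def)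
  then have "openin (top_of_set Mbar) (fst c \<inter> snd c -` W)" using chart_openin[OF c(1)] openin_trans by blast
  then have "\<forall>\<^sub>F q in at p within mint A. q \<in> fst c \<inter> snd c -` W"
    by (rule eventually_bdryI) (use c W in auto)
  then show "\<forall>\<^sub>F q in at p within mint A. snd c q \<in> W" by eventually_elim auto
qed

lemma eventually_chart:
  assumes c: "c \<in> A" "p \<in> fst c" and "open W" "snd c p \<in> W"
  shows "\<forall>\<^sub>F q in at p within mint A. q \<in> mint A \<and> q \<in> fst c \<and> snd c q \<in> W \<and> snd (snd c q) > 0"
  using eventually_mint eventually_bdryI[OF chart_openin[OF c(1)] c(2)] topological_tendstoD[OF tendsto_chart[OF c] assms(3,4)]
  by eventually_elim (auto intro: mint_pos c)

lemma tendsto_dtrans: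
  assumes c: "c \<in> A" and d: "d \<in> A" and p: "p \<in> fst c" "p \<in> fst d"
  shows "((\<lambda>q. dtrans c d q v) \<longlongrightarrow> dtrans c d p v) (at p within mint A)"
proof -
  obtain W F where W: "open W" "snd c p \<in> W" "Cinf_on W F"
    "\<forall>y\<in>W \<inter> half_space. y \<in> snd c ` (fst c \<inter> fst d)"
    "\<forall>y\<in>W \<inter> half_space. F y = snd d (chart_inv c y)"
    using transition_extension[OF c d p] .
  have "isCont (\<lambda>x. frechet_derivative F (at x) v) (snd c p)"
    using Cinf_on_continuous[OF Cinf_on_derivative[OF W(1,3)]] W(1,2) continuous_on_eq_continuous_at by blast
  from isCont_tendsto_compose[OF this tendsto_chart[OF c p(1)]]
  have "((\<lambda>q. frechet_derivative F (at (snd c q)) v) \<longlongrightarrow> dtrans c d p v) (at p within mint A)"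
    by (simp add: transition_derivative[OF c d p(1) W(2,1,3,5)])
  moreover have "\<forall>\<^sub>F q in at p within mint A. frechet_derivative F (at (snd c q)) v = dtrans c d q v"
    using eventually_chart[OF c p(1) W(1,2)]
    by eventually_elim (simp add: transition_derivative[OF c d _ _ W(1,3,5)])
  ultimately show ?thesis by (rule Lim_transform_eventually)
qed

lemma continuous_on_smooth_fun:
  assumes "smooth_fun A f" shows "continuous_on Mbar f"
proof (rule continuous_on_MbarI)
  fix c assume c: "c \<in> A"
  have "continuous_on (snd c ` fst c) (f \<circ> chart_inv c)"
    using assms c by (intro smooth_on_continuous) (simp add: smooth_fun_def)
  moreover have "continuous_on (fst c) (snd c)" using chart_homeo[OF c] by (simp add: homeomorphism_def)
  ultimately have "continuous_on (fst c) (\<lambda>p. (f \<circ> chart_inv c) (snd c p))"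
    by (rule continuous_on_compose2[OF _ _ subset_refl])
  then show "continuous_on (fst c) f" by (rule continuous_on_eq) (simp add: chart_inv_left c)
qed

text \<open>One direction is continuity of \<rho>. For the other, the part of \<open>Mbar\<close>
  outside suitable neighborhoods of the boundary points is compact and \<rho> has a positive minimum
  on it, so small \<rho> forces a point into one of the neighborhoods.\<close>

lemma to_bdry_iff:
  fixes f :: "'a \<Rightarrow> 'b::topological_space"
  assumes df: "defining_function A \<rho>"
  shows "(f \<longlongrightarrow> L) (to_bdry A \<rho>) \<longleftrightarrow> (\<forall>p\<in>mbdry A. (f \<longlongrightarrow> L) (at p within mint A))"
proof -
  have cont: "continuous_on Mbar \<rho>" using df continuous_on_smooth_fun by (simp add: defining_function_def)
  have zero: "p \<in> Mbar \<Longrightarrow> \<rho> p \<ge> 0 \<and> (\<rho> p = 0 \<longleftrightarrow> p \<in> mbdry A)" for p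
    using df union_charts by (auto simp: defining_function_def)
  show ?thesis
  proof (intro iffI ballI)
    fix p assume lim: "(f \<longlongrightarrow> L) (to_bdry A \<rho>)" and p: "p \<in> mbdry A"
    have "at p within mint A \<le> to_bdry A \<rho>"
      unfolding to_bdry_def
    proof (intro le_infI)
      have "(\<rho> \<longlongrightarrow> \<rho> p) (at p within Mbar)"
        using cont p mbdry_subset by (auto simp: continuous_on)
      then have "(\<rho> \<longlongrightarrow> 0) (at p within mint A)"
        using zero p mbdry_subset mint_eq by (metis (no_types, lifting) Diff_subset subsetD tendsto_within_subset)
      then show "at p within mint A \<le> filtercomap \<rho> (nhds 0)" by (simp add: filterlim_iff_le_filtercomap)
      show "at p within mint A \<le> principal (mint A)" by (simp add: le_principal eventually_mint)
    qed
    then show "(f \<longlongrightarrow> L) (at p within mint A)" using lim by (rule tendsto_mono)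
  next
    assume lim: "\<forall>p\<in>mbdry A. (f \<longlongrightarrow> L) (at p within mint A)"
    show "(f \<longlongrightarrow> L) (to_bdry A \<rho>)"
    proof (rule topological_tendstoI)
      fix O' assume O': "open O'" "L \<in> O'"
      have "\<forall>p\<in>mbdry A. \<exists>T. open T \<and> p \<in> T \<and> (\<forall>q\<in>T. q \<noteq> p \<longrightarrow> q \<in> mint A \<longrightarrow> f q \<in> O')"
      proof
        fix p assume "p \<in> mbdry A"
        with lim have "\<forall>\<^sub>F q in at p within mint A. f q \<in> O'" using topological_tendstoD O' by blast
        then show "\<exists>T. open T \<and> p \<in> T \<and> (\<forall>q\<in>T. q \<noteq> p \<longrightarrow> q \<in> mint A \<longrightarrow> f q \<in> O')"
          unfolding eventually_at_topological .
      qed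
      then obtain T where T: "\<And>p. p \<in> mbdry A \<Longrightarrow> open (T p) \<and> p \<in> T p \<and> (\<forall>q\<in>T p. q \<noteq> p \<longrightarrow> q \<in> mint A \<longrightarrow> f q \<in> O')"
        by metis
      define N where "N = Mbar - (\<Union>p\<in>mbdry A. T p)"
      have near: "f q \<in> O'" if "q \<in> mint A" "q \<notin> N" for q
      proof -
        from that obtain p where p: "p \<in> mbdry A" "q \<in> T p" by (auto simp: N_def mint_eq)
        then have "q \<noteq> p" using that(1) by (auto simp: mint_eq)
        then show ?thesis using T[OF p(1)] p(2) that(1) by blast
      qed
      have "open (\<Union>p\<in>mbdry A. T p)" using T by blast
      then have "compact N" using compact_Mbar by (simp add: N_def compact_diff)
      obtain m where m: "m > 0" "\<And>q. q \<in> N \<Longrightarrow> \<rho> q \<ge> m"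
      proof (cases "N = {}")
        case False
        have "continuous_on N \<rho>" using cont by (rule continuous_on_subset) (auto simp: N_def)
        from continuous_attains_inf[OF \<open>compact N\<close> False this]
        obtain q where q: "q \<in> N" "\<And>q'. q' \<in> N \<Longrightarrow> \<rho> q \<le> \<rho> q'" by blast
        have "q \<notin> mbdry A" using q(1) T by (auto simp: N_def)
        then have "\<rho> q > 0" using zero[of q] q(1) by (auto simp: N_def)
        then show ?thesis using that q(2) by blast
      qed (use that[of 1] in auto)
      have "\<forall>\<^sub>F t in nhds (0::real). t < m" using m(1) by (intro eventually_nhds_in_open[of "{..<m}", simplified]) 
      then have "\<forall>\<^sub>F q in filtercomap \<rho> (nhds 0). \<rho> q < m" by (rule eventually_filtercomapI)
      then have "\<forall>\<^sub>F q in filtercomap \<rho> (nhds 0). q \<in> mint A \<longrightarrow> f q \<in> O'"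
        by eventually_elim (use near m(2) in force)
      then show "\<forall>\<^sub>F q in to_bdry A \<rho>. f q \<in> O'" by (simp add: to_bdry_def eventually_inf_principal)
    qed
  qed
qed

end

section \<open>Global vector fields with constant components near a point\<close>

lemma Cinf_on_compose:
  "open S \<Longrightarrow> g ` S \<subseteq> T \<Longrightarrow> Cinf_on S g \<Longrightarrow> Cinf_on T f \<Longrightarrow> Cinf_on S (\<lambda>x. f (g x))"
  unfolding Cinf_on_def using Ck_on_compose by blast

lemma Cinf_on_scaleR:
  "open S \<Longrightarrow> Cinf_on S f \<Longrightarrow> Cinf_on S g \<Longrightarrow> Cinf_on S (\<lambda>x. f x *\<^sub>R g x)"
  unfolding Cinf_on_def using Ck_on_scaleR by blast

lemma Cinf_on_const: "Cinf_on S (\<lambda>x. c)"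
  unfolding Cinf_on_def using Ck_on_const by blast

lemma closed_half_space: "closed (half_space :: ('n::finite) coord set)"
  unfolding half_space_def by (intro closed_Collect_le continuous_intros)

context compact_mfd
begin

lemma openin_chart_preimage:
  assumes c: "c \<in> A" and W: "open W"
  shows "openin (top_of_set Mbar) {q \<in> fst c. snd c q \<in> W}"
proof -
  have "openin (top_of_set (fst c)) (fst c \<inter> snd c -` W)"
    using chart_homeo[OF c] W continuous_openin_preimage_gen by (auto simp: homeomorphism_def)
  moreover have "fst c \<inter> snd c -` W = {q \<in> fst c. snd c q \<in> W}" by auto
  ultimately show ?thesis using chart_openin[OF c] openin_trans by metis
qed

text \<open>A constant field of the chart, multiplied by a bump function and extended by 0, is
  smooth on the whole manifold because the bump vanishes outside a closed set inside the chart
  domain.\<close>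

lemma vector_field_exists:
  assumes c: "c \<in> A" and p: "p \<in> fst c"
  obtains X N where "smooth_vfield A X" "openin (top_of_set Mbar) N" "p \<in> N" "N \<subseteq> fst c" "\<forall>q\<in>N. X c q = a"
proof -
  define z0 where "z0 = snd c p"
  obtain W0 where W0: "open W0" "snd c p \<in> W0" "\<forall>y\<in>W0 \<inter> half_space. y \<in> snd c ` (fst c \<inter> fst c)"
    using chart_image_open_sub[OF c chart_openin[OF c] p p] .
  then obtain r where r: "r > 0" "cball z0 r \<subseteq> W0" unfolding z0_def using open_contains_cball by blast
  obtain \<beta> :: "'n coord \<Rightarrow> real" where \<beta>: "Cinf_on UNIV \<beta>" "\<And>z. dist z z0 < r / 2 \<Longrightarrow> \<beta> z = 1" "\<And>z. dist z z0 \<ge> r \<Longrightarrow> \<beta> z = 0"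
    using bump_function[OF r(1), of z0] by metis
  \<comment> \<open>T is compact as the image of a closed half-ball, hence closed because the space
    is Hausdorff, and \<beta> vanishes in the chart outside T.\<close>
  define T where "T = chart_inv c ` (cball z0 r \<inter> half_space)"
  have sub: "cball z0 r \<inter> half_space \<subseteq> snd c ` fst c" using r W0 by auto
  have "continuous_on (snd c ` fst c) (chart_inv c)" using chart_homeo[OF c] by (simp add: homeomorphism_def)
  then have "compact T"
    unfolding T_def using sub by (intro compact_continuous_image compact_Int_closed closed_half_space)
      (auto intro: continuous_on_subset)
  then have "closed T" by (rule compact_imp_closed)
  have T_sub: "T \<subseteq> fst c" unfolding T_def using sub chart_inv_in[OF c] by auto
  have off_T: "\<beta> (snd c q) = 0" if "q \<in> fst c" "q \<notin> T" for q
  proof (rule \<beta>(3), rule ccontr)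
    assume "\<not> r \<le> dist (snd c q) z0"
    then have "snd c q \<in> cball z0 r \<inter> half_space" using chart_half[OF c that(1)] by (simp add: dist_commute)
    then have "chart_inv c (snd c q) \<in> T" unfolding T_def by blast
    then show False using that chart_inv_left[OF c] by simp
  qed
  define X where "X = (\<lambda>d q. if q \<in> fst c then \<beta> (snd c q) *\<^sub>R dtrans c d q a else 0)"
  have X_smooth: "smooth_vfield A X"
    unfolding smooth_vfield_def
  proof (intro conjI ballI)
    fix d e q assume d: "d \<in> A" and e: "e \<in> A" and q: "q \<in> fst d \<inter> fst e"
    then have lin: "linear (dtrans d e q)" by (intro linear_dtrans) auto
    show "X e q = dtrans d e q (X d q)"
    proof (cases "q \<in> fst c")
      case True
      then have "dtrans d e q (dtrans c d q a) = dtrans c e q a" using q by (intro dtrans_chain c d e) auto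
      then show ?thesis using True by (simp add: X_def linear_scale[OF lin])
    qed (simp add: X_def linear_0[OF lin])
  next
    fix d assume d: "d \<in> A"
    show "smooth_on (snd d ` fst d) (\<lambda>x. X d (chart_inv d x))"
    proof (rule smooth_onI)
      fix x assume "x \<in> snd d ` fst d"
      then obtain q where q: "q \<in> fst d" "x = snd d q" by auto
      show "\<exists>W F. open W \<and> x \<in> W \<and> Cinf_on W F \<and> (\<forall>y. y \<in> snd d ` fst d \<longrightarrow> y \<in> W \<longrightarrow> F y = X d (chart_inv d y))"
      proof (cases "q \<in> fst c")
        case True
        obtain W G where W: "open W" "snd d q \<in> W" "Cinf_on W G"
          "\<forall>y\<in>W \<inter> half_space. y \<in> snd d ` (fst d \<inter> fst c)"
          "\<forall>y\<in>W \<inter> half_space. G y = snd c (chart_inv d y)"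
          using transition_extension[OF d c q(1) True] .
        obtain W' F where W': "open W'" "snd c q \<in> W'" "Cinf_on W' F"
          "\<forall>y\<in>W' \<inter> half_space. y \<in> snd c ` (fst c \<inter> fst d)"
          "\<forall>y\<in>W' \<inter> half_space. F y = snd d (chart_inv c y)"
          using transition_extension[OF c d True q(1)] .
        have Gq: "G (snd d q) = snd c q" using W(2,5) chart_half[OF d q(1)] q by (simp add: chart_inv_left d)
        define V where "V = W \<inter> G -` W'"
        have V: "open V" "snd d q \<in> V"
          using continuous_open_preimage[OF Cinf_on_continuous[OF W(3)] W(1) W'(1)] W(2) W'(2) Gq by (auto simp: V_def)
        have G: "Cinf_on V G" using W(3) by (rule Cinf_on_subset) (auto simp: V_def)
        \<comment> \<open>G extends the transition from d to c and F the one back; at y the field is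
          the image of \<open>\<beta> (G y)\<close> times a under the derivative of F at G
          y.\<close>
        have "Cinf_on V (\<lambda>y. \<beta> (G y) *\<^sub>R frechet_derivative F (at (G y)) a)"
          by (intro Cinf_on_scaleR V Cinf_on_compose[OF V(1) _ G \<beta>(1)]
              Cinf_on_compose[OF V(1) _ G Cinf_on_derivative[OF W'(1,3)]]) (auto simp: V_def)
        moreover have "\<beta> (G y) *\<^sub>R frechet_derivative F (at (G y)) a = X d (chart_inv d y)"
          if y: "y \<in> snd d ` fst d" "y \<in> V" for y
        proof -
          have half: "y \<in> half_space" using y(1) chart_half[OF d] by auto
          then have "y \<in> snd d ` (fst d \<inter> fst c)" using W(4) y(2) by (auto simp: V_def)
          then obtain q' where q': "q' \<in> fst d" "q' \<in> fst c" "y = snd d q'" by auto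
          have Gy: "G y = snd c q'" using W(5) y(2) half q' by (auto simp: V_def chart_inv_left[OF d])
          then have "snd c q' \<in> W'" using y(2) by (simp add: V_def)
          from transition_derivative[OF c d q'(2) this W'(1,3,5)]
          show ?thesis using q' Gy by (simp add: X_def chart_inv_left[OF d])
        qed
        ultimately show ?thesis using V q(2) by blast
      next
        case False
        have "openin (top_of_set Mbar) (Mbar - T)"
          using \<open>closed T\<close> by (metis Diff_eq open_Compl openin_open_Int)
        moreover have "q \<in> Mbar - T" using False T_sub fst_subset[OF d] q by auto
        ultimately obtain W where W: "open W" "snd d q \<in> W" "\<forall>y\<in>W \<inter> half_space. y \<in> snd d ` (fst d \<inter> (Mbar - T))"
          using chart_image_open_sub[OF d _ q(1)] by metis
        have "0 = X d (chart_inv d y)" if y: "y \<in> snd d ` fst d" "y \<in> W" for y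
        proof -
          have "y \<in> half_space" using y(1) chart_half[OF d] by auto
          then obtain q' where q': "q' \<in> fst d" "q' \<notin> T" "y = snd d q'" using W(3) y(2) by blast
          then show ?thesis using off_T[of q'] by (simp add: X_def chart_inv_left[OF d])
        qed
        then show ?thesis using W(1,2) q(2) Cinf_on_const[of W "0 :: 'n coord"] by blast
      qed
    qed
  qed
  show ?thesis
  proof (rule that[OF X_smooth])
    show "openin (top_of_set Mbar) {q \<in> fst c. snd c q \<in> ball z0 (r / 2)}"
      by (rule openin_chart_preimage[OF c open_ball])
    show "\<forall>q\<in>{q \<in> fst c. snd c q \<in> ball z0 (r / 2)}. X c q = a"
      using \<beta>(2) by (auto simp: X_def dtrans_self[OF c] dist_commute)
  qed (use p r(1) in \<open>auto simp: z0_def\<close>)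
qed

end

section \<open>Moebius parametrizations\<close>

locale collared_mfd = compact_mfd Mbar A
  for Mbar :: "'a::t2_space set" and A :: "('a, 'n::finite) chart set" +
  fixes \<rho> :: "'a \<Rightarrow> real" and \<rho>s :: real and K :: "'a set" and \<kappa> :: "'a \<Rightarrow> 'a"
    and B :: "('a set \<times> 'a set \<times> ('a \<Rightarrow> real^'n)) set"
    and I :: "nat set" and \<Phi> :: "nat \<Rightarrow> 'n coord \<Rightarrow> 'a"
  assumes df: "defining_function A \<rho>"
    and col: "collar Mbar A \<rho> \<rho>s K \<kappa>"
    and bg: "background_charts A B"
    and pf: "param_family Mbar A \<rho> K \<kappa> B I \<Phi>"
begin

text \<open>The background coordinates on the extended domain; \<open>collar\<close> puts this pair
  into the atlas.\<close>

definition bgc :: "'a set \<Rightarrow> ('a \<Rightarrow> real^'n) \<Rightarrow> ('a, 'n) chart" where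
  "bgc V \<theta> = ({q \<in> K. \<kappa> q \<in> V}, \<lambda>q. (\<theta> (\<kappa> q), \<rho> q))"

lemma bgc_chart: "(U, V, \<theta>) \<in> B \<Longrightarrow> bgc V \<theta> \<in> A"
  using bg col by (auto simp: background_charts_def collar_def bgc_def)

lemma in_bgc: "q \<in> fst (bgc V \<theta>) \<longleftrightarrow> q \<in> K \<and> \<kappa> q \<in> V"
  and fst_bgc: "fst (snd (bgc V \<theta>) q) = \<theta> (\<kappa> q)"
  and snd_bgc: "snd (snd (bgc V \<theta>) q) = \<rho> q"
  by (auto simp: bgc_def)

lemma rho_zero: "q \<in> Mbar \<Longrightarrow> \<rho> q \<ge> 0 \<and> (\<rho> q = 0 \<longleftrightarrow> q \<in> mbdry A)"
  using df union_charts by (auto simp: defining_function_def)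

lemma mint_iff: "q \<in> mint A \<longleftrightarrow> q \<in> Mbar \<and> \<rho> q > 0"
  using rho_zero[of q] by (auto simp: mint_eq)

lemma bdry_in_bgc: "p \<in> mbdry A \<Longrightarrow> p \<in> V \<Longrightarrow> p \<in> fst (bgc V \<theta>)"
  using col by (auto simp: in_bgc collar_def)

lemma bdry_bgc:
  assumes "p \<in> mbdry A" obtains U V \<theta> where "(U, V, \<theta>) \<in> B" "p \<in> U" "p \<in> V"
proof -
  have "p \<in> (\<Union>(U, V, \<theta>)\<in>B. U)" using assms bg by (simp add: background_charts_def)
  then obtain U V \<theta> where 1: "(U, V, \<theta>) \<in> B" "p \<in> U" by auto
  then have "closure U \<subseteq> V" using bg by (auto simp: background_charts_def)
  then have "p \<in> V" using closure_subset 1(2) by auto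
  with 1 show ?thesis using that by blast
qed

lemma kappa_bdry: "p \<in> mbdry A \<Longrightarrow> \<kappa> p = p"
  using col by (auto simp: collar_def)

text \<open>\<open>mbdry\<close> only asks for some chart with last coordinate 0. If another chart
  put p in the interior of the half-space, \<rho> would have an interior minimum there and its
  differential would vanish, against \<open>defining_function\<close>.\<close>

lemma boundary_chart:
  assumes c: "c \<in> A" and p: "p \<in> fst c" "p \<in> mbdry A" shows "snd (snd c p) = 0"
proof (rule ccontr)
  assume "snd (snd c p) \<noteq> 0"
  then have pos: "snd (snd c p) > 0" using chart_half[OF c p(1)] by (simp add: half_space_def)
  have sm: "smooth_on (snd c ` fst c) (\<rho> \<circ> chart_inv c)" using df c by (auto simp: defining_function_def smooth_fun_def)
  have z: "snd c p \<in> snd c ` fst c" using p by auto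
  obtain W F where W: "open W" "snd c p \<in> W" "Cinf_on W F" "\<forall>y\<in>snd c ` fst c \<inter> W. F y = (\<rho> \<circ> chart_inv c) y"
    using smooth_onD[OF sm z] .
  obtain W' where W': "open W'" "snd c p \<in> W'" "\<forall>y\<in>W' \<inter> half_space. y \<in> snd c ` (fst c \<inter> fst c)"
    using chart_image_open_sub[OF c chart_openin[OF c] p(1) p(1)] .
  define V where "V = W \<inter> W' \<inter> {y. snd y > 0}"
  have V: "open V" "snd c p \<in> V"
    using W W' pos by (auto simp: V_def intro!: open_Int open_Collect_less continuous_intros)
  have F_eq: "F y = \<rho> (chart_inv c y)" "y \<in> snd c ` fst c" if "y \<in> V" for y
  proof -
    have "y \<in> W' \<inter> half_space" using that by (auto simp: V_def half_space_def)
    then show "y \<in> snd c ` fst c" using W'(3) by auto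
    then show "F y = \<rho> (chart_inv c y)" using W(4) that by (auto simp: V_def)
  qed
  have "F (snd c p) = 0" using F_eq(1)[OF V(2)] p rho_zero[of p] mbdry_subset by (auto simp: chart_inv_left c)
  moreover have "F y \<ge> 0" if "y \<in> V" for y
    using F_eq[OF that] chart_inv_in[OF c F_eq(2)[OF that]] fst_subset[OF c] rho_zero by auto
  ultimately have "frechet_derivative F (at (snd c p)) = (\<lambda>v. 0)"
    using differential_zero_maxmin[OF V(2,1) Cinf_onD[OF W(3,2)]] by auto
  moreover have "differential \<rho> c p = frechet_derivative F (at (snd c p))"
    unfolding differential_def
  proof (rule half_space_derivativeI(2)[OF Cinf_onD[OF W(3,2)] V chart_half[OF c p(1)]])
    show "\<forall>y\<in>V \<inter> half_space. F y = (\<rho> \<circ> chart_inv c) y" using F_eq by auto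
  qed
  ultimately show False using df c p by (auto simp: defining_function_def)
qed

lemma eventually_bdry_chart:
  assumes c: "(U, V, \<theta>) \<in> B" and p: "p \<in> mbdry A" "p \<in> V" and P: "eventually P (at p within mint A)"
  obtains r where "r > 0" "\<forall>x. dist x (snd (bgc V \<theta>) p) < r \<longrightarrow> snd x > 0 \<longrightarrow>
    x \<in> snd (bgc V \<theta>) ` fst (bgc V \<theta>) \<and> chart_inv (bgc V \<theta>) x \<in> mint A \<and> P (chart_inv (bgc V \<theta>) x)"
proof -
  let ?c = "bgc V \<theta>"
  note cA = bgc_chart[OF c] and pc = bdry_in_bgc[OF p]
  obtain T where T: "open T" "p \<in> T" "\<And>q. q \<in> T \<Longrightarrow> q \<noteq> p \<Longrightarrow> q \<in> mint A \<Longrightarrow> P q"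
    using P unfolding eventually_at_topological by auto
  have "openin (top_of_set Mbar) (Mbar \<inter> T)" using T(1) by (rule openin_open_Int)
  moreover have "p \<in> Mbar \<inter> T" using T p mbdry_subset by auto
  ultimately obtain W where W: "open W" "snd ?c p \<in> W" "\<forall>y\<in>W \<inter> half_space. y \<in> snd ?c ` (fst ?c \<inter> (Mbar \<inter> T))"
    using chart_image_open_sub[OF cA _ pc] by metis
  obtain r where r: "r > 0" "ball (snd ?c p) r \<subseteq> W" using W open_contains_ball by blast
  have "x \<in> snd ?c ` fst ?c \<and> chart_inv ?c x \<in> mint A \<and> P (chart_inv ?c x)"
    if x: "dist x (snd ?c p) < r" "snd x > 0" for x
  proof -
    have "x \<in> W \<inter> half_space" using x r by (auto simp: dist_commute half_space_def)
    then obtain q where q: "q \<in> fst ?c" "q \<in> Mbar" "q \<in> T" "x = snd ?c q" using W(3) by blast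
    then have "q \<in> mint A" using x(2) by (simp add: snd_bgc mint_iff)
    moreover from this have "q \<noteq> p" using p by (auto simp: mint_eq)
    ultimately show ?thesis using q T(3) chart_inv_left[OF cA q(1)] by auto
  qed
  with r(1) show ?thesis using that by blast
qed

lemma bdry_nontrivial:
  assumes p: "p \<in> mbdry A" shows "at p within mint A \<noteq> bot"
proof
  assume "at p within mint A = bot"
  then have "eventually (\<lambda>q. False) (at p within mint A)" by (simp add: eventually_bot)
  moreover obtain U V \<theta> where c: "(U, V, \<theta>) \<in> B" "p \<in> V" using bdry_bgc[OF p] by metis
  ultimately obtain r where r: "r > 0" "\<forall>x. dist x (snd (bgc V \<theta>) p) < r \<longrightarrow> snd x > 0 \<longrightarrow>
    x \<in> snd (bgc V \<theta>) ` fst (bgc V \<theta>) \<and> chart_inv (bgc V \<theta>) x \<in> mint A \<and> False"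
    using eventually_bdry_chart[OF c(1) p c(2)] by metis
  let ?x = "snd (bgc V \<theta>) p + (0, r / 2)"
  have "snd (snd (bgc V \<theta>) p) \<ge> 0" using rho_zero[of p] p mbdry_subset by (auto simp: snd_bgc)
  then have "snd ?x > 0" using r(1) by simp
  moreover have "dist ?x (snd (bgc V \<theta>) p) < r" using r(1) by (simp add: dist_norm norm_Pair)
  ultimately show False using r(2) by blast
qed

lemma tendsto_rho: assumes p: "p \<in> mbdry A" shows "(\<rho> \<longlongrightarrow> 0) (at p within mint A)"
proof -
  obtain U V \<theta> where c: "(U, V, \<theta>) \<in> B" "p \<in> V" using bdry_bgc[OF p] by metis
  have "((\<lambda>q. snd (snd (bgc V \<theta>) q)) \<longlongrightarrow> snd (snd (bgc V \<theta>) p)) (at p within mint A)"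
    by (intro tendsto_snd tendsto_chart bgc_chart[OF c(1)] bdry_in_bgc p c)
  then show ?thesis using rho_zero[of p] p mbdry_subset by (auto simp: snd_bgc)
qed

lemma bg_bdry_chart:
  assumes "(U, V, \<theta>) \<in> B"
  shows "openin (top_of_set (mbdry A)) V" "open (\<theta> ` V)" "homeomorphism V (\<theta> ` V) \<theta> (inv_into V \<theta>)" "closure U \<subseteq> V"
  using assms bg by (auto simp: background_charts_def bdry_chart_def)

lemma tendsto_kappa: assumes p: "p \<in> mbdry A" shows "(\<kappa> \<longlongrightarrow> p) (at p within mint A)"
proof -
  obtain U V \<theta> where c: "(U, V, \<theta>) \<in> B" "p \<in> V" using bdry_bgc[OF p] by metis
  note cA = bgc_chart[OF c(1)] and pc = bdry_in_bgc[OF p c(2)] and hom = bg_bdry_chart(3)[OF c(1)]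
  have "((\<lambda>q. fst (snd (bgc V \<theta>) q)) \<longlongrightarrow> fst (snd (bgc V \<theta>) p)) (at p within mint A)"
    by (intro tendsto_fst tendsto_chart cA pc)
  then have 1: "((\<lambda>q. \<theta> (\<kappa> q)) \<longlongrightarrow> \<theta> p) (at p within mint A)" by (simp add: fst_bgc kappa_bdry[OF p])
  have "continuous_on (\<theta> ` V) (inv_into V \<theta>)" using hom by (simp add: homeomorphism_def)
  then have "isCont (inv_into V \<theta>) (\<theta> p)"
    using bg_bdry_chart(2)[OF c(1)] c(2) by (simp add: continuous_on_eq_continuous_at)
  from isCont_tendsto_compose[OF this 1]
  have "((\<lambda>q. inv_into V \<theta> (\<theta> (\<kappa> q))) \<longlongrightarrow> inv_into V \<theta> (\<theta> p)) (at p within mint A)" .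
  moreover have left: "inv_into V \<theta> (\<theta> r) = r" if "r \<in> V" for r using hom that by (simp add: homeomorphism_def)
  moreover have "\<forall>\<^sub>F q in at p within mint A. inv_into V \<theta> (\<theta> (\<kappa> q)) = \<kappa> q"
    using eventually_bdryI[OF chart_openin[OF cA] pc] by eventually_elim (simp add: left in_bgc)
  ultimately show ?thesis using c(2) by (simp add: Lim_transform_eventually)
qed

text \<open>\<open>moebius_param\<close> with its witnesses exposed and read in the background
  chart, where the parametrization is a dilation by \<open>\<rho> p0\<close> followed by a
  translation.\<close>

definition moeb :: "nat \<Rightarrow> 'a set \<Rightarrow> 'a set \<Rightarrow> ('a \<Rightarrow> real^'n) \<Rightarrow> 'a \<Rightarrow> bool" where
  "moeb i U V \<theta> p0 \<longleftrightarrow> (U, V, \<theta>) \<in> B \<and> p0 \<in> K \<and> \<kappa> p0 \<in> U \<and> \<rho> p0 > 0 \<and>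
    (\<forall>z\<in>hyp_ball 2. \<Phi> i z \<in> fst (bgc V \<theta>) \<and> snd (bgc V \<theta>) (\<Phi> i z) = (\<theta> (\<kappa> p0), 0) + \<rho> p0 *\<^sub>R z)"

lemma moebius_paramD: "moebius_param \<rho> K \<kappa> B (\<Phi> i) \<Longrightarrow> \<exists>U V \<theta> p0. moeb i U V \<theta> p0"
  unfolding moebius_param_def moeb_def by (fastforce simp: bgc_def)

lemma moebD:
  assumes "moeb i U V \<theta> p0"
  shows "(U, V, \<theta>) \<in> B" "p0 \<in> K" "\<kappa> p0 \<in> U" "\<rho> p0 > 0"
    "z \<in> hyp_ball 2 \<Longrightarrow> \<Phi> i z \<in> fst (bgc V \<theta>)"
    "z \<in> hyp_ball 2 \<Longrightarrow> snd (bgc V \<theta>) (\<Phi> i z) = (\<theta> (\<kappa> p0), 0) + \<rho> p0 *\<^sub>R z"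
  using assms by (auto simp: moeb_def)

lemma moeb_rho: "moeb i U V \<theta> p0 \<Longrightarrow> z \<in> hyp_ball 2 \<Longrightarrow> \<rho> (\<Phi> i z) = \<rho> p0 * snd z"
  using moebD(6)[of i U V \<theta> p0 z] snd_bgc[of V \<theta> "\<Phi> i z"] by simp

lemma hyp_ball_mono: "hyp_ball 1 \<subseteq> (hyp_ball 2 :: ('k::finite) coord set)"
  using closure_hyp_ball_1(1) closure_subset by blast

section \<open>Which parametrizations reach points near p\<close>

text \<open>The closed inner ball has compact image, and this image misses p because the ball lies
  at positive height while p has height 0 in every chart around it.\<close>

lemma smooth_param_away:
  assumes p: "p \<in> mbdry A" and i: "smooth_param A (\<Phi> i)"
  shows "\<forall>\<^sub>F q in at p within mint A. q \<notin> \<Phi> i ` hyp_ball 1"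
proof -
  obtain c where c: "c \<in> A" "snd c ` fst c = hyp_ball 2" "\<forall>z\<in>hyp_ball 2. \<Phi> i z \<in> fst c \<and> snd c (\<Phi> i z) = z"
    using i by (auto simp: smooth_param_def)
  define C where "C = \<Phi> i ` closure (hyp_ball 1)"
  have "continuous_on (hyp_ball 2) (chart_inv c)" using chart_homeo[OF c(1)] c(2) by (simp add: homeomorphism_def)
  then have "continuous_on (hyp_ball 2) (\<Phi> i)"
    by (rule continuous_on_eq) (metis c(1,3) chart_inv_left)
  then have "compact C"
    unfolding C_def by (intro compact_continuous_image closure_hyp_ball_1(2) continuous_on_subset[OF _ closure_hyp_ball_1(1)])
  then have "closed C" by (rule compact_imp_closed)
  have "p \<notin> C"
  proof
    assume "p \<in> C"
    then obtain z where z: "z \<in> hyp_ball 2" "p = \<Phi> i z" using closure_hyp_ball_1(1) by (auto simp: C_def)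
    then have "snd (snd c p) > 0" using c(3) hyp_ball_pos[OF z(1)] by auto
    moreover have "p \<in> fst c" using c(3) z by auto
    ultimately show False using boundary_chart[OF c(1) _ p] by auto
  qed
  then have "\<forall>\<^sub>F q in at p within mint A. q \<in> - C"
    unfolding eventually_at_topological using \<open>closed C\<close> by (intro exI[of _ "- C"]) auto
  then show ?thesis by eventually_elim (use closure_subset in \<open>auto simp: C_def\<close>)
qed

text \<open>Centers project into U, and the image of an inner ball strays from its center by at most
  a multiple of \<rho>. So for small \<rho> such points project into a compact subset R of V,
  whereas near a point p outside V the projection \<kappa> leaves R.\<close>

lemma moebius_away:
  assumes p: "p \<in> mbdry A" and b: "(U, V, \<theta>) \<in> B" and pV: "p \<notin> V"
  shows "\<forall>\<^sub>F q in at p within mint A. \<forall>i p0 z. moeb i U V \<theta> p0 \<longrightarrow> z \<in> hyp_ball 1 \<longrightarrow> q \<noteq> \<Phi> i z"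
proof (cases "U = {}")
  case True
  then show ?thesis by (auto simp: moeb_def)
next
  case False
  note bc = bg_bdry_chart[OF b]
  have "V \<subseteq> Mbar" using bc(1) openin_imp_subset mbdry_subset by blast
  then have "closure U = Mbar \<inter> closure U" using bc(4) by auto
  then have cU: "compact (closure U)" using compact_Int_closed[OF compact_Mbar closed_closure, of U] by simp
  have cont: "continuous_on V \<theta>" "continuous_on (\<theta> ` V) (inv_into V \<theta>)" using bc(3) by (simp_all add: homeomorphism_def)
  define S where "S = \<theta> ` closure U"
  have S: "S \<noteq> {}" "compact S" "S \<subseteq> \<theta> ` V"
    using False cU bc(4) closure_subset[of U] unfolding S_def
    by (auto intro!: compact_continuous_image continuous_on_subset[OF cont(1)])
  obtain \<eta> where \<eta>: "\<eta> > 0" "{x. infdist x S \<le> \<eta>} \<subseteq> \<theta> ` V"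
    using compact_in_open_separated[OF S(1,2) bc(2) S(3)] by blast
  \<comment> \<open>\<eta> is chosen so that the closed \<eta>-neighborhood of the coordinates of
    \<open>closure U\<close> is still inside the image of V; hence R is compact and closed.\<close>
  define R where "R = inv_into V \<theta> ` {x. infdist x S \<le> \<eta>}"
  have "compact R"
    unfolding R_def by (intro compact_continuous_image compact_infdist_le S \<eta> continuous_on_subset[OF cont(2)])
  then have "closed R" by (rule compact_imp_closed)
  have left: "inv_into V \<theta> (\<theta> r) = r" if "r \<in> V" for r using bc(3) that by (simp add: homeomorphism_def)
  have "R \<subseteq> V" unfolding R_def using \<eta>(2) left by auto
  then have "p \<in> - R" using pV by auto
  then have ev1: "\<forall>\<^sub>F q in at p within mint A. \<kappa> q \<in> - R"
    using topological_tendstoD[OF tendsto_kappa[OF p], of "- R"] \<open>closed R\<close> by auto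
  \<comment> \<open>One factor e from \<rho> at the center being at most e times \<rho> q, the other
    from the bound e on the horizontal coordinate in the inner ball.\<close>
  have "((\<lambda>q. exp 1 * exp 1 * \<rho> q) \<longlongrightarrow> exp 1 * exp 1 * 0) (at p within mint A)"
    by (intro tendsto_intros tendsto_rho p)
  then have ev2: "\<forall>\<^sub>F q in at p within mint A. exp 1 * exp 1 * \<rho> q < \<eta>" using \<eta>(1) by (intro order_tendstoD) auto
  from ev1 ev2 show ?thesis
  proof eventually_elim
    fix q assume q: "\<kappa> q \<in> - R" "exp 1 * exp 1 * \<rho> q < \<eta>"
    show "\<forall>i p0 z. moeb i U V \<theta> p0 \<longrightarrow> z \<in> hyp_ball 1 \<longrightarrow> q \<noteq> \<Phi> i z"
    proof (intro allI impI notI)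
      fix i p0 z assume m: "moeb i U V \<theta> p0" and z: "z \<in> hyp_ball 1" and qz: "q = \<Phi> i z"
      have z2: "z \<in> hyp_ball 2" using z hyp_ball_mono by auto
      have \<kappa>V: "\<kappa> q \<in> V" using moebD(5)[OF m z2] qz by (simp add: in_bgc)
      have "\<theta> (\<kappa> q) = \<theta> (\<kappa> p0) + \<rho> p0 *\<^sub>R fst z"
        using moebD(6)[OF m z2] qz fst_bgc[of V \<theta> q] by simp
      then have "dist (\<theta> (\<kappa> q)) (\<theta> (\<kappa> p0)) = \<rho> p0 * norm (fst z)" using moebD(4)[OF m] by (simp add: dist_norm)
      also have "\<dots> \<le> (exp 1 * \<rho> q) * exp 1"
      proof (intro mult_mono hyp_ball_1_bounds(3)[OF z])
        have "\<rho> p0 * 1 \<le> \<rho> p0 * (exp 1 * snd z)"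
          using hyp_ball_1_bounds(1)[OF z] moebD(4)[OF m] by (intro mult_left_mono) (auto simp: exp_minus field_simps)
        then show "\<rho> p0 \<le> exp 1 * \<rho> q" using moeb_rho[OF m z2] qz by (simp add: mult_ac)
        then show "0 \<le> exp 1 * \<rho> q" using moebD(4)[OF m] by linarith
      qed simp
      also have "\<dots> < \<eta>" using q(2) by (simp add: mult_ac)
      finally have d: "dist (\<theta> (\<kappa> q)) (\<theta> (\<kappa> p0)) < \<eta>" .
      have "\<theta> (\<kappa> p0) \<in> S" using moebD(3)[OF m] closure_subset by (auto simp: S_def)
      then have "infdist (\<theta> (\<kappa> q)) S \<le> \<eta>" using d infdist_le2 by fastforce
      then have "inv_into V \<theta> (\<theta> (\<kappa> q)) \<in> R" by (auto simp: R_def)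
      then show False using q(1) left[OF \<kappa>V] by simp
    qed
  qed
qed

text \<open>Finitely many smooth parametrizations and finitely many background charts avoid a
  neighborhood of p. What remains are Moebius parametrizations whose extended chart domain contains
  p, so that their bounds can be transferred by a transition map that is smooth at p.\<close>

lemma localization:
  assumes p: "p \<in> mbdry A"
  shows "\<forall>\<^sub>F q in at p within mint A. \<exists>i\<in>I. \<exists>U V \<theta> p0 z. moeb i U V \<theta> p0 \<and> p \<in> V \<and> z \<in> hyp_ball 1 \<and> q = \<Phi> i z"
proof -
  obtain J where J: "J \<subseteq> I" "finite J" "\<forall>i\<in>I - J. moebius_param \<rho> K \<kappa> B (\<Phi> i)" "\<forall>i\<in>J. smooth_param A (\<Phi> i)"
    and cover: "(\<Union>i\<in>I. \<Phi> i ` hyp_ball 1) = mint A"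
    using pf unfolding param_family_def by auto
  have ev1: "\<forall>\<^sub>F q in at p within mint A. \<forall>i\<in>J. q \<notin> \<Phi> i ` hyp_ball 1"
    using smooth_param_away[OF p] J by (intro eventually_ball_finite) auto
  have "finite B" using bg by (simp add: background_charts_def)
  then have "\<forall>\<^sub>F q in at p within mint A. \<forall>b\<in>B. p \<notin> fst (snd b) \<longrightarrow>
      (\<forall>i p0 z. moeb i (fst b) (fst (snd b)) (snd (snd b)) p0 \<longrightarrow> z \<in> hyp_ball 1 \<longrightarrow> q \<noteq> \<Phi> i z)"
  proof (rule eventually_ball_finite, intro ballI)
    fix b assume "b \<in> B"
    then show "\<forall>\<^sub>F q in at p within mint A. p \<notin> fst (snd b) \<longrightarrow>
      (\<forall>i p0 z. moeb i (fst b) (fst (snd b)) (snd (snd b)) p0 \<longrightarrow> z \<in> hyp_ball 1 \<longrightarrow> q \<noteq> \<Phi> i z)"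
      using moebius_away[OF p, of "fst b" "fst (snd b)" "snd (snd b)"] by (cases "p \<in> fst (snd b)") simp_all
  qed
  with ev1 eventually_mint show ?thesis
  proof eventually_elim
    fix q assume q: "\<forall>i\<in>J. q \<notin> \<Phi> i ` hyp_ball 1" "q \<in> mint A"
      "\<forall>b\<in>B. p \<notin> fst (snd b) \<longrightarrow>
      (\<forall>i p0 z. moeb i (fst b) (fst (snd b)) (snd (snd b)) p0 \<longrightarrow> z \<in> hyp_ball 1 \<longrightarrow> q \<noteq> \<Phi> i z)"
    then obtain i z where i: "i \<in> I" "z \<in> hyp_ball 1" "q = \<Phi> i z" using cover by blast
    then have "i \<in> I - J" using q(1) by auto
    then obtain U V \<theta> p0 where m: "moeb i U V \<theta> p0" using J(3) moebius_paramD by blast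
    have "p \<in> V"
      using q(3)[rule_format, OF moebD(1)[OF m], of i p0 z] m i by auto
    then show "\<exists>i\<in>I. \<exists>U V \<theta> p0 z. moeb i U V \<theta> p0 \<and> p \<in> V \<and> z \<in> hyp_ball 1 \<and> q = \<Phi> i z"
      using m i by blast
  qed
qed

end

section \<open>Weighted bounds in charts near the boundary\<close>

lemma tensor2_onD:
  assumes "tensor2_on A N u"
  shows "c \<in> A \<Longrightarrow> p \<in> fst c \<Longrightarrow> p \<in> N \<Longrightarrow> bilinear (u c p)"
    and "c \<in> A \<Longrightarrow> d \<in> A \<Longrightarrow> p \<in> fst c \<Longrightarrow> p \<in> fst d \<Longrightarrow> p \<in> N \<Longrightarrow> u c p v w = u d p (dtrans c d p v) (dtrans c d p w)"
  using assms unfolding tensor2_on_def by blast+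

lemma Ck_on_le: "j \<le> k \<Longrightarrow> Ck_on k S f \<Longrightarrow> Ck_on j S f"
  by (induction rule: inc_induct) (auto dest: Ck_on_Suc_imp)

lemma Ck_tensors_bound:
  assumes w: "w \<in> Ck_tensors A I \<Phi> k \<alpha>"
  obtains C where "C \<ge> 0" "\<And>i e f z vs. \<lbrakk>i \<in> I; e \<in> Basis; f \<in> Basis; z \<in> hyp_ball 2; set vs \<subseteq> Basis; length vs \<le> k\<rbrakk> \<Longrightarrow>
    \<bar>iter_deriv vs (\<lambda>x. pullback A (\<Phi> i) w x e f) z\<bar> \<le> C"
proof -
  define N where "N = tensor_norm A I \<Phi> k \<alpha> w"
  have N: "N < top" using w by (simp add: Ck_tensors_def N_def)
  have "\<bar>iter_deriv vs (\<lambda>x. pullback A (\<Phi> i) w x e f) z\<bar> \<le> enn2real N"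
    if *: "i \<in> I" "e \<in> Basis" "f \<in> Basis" "z \<in> hyp_ball 2" "set vs \<subseteq> Basis" "length vs \<le> k" for i e f z vs
  proof -
    let ?h = "\<lambda>a b. holder_norm k \<alpha> (hyp_ball 2) (\<lambda>x. pullback A (\<Phi> i) w x a b)"
    have "ennreal \<bar>iter_deriv vs (\<lambda>x. pullback A (\<Phi> i) w x e f) z\<bar> \<le>
        (SUP x\<in>hyp_ball 2. ennreal \<bar>iter_deriv vs (\<lambda>x. pullback A (\<Phi> i) w x e f) x\<bar>)"
      using * by (intro SUP_upper)
    also have "\<dots> \<le> (SUP vs\<in>{vs. set vs \<subseteq> Basis \<and> length vs \<le> k}. SUP x\<in>hyp_ball 2. ennreal \<bar>iter_deriv vs (\<lambda>x. pullback A (\<Phi> i) w x e f) x\<bar>)"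
      using * by (intro SUP_upper2[of vs]) auto
    also have "\<dots> \<le> ?h e f" unfolding holder_norm_def by simp
    also have "\<dots> \<le> (\<Sum>b\<in>Basis. ?h e b)" using * by (intro member_le_sum) auto
    also have "\<dots> \<le> (\<Sum>a\<in>Basis. \<Sum>b\<in>Basis. ?h a b)"
      using * by (intro member_le_sum[of e Basis "\<lambda>a. \<Sum>b\<in>Basis. ?h a b"]) auto
    also have "\<dots> \<le> N" unfolding N_def tensor_norm_def using * by (intro SUP_upper2[of i]) auto
    finally have "enn2real (ennreal \<bar>iter_deriv vs (\<lambda>x. pullback A (\<Phi> i) w x e f) z\<bar>) \<le> enn2real N"
      using N by (rule enn2real_mono)
    then show ?thesis by simp
  qed
  then show ?thesis using that[of "enn2real N"] by simp
qed

context collared_mfd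
begin

lemma moeb_mint:
  assumes "moeb i U V \<theta> p0" "z \<in> hyp_ball 2" shows "\<Phi> i z \<in> mint A"
  using moeb_rho[OF assms] moebD(4)[OF assms(1)] moebD(5)[OF assms] hyp_ball_pos[OF assms(2)]
    fst_subset[OF bgc_chart[OF moebD(1)[OF assms(1)]]]
  by (auto simp: mint_iff)

text \<open>In the background chart the parametrization has derivative \<open>\<rho> p0\<close>
  times the identity, once for each slot of the tensor. The arbitrary chart inside
  \<open>pullback\<close> drops out by the transformation law.\<close>

lemma pullback_moebius:
  assumes m: "moeb i U V \<theta> p0" and z: "z \<in> hyp_ball 2" and w: "tensor2_on A (mint A) w"
  shows "pullback A (\<Phi> i) w z v v' = (\<rho> p0)\<^sup>2 * w (bgc V \<theta>) (\<Phi> i z) v v'"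
proof -
  define c where "c = bgc V \<theta>"
  define q where "q = \<Phi> i z"
  define d where "d = chart_at A q"
  define aff where "aff = (\<lambda>z::'n coord. (\<theta> (\<kappa> p0), 0) + \<rho> p0 *\<^sub>R z)"
  have c: "c \<in> A" unfolding c_def using bgc_chart moebD(1)[OF m] by blast
  have qm: "q \<in> mint A" unfolding q_def by (rule moeb_mint[OF m z])
  have d: "d \<in> A" "q \<in> fst d" using chart_at[of q] qm by (auto simp: d_def mint_iff)
  have im: "\<Phi> i z' \<in> fst c" "snd c (\<Phi> i z') = aff z'" if "z' \<in> hyp_ball 2" for z'
    using moebD(5,6)[OF m that] by (auto simp: c_def aff_def)
  have qc: "q \<in> fst c" "snd c q = aff z" using im[OF z] by (auto simp: q_def)
  obtain W F where W: "open W" "snd c q \<in> W" "Cinf_on W F"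
    "\<forall>y\<in>W \<inter> half_space. y \<in> snd c ` (fst c \<inter> fst d)"
    "\<forall>y\<in>W \<inter> half_space. F y = snd d (chart_inv c y)"
    using transition_extension[OF c d(1) qc(1) d(2)] .
  have aff: "(aff has_derivative (\<lambda>v. \<rho> p0 *\<^sub>R v)) (at z)"
    unfolding aff_def by (auto intro!: derivative_eq_intros)
  have cont: "continuous_on UNIV aff" unfolding aff_def by (intro continuous_intros)
  have "((\<lambda>z. F (aff z)) has_derivative (\<lambda>v. dtrans c d q (\<rho> p0 *\<^sub>R v))) (at z)"
    using has_derivative_compose[OF aff, of F "dtrans c d q"] Cinf_onD[OF W(3,2)]
      transition_derivative[OF c d(1) qc(1) W(2,1,3,5)] qc(2) by simp
  then have "((snd d \<circ> \<Phi> i) has_derivative (\<lambda>v. dtrans c d q (\<rho> p0 *\<^sub>R v))) (at z)"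
  proof (rule has_derivative_transform_within_open[where s="hyp_ball 2 \<inter> aff -` W"])
    show "open (hyp_ball 2 \<inter> aff -` W)"
      using continuous_open_preimage[OF cont open_UNIV W(1)] by (intro open_Int open_hyp_ball) simp
    show "z \<in> hyp_ball 2 \<inter> aff -` W" using z W(2) qc(2) by simp
    fix z' assume z': "z' \<in> hyp_ball 2 \<inter> aff -` W"
    then have "aff z' \<in> W \<inter> half_space" using im[of z'] chart_half[OF c, of "\<Phi> i z'"] by auto
    then show "F (aff z') = (snd d \<circ> \<Phi> i) z'" using W(5) im[of z'] z' chart_inv_left[OF c, of "\<Phi> i z'"] by auto
  qed
  then have D: "frechet_derivative (snd d \<circ> \<Phi> i) (at z) = (\<lambda>v. dtrans c d q (\<rho> p0 *\<^sub>R v))"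
    using frechet_derivative_at by metis
  have lin: "linear (dtrans c d q)" using linear_dtrans[OF c d(1) qc(1) d(2)] .
  have "pullback A (\<Phi> i) w z v v' = w d q (dtrans c d q (\<rho> p0 *\<^sub>R v)) (dtrans c d q (\<rho> p0 *\<^sub>R v'))"
    by (simp add: pullback_def Let_def q_def[symmetric] d_def[symmetric] D)
  also have "\<dots> = (\<rho> p0)\<^sup>2 * w d q (dtrans c d q v) (dtrans c d q v')"
    using tensor2_onD(1)[OF w d qm]
    by (simp add: linear_scale[OF lin] bilinear_lmul bilinear_rmul power2_eq_square)
  also have "w d q (dtrans c d q v) (dtrans c d q v') = w c q v v'"
    using tensor2_onD(2)[OF w c d(1) qc(1) d(2) qm] by simp
  finally show ?thesis by (simp add: c_def q_def)
qed

text \<open>What weight 2 and one derivative mean in background coordinates: the weight compensates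
  the dilation of a covariant 2-tensor, and each coordinate derivative costs 1/\<rho>.\<close>

definition good :: "('a, 'n) tensor2 \<Rightarrow> real \<Rightarrow> 'a set \<Rightarrow> ('a \<Rightarrow> real^'n) \<Rightarrow> 'a \<Rightarrow> bool" where
  "good u C V \<theta> q \<longleftrightarrow> q \<in> fst (bgc V \<theta>) \<and> (\<forall>e\<in>Basis. \<forall>f\<in>Basis.
    (\<lambda>x. u (bgc V \<theta>) (chart_inv (bgc V \<theta>) x) e f) differentiable at (snd (bgc V \<theta>) q) \<and>
    \<bar>u (bgc V \<theta>) q e f\<bar> \<le> C \<and>
    (\<forall>b\<in>Basis. \<bar>frechet_derivative (\<lambda>x. u (bgc V \<theta>) (chart_inv (bgc V \<theta>) x) e f) (at (snd (bgc V \<theta>) q)) b\<bar> \<le> C / \<rho> q))"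

text \<open>The norm is uniform over the parametrizations, and on the inner ball \<rho> at the image
  is comparable to the dilation factor, so a single constant C serves for all of them.\<close>

lemma weighted_moebius_bounds:
  assumes u: "u \<in> weighted_Ck_tensors A \<rho> I \<Phi> k \<alpha> 2" and k: "k \<ge> 1"
  obtains C where "C \<ge> 0" "\<And>i U V \<theta> p0 z. i \<in> I \<Longrightarrow> moeb i U V \<theta> p0 \<Longrightarrow> z \<in> hyp_ball 1 \<Longrightarrow> good u C V \<theta> (\<Phi> i z)"
proof -
  define w where "w = scale_tensor (\<lambda>p. \<rho> p powr (- 2)) u"
  have w: "w \<in> Ck_tensors A I \<Phi> k \<alpha>" using u by (simp add: weighted_Ck_tensors_def w_def)
  then have wt: "tensor2_on A (mint A) w"
    and wC: "\<And>i e f. i \<in> I \<Longrightarrow> e \<in> Basis \<Longrightarrow> f \<in> Basis \<Longrightarrow> Ck_on k (hyp_ball 2) (\<lambda>x. pullback A (\<Phi> i) w x e f)"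
    by (auto simp: Ck_tensors_def)
  obtain C0 where C0: "C0 \<ge> 0" "\<And>i e f z vs. \<lbrakk>i \<in> I; e \<in> Basis; f \<in> Basis; z \<in> hyp_ball 2; set vs \<subseteq> Basis; length vs \<le> k\<rbrakk> \<Longrightarrow>
    \<bar>iter_deriv vs (\<lambda>x. pullback A (\<Phi> i) w x e f) z\<bar> \<le> C0"
    using Ck_tensors_bound[OF w] by metis
  define E :: real where "E = exp 1"
  have E: "E \<ge> 1" by (simp add: E_def)
  \<comment> \<open>With E bounding the height: the square of the height is at most E^2 and its
    derivative contributes two more terms of that size, while 1/r <= E/\<rho> gives the third factor
    E.\<close>
  define C where "C = (3 * (E * E * E)) * C0"
  have "good u C V \<theta> (\<Phi> i z)" if i: "i \<in> I" and m: "moeb i U V \<theta> p0" and z1: "z \<in> hyp_ball 1" for i U V \<theta> p0 z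
  proof -
    have z: "z \<in> hyp_ball 2" using z1 hyp_ball_mono by auto
    have zE: "0 < snd z" "snd z \<le> E" using hyp_ball_pos[OF z] hyp_ball_1_bounds(2)[OF z1] by (auto simp: E_def)
    define c where "c = bgc V \<theta>"
    define q where "q = \<Phi> i z"
    define r where "r = \<rho> p0"
    define a where "a = (\<theta> (\<kappa> p0), 0 :: real)"
    have r: "r > 0" using moebD(4)[OF m] by (simp add: r_def)
    have c: "c \<in> A" unfolding c_def using bgc_chart moebD(1)[OF m] by blast
    have im: "\<Phi> i z' \<in> fst c" "snd c (\<Phi> i z') = a + r *\<^sub>R z'" "\<rho> (\<Phi> i z') = r * snd z'" if "z' \<in> hyp_ball 2" for z'
      using moebD(5,6)[OF m that] moeb_rho[OF m that] by (auto simp: c_def a_def r_def)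
    have \<rho>q: "\<rho> q = r * snd z" using im[OF z] by (simp add: q_def)
    have rinv: "inverse r \<le> E / \<rho> q"
      using r zE by (simp add: \<rho>q field_simps)
    show ?thesis
      unfolding good_def c_def[symmetric] q_def[symmetric]
    proof (intro conjI ballI)
      show "q \<in> fst c" using im[OF z] by (simp add: q_def)
      fix e f :: "'n coord" assume ef: "e \<in> Basis" "f \<in> Basis"
      define \<phi> where "\<phi> = (\<lambda>z. pullback A (\<Phi> i) w z e f)"
      \<comment> \<open>The powers of r from the dilation and from the weight cancel, leaving only
        the square of the height.\<close>
      have u_eq: "u c (\<Phi> i z') e f = (snd z')\<^sup>2 * \<phi> z'" if z': "z' \<in> hyp_ball 2" for z'
      proof -
        have "\<phi> z' = r\<^sup>2 * ((r * snd z') powr (- 2) * u c (\<Phi> i z') e f)"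
          using pullback_moebius[OF m z' wt, of e f] im[OF z'] by (simp add: \<phi>_def w_def scale_tensor_def c_def r_def)
        moreover have "(r * snd z') powr (- 2) = inverse ((r * snd z')\<^sup>2)"
          using r hyp_ball_pos[OF z'] by (simp add: powr_minus powr_numeral)
        ultimately show ?thesis using r hyp_ball_pos[OF z'] by (simp add: field_simps)
      qed
      have \<phi>_bound: "\<bar>\<phi> z\<bar> \<le> C0" using C0(2)[OF i ef z, of "[]"] by (simp add: \<phi>_def)
      have "Ck_on 1 (hyp_ball 2) \<phi>" unfolding \<phi>_def using k wC[OF i ef] by (rule Ck_on_le)
      then have \<phi>_deriv: "(\<phi> has_derivative frechet_derivative \<phi> (at z)) (at z)"
        using Ck_on_SucD[of 0 "hyp_ball 2" \<phi> z] z by simp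
      then have lin: "linear (frechet_derivative \<phi> (at z))" by (rule has_derivative_linear)
      have d\<phi>_bound: "\<bar>frechet_derivative \<phi> (at z) b\<bar> \<le> C0" if "b \<in> Basis" for b
        using C0(2)[OF i ef z, of "[b]"] that k by (simp add: \<phi>_def)
      \<comment> \<open>\<psi> undoes the dilation; differentiating through it produces the factor
        1/r.\<close>
      define \<psi> where "\<psi> = (\<lambda>x. inverse r *\<^sub>R (x - a))"
      have \<psi>: "\<psi> (snd c q) = z" using im[OF z] r by (simp add: \<psi>_def q_def)
      have \<psi>': "(\<psi> has_derivative (\<lambda>v. inverse r *\<^sub>R v)) (at (snd c q))"
        unfolding \<psi>_def by (auto intro!: derivative_eq_intros)
      have cont: "continuous_on UNIV \<psi>" unfolding \<psi>_def by (intro continuous_intros)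
      have "((\<lambda>x. (snd (\<psi> x))\<^sup>2 * \<phi> (\<psi> x)) has_derivative
          (\<lambda>b. (snd z)\<^sup>2 * frechet_derivative \<phi> (at z) (inverse r *\<^sub>R b) + (2 * snd z * snd (inverse r *\<^sub>R b)) * \<phi> z)) (at (snd c q))"
      proof -
        have 1: "((\<lambda>x. \<phi> (\<psi> x)) has_derivative (\<lambda>b. frechet_derivative \<phi> (at z) (inverse r *\<^sub>R b))) (at (snd c q))"
          using has_derivative_compose[OF \<psi>', of \<phi>] \<phi>_deriv \<psi> by simp
        have 2: "((\<lambda>x. snd (\<psi> x)) has_derivative (\<lambda>b. snd (inverse r *\<^sub>R b))) (at (snd c q))"
          using has_derivative_snd[OF \<psi>'] .
        have 3: "((\<lambda>x. (snd (\<psi> x))\<^sup>2) has_derivative (\<lambda>b. 2 * snd z * snd (inverse r *\<^sub>R b))) (at (snd c q))"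
          using has_derivative_mult[OF 2 2] by (simp add: power2_eq_square \<psi> algebra_simps)
        show ?thesis using has_derivative_mult[OF 3 1] by (simp add: \<psi>)
      qed
      then have D: "((\<lambda>x. u c (chart_inv c x) e f) has_derivative
          (\<lambda>b. (snd z)\<^sup>2 * frechet_derivative \<phi> (at z) (inverse r *\<^sub>R b) + (2 * snd z * snd (inverse r *\<^sub>R b)) * \<phi> z)) (at (snd c q))"
      proof (rule has_derivative_transform_within_open[where s="\<psi> -` hyp_ball 2"])
        show "open (\<psi> -` hyp_ball 2)" using continuous_open_preimage[OF cont open_UNIV open_hyp_ball] by simp
        show "snd c q \<in> \<psi> -` hyp_ball 2" using \<psi> z by simp
        fix x assume "x \<in> \<psi> -` hyp_ball 2"
        then have h: "\<psi> x \<in> hyp_ball 2" by simp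
        have "snd c (\<Phi> i (\<psi> x)) = x" using im(2)[OF h] r by (simp add: \<psi>_def)
        then have "chart_inv c x = \<Phi> i (\<psi> x)" using chart_inv_left[OF c im(1)[OF h]] by simp
        then show "(snd (\<psi> x))\<^sup>2 * \<phi> (\<psi> x) = u c (chart_inv c x) e f" using u_eq[OF h] by simp
      qed
      then show "(\<lambda>x. u c (chart_inv c x) e f) differentiable at (snd c q)" by (rule differentiableI)
      have z2: "(snd z)\<^sup>2 \<le> E * E" using zE E unfolding power2_eq_square by (intro mult_mono) auto
      have EE: "E * E \<le> E * E * E" using E by (simp add: mult_le_cancel_left1)
      have "\<bar>u c q e f\<bar> = (snd z)\<^sup>2 * \<bar>\<phi> z\<bar>" using u_eq[OF z] by (simp add: q_def abs_mult)
      also have "\<dots> \<le> (E * E) * C0" using z2 \<phi>_bound E by (intro mult_mono) auto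
      also have "\<dots> \<le> C" unfolding C_def using EE C0(1) E by (intro mult_right_mono) auto
      finally show "\<bar>u c q e f\<bar> \<le> C" .
      fix b :: "'n coord" assume b: "b \<in> Basis"
      have sb: "\<bar>snd b\<bar> \<le> 1" using norm_components_le(2)[of b] norm_Basis[OF b] by simp
      have "\<bar>frechet_derivative (\<lambda>x. u c (chart_inv c x) e f) (at (snd c q)) b\<bar> =
          \<bar>(snd z)\<^sup>2 * (inverse r * frechet_derivative \<phi> (at z) b) + (2 * snd z * (inverse r * snd b)) * \<phi> z\<bar>"
        unfolding frechet_derivative_at[OF D, symmetric] by (simp add: linear_scale[OF lin])
      also have "\<dots> = inverse r * \<bar>(snd z)\<^sup>2 * frechet_derivative \<phi> (at z) b + 2 * snd z * snd b * \<phi> z\<bar>"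
      proof -
        have "(snd z)\<^sup>2 * (inverse r * frechet_derivative \<phi> (at z) b) + (2 * snd z * (inverse r * snd b)) * \<phi> z
            = inverse r * ((snd z)\<^sup>2 * frechet_derivative \<phi> (at z) b + 2 * snd z * snd b * \<phi> z)"
          by (simp add: algebra_simps)
        then show ?thesis using r by (simp add: abs_mult)
      qed
      also have "\<dots> \<le> (E / \<rho> q) * (3 * (E * E) * C0)"
      proof (rule mult_mono[OF rinv])
        have t1: "\<bar>(snd z)\<^sup>2 * frechet_derivative \<phi> (at z) b\<bar> \<le> (E * E) * C0"
          unfolding abs_mult using z2 d\<phi>_bound[OF b] E by (intro mult_mono) auto
        have "\<bar>snd z * snd b\<bar> \<le> E * 1" unfolding abs_mult using zE sb by (intro mult_mono) auto
        also have "\<dots> \<le> E * E" using E by (intro mult_left_mono) auto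
        finally have "\<bar>snd z * snd b\<bar> * \<bar>\<phi> z\<bar> \<le> (E * E) * C0" using \<phi>_bound E by (intro mult_mono) auto
        then have t2: "\<bar>2 * snd z * snd b * \<phi> z\<bar> \<le> 2 * ((E * E) * C0)" by (simp add: abs_mult mult_ac)
        show "\<bar>(snd z)\<^sup>2 * frechet_derivative \<phi> (at z) b + 2 * snd z * snd b * \<phi> z\<bar> \<le> 3 * (E * E) * C0"
          using t1 t2 by (simp add: mult.assoc)
        show "0 \<le> E / \<rho> q" using E r zE by (simp add: \<rho>q)
      qed simp
      also have "\<dots> = C / \<rho> q" by (simp add: C_def)
      finally show "\<bar>frechet_derivative (\<lambda>x. u c (chart_inv c x) e f) (at (snd c q)) b\<bar> \<le> C / \<rho> q" .
    qed
  qed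
  moreover have "C \<ge> 0" using C0(1) E by (simp add: C_def)
  ultimately show ?thesis using that by metis
qed

text \<open>Components in c are combinations of those in the background chart with coefficients from
  the derivative F1 of the transition map, bounded near p. Differentiation gives terms with
  derivatives of u, of size C/\<rho>, and terms with F2 and values of u, where C <= C/\<rho> once
  \<rho> < 1.\<close>

lemma good_transfer:
  assumes u: "tensor2_on A (mint A) u" and C: "C \<ge> 0"
    and p: "p \<in> mbdry A" and c: "c \<in> A" "p \<in> fst c" and b: "(U, V, \<theta>) \<in> B" "p \<in> V"
  obtains C' where "C' \<ge> 0" "\<forall>\<^sub>F q in at p within mint A. good u C V \<theta> q \<longrightarrow>
     (\<lambda>x. u c (chart_inv c x) v w) differentiable at (snd c q) \<and> \<bar>u c q v w\<bar> \<le> C' \<and>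
     \<bar>frechet_derivative (\<lambda>x. u c (chart_inv c x) v w) (at (snd c q)) a\<bar> \<le> C' / \<rho> q"
proof -
  define c' where "c' = bgc V \<theta>"
  have c': "c' \<in> A" "p \<in> fst c'" using bgc_chart[OF b(1)] bdry_in_bgc[OF p b(2)] by (simp_all add: c'_def)
  obtain W F where W: "open W" "snd c p \<in> W" "Cinf_on W F"
    "\<forall>y\<in>W \<inter> half_space. y \<in> snd c ` (fst c \<inter> fst c')"
    "\<forall>y\<in>W \<inter> half_space. F y = snd c' (chart_inv c y)"
    using transition_extension[OF c(1) c'(1) c(2) c'(2)] .
  define F1 where "F1 = (\<lambda>v x. frechet_derivative F (at x) v)"
  define F2 where "F2 = (\<lambda>v a x. frechet_derivative (F1 v) (at x) a)"
  have F1: "(F has_derivative (\<lambda>v. F1 v x)) (at x)" if "x \<in> W" for x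
    using Cinf_onD[OF W(3) that] by (simp add: F1_def)
  have F1_inf: "Cinf_on W (F1 v)" for v unfolding F1_def by (rule Cinf_on_derivative[OF W(1,3)])
  have F2: "(F1 v has_derivative (\<lambda>a. F2 v a x)) (at x)" if "x \<in> W" for x v
    using Cinf_onD[OF F1_inf that] by (simp add: F2_def)
  have F2_inf: "Cinf_on W (F2 v a)" for v a unfolding F2_def by (rule Cinf_on_derivative[OF W(1) F1_inf])
  have lin1: "linear (\<lambda>v. F1 v x)" if "x \<in> W" for x using F1[OF that] by (rule has_derivative_linear)
  have ev_bound: "\<forall>\<^sub>F q in at p within mint A. norm (f (snd c q)) \<le> norm (f (snd c p)) + 1" if "Cinf_on W f" for f :: "'n coord \<Rightarrow> 'n coord"
  proof -
    have "isCont f (snd c p)"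
      using Cinf_on_continuous[OF that] W(1,2) continuous_on_eq_continuous_at by blast
    from tendsto_norm[OF isCont_tendsto_compose[OF this tendsto_chart[OF c]]]
    have "\<forall>\<^sub>F q in at p within mint A. norm (f (snd c q)) < norm (f (snd c p)) + 1" by (rule order_tendstoD) simp
    then show ?thesis by eventually_elim simp
  qed
  \<comment> \<open>By continuity the coefficients near p exceed their norms at p by at most
    1.\<close>
  define K where "K = 1 + norm (F1 v (snd c p)) + norm (F1 w (snd c p)) + norm (F1 a (snd c p))
      + norm (F2 v a (snd c p)) + norm (F2 w a (snd c p))"
  have K: "K \<ge> 1" by (simp add: K_def)
  define N where "N = real (card (Basis :: 'n coord set))"
  have N: "N \<ge> 1" using DIM_positive[where 'a="'n coord"] by (simp add: N_def)
  \<comment> \<open>N^2 pairs of basis vectors; in each, the derivative of u in direction F1 a is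
    itself a sum of N terms, and the product rule for the coefficients gives two more.\<close>
  define C' where "C' = N * (N * (K * K * (N * (K * C)) + 2 * (K * K * C)))"
  have C'0: "C' \<ge> 0" using N K C by (simp add: C'_def)
  have "\<forall>\<^sub>F q in at p within mint A. \<rho> q < 1" using tendsto_rho[OF p] by (rule order_tendstoD) simp
  with eventually_chart[OF c W(1,2)] ev_bound[OF F1_inf[of v]] ev_bound[OF F1_inf[of w]] ev_bound[OF F1_inf[of a]]
    ev_bound[OF F2_inf[of v a]] ev_bound[OF F2_inf[of w a]]
  have "\<forall>\<^sub>F q in at p within mint A. good u C V \<theta> q \<longrightarrow>
     (\<lambda>x. u c (chart_inv c x) v w) differentiable at (snd c q) \<and> \<bar>u c q v w\<bar> \<le> C' \<and>
     \<bar>frechet_derivative (\<lambda>x. u c (chart_inv c x) v w) (at (snd c q)) a\<bar> \<le> C' / \<rho> q"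
  proof eventually_elim
    fix q
    assume q: "q \<in> mint A \<and> q \<in> fst c \<and> snd c q \<in> W \<and> snd (snd c q) > 0" and \<rho>1: "\<rho> q < 1"
      and K1: "norm (F1 v (snd c q)) \<le> norm (F1 v (snd c p)) + 1" "norm (F1 w (snd c q)) \<le> norm (F1 w (snd c p)) + 1"
        "norm (F1 a (snd c q)) \<le> norm (F1 a (snd c p)) + 1" "norm (F2 v a (snd c q)) \<le> norm (F2 v a (snd c p)) + 1"
        "norm (F2 w a (snd c q)) \<le> norm (F2 w a (snd c p)) + 1"
    define x0 where "x0 = snd c q"
    have x0W: "x0 \<in> W" using q by (simp add: x0_def)
    have \<rho>0: "\<rho> q > 0" using q by (simp add: mint_iff)
    have comp_le: "\<bar>y \<bullet> e\<bar> \<le> K" if "norm y \<le> K" "e \<in> Basis" for y e :: "'n coord"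
      using Basis_le_norm[OF that(2), of y] that(1) by linarith
    have nn: "norm (F1 v x0) \<le> K" "norm (F1 w x0) \<le> K" "norm (F1 a x0) \<le> K" "norm (F2 v a x0) \<le> K" "norm (F2 w a x0) \<le> K"
      using K1 norm_ge_zero[of "F1 v (snd c p)"] norm_ge_zero[of "F1 w (snd c p)"] norm_ge_zero[of "F1 a (snd c p)"]
        norm_ge_zero[of "F2 v a (snd c p)"] norm_ge_zero[of "F2 w a (snd c p)"]
      unfolding K_def x0_def by linarith+
    show "good u C V \<theta> q \<longrightarrow>
     (\<lambda>x. u c (chart_inv c x) v w) differentiable at (snd c q) \<and> \<bar>u c q v w\<bar> \<le> C' \<and>
     \<bar>frechet_derivative (\<lambda>x. u c (chart_inv c x) v w) (at (snd c q)) a\<bar> \<le> C' / \<rho> q"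
    proof
      assume g: "good u C V \<theta> q"
      define E where "E = (\<lambda>e f y. u c' (chart_inv c' y) e f)"
      define DE where "DE = (\<lambda>e f. frechet_derivative (E e f) (at (snd c' q)))"
      have qc': "q \<in> fst c'" using g by (simp add: good_def c'_def)
      have E_deriv: "(E e f has_derivative DE e f) (at (snd c' q))" if "e \<in> Basis" "f \<in> Basis" for e f
        using g that unfolding good_def c'_def[symmetric] DE_def E_def frechet_derivative_works by blast
      have E_bound: "\<bar>E e f (snd c' q)\<bar> \<le> C" if "e \<in> Basis" "f \<in> Basis" for e f
        using g that unfolding good_def c'_def[symmetric] E_def by (simp add: chart_inv_left c' qc')
      have DE_bound: "\<bar>DE e f b\<bar> \<le> C / \<rho> q" if "e \<in> Basis" "f \<in> Basis" "b \<in> Basis" for e f b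
        using g that unfolding good_def c'_def[symmetric] DE_def E_def by blast
      have Fx0: "F x0 = snd c' q"
        using W(5) x0W q chart_half[OF c(1), of q] by (simp add: x0_def chart_inv_left c)
      \<comment> \<open>The restriction to positive height places the point in the interior, where u
        satisfies the transformation law.\<close>
      have expand: "u c (chart_inv c x) v w = (\<Sum>e\<in>Basis. \<Sum>f\<in>Basis. ((F1 v x \<bullet> e) * (F1 w x \<bullet> f)) * E e f (F x))"
        if x: "x \<in> W \<inter> {x. snd x > 0}" for x
      proof -
        have xh: "x \<in> W \<inter> half_space" using x by (auto simp: half_space_def)
        then obtain y where y: "y \<in> fst c" "y \<in> fst c'" "x = snd c y" using W(4) by blast
        have ym: "y \<in> mint A"
          using boundary_chart[OF c(1) y(1)] x y fst_subset[OF c(1)] by (auto simp: mint_eq)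
        have Fy: "F x = snd c' y" using W(5) xh y by (simp add: chart_inv_left c)
        have "u c y v w = u c' y (dtrans c c' y v) (dtrans c c' y w)"
          using tensor2_onD(2)[OF u c(1) c'(1) y(1,2) ym] .
        also have "\<dots> = u c' y (F1 v x) (F1 w x)"
          using transition_derivative[OF c(1) c'(1) y(1) _ W(1,3,5)] xh y(3) by (simp add: F1_def)
        also have "\<dots> = (\<Sum>e\<in>Basis. \<Sum>f\<in>Basis. ((F1 v x \<bullet> e) * (F1 w x \<bullet> f)) * u c' y e f)"
          using bilinear_expand[OF tensor2_onD(1)[OF u c'(1) y(2) ym], of "F1 v x" "F1 w x"] by simp
        finally show ?thesis using y Fy by (simp add: E_def chart_inv_left c c')
      qed
      let ?D = "\<lambda>a. \<Sum>e\<in>Basis. \<Sum>f\<in>Basis. ((F1 v x0 \<bullet> e) * (F1 w x0 \<bullet> f)) * DE e f (F1 a x0) +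
          ((F1 v x0 \<bullet> e) * (F2 w a x0 \<bullet> f) + (F2 v a x0 \<bullet> e) * (F1 w x0 \<bullet> f)) * E e f (F x0)"
      have "((\<lambda>x. \<Sum>e\<in>Basis. \<Sum>f\<in>Basis. ((F1 v x \<bullet> e) * (F1 w x \<bullet> f)) * E e f (F x)) has_derivative ?D) (at x0)"
      proof (intro has_derivative_sum has_derivative_mult has_derivative_inner_left F2 x0W)
        fix e f :: "'n coord" assume "e \<in> Basis" "f \<in> Basis"
        from E_deriv[OF this] show "((\<lambda>x. E e f (F x)) has_derivative (\<lambda>a. DE e f (F1 a x0))) (at x0)"
          unfolding Fx0[symmetric] by (rule has_derivative_compose[OF F1[OF x0W]])
      qed
      then have D: "((\<lambda>x. u c (chart_inv c x) v w) has_derivative ?D) (at x0)"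
      proof (rule has_derivative_transform_within_open)
        show "open (W \<inter> {x. snd x > 0})" using W(1) by (intro open_Int open_Collect_less continuous_intros)
        show "x0 \<in> W \<inter> {x. snd x > 0}" using q by (simp add: x0_def)
      qed (simp add: expand)
      have DE1: "\<bar>DE e f (F1 a x0)\<bar> \<le> N * (K * (C / \<rho> q))" if ef: "e \<in> Basis" "f \<in> Basis" for e f
      proof -
        have "DE e f (F1 a x0) = (\<Sum>b\<in>Basis. (F1 a x0 \<bullet> b) * DE e f b)"
          using linear_expand[OF has_derivative_linear[OF E_deriv[OF ef]], of "F1 a x0"] by simp
        also have "\<bar>\<dots>\<bar> \<le> (\<Sum>b\<in>(Basis :: 'n coord set). K * (C / \<rho> q))"
          unfolding abs_mult
        proof (intro order.trans[OF sum_abs] sum_mono)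
          fix b :: "'n coord" assume "b \<in> Basis"
          then show "\<bar>(F1 a x0 \<bullet> b) * DE e f b\<bar> \<le> K * (C / \<rho> q)"
            unfolding abs_mult using K by (intro mult_mono comp_le nn DE_bound ef) auto
        qed
        finally show ?thesis by (simp add: N_def)
      qed
      have C\<rho>: "C \<le> C / \<rho> q" using \<rho>0 \<rho>1 C by (simp add: field_simps mult_left_le)
      have val: "\<bar>u c q v w\<bar> \<le> N * (N * (K * K * C))"
      proof -
        have "u c q v w = (\<Sum>e\<in>Basis. \<Sum>f\<in>Basis. ((F1 v x0 \<bullet> e) * (F1 w x0 \<bullet> f)) * E e f (F x0))"
          using expand[of x0] q by (simp add: x0_def chart_inv_left c)
        also have "\<bar>\<dots>\<bar> \<le> (\<Sum>e\<in>(Basis :: 'n coord set). \<Sum>f\<in>(Basis :: 'n coord set). K * K * C)"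
        proof (intro order.trans[OF sum_abs] sum_mono)
          fix e f :: "'n coord" assume "e \<in> Basis" "f \<in> Basis"
          then show "\<bar>((F1 v x0 \<bullet> e) * (F1 w x0 \<bullet> f)) * E e f (F x0)\<bar> \<le> K * K * C"
            unfolding abs_mult Fx0 using K by (intro mult_mono comp_le nn E_bound) auto
        qed
        finally show ?thesis by (simp add: N_def)
      qed
      have der: "\<bar>?D a\<bar> \<le> N * (N * (K * K * (N * (K * (C / \<rho> q))) + 2 * (K * K * (C / \<rho> q))))"
      proof -
        have "\<bar>?D a\<bar> \<le> (\<Sum>e\<in>(Basis :: 'n coord set). \<Sum>f\<in>(Basis :: 'n coord set). K * K * (N * (K * (C / \<rho> q))) + 2 * (K * K * (C / \<rho> q)))"
        proof (intro order.trans[OF sum_abs] sum_mono)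
          fix e f :: "'n coord" assume ef: "e \<in> Basis" "f \<in> Basis"
          have 1: "\<bar>((F1 v x0 \<bullet> e) * (F1 w x0 \<bullet> f)) * DE e f (F1 a x0)\<bar> \<le> K * K * (N * (K * (C / \<rho> q)))"
            unfolding abs_mult using K ef by (intro mult_mono comp_le nn DE1) auto
          have 2: "\<bar>(F1 v x0 \<bullet> e) * (F2 w a x0 \<bullet> f) + (F2 v a x0 \<bullet> e) * (F1 w x0 \<bullet> f)\<bar> \<le> K * K + K * K"
          proof (intro order.trans[OF abs_triangle_ineq] add_mono)
            show "\<bar>(F1 v x0 \<bullet> e) * (F2 w a x0 \<bullet> f)\<bar> \<le> K * K" "\<bar>(F2 v a x0 \<bullet> e) * (F1 w x0 \<bullet> f)\<bar> \<le> K * K"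
              unfolding abs_mult using K ef by (intro mult_mono comp_le nn; simp)+
          qed
          have "\<bar>((F1 v x0 \<bullet> e) * (F2 w a x0 \<bullet> f) + (F2 v a x0 \<bullet> e) * (F1 w x0 \<bullet> f)) * E e f (F x0)\<bar> \<le> (K * K + K * K) * (C / \<rho> q)"
            unfolding abs_mult[of "_ + _"] Fx0 using 2 E_bound[OF ef] C\<rho> K by (intro mult_mono) auto
          then show "\<bar>((F1 v x0 \<bullet> e) * (F1 w x0 \<bullet> f)) * DE e f (F1 a x0) +
            ((F1 v x0 \<bullet> e) * (F2 w a x0 \<bullet> f) + (F2 v a x0 \<bullet> e) * (F1 w x0 \<bullet> f)) * E e f (F x0)\<bar>
            \<le> K * K * (N * (K * (C / \<rho> q))) + 2 * (K * K * (C / \<rho> q))"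
            using 1 by (intro order.trans[OF abs_triangle_ineq] add_mono) (auto simp: algebra_simps)
        qed
        then show ?thesis by (simp add: N_def)
      qed
      show "(\<lambda>x. u c (chart_inv c x) v w) differentiable at (snd c q) \<and> \<bar>u c q v w\<bar> \<le> C' \<and>
        \<bar>frechet_derivative (\<lambda>x. u c (chart_inv c x) v w) (at (snd c q)) a\<bar> \<le> C' / \<rho> q"
      proof (intro conjI)
        show "(\<lambda>x. u c (chart_inv c x) v w) differentiable at (snd c q)"
          using D unfolding x0_def by (rule differentiableI)
        have "K * K * C \<le> K * K * (N * (K * C)) + 2 * (K * K * C)"
          using K N C by (intro add_increasing) auto
        then have "N * (N * (K * K * C)) \<le> C'" unfolding C'_def using N by (intro mult_left_mono) auto
        then show "\<bar>u c q v w\<bar> \<le> C'" using val by linarith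
        have "\<bar>?D a\<bar> \<le> C' / \<rho> q"
          using der unfolding C'_def by (simp add: algebra_simps add_divide_distrib)
        then show "\<bar>frechet_derivative (\<lambda>x. u c (chart_inv c x) v w) (at (snd c q)) a\<bar> \<le> C' / \<rho> q"
          unfolding x0_def[symmetric] frechet_derivative_at[OF D, symmetric] .
      qed
    qed
  qed
  with C'0 show ?thesis by (rule that)
qed

text \<open>By \<open>localization\<close> each q near p is handled by one of finitely many
  background charts containing p. Which one depends on q, so the sum of their nonnegative constants
  is used.\<close>

lemma tensor_bound:
  assumes u: "u \<in> weighted_Ck_tensors A \<rho> I \<Phi> k \<alpha> 2" and k: "k \<ge> 1" and ut: "tensor2_on A (mint A) u"
    and p: "p \<in> mbdry A" and c: "c \<in> A" "p \<in> fst c"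
  obtains C where "\<forall>\<^sub>F q in at p within mint A.
     (\<lambda>x. u c (chart_inv c x) v w) differentiable at (snd c q) \<and> \<bar>u c q v w\<bar> \<le> C \<and>
     \<bar>frechet_derivative (\<lambda>x. u c (chart_inv c x) v w) (at (snd c q)) a\<bar> \<le> C / \<rho> q"
proof -
  obtain C0 where C0: "C0 \<ge> 0" "\<And>i U V \<theta> p0 z. i \<in> I \<Longrightarrow> moeb i U V \<theta> p0 \<Longrightarrow> z \<in> hyp_ball 1 \<Longrightarrow> good u C0 V \<theta> (\<Phi> i z)"
    using weighted_moebius_bounds[OF u k] by metis
  define P where "P = (\<lambda>C q. (\<lambda>x. u c (chart_inv c x) v w) differentiable at (snd c q) \<and> \<bar>u c q v w\<bar> \<le> C \<and>
     \<bar>frechet_derivative (\<lambda>x. u c (chart_inv c x) v w) (at (snd c q)) a\<bar> \<le> C / \<rho> q)"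
  define B' where "B' = {b\<in>B. p \<in> fst (snd b)}"
  have fin: "finite B'" using bg by (simp add: B'_def background_charts_def)
  have "\<forall>b\<in>B'. \<exists>C'\<ge>0. \<forall>\<^sub>F q in at p within mint A. good u C0 (fst (snd b)) (snd (snd b)) q \<longrightarrow> P C' q"
  proof
    fix b assume "b \<in> B'"
    then have b: "(fst b, fst (snd b), snd (snd b)) \<in> B" "p \<in> fst (snd b)" by (auto simp: B'_def)
    obtain C' where "C' \<ge> 0" "\<forall>\<^sub>F q in at p within mint A. good u C0 (fst (snd b)) (snd (snd b)) q \<longrightarrow> P C' q"
      by (rule good_transfer[OF ut C0(1) p c b, of v w a]) (rule that, assumption, simp only: P_def)
    then show "\<exists>C'\<ge>0. \<forall>\<^sub>F q in at p within mint A. good u C0 (fst (snd b)) (snd (snd b)) q \<longrightarrow> P C' q" by blast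
  qed
  then obtain f where f: "\<And>b. b \<in> B' \<Longrightarrow> f b \<ge> 0"
    "\<And>b. b \<in> B' \<Longrightarrow> \<forall>\<^sub>F q in at p within mint A. good u C0 (fst (snd b)) (snd (snd b)) q \<longrightarrow> P (f b) q"
    by metis
  have "\<forall>\<^sub>F q in at p within mint A. \<forall>b\<in>B'. good u C0 (fst (snd b)) (snd (snd b)) q \<longrightarrow> P (f b) q"
    using f(2) by (intro eventually_ball_finite fin ballI)
  with localization[OF p] eventually_mint have "\<forall>\<^sub>F q in at p within mint A. P (\<Sum>b\<in>B'. f b) q"
  proof eventually_elim
    fix q assume "\<exists>i\<in>I. \<exists>U V \<theta> p0 z. moeb i U V \<theta> p0 \<and> p \<in> V \<and> z \<in> hyp_ball 1 \<and> q = \<Phi> i z"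
      and qm: "q \<in> mint A" and all: "\<forall>b\<in>B'. good u C0 (fst (snd b)) (snd (snd b)) q \<longrightarrow> P (f b) q"
    then obtain i U V \<theta> p0 z where *: "i \<in> I" "moeb i U V \<theta> p0" "p \<in> V" "z \<in> hyp_ball 1" "q = \<Phi> i z" by blast
    have b: "(U, V, \<theta>) \<in> B'" using moebD(1)[OF *(2)] *(3) by (simp add: B'_def)
    have "good u C0 V \<theta> q" using C0(2)[OF *(1,2,4)] *(5) by simp
    then have Pb: "P (f (U, V, \<theta>)) q" using all b by fastforce
    have le: "f (U, V, \<theta>) \<le> (\<Sum>b\<in>B'. f b)" using f(1) b fin by (intro member_le_sum) auto
    moreover have "f (U, V, \<theta>) / \<rho> q \<le> (\<Sum>b\<in>B'. f b) / \<rho> q"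
      using le qm by (intro divide_right_mono) (auto simp: mint_iff)
    ultimately show "P (\<Sum>b\<in>B'. f b) q" using Pb unfolding P_def by force
  qed
  then show ?thesis unfolding P_def by (rule that)
qed

end

section \<open>Boundary behaviour of the metric\<close>

lemma tendsto_iff_limit_eq:
  fixes L :: "'b::t2_space"
  assumes "F \<noteq> bot" "(f \<longlongrightarrow> L) F" shows "(f \<longlongrightarrow> M) F \<longleftrightarrow> L = M"
  using assms tendsto_unique by blast

context compact_mfd
begin

lemma christoffel_eq:
  assumes "c \<in> A" "q \<in> fst c"
  shows "christoffel g c q u v = chris (\<lambda>x. g c (chart_inv c x)) (snd c q) u v"
  using chart_inv_left[OF assms] by (simp add: christoffel_def chris_def koszul_def[abs_def] dform_def Let_def)

lemma riemann_eq:
  assumes c: "c \<in> A" "q \<in> fst c"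
    and S: "open S" "snd c q \<in> S" "S \<subseteq> snd c ` fst c"
  shows "riemann g c q u v w = rie (\<lambda>x. g c (chart_inv c x)) (snd c q) u v w"
proof -
  let ?G = "\<lambda>x. g c (chart_inv c x)"
  have "frechet_derivative (\<lambda>x. christoffel g c (chart_inv c x) b e) (at (snd c q)) =
      frechet_derivative (\<lambda>x. chris ?G x b e) (at (snd c q))" for b e
  proof (rule frechet_derivative_cong_open[OF S(1,2)])
    fix y assume "y \<in> S"
    then have "y \<in> snd c ` fst c" using S(3) by blast
    then show "christoffel g c (chart_inv c y) b e = chris ?G y b e"
      using christoffel_eq[OF c(1) chart_inv_in[OF c(1)], of y g b e] chart_inv_right[OF c(1)] by simp
  qed
  then show ?thesis
    by (simp add: riemann_def rie_def Let_def christoffel_eq[OF c])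
qed

lemma interior_chart_nbhd:
  assumes c: "c \<in> A" "q \<in> fst c" and U: "openin (top_of_set Mbar) U" "q \<in> U" and q: "snd (snd c q) > 0"
  obtains S where "open S" "snd c q \<in> S" "S \<subseteq> {x. snd x > 0}" "S \<subseteq> snd c ` (fst c \<inter> U)"
proof -
  obtain W where W: "open W" "snd c q \<in> W" "\<forall>y\<in>W \<inter> half_space. y \<in> snd c ` (fst c \<inter> U)"
    using chart_image_open_sub[OF c(1) U(1) c(2) U(2)] .
  have "open (W \<inter> {x. snd x > 0})" using W(1) by (intro open_Int open_Collect_less continuous_intros)
  then show ?thesis
    by (rule that) (use W q in \<open>auto simp: half_space_def\<close>)
qed

lemma riemannian_onD:
  assumes "riemannian_on A N g" "c \<in> A" "q \<in> fst c" "q \<in> N" shows "inner_form (g c q)"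
  using assms unfolding riemannian_on_def inner_form_def by (auto intro: tensor2_onD)

lemma smooth_metric_tendsto:
  assumes h: "smooth_metric A h" and c: "c \<in> A" "p \<in> fst c"
  shows "((\<lambda>q. h c q v w) \<longlongrightarrow> h c p v w) (at p within mint A)"
proof -
  have sm: "smooth_on (snd c ` fst c) (\<lambda>x. h c (chart_inv c x) v w)" using h c unfolding smooth_metric_def by blast
  have z: "snd c p \<in> snd c ` fst c" using c by auto
  obtain W F where W: "open W" "snd c p \<in> W" "Cinf_on W F" "\<forall>y\<in>snd c ` fst c \<inter> W. F y = h c (chart_inv c y) v w"
    using smooth_onD[OF sm z] .
  have "isCont F (snd c p)"
    using Cinf_on_continuous[OF W(3)] W(1,2) continuous_on_eq_continuous_at by blast
  from isCont_tendsto_compose[OF this tendsto_chart[OF c]]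
  have "((\<lambda>q. F (snd c q)) \<longlongrightarrow> h c p v w) (at p within mint A)" using W(2,4) z c by (simp add: chart_inv_left)
  moreover have "\<forall>\<^sub>F q in at p within mint A. F (snd c q) = h c q v w"
    using eventually_chart[OF c W(1,2)] by eventually_elim (use W(4) c in \<open>auto simp: chart_inv_left\<close>)
  ultimately show ?thesis by (rule Lim_transform_eventually)
qed

lemma smooth_metric_form:
  assumes h: "smooth_metric A h" and c: "c \<in> A" "q \<in> fst c" shows "inner_form (h c q)"
  by (rule riemannian_onD[of "\<Union>c\<in>A. fst c"]) (use h c in \<open>auto simp: smooth_metric_def\<close>)

end

locale ah_metric = collared_mfd Mbar A \<rho> \<rho>s K \<kappa> B I \<Phi>
  for Mbar :: "'a::t2_space set" and A :: "('a, 'n::finite) chart set"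
    and \<rho> \<rho>s K \<kappa> B I \<Phi> +
  fixes h g gbar :: "('a, 'n) tensor2" and k :: nat and \<alpha> :: real
  assumes h: "smooth_metric A h" and k: "k \<ge> 2"
    and g_eq: "g = scale_tensor (\<lambda>p. \<rho> p powr (-2)) gbar"
    and g_riem: "riemannian_on A (mint A) g"
    and gbar: "gbar \<in> weighted_Ck_tensors A \<rho> I \<Phi> k \<alpha> 2"
    and lie: "\<forall>X. smooth_vfield A X \<longrightarrow> lie_deriv X gbar \<in> weighted_Ck_tensors A \<rho> I \<Phi> (k - 1) \<alpha> 2"
    and pd: "\<forall>c\<in>A. \<forall>p\<in>fst c \<inter> mbdry A. sym_pos_def (extend_tensor A gbar c p)"
begin

lemma g_val: "q \<in> mint A \<Longrightarrow> g c q v w = inverse ((\<rho> q)\<^sup>2) * gbar c q v w"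
  by (simp add: g_eq scale_tensor_def mint_iff powr_minus powr_numeral)

lemma weighted_tensor:
  assumes "u \<in> weighted_Ck_tensors A \<rho> I \<Phi> j \<alpha> 2" shows "tensor2_on A (mint A) u"
proof -
  have t: "tensor2_on A (mint A) (scale_tensor (\<lambda>p. \<rho> p powr (- 2)) u)"
    using assms by (simp add: weighted_Ck_tensors_def Ck_tensors_def)
  have pos: "\<rho> q powr (- 2) > 0" if "q \<in> mint A" for q using that by (simp add: mint_iff)
  have u: "u c q v w = inverse (\<rho> q powr (- 2)) * scale_tensor (\<lambda>p. \<rho> p powr (- 2)) u c q v w" if "q \<in> mint A" for c q v w
    using pos[OF that] by (simp add: scale_tensor_def)
  show ?thesis
    unfolding tensor2_on_def
  proof (intro conjI ballI allI)
    fix c q assume c: "c \<in> A" and q: "q \<in> fst c \<inter> mint A"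
    have "u c q = (\<lambda>v w. inverse (\<rho> q powr (- 2)) * scale_tensor (\<lambda>p. \<rho> p powr (- 2)) u c q v w)"
      using q by (intro ext u) auto
    then show "bilinear (u c q)" using bilinear_cmult[OF tensor2_onD(1)[OF t c]] q by auto
  next
    fix c d q v w assume c: "c \<in> A" and d: "d \<in> A" and q: "q \<in> fst c \<inter> fst d \<inter> mint A"
    then have "scale_tensor (\<lambda>p. \<rho> p powr (- 2)) u c q v w = scale_tensor (\<lambda>p. \<rho> p powr (- 2)) u d q (dtrans c d q v) (dtrans c d q w)"
      by (intro tensor2_onD(2)[OF t]) auto
    then show "u c q v w = u d q (dtrans c d q v) (dtrans c d q w)" using u[of q] q by simp
  qed
qed

lemmas gbar_tensor = weighted_tensor[OF gbar]

lemma g_tensor: "tensor2_on A (mint A) g"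
  using g_riem by (simp add: riemannian_on_def)

lemmas g_form = riemannian_onD[OF g_riem]

lemma gbar_form:
  assumes "c \<in> A" "q \<in> fst c" "q \<in> mint A" shows "inner_form (gbar c q)"
proof -
  have r: "\<rho> q > 0" using assms by (simp add: mint_iff)
  have "gbar c q = (\<lambda>v w. (\<rho> q)\<^sup>2 * g c q v w)" using r by (intro ext) (simp add: g_val[OF assms(3)])
  then show ?thesis using inner_form_scale[OF g_form[OF assms], of "(\<rho> q)\<^sup>2"] r by simp
qed

end

section \<open>The metric near a fixed boundary point\<close>

locale ah_point = ah_metric +
  fixes p :: 'a and U V :: "'a set" and \<theta> :: "'a \<Rightarrow> real^'b"
  assumes p: "p \<in> mbdry A" and b: "(U, V, \<theta>) \<in> B" and pV: "p \<in> V"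
begin

definition c where "c = bgc V \<theta>"

lemma c: "c \<in> A" "p \<in> fst c"
  using bgc_chart[OF b] bdry_in_bgc[OF p pV] by (simp_all add: c_def)

lemma snd_c: "snd (snd c q) = \<rho> q"
  by (simp add: c_def snd_bgc)

definition G where "G = (\<lambda>x. gbar c (chart_inv c x))"

definition Fp where "Fp = at p within mint A"

lemma Fp_nontrivial: "Fp \<noteq> bot"
  unfolding Fp_def by (rule bdry_nontrivial[OF p])

text \<open>For a vector field with constant components near \<open>p\<close> the Lie derivative is the directional derivative.\<close>

lemma dform_eq_lie:
  obtains X where "smooth_vfield A X"
    "\<forall>\<^sub>F q in Fp. \<exists>S. open S \<and> snd c q \<in> S \<and> (\<forall>y\<in>S. \<forall>v w. dform G y a v w = lie_deriv X gbar c (chart_inv c y) v w)"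
proof -
  obtain X N where X: "smooth_vfield A X" "openin (top_of_set Mbar) N" "p \<in> N" "N \<subseteq> fst c" "\<forall>q\<in>N. X c q = a"
    using vector_field_exists[OF c] .
  have nbhd: "\<exists>S. open S \<and> snd c q \<in> S \<and> S \<subseteq> {x. snd x > 0} \<and> S \<subseteq> snd c ` (fst c \<inter> N)"
    if q: "q \<in> N" "q \<in> mint A" for q
  proof -
    have qc: "q \<in> fst c" using q X by auto
    show ?thesis
      by (rule interior_chart_nbhd[OF c(1) qc X(2) q(1) mint_pos[OF c(1) qc q(2)]]) blast
  qed
  have eq: "dform G (snd c q) a v w = lie_deriv X gbar c q v w" if q: "q \<in> N" "q \<in> mint A" for q v w
  proof -
    have qc: "q \<in> fst c" using q X by auto
    obtain S where S: "open S" "snd c q \<in> S" "S \<subseteq> snd c ` (fst c \<inter> N)" using nbhd[OF q] by blast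
    have "frechet_derivative (\<lambda>x. X c (chart_inv c x)) (at (snd c q)) = frechet_derivative (\<lambda>x. a) (at (snd c q))"
    proof (rule frechet_derivative_cong_open[OF S(1,2)])
      fix y assume "y \<in> S"
      then obtain q' where "q' \<in> fst c" "q' \<in> N" "y = snd c q'" using S(3) by blast
      then show "X c (chart_inv c y) = a" using X(5) by (simp add: chart_inv_left c)
    qed
    then have "frechet_derivative (\<lambda>x. X c (chart_inv c x)) (at (snd c q)) = (\<lambda>v. 0)" by simp
    then show ?thesis
      using X(5) q(1) inner_form_bilinear[OF gbar_form[OF c(1) qc q(2)]]
      by (simp add: lie_deriv_def dform_def G_def bilinear_lzero bilinear_rzero)
  qed
  have "\<forall>\<^sub>F q in Fp. q \<in> N \<and> q \<in> mint A"
    unfolding Fp_def using eventually_bdryI[OF X(2,3)] eventually_mint by eventually_elim simp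
  then have "\<forall>\<^sub>F q in Fp. \<exists>S. open S \<and> snd c q \<in> S \<and> (\<forall>y\<in>S. \<forall>v w. dform G y a v w = lie_deriv X gbar c (chart_inv c y) v w)"
  proof eventually_elim
    case (elim q)
    then obtain S where S: "open S" "snd c q \<in> S" "S \<subseteq> {x. snd x > 0}" "S \<subseteq> snd c ` (fst c \<inter> N)"
      using nbhd[of q] by blast
    have "\<forall>v w. dform G y a v w = lie_deriv X gbar c (chart_inv c y) v w" if y: "y \<in> S" for y
    proof -
      obtain q' where q': "q' \<in> fst c" "q' \<in> N" "y = snd c q'" using S(4) y by blast
      have "\<rho> q' > 0" using S(3) y q' snd_c by auto
      then have "q' \<in> mint A" using fst_subset[OF c(1)] q' by (auto simp: mint_iff)
      then show ?thesis using eq[OF q'(2)] q'(3) chart_inv_left[OF c(1) q'(1)] by metis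
    qed
    then show ?case using S(1,2) by blast
  qed
  with X(1) show ?thesis by (rule that)
qed

text \<open>The derivative of G is a value of the Lie derivative, hence bounded, and its second
  derivative is a first derivative of the Lie derivative, hence O(1/\<rho>); this uses k - 1 >=
  1.\<close>

lemma G_bounds:
  obtains C where "\<forall>\<^sub>F q in Fp. (\<lambda>y. G y v w) differentiable (at (snd c q)) \<and>
    \<bar>dform G (snd c q) a v w\<bar> \<le> C \<and> (\<lambda>y. dform G y a v w) differentiable (at (snd c q)) \<and>
    \<bar>d2form G (snd c q) e a v w\<bar> \<le> C / \<rho> q"
proof -
  obtain X where X: "smooth_vfield A X"
    "\<forall>\<^sub>F q in Fp. \<exists>S. open S \<and> snd c q \<in> S \<and> (\<forall>y\<in>S. \<forall>v w. dform G y a v w = lie_deriv X gbar c (chart_inv c y) v w)"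
    by (rule dform_eq_lie)
  define L where "L = (\<lambda>y. lie_deriv X gbar c (chart_inv c y) v w)"
  have lieX: "lie_deriv X gbar \<in> weighted_Ck_tensors A \<rho> I \<Phi> (k - 1) \<alpha> 2" using lie X(1) by blast
  have k1: "1 \<le> k - 1" "1 \<le> k" using k by auto
  obtain C0 where C0: "\<forall>\<^sub>F q in at p within mint A.
     (\<lambda>x. gbar c (chart_inv c x) v w) differentiable at (snd c q) \<and> \<bar>gbar c q v w\<bar> \<le> C0 \<and>
     \<bar>frechet_derivative (\<lambda>x. gbar c (chart_inv c x) v w) (at (snd c q)) a\<bar> \<le> C0 / \<rho> q"
    by (rule tensor_bound[OF gbar k1(2) gbar_tensor p c])
  obtain C where C: "\<forall>\<^sub>F q in at p within mint A. L differentiable at (snd c q) \<and> \<bar>lie_deriv X gbar c q v w\<bar> \<le> C \<and>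
     \<bar>frechet_derivative L (at (snd c q)) e\<bar> \<le> C / \<rho> q"
    unfolding L_def by (rule tensor_bound[OF lieX k1(1) weighted_tensor[OF lieX] p c])
  have "\<forall>\<^sub>F q in Fp. (\<lambda>y. G y v w) differentiable (at (snd c q)) \<and>
    \<bar>dform G (snd c q) a v w\<bar> \<le> C \<and> (\<lambda>y. dform G y a v w) differentiable (at (snd c q)) \<and>
    \<bar>d2form G (snd c q) e a v w\<bar> \<le> C / \<rho> q"
    using X(2) C0[folded Fp_def] C[folded Fp_def] eventually_bdryI[OF chart_openin[OF c(1)] c(2), folded Fp_def]
  proof eventually_elim
    case (elim q)
    \<comment> \<open>The identity with the Lie derivative holds on a neighborhood of the point, so
      it may be differentiated.\<close>
    then obtain S where S: "open S" "snd c q \<in> S" and loc: "\<And>y. y \<in> S \<Longrightarrow> dform G y a v w = L y"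
      unfolding L_def by blast
    have L: "(L has_derivative frechet_derivative L (at (snd c q))) (at (snd c q))"
      using elim(3) frechet_derivative_works by blast
    have "((\<lambda>y. dform G y a v w) has_derivative frechet_derivative L (at (snd c q))) (at (snd c q))"
      by (rule has_derivative_transform_within_open[OF L S]) (rule loc[symmetric])
    moreover have "frechet_derivative (\<lambda>y. dform G y a v w) (at (snd c q)) = frechet_derivative L (at (snd c q))"
      by (rule frechet_derivative_cong_open[OF S loc])
    ultimately show ?case
      using elim(2,3) loc[OF S(2)] chart_inv_left[OF c(1) elim(4)] differentiableI
      by (auto simp: d2form_def L_def G_def)
  qed
  then show ?thesis by (rule that)
qed

definition halfball where "halfball r = ball (snd c p) r \<inter> {x. snd x > 0}"

lemma open_halfball: "open (halfball r)"
  unfolding halfball_def by (intro open_Int open_ball open_Collect_less continuous_intros)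

lemma eventually_halfball:
  assumes "r > 0" shows "\<forall>\<^sub>F q in Fp. snd c q \<in> halfball r"
  using eventually_chart[OF c open_ball, of "snd c p" r] assms unfolding Fp_def halfball_def
  by (auto elim: eventually_mono)

lemma halfballE:
  assumes "eventually P Fp"
  obtains r where "r > 0" "\<forall>x\<in>halfball r. x \<in> snd c ` fst c \<and> chart_inv c x \<in> mint A \<and> P (chart_inv c x)"
proof -
  obtain r where "r > 0" "\<forall>x. dist x (snd c p) < r \<longrightarrow> snd x > 0 \<longrightarrow>
    x \<in> snd c ` fst c \<and> chart_inv c x \<in> mint A \<and> P (chart_inv c x)"
    using eventually_bdry_chart[OF b p pV assms[unfolded Fp_def]] unfolding c_def .
  then show ?thesis by (intro that[of r]) (auto simp: halfball_def dist_commute)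
qed

lemma metric_field_G:
  obtains r where "r > 0" "metric_field G (halfball r)" "\<forall>x\<in>halfball r. x \<in> snd c ` fst c \<and> chart_inv c x \<in> mint A"
proof -
  define P where "P = (\<lambda>q. \<forall>v\<in>Basis. \<forall>w\<in>Basis. \<forall>a\<in>Basis. (\<lambda>y. G y v w) differentiable (at (snd c q)) \<and>
      (\<lambda>y. dform G y a v w) differentiable (at (snd c q)))"
  have "eventually P Fp"
    unfolding P_def
  proof (intro eventually_ball_finite ballI finite_Basis)
    fix v w a :: "'b coord"
    show "\<forall>\<^sub>F q in Fp. (\<lambda>y. G y v w) differentiable (at (snd c q)) \<and> (\<lambda>y. dform G y a v w) differentiable (at (snd c q))"
      by (rule G_bounds[of v w a 0]) (auto elim: eventually_mono)
  qed
  then obtain r where r: "r > 0" "\<forall>x\<in>halfball r. x \<in> snd c ` fst c \<and> chart_inv c x \<in> mint A \<and> P (chart_inv c x)"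
    by (rule halfballE)
  have "metric_field G (halfball r)"
  proof (rule metric_fieldI_basis[OF open_halfball])
    fix x assume x: "x \<in> halfball r"
    then have x': "x \<in> snd c ` fst c" "chart_inv c x \<in> mint A" "P (chart_inv c x)" using r by auto
    have x_eq: "snd c (chart_inv c x) = x" using chart_inv_right[OF c(1) x'(1)] .
    show "inner_form (G x)" unfolding G_def by (rule gbar_form[OF c(1) chart_inv_in[OF c(1) x'(1)] x'(2)])
    fix v w :: "'b coord" assume vw: "v \<in> Basis" "w \<in> Basis"
    show "(\<lambda>y. G y v w) differentiable at x" using x'(3) vw nonempty_Basis unfolding P_def x_eq by blast
    fix a :: "'b coord" assume "a \<in> Basis"
    then show "(\<lambda>y. dform G y a v w) differentiable at x" using x'(3) vw unfolding P_def x_eq by blast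
  qed
  with r show ?thesis using that by blast
qed

lemma c_p_zero: "snd (snd c p) = 0"
  using boundary_chart[OF c p] .

text \<open>Bounded derivatives on a convex half-ball make G Lipschitz, hence uniformly continuous,
  so it has a limit at the boundary point; the limit is the value that \<open>Lim\<close> picks in
  \<open>extend_tensor\<close>.\<close>

lemma gbar_limit: "((\<lambda>q. gbar c q v w) \<longlongrightarrow> extend_tensor A gbar c p v w) Fp"
proof -
  have "\<forall>a. \<exists>C. \<forall>\<^sub>F q in Fp. (\<lambda>y. G y v w) differentiable (at (snd c q)) \<and> \<bar>dform G (snd c q) a v w\<bar> \<le> C"
  proof
    fix a
    obtain C where "\<forall>\<^sub>F q in Fp. (\<lambda>y. G y v w) differentiable (at (snd c q)) \<and>
      \<bar>dform G (snd c q) a v w\<bar> \<le> C \<and> (\<lambda>y. dform G y a v w) differentiable (at (snd c q)) \<and>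
      \<bar>d2form G (snd c q) 0 a v w\<bar> \<le> C / \<rho> q" by (rule G_bounds)
    then have "\<forall>\<^sub>F q in Fp. (\<lambda>y. G y v w) differentiable (at (snd c q)) \<and> \<bar>dform G (snd c q) a v w\<bar> \<le> C"
      by eventually_elim simp
    then show "\<exists>C. \<forall>\<^sub>F q in Fp. (\<lambda>y. G y v w) differentiable (at (snd c q)) \<and> \<bar>dform G (snd c q) a v w\<bar> \<le> C" ..
  qed
  from choice[OF this] obtain C where C: "\<forall>a. \<forall>\<^sub>F q in Fp. (\<lambda>y. G y v w) differentiable (at (snd c q)) \<and> \<bar>dform G (snd c q) a v w\<bar> \<le> C a"
    by (elim exE)
  have "\<forall>\<^sub>F q in Fp. \<forall>a\<in>Basis. (\<lambda>y. G y v w) differentiable (at (snd c q)) \<and> \<bar>dform G (snd c q) a v w\<bar> \<le> C a"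
    using C by (intro eventually_ball_finite ballI finite_Basis) blast
  then obtain r where r: "r > 0" "\<forall>x\<in>halfball r. x \<in> snd c ` fst c \<and> chart_inv c x \<in> mint A \<and>
      (\<forall>a\<in>Basis. (\<lambda>y. G y v w) differentiable (at (snd c (chart_inv c x))) \<and> \<bar>dform G (snd c (chart_inv c x)) a v w\<bar> \<le> C a)"
    by (rule halfballE)
  define L where "L = (\<Sum>a\<in>Basis. \<bar>C a\<bar>)"
  have deriv: "((\<lambda>y. G y v w) has_derivative (\<lambda>a. dform G x a v w)) (at x)"
    and bound: "\<forall>a\<in>Basis. \<bar>dform G x a v w\<bar> \<le> C a" if x: "x \<in> halfball r" for x
  proof -
    have "snd c (chart_inv c x) = x" using r(2) x chart_inv_right[OF c(1)] by blast
    then have *: "\<forall>a\<in>Basis. (\<lambda>y. G y v w) differentiable (at x) \<and> \<bar>dform G x a v w\<bar> \<le> C a" using r(2) x by fastforce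
    then show "\<forall>a\<in>Basis. \<bar>dform G x a v w\<bar> \<le> C a" by blast
    have "(\<lambda>y. G y v w) differentiable (at x)" using * nonempty_Basis by blast
    then show "((\<lambda>y. G y v w) has_derivative (\<lambda>a. dform G x a v w)) (at x)"
      unfolding dform_def frechet_derivative_works by (simp add: eta_contract_eq)
  qed
  have cvx: "convex (halfball r)"
  proof -
    have "convex {x :: 'b coord. snd x > 0}"
      using convex_halfspace_gt[of 0 "(0, 1) :: 'b coord"] by (simp add: inner_prod_def)
    then show ?thesis unfolding halfball_def by (intro convex_Int convex_ball)
  qed
  have lip: "norm (G x v w - G y v w) \<le> L * norm (x - y)" if "x \<in> halfball r" "y \<in> halfball r" for x y
  proof (rule differentiable_bound[OF cvx _ _ that])
    fix x assume x: "x \<in> halfball r"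
    show "((\<lambda>y. G y v w) has_derivative (\<lambda>a. dform G x a v w)) (at x within halfball r)"
      using deriv[OF x] by (rule has_derivative_at_withinI)
    show "onorm (\<lambda>a. dform G x a v w) \<le> L"
    proof (rule onorm_bound)
      show "0 \<le> L" by (auto simp: L_def intro: sum_nonneg)
      fix y
      have "dform G x y v w = (\<Sum>a\<in>Basis. (y \<bullet> a) * dform G x a v w)"
        using linear_expand[OF has_derivative_linear[OF deriv[OF x]], of y] by simp
      also have "\<bar>\<dots>\<bar> \<le> (\<Sum>a\<in>Basis. norm y * \<bar>C a\<bar>)"
      proof (intro order.trans[OF sum_abs] sum_mono)
        fix a :: "'b coord" assume a: "a \<in> Basis"
        then have "\<bar>dform G x a v w\<bar> \<le> \<bar>C a\<bar>" using bound[OF x] by fastforce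
        then show "\<bar>(y \<bullet> a) * dform G x a v w\<bar> \<le> norm y * \<bar>C a\<bar>"
          unfolding abs_mult using Basis_le_norm[OF a, of y] by (intro mult_mono) auto
      qed
      also have "\<dots> = L * norm y" by (simp add: L_def sum_distrib_left mult.commute)
      finally show "norm (dform G x y v w) \<le> L * norm y" by simp
    qed
  qed
  have L0: "L \<ge> 0" by (auto simp: L_def intro: sum_nonneg)
  have "uniformly_continuous_on (halfball r) (\<lambda>x. G x v w)"
    unfolding uniformly_continuous_on_def
  proof (intro allI impI)
    fix e :: real assume e: "e > 0"
    show "\<exists>d>0. \<forall>x\<in>halfball r. \<forall>x'\<in>halfball r. dist x' x < d \<longrightarrow> dist (G x' v w) (G x v w) < e"
    proof (intro exI[of _ "e / (L + 1)"] conjI ballI impI)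
      show "e / (L + 1) > 0" using e L0 by simp
      fix x x' assume x: "x \<in> halfball r" "x' \<in> halfball r" and d: "dist x' x < e / (L + 1)"
      have "dist (G x' v w) (G x v w) \<le> L * dist x' x" using lip[OF x(2,1)] by (simp add: dist_norm)
      also have "\<dots> \<le> (L + 1) * dist x' x" by (intro mult_right_mono) auto
      also have "\<dots> < e" using d L0 by (simp add: pos_less_divide_eq mult.commute)
      finally show "dist (G x' v w) (G x v w) < e" .
    qed
  qed
  moreover have "snd c p \<in> closure (halfball r)"
    unfolding closure_approachable
  proof (intro allI impI)
    fix e :: real assume e: "e > 0"
    define t where "t = min e r / 2"
    have t: "t > 0" "t < e" "t < r" using e r(1) by (auto simp: t_def)
    have "dist (snd c p + (0, t)) (snd c p) = t" using t by (simp add: dist_norm norm_Pair)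
    then show "\<exists>y\<in>halfball r. dist y (snd c p) < e"
      using t c_p_zero by (intro bexI[of _ "snd c p + (0, t)"]) (auto simp: halfball_def dist_commute)
  qed
  ultimately obtain l where l: "((\<lambda>x. G x v w) \<longlongrightarrow> l) (at (snd c p) within halfball r)"
    by (rule uniformly_continuous_on_extension_at_closure)
  \<comment> \<open>Interior points never map to \<open>snd c p\<close>, since their last coordinate
    is positive and that of p is 0; so the punctured limit in coordinates pulls back to the
    manifold.\<close>
  have "filterlim (snd c) (at (snd c p) within halfball r) Fp"
    unfolding filterlim_at
  proof
    show "\<forall>\<^sub>F x in Fp. snd c x \<in> halfball r \<and> snd c x \<noteq> snd c p"
      using eventually_halfball[OF r(1)] by eventually_elim (use c_p_zero in \<open>auto simp: halfball_def\<close>)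
    show "(snd c \<longlongrightarrow> snd c p) Fp" unfolding Fp_def by (rule tendsto_chart[OF c])
  qed
  from filterlim_compose[OF l this] have "((\<lambda>q. G (snd c q) v w) \<longlongrightarrow> l) Fp" .
  moreover have "\<forall>\<^sub>F q in Fp. G (snd c q) v w = gbar c q v w"
    using eventually_bdryI[OF chart_openin[OF c(1)] c(2)] unfolding Fp_def
    by eventually_elim (simp add: G_def chart_inv_left c)
  ultimately have lim: "((\<lambda>q. gbar c q v w) \<longlongrightarrow> l) Fp" by (rule Lim_transform_eventually)
  moreover have "extend_tensor A gbar c p v w = l"
    using tendsto_Lim[OF Fp_nontrivial lim] p by (simp add: extend_tensor_def mint_eq Fp_def)
  ultimately show ?thesis by simp
qed

definition G0 where "G0 = extend_tensor A gbar c p"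

lemma ev_gbar_form: "\<forall>\<^sub>F q in Fp. inner_form (gbar c q)"
  using eventually_mint eventually_bdryI[OF chart_openin[OF c(1)] c(2)] unfolding Fp_def
  by eventually_elim (rule gbar_form[OF c(1)])

text \<open>Bilinearity passes to the limit; strict positivity does not, and comes from the
  hypothesis \<open>pd\<close>.\<close>

lemma G0_form: "inner_form G0"
  unfolding inner_form_def
proof
  show "sym_pos_def G0" using pd c p by (auto simp: G0_def)
  note lim = gbar_limit[folded G0_def]
  have ev: "\<forall>\<^sub>F q in Fp. bilinear (gbar c q)"
    using ev_gbar_form by eventually_elim (rule inner_form_bilinear)
  note uniq = tendsto_unique[OF Fp_nontrivial]
  show "bilinear G0"
    unfolding bilinear_def
  proof (intro conjI allI; rule linear_realI)
    fix x y z :: "'b coord" and r :: real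
    have "((\<lambda>q. gbar c q x (y + z)) \<longlongrightarrow> G0 x y + G0 x z) Fp"
      by (rule Lim_transform_eventually[OF tendsto_add[OF lim lim]])
        (rule eventually_mono[OF ev], simp add: bilinear_radd)
    from uniq[OF lim this] show "G0 x (y + z) = G0 x y + G0 x z" .
    have "((\<lambda>q. gbar c q x (r *\<^sub>R y)) \<longlongrightarrow> r * G0 x y) Fp"
      by (rule Lim_transform_eventually[OF tendsto_mult[OF tendsto_const lim]])
        (rule eventually_mono[OF ev], simp add: bilinear_rmul)
    from uniq[OF lim this] show "G0 x (r *\<^sub>R y) = r * G0 x y" .
    have "((\<lambda>q. gbar c q (y + z) x) \<longlongrightarrow> G0 y x + G0 z x) Fp"
      by (rule Lim_transform_eventually[OF tendsto_add[OF lim lim]])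
        (rule eventually_mono[OF ev], simp add: bilinear_ladd)
    from uniq[OF lim this] show "G0 (y + z) x = G0 y x + G0 z x" .
    have "((\<lambda>q. gbar c q (r *\<^sub>R y) x) \<longlongrightarrow> r * G0 y x) Fp"
      by (rule Lim_transform_eventually[OF tendsto_mult[OF tendsto_const lim]])
        (rule eventually_mono[OF ev], simp add: bilinear_lmul)
    from uniq[OF lim this] show "G0 (r *\<^sub>R y) x = r * G0 y x" .
  qed
qed

end

section \<open>Change of charts and curvature limits\<close>

lemma metric_field_cong:
  assumes G: "metric_field G S" and eq: "\<And>x. x \<in> S \<Longrightarrow> G x = G' x"
  shows "metric_field G' S"
proof -
  interpret metric_field G S by (rule G)
  show ?thesis
  proof
    show "open S" by (rule S)
    fix x assume x: "x \<in> S"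
    show "inner_form (G' x)" using form[OF x] eq[OF x] by simp
    show "(\<lambda>y. G' y v w) differentiable at x" for v w
      by (rule differentiableI, rule has_derivative_transform_within_open[OF has_derivative_form[OF x] S x]) (simp add: eq)
    show "(\<lambda>y. dform G' y a v w) differentiable at x" for a v w
      by (rule differentiableI, rule has_derivative_transform_within_open[OF has_derivative_dform[OF x] S x])
        (simp add: dform_cong[OF S eq])
  qed
qed

lemma linear_snd_prod: "linear (snd :: 'a::real_vector \<times> 'b::real_vector \<Rightarrow> 'b)"
  by (rule linearI) simp_all

context ah_metric
begin

text \<open>Twice differentiability of g is given in the chart c alone, and
  \<open>metric_transformI\<close> carries it over to d through a smooth extension of the transition
  map.\<close>

lemma riemann_transform:
  assumes c: "c \<in> A" "q \<in> fst c" and d: "d \<in> A" "q \<in> fst d" and q: "q \<in> mint A"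
    and S: "metric_field (\<lambda>x. g c (chart_inv c x)) S" "snd c q \<in> S" "S \<subseteq> snd c ` fst c"
  shows "dtrans d c q (riemann g d q u v w) = riemann g c q (dtrans d c q u) (dtrans d c q v) (dtrans d c q w)"
proof -
  obtain W F where W: "open W" "snd d q \<in> W" "Cinf_on W F"
    "\<forall>y\<in>W \<inter> half_space. y \<in> snd d ` (fst d \<inter> fst c)"
    "\<forall>y\<in>W \<inter> half_space. F y = snd c (chart_inv d y)"
    using transition_extension[OF d(1) c(1) d(2) c(2)] .
  have oS: "open S" using S(1) by (rule metric_field.S)
  define F1 where "F1 = (\<lambda>x v. frechet_derivative F (at x) v)"
  define F2 where "F2 = (\<lambda>x a v. frechet_derivative (\<lambda>x. F1 x v) (at x) a)"
  define F3 where "F3 = (\<lambda>x b a v. frechet_derivative (\<lambda>x. F2 x a v) (at x) b)"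
  have F1_inf: "Cinf_on W (\<lambda>x. F1 x v)" for v unfolding F1_def by (rule Cinf_on_derivative[OF W(1,3)])
  have F2_inf: "Cinf_on W (\<lambda>x. F2 x a v)" for a v unfolding F2_def by (rule Cinf_on_derivative[OF W(1) F1_inf])
  have F3_inf: "Cinf_on W (\<lambda>x. F3 x b a v)" for a b v unfolding F3_def by (rule Cinf_on_derivative[OF W(1) F2_inf])
  \<comment> \<open>Positive height makes F agree with the transition map on a full neighborhood, so
    that ordinary derivatives can be used.\<close>
  define S1 where "S1 = W \<inter> F -` S \<inter> {x. snd x > 0}"
  have S1: "open S1"
    unfolding S1_def
    by (intro open_Int[OF continuous_open_preimage[OF Cinf_on_continuous[OF W(3)] W(1) oS]]
        open_Collect_less continuous_intros)
  have S1_sub: "S1 \<subseteq> snd d ` fst d" using W(4) by (auto simp: S1_def half_space_def)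
  have Fq: "F (snd d q) = snd c q" using W(2,5) chart_half[OF d] by (simp add: chart_inv_left d)
  have qS1: "snd d q \<in> S1" using W(2) S(2) Fq mint_pos[OF d q] by (simp add: S1_def)
  have pt: "\<exists>y. y \<in> fst d \<and> y \<in> fst c \<and> y \<in> mint A \<and> x = snd d y \<and> F x = snd c y \<and> dtrans d c y = F1 x" if x: "x \<in> S1" for x
  proof -
    have xW: "x \<in> W \<inter> half_space" using x by (auto simp: S1_def half_space_def)
    then obtain y where y: "y \<in> fst d" "y \<in> fst c" "x = snd d y" using W(4) by blast
    have "y \<in> mint A"
      using boundary_chart[OF d(1) y(1)] x y fst_subset[OF d(1)] by (auto simp: mint_eq S1_def)
    moreover have "F x = snd c y" using W(5) xW y by (simp add: chart_inv_left d)
    moreover have "dtrans d c y = F1 x"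
      using transition_derivative[OF d(1) c(1) y(1) _ W(1,3,5)] xW y(3) by (auto simp: F1_def)
    ultimately show ?thesis using y by blast
  qed
  have "metric_transform (\<lambda>x. g d (chart_inv d x)) S1 (\<lambda>x. g c (chart_inv c x)) S F F1 F2 F3"
  proof (rule metric_transformI[OF S(1) S1])
    fix x assume x: "x \<in> S1"
    then have xW: "x \<in> W" by (simp add: S1_def)
    show "F x \<in> S" using x by (simp add: S1_def)
    show "(F has_derivative F1 x) (at x)" using Cinf_onD[OF W(3) xW] by (simp add: F1_def)
    show "((\<lambda>x. F1 x v) has_derivative (\<lambda>a. F2 x a v)) (at x)" for v using Cinf_onD[OF F1_inf xW] by (simp add: F2_def)
    show "((\<lambda>x. F2 x a v) has_derivative (\<lambda>b. F3 x b a v)) (at x)" for a v using Cinf_onD[OF F2_inf xW] by (simp add: F3_def)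
    show "isCont (\<lambda>x. F3 x b a v) x" for b a v
      using Cinf_on_continuous[OF F3_inf] W(1) xW continuous_on_eq_continuous_at by blast
    obtain y where y: "y \<in> fst d" "y \<in> fst c" "y \<in> mint A" "x = snd d y" "F x = snd c y" "dtrans d c y = F1 x"
      using pt[OF x] by blast
    have "F1 x (dtrans c d y v) = v" for v using dtrans_inverse[OF c(1) d(1) y(2,1)] y(6) by simp
    then show "surj (F1 x)" by (metis surjI)
    show "g d (chart_inv d x) v w = g c (chart_inv c (F x)) (F1 x v) (F1 x w)" for v w
      using tensor2_onD(2)[OF g_tensor d(1) c(1) y(1,2,3)] y by (simp add: chart_inv_left c d)
  qed
  then interpret metric_transform "\<lambda>x. g d (chart_inv d x)" S1 "\<lambda>x. g c (chart_inv c x)" S F F1 F2 F3 .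
  have T: "dtrans d c q = F1 (snd d q)"
    using transition_derivative[OF d(1) c(1) d(2) W(2,1,3,5)] by (auto simp: F1_def)
  show ?thesis
    using rie_pull[OF qS1, of u v w] riemann_eq[OF d S1 qS1 S1_sub] riemann_eq[OF c oS S(2,3)] by (simp add: T Fq)
qed

end

text \<open>In the application c is the background chart at p and d is \<open>chart_at A q\<close>,
  which need not depend continuously on q. The comparison is therefore made at a single point
  q.\<close>

locale chart_change = ah_metric +
  fixes c d :: "('a, 'b) chart" and q S
  assumes c: "c \<in> A" "q \<in> fst c" and d: "d \<in> A" "q \<in> fst d" and q: "q \<in> mint A"
    and S: "metric_field (\<lambda>x. g c (chart_inv c x)) S" "snd c q \<in> S" "S \<subseteq> snd c ` fst c"
begin

abbreviation "T \<equiv> dtrans d c q"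
abbreviation "M \<equiv> dtrans c d q"

lemma iso_g: "isometry_forms (g d q) (g c q) T M"
  by (rule isometry_formsI[OF d(1) c(1) d(2) c(2) g_form g_form]) (auto intro: c d q tensor2_onD[OF g_tensor])

lemma iso_h: "isometry_forms (h d q) (h c q) T M"
proof (rule isometry_formsI[OF d(1) c(1) d(2) c(2) smooth_metric_form[OF h d] smooth_metric_form[OF h c]])
  have "tensor2_on A (\<Union>c\<in>A. fst c) h" using h by (simp add: smooth_metric_def riemannian_on_def)
  then show "h d q v w = h c q (T v) (T w)" for v w by (rule tensor2_onD(2)) (use c d in auto)
qed

lemma TM: "T (M v) = v" and MT: "M (T v) = v"
  using dtrans_inverse c d by auto

lemma linear_T: "linear T" and linear_M: "linear M"
  using linear_dtrans c d by auto

lemmas riemann_T = riemann_transform[OF c d q S]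

lemma linear_riemann:
  "linear (\<lambda>u. riemann g c q u v w)" "linear (\<lambda>v. riemann g c q u v w)" "linear (\<lambda>w. riemann g c q u v w)"
  using metric_field.linear_rie[OF S(1,2)] riemann_eq[OF c metric_field.S[OF S(1)] S(2,3)] by simp_all

lemma inner_M: "i \<bullet> M x = adjoint M i \<bullet> x"
  using adjoint_works[OF linear_M, of x i] by (simp add: inner_commute)

lemma norm22_invariant:
  "norm22 (h d q) (\<lambda>u v l m. curvature_operator g d q u v l m - - wedge u v l m) =
   norm22 (h c q) (\<lambda>u v l m. curvature_operator g c q u v l m - - wedge u v l m)"
proof -
  interpret h: isometry_forms "h d q" "h c q" T M by (rule iso_h)
  interpret g: isometry_forms "g d q" "g c q" T M by (rule iso_g)
  define t where "t = (\<lambda>e u v i j. curvature_operator g e q u v (inner i) (inner j) - - wedge u v (inner i) (inner j))"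
  note lin_sharp = linear_sharp_inner[OF g_form[OF c q]]
  have lins: "linear (\<lambda>u. t c u v i j)" "linear (\<lambda>v. t c u v i j)" "linear (\<lambda>i. t c u v i j)" "linear (\<lambda>j. t c u v i j)" for u v i j
    unfolding t_def curvature_operator_def wedge_def
    by (intro linear_realI; simp add: linear_add[OF linear_riemann(1)] linear_scale[OF linear_riemann(1)]
        linear_add[OF linear_riemann(2)] linear_scale[OF linear_riemann(2)] linear_add[OF linear_riemann(3)]
        linear_scale[OF linear_riemann(3)] linear_add[OF lin_sharp] linear_scale[OF lin_sharp]
        inner_add_left inner_add_right algebra_simps)+
  have tr: "t d u v i j = t c (T u) (T v) (adjoint M i) (adjoint M j)" for u v i j
  proof -
    have "T (sharp (g d q) (inner j)) = sharp (g c q) (\<lambda>w. j \<bullet> M w)" by (rule g.sharp_transform[OF linear_inner])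
    also have "(\<lambda>w. j \<bullet> M w) = inner (adjoint M j)" by (intro ext) (rule inner_M)
    finally have sh: "T (sharp (g d q) (inner j)) = sharp (g c q) (inner (adjoint M j))" .
    have "i \<bullet> riemann g d q u v (sharp (g d q) (inner j)) = i \<bullet> M (T (riemann g d q u v (sharp (g d q) (inner j))))"
      by (simp add: MT)
    also have "\<dots> = adjoint M i \<bullet> riemann g c q (T u) (T v) (sharp (g c q) (inner (adjoint M j)))"
      by (simp add: inner_M riemann_T sh)
    finally show ?thesis
      by (simp add: t_def curvature_operator_def wedge_def inner_M[symmetric] MT)
  qed
  from h.norm22_transform[where ?t1.0="t d" and ?t2.0="t c", OF lins tr]
  show ?thesis unfolding norm22_def t_def by simp
qed

lemma linear_ricci: "linear (ricci g c q v)"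
  unfolding ricci_def[abs_def]
  by (intro linear_compose_sum ballI linear_compose[OF linear_riemann(3) linear_inner, unfolded comp_def])

text \<open>The contraction runs over the standard basis in both charts; the trace absorbs the
  change of basis by \<open>trace_comm\<close>.\<close>

lemma ricci_T: "ricci g d q v w = ricci g c q (T v) (T w)"
proof -
  have "ricci g d q v w = (\<Sum>b\<in>Basis. b \<bullet> M (riemann g c q (T b) (T v) (T w)))"
    unfolding ricci_def using riemann_T[of _ v w] MT by metis
  also have "\<dots> = (\<Sum>b\<in>Basis. b \<bullet> riemann g c q (T (M b)) (T v) (T w))"
    using trace_comm[OF linear_M linear_compose[OF linear_T linear_riemann(1)]] by (simp add: comp_def)
  finally show ?thesis by (simp add: ricci_def TM)
qed

lemma ricci_operator_T: "T (ricci_operator g d q v) = ricci_operator g c q (T v)"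
proof -
  interpret g: isometry_forms "g d q" "g c q" T M by (rule iso_g)
  have "linear (ricci g d q v)"
    unfolding ricci_T using linear_compose[OF linear_T linear_ricci] by (simp add: comp_def)
  from g.sharp_transform[OF this] show ?thesis
    by (simp add: ricci_operator_def ricci_T TM)
qed

lemma linear_ricci_operator: "linear (ricci_operator g c q)"
proof (rule linearI)
  have r: "riemann g c q b (v + v') w = riemann g c q b v w + riemann g c q b v' w"
    "riemann g c q b (r *\<^sub>R v) w = r *\<^sub>R riemann g c q b v w" for b v v' w r
    using linear_add[OF linear_riemann(2)] linear_scale[OF linear_riemann(2)] by auto
  note form = g_form[OF c q]
  fix v v' r
  have "ricci g c q (v + v') = (\<lambda>w. ricci g c q v w + ricci g c q v' w)"
    by (intro ext) (simp add: ricci_def r inner_add_right sum.distrib)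
  then show "ricci_operator g c q (v + v') = ricci_operator g c q v + ricci_operator g c q v'"
    using sharp_add[OF form linear_ricci linear_ricci] by (simp add: ricci_operator_def)
  have "ricci g c q (r *\<^sub>R v) = (\<lambda>w. r * ricci g c q v w)"
    by (intro ext) (simp add: ricci_def r sum_distrib_left)
  then show "ricci_operator g c q (r *\<^sub>R v) = r *\<^sub>R ricci_operator g c q v"
    using sharp_cmult[OF form linear_ricci] by (simp add: ricci_operator_def)
qed

lemma norm11_invariant:
  "norm11 (h d q) (\<lambda>v. ricci_operator g d q v - r *\<^sub>R v) = norm11 (h c q) (\<lambda>v. ricci_operator g c q v - r *\<^sub>R v)"
proof -
  interpret h: isometry_forms "h d q" "h c q" T M by (rule iso_h)
  have "linear (\<lambda>v. ricci_operator g c q v - r *\<^sub>R v)"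
    by (intro linear_compose_sub linear_ricci_operator linear_scale_self)
  moreover have "T (ricci_operator g d q v - r *\<^sub>R v) = ricci_operator g c q (T v) - r *\<^sub>R T v" for v
    by (simp add: linear_diff[OF linear_T] linear_scale[OF linear_T] ricci_operator_T)
  ultimately show ?thesis
    unfolding norm11_def by (subst h.norm11_transform[where ?T2.0="\<lambda>v. ricci_operator g c q v - r *\<^sub>R v"]) auto
qed

lemma scalar_curvature_invariant: "scalar_curvature g d q = scalar_curvature g c q"
proof -
  have "scalar_curvature g d q = (\<Sum>b\<in>Basis. b \<bullet> M (ricci_operator g c q (T b)))"
    unfolding scalar_curvature_def ricci_operator_T[symmetric] by (simp add: MT)
  also have "\<dots> = (\<Sum>b\<in>Basis. b \<bullet> ricci_operator g c q (T (M b)))"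
    using trace_comm[OF linear_M linear_compose[OF linear_T linear_ricci_operator]] by (simp add: comp_def)
  finally show ?thesis by (simp add: scalar_curvature_def TM)
qed

end

section \<open>Curvature limits at a boundary point\<close>

context ah_point
begin

lemma conformal_limit_G:
  obtains r where "r > 0" "conformal_limit G (halfball r) snd (filtermap (snd c) Fp) G0"
    "\<forall>x\<in>halfball r. x \<in> snd c ` fst c \<and> chart_inv c x \<in> mint A"
proof -
  obtain r where r: "r > 0" "metric_field G (halfball r)" "\<forall>x\<in>halfball r. x \<in> snd c ` fst c \<and> chart_inv c x \<in> mint A"
    by (rule metric_field_G)
  interpret metric_field G "halfball r" by (rule r(2))
  have \<rho>0: "(\<rho> \<longlongrightarrow> 0) Fp" unfolding Fp_def by (rule tendsto_rho[OF p])
  have ev_pos: "\<forall>\<^sub>F q in Fp. \<rho> q > 0"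
    using eventually_mint unfolding Fp_def by eventually_elim (simp add: mint_iff)
  have "conformal_limit G (halfball r) snd (filtermap (snd c) Fp) G0"
  proof (intro conformal_limit.intro conformal_field.intro conformal_field_axioms.intro conformal_limit_axioms.intro r(2))
    show "linear (snd :: 'b coord \<Rightarrow> real)" by (rule linear_snd_prod)
    show "0 < snd x" if "x \<in> halfball r" for x using that by (simp add: halfball_def)
    show "\<forall>\<^sub>F x in filtermap (snd c) Fp. x \<in> halfball r"
      using eventually_halfball[OF r(1)] by (simp add: eventually_filtermap)
    show "inner_form G0" by (rule G0_form)
    fix v w
    have "\<forall>\<^sub>F q in Fp. gbar c q v w = G (snd c q) v w"
      using eventually_bdryI[OF chart_openin[OF c(1)] c(2)] unfolding Fp_def
      by eventually_elim (simp add: G_def chart_inv_left c)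
    with gbar_limit have "((\<lambda>q. G (snd c q) v w) \<longlongrightarrow> G0 v w) Fp"
      unfolding G0_def by (rule Lim_transform_eventually)
    then show "((\<lambda>x. G x v w) \<longlongrightarrow> G0 v w) (filtermap (snd c) Fp)" by (simp add: filterlim_filtermap)
    fix a e
    obtain C where C: "\<forall>\<^sub>F q in Fp. (\<lambda>y. G y v w) differentiable (at (snd c q)) \<and>
      \<bar>dform G (snd c q) a v w\<bar> \<le> C \<and> (\<lambda>y. dform G y a v w) differentiable (at (snd c q)) \<and>
      \<bar>d2form G (snd c q) e a v w\<bar> \<le> C / \<rho> q"
      by (rule G_bounds)
    \<comment> \<open>The same majorant serves twice: \<rho> C for the first derivatives, and
      \<rho>^2 C/\<rho> for the second.\<close>
    have lim: "((\<lambda>q. \<rho> q * C) \<longlongrightarrow> 0) Fp" using tendsto_mult_left_zero[OF \<rho>0] .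
    have "((\<lambda>q. \<rho> q * dform G (snd c q) a v w) \<longlongrightarrow> 0) Fp"
    proof (rule Lim_null_comparison[OF _ lim])
      show "\<forall>\<^sub>F q in Fp. norm (\<rho> q * dform G (snd c q) a v w) \<le> \<rho> q * C"
        using C ev_pos by eventually_elim (auto simp: abs_mult intro!: mult_left_mono)
    qed
    then show "((\<lambda>x. snd x * dform G x a v w) \<longlongrightarrow> 0) (filtermap (snd c) Fp)" by (simp add: filterlim_filtermap snd_c)
    have "((\<lambda>q. (\<rho> q)\<^sup>2 * d2form G (snd c q) e a v w) \<longlongrightarrow> 0) Fp"
    proof (rule Lim_null_comparison[OF _ lim])
      show "\<forall>\<^sub>F q in Fp. norm ((\<rho> q)\<^sup>2 * d2form G (snd c q) e a v w) \<le> \<rho> q * C"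
        using C ev_pos
      proof eventually_elim
        case (elim q)
        then have "\<bar>(\<rho> q)\<^sup>2 * d2form G (snd c q) e a v w\<bar> \<le> (\<rho> q)\<^sup>2 * (C / \<rho> q)"
          unfolding abs_mult by (intro mult_mono) auto
        also have "\<dots> = \<rho> q * C" using elim by (simp add: power2_eq_square)
        finally show ?case by simp
      qed
    qed
    then show "((\<lambda>x. (snd x)\<^sup>2 * d2form G x e a v w) \<longlongrightarrow> 0) (filtermap (snd c) Fp)"
      by (simp add: filterlim_filtermap snd_c)
  qed
  with r(1,3) show ?thesis by (intro that)
qed

text \<open>The squared norm of d\<rho> with respect to G0, since in background coordinates d\<rho>
  is the projection \<open>snd\<close>.\<close>

definition N0 where "N0 = snd (sharp G0 snd)"

lemma
  shows curvature_operator_limit: "linear l \<Longrightarrow> linear m \<Longrightarrow>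
      ((\<lambda>q. curvature_operator g c q u v l m) \<longlongrightarrow> - N0 * wedge u v l m) Fp"
    and ricci_operator_limit: "((\<lambda>q. ricci_operator g c q v) \<longlongrightarrow> (- N0 * real CARD('b)) *\<^sub>R v) Fp"
    and scalar_curvature_limit: "((\<lambda>q. scalar_curvature g c q) \<longlongrightarrow> - N0 * (real CARD('b) * (real CARD('b) + 1))) Fp"
    and ev_metric_field: "\<forall>\<^sub>F q in Fp. q \<in> mint A \<and> q \<in> fst c \<and>
      (\<exists>S. metric_field (\<lambda>x. g c (chart_inv c x)) S \<and> snd c q \<in> S \<and> S \<subseteq> snd c ` fst c)"
proof -
  obtain r where r: "r > 0" "conformal_limit G (halfball r) snd (filtermap (snd c) Fp) G0"
    "\<forall>x\<in>halfball r. x \<in> snd c ` fst c \<and> chart_inv c x \<in> mint A"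
    by (rule conformal_limit_G)
  interpret CL: conformal_limit G "halfball r" snd "filtermap (snd c) Fp" G0 by (rule r(2))
  have N0: "snd CL.nu0 = N0" by (simp add: CL.nu0_def N0_def)
  have dim: "real DIM('b coord) = real CARD('b) + 1" by simp
  let ?gg = "\<lambda>x. g c (chart_inv c x)"
  have sub: "halfball r \<subseteq> snd c ` fst c" using r(3) by blast
  \<comment> \<open>The conformal factor built from \<open>snd\<close> is the one built from \<rho>,
    because \<rho> is the last background coordinate.\<close>
  have gg: "CL.g x = ?gg x" if x: "x \<in> halfball r" for x
  proof (intro ext)
    fix v w
    have "\<rho> (chart_inv c x) = snd x" using snd_c[of "chart_inv c x"] chart_inv_right[OF c(1)] r(3) x by simp
    then show "CL.g x v w = ?gg x v w" using g_val[of "chart_inv c x" c v w] r(3) x unfolding CL.g_def by (simp add: G_def)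
  qed
  have mf: "metric_field ?gg (halfball r)" by (rule metric_field_cong[OF CL.metric_field_g gg])
  have ev: "\<forall>\<^sub>F q in Fp. q \<in> mint A \<and> q \<in> fst c \<and> snd c q \<in> halfball r"
    using eventually_halfball[OF r(1)] eventually_mint eventually_bdryI[OF chart_openin[OF c(1)] c(2)] unfolding Fp_def
    by eventually_elim simp
  then show "\<forall>\<^sub>F q in Fp. q \<in> mint A \<and> q \<in> fst c \<and>
      (\<exists>S. metric_field (\<lambda>x. g c (chart_inv c x)) S \<and> snd c q \<in> S \<and> S \<subseteq> snd c ` fst c)"
    by eventually_elim (use mf sub in blast)
  have R: "riemann g c q u v w = rie CL.g (snd c q) u v w" and gq: "g c q = CL.g (snd c q)"
    if "q \<in> fst c" "snd c q \<in> halfball r" for q u v w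
  proof -
    show "riemann g c q u v w = rie CL.g (snd c q) u v w"
      using riemann_eq[OF c(1) that(1) open_halfball that(2) sub] rie_cong[OF open_halfball gg that(2)] by simp
    show "g c q = CL.g (snd c q)" using gg[OF that(2)] chart_inv_left[OF c(1) that(1)] by simp
  qed
  show "((\<lambda>q. curvature_operator g c q u v l m) \<longlongrightarrow> - N0 * wedge u v l m) Fp" if lm: "linear l" "linear m" for u v l m
  proof -
    have "((\<lambda>q. l (rie CL.g (snd c q) u v (sharp (CL.g (snd c q)) m))) \<longlongrightarrow> - N0 * wedge u v l m) Fp"
      using CL.tendsto_curvature_operator[OF lm, of u v] by (simp add: filterlim_filtermap N0 wedge_def)
    moreover have "\<forall>\<^sub>F q in Fp. l (rie CL.g (snd c q) u v (sharp (CL.g (snd c q)) m)) = curvature_operator g c q u v l m"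
      using ev by eventually_elim (simp add: curvature_operator_def R gq)
    ultimately show ?thesis by (rule Lim_transform_eventually)
  qed
  have ric: "ricci g c q v = CL.ric (snd c q) v" if "q \<in> fst c" "snd c q \<in> halfball r" for q v
    by (intro ext) (simp add: ricci_def CL.ric_def R[OF that])
  have ricop: "ricci_operator g c q v = sharp (CL.g (snd c q)) (CL.ric (snd c q) v)" if "q \<in> fst c" "snd c q \<in> halfball r" for q v
    by (simp add: ricci_operator_def ric[OF that] gq[OF that])
  show "((\<lambda>q. ricci_operator g c q v) \<longlongrightarrow> (- N0 * real CARD('b)) *\<^sub>R v) Fp" for v
  proof -
    have "((\<lambda>q. sharp (CL.g (snd c q)) (CL.ric (snd c q) v)) \<longlongrightarrow> (- N0 * real CARD('b)) *\<^sub>R v) Fp"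
      using CL.tendsto_ricci_operator[of v] unfolding dim by (simp add: filterlim_filtermap N0)
    moreover have "\<forall>\<^sub>F q in Fp. sharp (CL.g (snd c q)) (CL.ric (snd c q) v) = ricci_operator g c q v"
      using ev by eventually_elim (simp add: ricop)
    ultimately show ?thesis by (rule Lim_transform_eventually)
  qed
  show "((\<lambda>q. scalar_curvature g c q) \<longlongrightarrow> - N0 * (real CARD('b) * (real CARD('b) + 1))) Fp"
  proof -
    have "((\<lambda>q. \<Sum>b\<in>Basis. b \<bullet> sharp (CL.g (snd c q)) (CL.ric (snd c q) b)) \<longlongrightarrow> - N0 * (real CARD('b) * (real CARD('b) + 1))) Fp"
      using CL.tendsto_scalar_curvature unfolding dim by (simp add: filterlim_filtermap N0 mult.assoc)
    moreover have "\<forall>\<^sub>F q in Fp. (\<Sum>b\<in>Basis. b \<bullet> sharp (CL.g (snd c q)) (CL.ric (snd c q) b)) = scalar_curvature g c q"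
      using ev by eventually_elim (simp add: scalar_curvature_def ricop)
    ultimately show ?thesis by (rule Lim_transform_eventually)
  qed
qed

lemma ev_chart_change:
  "\<forall>\<^sub>F q in Fp. \<exists>S. chart_change Mbar A \<rho> \<rho>s K \<kappa> B I \<Phi> h g gbar k \<alpha> c (chart_at A q) q S"
  using ev_metric_field
proof eventually_elim
  case (elim q)
  then obtain S where S: "metric_field (\<lambda>x. g c (chart_inv c x)) S" "snd c q \<in> S" "S \<subseteq> snd c ` fst c" by blast
  have "q \<in> Mbar" using elim by (simp add: mint_iff)
  have "chart_change Mbar A \<rho> \<rho>s K \<kappa> B I \<Phi> h g gbar k \<alpha> c (chart_at A q) q S"
    by (intro chart_change.intro chart_change_axioms.intro ah_metric_axioms)
      (use elim c S chart_at[OF \<open>q \<in> Mbar\<close>] in auto)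
  then show ?case ..
qed

lemma h_limit:
  "\<And>v w. ((\<lambda>q. h c q v w) \<longlongrightarrow> h c p v w) Fp" "\<forall>\<^sub>F q in Fp. inner_form (h c q)" "inner_form (h c p)"
proof -
  show "((\<lambda>q. h c q v w) \<longlongrightarrow> h c p v w) Fp" for v w unfolding Fp_def by (rule smooth_metric_tendsto[OF h c])
  show "\<forall>\<^sub>F q in Fp. inner_form (h c q)"
    using eventually_bdryI[OF chart_openin[OF c(1)] c(2)] unfolding Fp_def
    by eventually_elim (rule smooth_metric_form[OF h c(1)])
  show "inner_form (h c p)" by (rule smooth_metric_form[OF h c])
qed

text \<open>The norm converges to |1 - N0| times the norm of the identity of bivectors. It is
  computed in the fixed chart c and moved to the arbitrary charts by
  \<open>norm22_invariant\<close>.\<close>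

lemma curvature_operator_limit_iff:
  "((\<lambda>q. norm22 (h (chart_at A q) q) (\<lambda>u v l m. curvature_operator g (chart_at A q) q u v l m - - wedge u v l m)) \<longlongrightarrow> 0) Fp
   \<longleftrightarrow> N0 = 1"
proof -
  let ?N = "real DIM('b coord)"
  have "((\<lambda>q. norm22 (h c q) (\<lambda>u v l m. curvature_operator g c q u v l m - - wedge u v l m))
      \<longlongrightarrow> norm22 (h c p) (\<lambda>u v l m. (1 - N0) * wedge u v l m)) Fp"
  proof (rule tendsto_norm22[OF h_limit])
    fix u v i j
    have "((\<lambda>q. curvature_operator g c q u v (inner i) (inner j) - - wedge u v (inner i) (inner j)) \<longlongrightarrow>
        - N0 * wedge u v (inner i) (inner j) - - wedge u v (inner i) (inner j)) Fp"
      by (intro tendsto_diff tendsto_const curvature_operator_limit linear_inner)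
    then show "((\<lambda>q. curvature_operator g c q u v (inner i) (inner j) - - wedge u v (inner i) (inner j)) \<longlongrightarrow>
        (1 - N0) * wedge u v (inner i) (inner j)) Fp" by (simp add: algebra_simps)
  qed
  then have lim: "((\<lambda>q. norm22 (h c q) (\<lambda>u v l m. curvature_operator g c q u v l m - - wedge u v l m))
      \<longlongrightarrow> \<bar>1 - N0\<bar> * sqrt (2 * (?N\<^sup>2 - ?N))) Fp"
    by (simp only: norm22_scale_wedge[OF h_limit(3)])
  have "((\<lambda>q. norm22 (h (chart_at A q) q) (\<lambda>u v l m. curvature_operator g (chart_at A q) q u v l m - - wedge u v l m))
      \<longlongrightarrow> \<bar>1 - N0\<bar> * sqrt (2 * (?N\<^sup>2 - ?N))) Fp"
  proof (rule Lim_transform_eventually[OF lim])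
    show "\<forall>\<^sub>F q in Fp. norm22 (h c q) (\<lambda>u v l m. curvature_operator g c q u v l m - - wedge u v l m) =
        norm22 (h (chart_at A q) q) (\<lambda>u v l m. curvature_operator g (chart_at A q) q u v l m - - wedge u v l m)"
      using ev_chart_change by eventually_elim (elim exE, drule chart_change.norm22_invariant, erule sym)
  qed
  \<comment> \<open>The dimension n + 1 is at least 2.\<close>
  moreover have "sqrt (2 * (?N\<^sup>2 - ?N)) > 0"
    by (simp add: power2_eq_square algebra_simps) (intro add_pos_pos mult_pos_pos; simp)
  ultimately show ?thesis
    by (subst tendsto_iff_limit_eq[OF Fp_nontrivial]) auto
qed

lemma ricci_operator_limit_iff:
  "((\<lambda>q. norm11 (h (chart_at A q) q) (\<lambda>v. ricci_operator g (chart_at A q) q v - (- real CARD('b)) *\<^sub>R v)) \<longlongrightarrow> 0) Fp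
   \<longleftrightarrow> N0 = 1"
proof -
  let ?n = "real CARD('b)"
  have "((\<lambda>q. norm11 (h c q) (\<lambda>v. ricci_operator g c q v - (- ?n) *\<^sub>R v))
      \<longlongrightarrow> norm11 (h c p) (\<lambda>v. (?n * (1 - N0)) *\<^sub>R v)) Fp"
  proof (rule tendsto_norm11[OF h_limit])
    fix v
    have "((\<lambda>q. ricci_operator g c q v - (- ?n) *\<^sub>R v) \<longlongrightarrow> (- N0 * ?n) *\<^sub>R v - (- ?n) *\<^sub>R v) Fp"
      by (intro tendsto_diff tendsto_const ricci_operator_limit)
    then show "((\<lambda>q. ricci_operator g c q v - (- ?n) *\<^sub>R v) \<longlongrightarrow> (?n * (1 - N0)) *\<^sub>R v) Fp"
      by (simp only: scaleR_diff_left[symmetric]) (simp add: algebra_simps)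
  qed
  then have lim: "((\<lambda>q. norm11 (h c q) (\<lambda>v. ricci_operator g c q v - (- ?n) *\<^sub>R v))
      \<longlongrightarrow> \<bar>?n * (1 - N0)\<bar> * sqrt (real DIM('b coord))) Fp"
    by (simp only: norm11_scale_id[OF h_limit(3)])
  have "((\<lambda>q. norm11 (h (chart_at A q) q) (\<lambda>v. ricci_operator g (chart_at A q) q v - (- ?n) *\<^sub>R v))
      \<longlongrightarrow> \<bar>?n * (1 - N0)\<bar> * sqrt (real DIM('b coord))) Fp"
  proof (rule Lim_transform_eventually[OF lim])
    show "\<forall>\<^sub>F q in Fp. norm11 (h c q) (\<lambda>v. ricci_operator g c q v - (- ?n) *\<^sub>R v) =
        norm11 (h (chart_at A q) q) (\<lambda>v. ricci_operator g (chart_at A q) q v - (- ?n) *\<^sub>R v)"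
      using ev_chart_change by eventually_elim (elim exE, drule chart_change.norm11_invariant, erule sym)
  qed
  then show ?thesis
    by (subst tendsto_iff_limit_eq[OF Fp_nontrivial]) auto
qed

lemma scalar_curvature_limit_iff:
  "((\<lambda>q. scalar_curvature g (chart_at A q) q) \<longlongrightarrow> - (real CARD('b) * (real CARD('b) + 1))) Fp \<longleftrightarrow> N0 = 1"
proof -
  have "((\<lambda>q. scalar_curvature g (chart_at A q) q) \<longlongrightarrow> - N0 * (real CARD('b) * (real CARD('b) + 1))) Fp"
  proof (rule Lim_transform_eventually[OF scalar_curvature_limit])
    show "\<forall>\<^sub>F q in Fp. scalar_curvature g c q = scalar_curvature g (chart_at A q) q"
      using ev_chart_change by eventually_elim (elim exE, drule chart_change.scalar_curvature_invariant, erule sym)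
  qed
  then show ?thesis
    by (subst tendsto_iff_limit_eq[OF Fp_nontrivial]) (auto simp: add_eq_0_iff)
qed

text \<open>Condition (4) ranges over all charts d at p. The transformation law of gbar passes to
  the boundary because \<open>dtrans\<close> is continuous there, and \<rho> in d is the last
  component of the transition to c, so the norm is that of \<open>snd\<close> under G0.\<close>

lemma covector_norm_boundary:
  assumes d: "d \<in> A" "p \<in> fst d"
  shows "covector_norm (extend_tensor A gbar d p) (differential \<rho> d p) = sqrt N0"
proof -
  have ext_d: "extend_tensor A gbar d p v w = G0 (dtrans d c p v) (dtrans d c p w)" for v w
  proof -
    have "((\<lambda>q. gbar c q (dtrans d c q v) (dtrans d c q w)) \<longlongrightarrow> G0 (dtrans d c p v) (dtrans d c p w)) Fp"
    proof (rule tendsto_bilinear_forms[where B="gbar c" and ?B0.0=G0])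
      show "((\<lambda>q. gbar c q v w) \<longlongrightarrow> G0 v w) Fp" for v w unfolding G0_def by (rule gbar_limit)
      show "\<forall>\<^sub>F q in Fp. bilinear (gbar c q)" using ev_gbar_form by eventually_elim (rule inner_form_bilinear)
      show "bilinear G0" by (rule inner_form_bilinear[OF G0_form])
      show "((\<lambda>q. dtrans d c q v) \<longlongrightarrow> dtrans d c p v) Fp" "((\<lambda>q. dtrans d c q w) \<longlongrightarrow> dtrans d c p w) Fp"
        unfolding Fp_def by (rule tendsto_dtrans[OF d(1) c(1) d(2) c(2)])+
    qed
    moreover have "\<forall>\<^sub>F q in Fp. gbar c q (dtrans d c q v) (dtrans d c q w) = gbar d q v w"
      using eventually_mint eventually_bdryI[OF chart_openin[OF c(1)] c(2)] eventually_bdryI[OF chart_openin[OF d(1)] d(2)]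
      unfolding Fp_def by eventually_elim (rule tensor2_onD(2)[OF gbar_tensor d(1) c(1), symmetric])
    ultimately have "((\<lambda>q. gbar d q v w) \<longlongrightarrow> G0 (dtrans d c p v) (dtrans d c p w)) Fp"
      by (rule Lim_transform_eventually)
    from tendsto_Lim[OF Fp_nontrivial this] show ?thesis using p by (simp add: extend_tensor_def mint_eq Fp_def)
  qed
  have dd: "differential \<rho> d p = (\<lambda>v. snd (dtrans d c p v))"
  proof -
    obtain W F where W: "open W" "snd d p \<in> W" "Cinf_on W F"
      "\<forall>y\<in>W \<inter> half_space. y \<in> snd d ` (fst d \<inter> fst c)"
      "\<forall>y\<in>W \<inter> half_space. F y = snd c (chart_inv d y)"
      using transition_extension[OF d(1) c(1) d(2) c(2)] .
    have "(F has_derivative dtrans d c p) (at (snd d p))"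
      using Cinf_onD[OF W(3,2)] transition_derivative[OF d(1) c(1) d(2) W(2,1,3,5)] by simp
    from has_derivative_snd[OF this]
    have "((\<lambda>y. snd (F y)) has_derivative (\<lambda>v. snd (dtrans d c p v))) (at (snd d p))" .
    then show ?thesis
      unfolding differential_def
      by (rule half_space_derivativeI(2)[OF _ W(1,2) chart_half[OF d]]) (use W(5) snd_c in auto)
  qed
  have "inner_form (extend_tensor A gbar d p)"
  proof -
    have "extend_tensor A gbar d p = (\<lambda>v w. G0 (dtrans d c p v) (dtrans d c p w))" by (intro ext) (rule ext_d)
    then have "bilinear (extend_tensor A gbar d p)"
      using bilinear_comp_linear[OF inner_form_bilinear[OF G0_form] linear_dtrans linear_dtrans] c d by simp
    then show ?thesis using pd d p by (simp add: inner_form_def)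
  qed
  then interpret isometry_forms "extend_tensor A gbar d p" G0 "dtrans d c p" "dtrans c d p"
    by (rule isometry_formsI[OF d(1) c(1) d(2) c(2) _ G0_form]) (rule ext_d)
  show ?thesis
    unfolding dd covector_norm_transform[OF linear_snd_prod] by (simp add: covector_norm_def N0_def)
qed

end

context ah_metric
begin

text \<open>All quantifiers over the boundary are pulled outside, so that each of (1)-(3) is
  compared with (4) at a single boundary point.\<close>

lemma equivalences:
  "tendsto22 A h (curvature_operator g) (\<lambda>c p u v l m. - wedge u v l m) (to_bdry A \<rho>) \<longleftrightarrow>
    (\<forall>c\<in>A. \<forall>p\<in>fst c \<inter> mbdry A. covector_norm (extend_tensor A gbar c p) (differential \<rho> c p) = 1)" (is ?R1)
  "tendsto11 A h (ricci_operator g) (\<lambda>c p v. - real CARD('n) *\<^sub>R v) (to_bdry A \<rho>) \<longleftrightarrow>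
    (\<forall>c\<in>A. \<forall>p\<in>fst c \<inter> mbdry A. covector_norm (extend_tensor A gbar c p) (differential \<rho> c p) = 1)" (is ?R2)
  "((\<lambda>p. scalar_curvature g (chart_at A p) p) \<longlongrightarrow> - (real CARD('n) * (real CARD('n) + 1))) (to_bdry A \<rho>) \<longleftrightarrow>
    (\<forall>c\<in>A. \<forall>p\<in>fst c \<inter> mbdry A. covector_norm (extend_tensor A gbar c p) (differential \<rho> c p) = 1)" (is ?R3)
proof -
  let ?one = "\<lambda>p. \<forall>c\<in>A. p \<in> fst c \<longrightarrow> covector_norm (extend_tensor A gbar c p) (differential \<rho> c p) = 1"
  have P4: "(\<forall>c\<in>A. \<forall>p\<in>fst c \<inter> mbdry A. covector_norm (extend_tensor A gbar c p) (differential \<rho> c p) = 1) \<longleftrightarrow> (\<forall>p\<in>mbdry A. ?one p)" by blast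
  have pt: "((\<lambda>q. norm22 (h (chart_at A q) q) (\<lambda>u v l m. curvature_operator g (chart_at A q) q u v l m - - wedge u v l m)) \<longlongrightarrow> 0)
        (at p within mint A) \<longleftrightarrow> ?one p"
    "((\<lambda>q. norm11 (h (chart_at A q) q) (\<lambda>v. ricci_operator g (chart_at A q) q v - (- real CARD('n)) *\<^sub>R v)) \<longlongrightarrow> 0)
        (at p within mint A) \<longleftrightarrow> ?one p"
    "((\<lambda>q. scalar_curvature g (chart_at A q) q) \<longlongrightarrow> - (real CARD('n) * (real CARD('n) + 1))) (at p within mint A) \<longleftrightarrow> ?one p"
    if p: "p \<in> mbdry A" for p
  proof -
    obtain U V \<theta> where b: "(U, V, \<theta>) \<in> B" "p \<in> V" using bdry_bgc[OF p] by metis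
    interpret ah_point Mbar A \<rho> \<rho>s K \<kappa> B I \<Phi> h g gbar k \<alpha> p U V \<theta>
      by unfold_locales (rule p b)+
    \<comment> \<open>The norm of d\<rho> is \<open>sqrt N0\<close> in every chart around p, and the
      background chart is one of them, so the condition is not vacuous.\<close>
    have "?one p \<longleftrightarrow> N0 = 1" using covector_norm_boundary c by auto
    then show "((\<lambda>q. norm22 (h (chart_at A q) q) (\<lambda>u v l m. curvature_operator g (chart_at A q) q u v l m - - wedge u v l m)) \<longlongrightarrow> 0)
        (at p within mint A) \<longleftrightarrow> ?one p"
      "((\<lambda>q. norm11 (h (chart_at A q) q) (\<lambda>v. ricci_operator g (chart_at A q) q v - (- real CARD('n)) *\<^sub>R v)) \<longlongrightarrow> 0)
        (at p within mint A) \<longleftrightarrow> ?one p"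
      "((\<lambda>q. scalar_curvature g (chart_at A q) q) \<longlongrightarrow> - (real CARD('n) * (real CARD('n) + 1))) (at p within mint A) \<longleftrightarrow> ?one p"
      using curvature_operator_limit_iff ricci_operator_limit_iff scalar_curvature_limit_iff by (simp_all only: Fp_def)
  qed
  show ?R1 unfolding tendsto22_def Let_def to_bdry_iff[OF df] P4 by (intro ball_cong refl pt)
  show ?R2 unfolding tendsto11_def Let_def to_bdry_iff[OF df] P4 by (intro ball_cong refl pt)
  show ?R3 unfolding to_bdry_iff[OF df] P4 by (intro ball_cong refl pt)
qed

end

theorem theorem1p1:
  fixes Mbar :: "'a::t2_space set"
    and A :: "('a, 'n::finite) chart set"
    and \<rho> :: "'a \<Rightarrow> real"
    and \<rho>s :: real and K :: "'a set" and \<kappa> :: "'a \<Rightarrow> 'a"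
    and B :: "('a set \<times> 'a set \<times> ('a \<Rightarrow> real^'n)) set"
    and I :: "nat set" and \<Phi> :: "nat \<Rightarrow> 'n coord \<Rightarrow> 'a"
    and h g gbar :: "('a, 'n) tensor2"
    and k :: nat and \<alpha> :: real
  assumes "compact_manifold Mbar A"
    and "defining_function A \<rho>"
    and "collar Mbar A \<rho> \<rho>s K \<kappa>"
    and "background_charts A B"
    and "param_family Mbar A \<rho> K \<kappa> B I \<Phi>"
    and "smooth_metric A h"
    and "k \<ge> 2" and "0 \<le> \<alpha>" and "\<alpha> < 1"
    and "g = scale_tensor (\<lambda>p. \<rho> p powr (-2)) gbar"
    and "riemannian_on A (mint A) g"
    and "gbar \<in> weighted_Ck_tensors A \<rho> I \<Phi> k \<alpha> 2"
    and "\<forall>X. smooth_vfield A X \<longrightarrow> lie_deriv X gbar \<in> weighted_Ck_tensors A \<rho> I \<Phi> (k - 1) \<alpha> 2"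
    and "\<forall>c\<in>A. \<forall>p\<in>fst c \<inter> mbdry A. sym_pos_def (extend_tensor A gbar c p)"
  defines "P1 \<equiv> tendsto22 A h (curvature_operator g) (\<lambda>c p u v l m. - wedge u v l m) (to_bdry A \<rho>)"
    and "P2 \<equiv> tendsto11 A h (ricci_operator g) (\<lambda>c p v. - real CARD('n) *\<^sub>R v) (to_bdry A \<rho>)"
    and "P3 \<equiv> ((\<lambda>p. scalar_curvature g (chart_at A p) p) \<longlongrightarrow>
                 - (real CARD('n) * (real CARD('n) + 1))) (to_bdry A \<rho>)"
    and "P4 \<equiv> \<forall>c\<in>A. \<forall>p\<in>fst c \<inter> mbdry A.
                 covector_norm (extend_tensor A gbar c p) (differential \<rho> c p) = 1"
  shows "(P1 \<longleftrightarrow> P2) \<and> (P2 \<longleftrightarrow> P3) \<and> (P3 \<longleftrightarrow> P4)"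
proof -
  interpret ah_metric Mbar A \<rho> \<rho>s K \<kappa> B I \<Phi> h g gbar k \<alpha>
    by unfold_locales (rule assms)+
  show ?thesis
    unfolding P1_def P2_def P3_def P4_def equivalences by simp
qed

end
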